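(* Let $p\in(1,\infty)$, $k\in\mathbb{N}_0$, $\tilde\gamma\in(-1,2p-1)\setminus\{p-1\}$, $\omega\in(0,\pi)$ and let $X$ be a $\mathrm{UMD}$ Banach space. Then for all $f\in W^{k,p}(\mathbb{R}_+,w_{\tilde\gamma+kp};X)$ and $\lambda\in\Sigma_{\pi-\omega}$ there exists a unique $u\in W^{k+2,p}_{\mathrm{Dir}}(\mathbb{R}_+,w_{\tilde\gamma+kp};X)$ such that $\lambda u-\Delta_{\mathrm{Dir}}u=f$. Moreover, this solution satisfies $$\sum_{j=0}^2|\lambda|^{1-\frac j2}\|\partial_x^ju\|_{W^{k,p}(\mathbb{R}_+,w_{\tilde\gamma+kp};X)}\le C\,h_{k,\tilde\gamma}(\lambda)\,\|f\|_{W^{k,p}(\mathbb{R}_+,w_{\tilde\gamma+kp};X)},$$ where $$h_{k,\tilde\gamma}(\lambda):=1+|\lambda|^{-\frac{(\tilde\gamma+kp-2p+1)_+}{2p}}$$ and the constant $C>0$ only depends on $p,k,\tilde\gamma,\omega$ and $X$.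
   Context: $\mathbb{N}_0=\{0,1,2,\dots\}$, $\mathbb{R}_+=(0,\infty)$, $(a)_+:=\max\{a,0\}$ for $a\in\mathbb{R}$, and $\Sigma_\theta=\{z\in\mathbb{C}\setminus\{0\}:|\arg z|<\theta\}$ for $\theta\in(0,\pi)$. For $\gamma>-1$, $w_\gamma(x)=|x|^\gamma$ on $\mathbb{R}_+$; $L^p(\mathbb{R}_+,w_\gamma;X)$ is the space of strongly measurable $f:\mathbb{R}_+\to X$ with $\int_0^\infty\|f(x)\|_X^px^\gamma\,dx<\infty$, and $W^{k,p}(\mathbb{R}_+,w_\gamma;X)$ is the space of $X$-valued distributions on $\mathbb{R}_+$ all of whose derivatives of order $\le k$ lie in $L^p(\mathbb{R}_+,w_\gamma;X)$, with its canonical norm. $W^{k+2,p}_{\mathrm{Dir}}(\mathbb{R}_+,w_\gamma;X):=\{u\in W^{k+2,p}(\mathbb{R}_+,w_\gamma;X):\mathrm{Tr}\,u=u(0)=0\}$ (the trace is well defined for the weight exponents considered). $\Delta_{\mathrm{Dir}}u=\partial_x^2u$ for $u$ in this space. *)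

theory Defs
  imports "HOL-Probability.Probability"
begin

section \<open>Complex Banach spaces\<close>

class complex_banach = banach +
  fixes scaleC :: "complex \<Rightarrow> 'a \<Rightarrow> 'a" (infixr \<open>*\<^sub>C\<close> 75)
  assumes scaleC_add_right: "a *\<^sub>C (x + y) = a *\<^sub>C x + a *\<^sub>C y"
    and scaleC_add_left: "(a + b) *\<^sub>C x = a *\<^sub>C x + b *\<^sub>C x"
    and scaleC_scaleC: "a *\<^sub>C b *\<^sub>C x = (a * b) *\<^sub>C x"
    and scaleC_of_real: "complex_of_real r *\<^sub>C x = r *\<^sub>R x"
    and norm_scaleC: "norm (a *\<^sub>C x) = cmod a * norm x"

instantiation complex :: complex_banach
begin

definition scaleC_complex :: "complex \<Rightarrow> complex \<Rightarrow> complex" where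
  "scaleC_complex a x = a * x"

instance
  by standard (auto simp: scaleC_complex_def ring_distribs norm_mult scaleR_conv_of_real)

end


section \<open>Bochner integration in possibly non-separable Banach spaces\<close>

text \<open>The library's \<^const>\<open>has_bochner_integral\<close> is restricted to second countable target
  spaces. The following is its definition without that restriction, Borel measurability being
  replaced by strong measurability: almost everywhere convergence of simple functions supported
  on sets of finite measure.\<close>

definition strongly_measurable :: "'s measure \<Rightarrow> ('s \<Rightarrow> 'a::banach) \<Rightarrow> bool" where
  "strongly_measurable M f \<longleftrightarrow>
     (\<exists>s. (\<forall>i. Bochner_Integration.simple_bochner_integrable M (s i)) \<and>
          (AE x in M. (\<lambda>i::nat. s i x) \<longlonglongrightarrow> f x))"

definition has_Bochner_integral :: "'s measure \<Rightarrow> ('s \<Rightarrow> 'a::banach) \<Rightarrow> 'a \<Rightarrow> bool" where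
  "has_Bochner_integral M f I \<longleftrightarrow> strongly_measurable M f \<and>
     (\<exists>s. (\<forall>i. Bochner_Integration.simple_bochner_integrable M (s i)) \<and>
          (\<lambda>i::nat. \<integral>\<^sup>+x. ennreal (norm (f x - s i x)) \<partial>M) \<longlonglongrightarrow> 0 \<and>
          (\<lambda>i. Bochner_Integration.simple_bochner_integral M (s i)) \<longlonglongrightarrow> I)"

text \<open>Elements of \<open>L\<^sup>p\<close> are represented by functions; equality in \<open>L\<^sup>p\<close> is equality almost
  everywhere.\<close>

definition Lp :: "'s measure \<Rightarrow> real \<Rightarrow> ('s \<Rightarrow> 'a::banach) set" where
  "Lp M p = {f. strongly_measurable M f \<and> (\<integral>\<^sup>+x. ennreal (norm (f x) powr p) \<partial>M) < \<infinity>}"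

definition Lp_norm :: "'s measure \<Rightarrow> real \<Rightarrow> ('s \<Rightarrow> 'a::banach) \<Rightarrow> real" where
  "Lp_norm M p f = enn2real (\<integral>\<^sup>+x. ennreal (norm (f x) powr p) \<partial>M) powr (1 / p)"


section \<open>UMD spaces\<close>

text \<open>Finite \<open>L\<^sup>p\<close>-martingales \<open>f 0, \<dots>, f N\<close> with respect to a \<open>\<sigma>\<close>-finite filtration
  \<open>F 0, \<dots>, F N\<close> of a measure space \<open>M\<close>. The last condition says that the conditional expectation
  of \<open>f n\<close> given \<open>F m\<close> is \<open>f m\<close>.\<close>

definition Lp_martingale ::
  "'s measure \<Rightarrow> (nat \<Rightarrow> 's measure) \<Rightarrow> nat \<Rightarrow> real \<Rightarrow> (nat \<Rightarrow> 's \<Rightarrow> 'a::banach) \<Rightarrow> bool" where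
  "Lp_martingale M F N p f \<longleftrightarrow>
     (\<forall>n\<le>N. sigma_finite_subalgebra M (F n)) \<and>
     (\<forall>m n. m \<le> n \<and> n \<le> N \<longrightarrow> sets (F m) \<subseteq> sets (F n)) \<and>
     (\<forall>n\<le>N. f n \<in> Lp (restr_to_subalg M (F n)) p) \<and>
     (\<forall>m n. m \<le> n \<and> n \<le> N \<longrightarrow>
        (\<forall>A\<in>sets (F m). emeasure M A < \<infinity> \<longrightarrow>
           (\<exists>I. has_Bochner_integral M (\<lambda>x. indicator A x *\<^sub>R f n x) I \<and>
                has_Bochner_integral M (\<lambda>x. indicator A x *\<^sub>R f m x) I)))"

text \<open>A definition cannot quantify over the type of the sample points. Taking all
  \<open>\<sigma>\<close>-finite measures on all \<open>\<sigma>\<close>-algebras over subsets of \<^typ>\<open>real\<close> is no loss: the joint law of a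
  finite strongly measurable martingale lives on a Polish space, which is Borel isomorphic
  to a Borel subset of the real line.\<close>

definition UMD :: "'a::complex_banach itself \<Rightarrow> bool" where
  "UMD _ \<longleftrightarrow> (\<forall>p::real. 1 < p \<longrightarrow> (\<exists>\<beta>\<ge>0.
     \<forall>(M::real measure) F N (f :: nat \<Rightarrow> real \<Rightarrow> 'a) (\<epsilon> :: nat \<Rightarrow> complex).
       sigma_finite_measure M \<and> Lp_martingale M F N p f \<and> (\<forall>n. cmod (\<epsilon> n) = 1) \<longrightarrow>
         Lp_norm M p (\<lambda>x. \<Sum>n=1..N. \<epsilon> n *\<^sub>C (f n x - f (n - 1) x))
         \<le> \<beta> * Lp_norm M p (\<lambda>x. \<Sum>n=1..N. f n x - f (n - 1) x)))"


section \<open>Weighted Sobolev spaces on the half-line\<close>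

definition half_line :: "real measure" where
  "half_line = lebesgue_on {0<..}"

definition weighted :: "real \<Rightarrow> real measure" where
  "weighted \<gamma> = density half_line (\<lambda>x. ennreal (\<bar>x\<bar> powr \<gamma>))"

definition test_functions :: "(real \<Rightarrow> real) set" where
  "test_functions = {\<phi>. (\<forall>n x. (deriv ^^ n) \<phi> field_differentiable at x) \<and>
     (\<exists>a b. 0 < a \<and> a \<le> b \<and> (\<forall>x. x \<notin> {a..b} \<longrightarrow> \<phi> x = 0))}"

text \<open>The \<open>j\<close>-th distributional derivative of \<open>u\<close> on the half-line is (represented by) \<open>g\<close>. Complex
  test functions would give the same notion, by linearity.\<close>

definition has_weak_deriv :: "nat \<Rightarrow> (real \<Rightarrow> 'a::banach) \<Rightarrow> (real \<Rightarrow> 'a) \<Rightarrow> bool" where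
  "has_weak_deriv j u g \<longleftrightarrow> (\<forall>\<phi>\<in>test_functions. \<exists>I.
     has_Bochner_integral half_line (\<lambda>x. (deriv ^^ j) \<phi> x *\<^sub>R u x) I \<and>
     has_Bochner_integral half_line (\<lambda>x. \<phi> x *\<^sub>R g x) ((-1) ^ j *\<^sub>R I))"

text \<open>The representative is unique up to null sets, if it exists.\<close>

definition weak_deriv :: "nat \<Rightarrow> (real \<Rightarrow> 'a::banach) \<Rightarrow> real \<Rightarrow> 'a" where
  "weak_deriv j u = (SOME g. has_weak_deriv j u g)"

definition sobolev :: "nat \<Rightarrow> real \<Rightarrow> real \<Rightarrow> (real \<Rightarrow> 'a::banach) set" where
  "sobolev k p \<gamma> = {u. u \<in> Lp (weighted \<gamma>) p \<and>
     (\<forall>j\<le>k. \<exists>g \<in> Lp (weighted \<gamma>) p. has_weak_deriv j u g)}"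

definition sobolev_norm :: "nat \<Rightarrow> real \<Rightarrow> real \<Rightarrow> (real \<Rightarrow> 'a::banach) \<Rightarrow> real" where
  "sobolev_norm k p \<gamma> u = (\<Sum>j\<le>k. Lp_norm (weighted \<gamma>) p (weak_deriv j u))"

text \<open>The trace \<open>u(0)\<close> is the value at \<open>0\<close> of the representative of \<open>u\<close> that is continuous up to the
  boundary.\<close>

definition has_trace :: "(real \<Rightarrow> 'a::banach) \<Rightarrow> 'a \<Rightarrow> bool" where
  "has_trace u y \<longleftrightarrow>
     (\<exists>v. continuous_on {0..} v \<and> (AE x in half_line. v x = u x) \<and> v 0 = y)"

definition sobolev_Dir :: "nat \<Rightarrow> real \<Rightarrow> real \<Rightarrow> (real \<Rightarrow> 'a::banach) set" where
  "sobolev_Dir m p \<gamma> = {u \<in> sobolev m p \<gamma>. has_trace u 0}"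

definition Laplacian_Dir :: "(real \<Rightarrow> 'a::banach) \<Rightarrow> real \<Rightarrow> 'a" where
  "Laplacian_Dir u = weak_deriv 2 u"

definition resolvent_solution ::
  "nat \<Rightarrow> real \<Rightarrow> real \<Rightarrow> complex \<Rightarrow> (real \<Rightarrow> 'a::complex_banach) \<Rightarrow> (real \<Rightarrow> 'a) \<Rightarrow> bool" where
  "resolvent_solution k p \<gamma> lam f u \<longleftrightarrow>
     u \<in> sobolev_Dir (k + 2) p \<gamma> \<and> (AE x in half_line. lam *\<^sub>C u x - Laplacian_Dir u x = f x)"


section \<open>Sectors and the growth function\<close>

definition sector :: "real \<Rightarrow> complex set" where
  "sector \<theta> = {z. z \<noteq> 0 \<and> \<bar>Arg z\<bar> < \<theta>}"

definition growth :: "real \<Rightarrow> nat \<Rightarrow> real \<Rightarrow> complex \<Rightarrow> real" where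
  "growth p k \<gamma> lam = 1 + cmod lam powr (- (max (\<gamma> + real k * p - 2 * p + 1) 0 / (2 * p)))"

end

theory Submission
  imports Defs
begin

text \<open>Write \<open>\<lambda> = \<mu>\<^sup>2\<close> with \<open>Re \<mu> \<ge> \<kappa> \<bar>\<mu>\<bar>\<close>, where \<open>\<kappa> = sin (\<omega> / 2)\<close>, let \<open>a\<close> be the given exponent in \<open>(-1, 2 p - 1)\<close> and
\<open>G = a + k p\<close> the exponent of the Sobolev spaces. The operator factorises,
\<open>\<mu>\<^sup>2 - \<partial>\<^sup>2 = (\<mu> - \<partial>) (\<mu> + \<partial>)\<close>, so the Dirichlet problem is solved by two explicit integrals: first
\<open>w x = \<integral>\<^sub>x\<^sup>\<infinity> exp (- \<mu> (y - x)) f y dy\<close>, then \<open>u x = \<integral>\<^sub>0\<^sup>x exp (- \<mu> (x - y)) w y dy\<close>. Their norms are dominated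
pointwise by two positive scalar operators, \<open>forward_exp\<close> and \<open>backward_exp\<close>, applied to the norm of
\<open>f\<close>. Hence every estimate reduces to inequalities for positive kernels.

\<^item> One weight. For exponents in \<open>(-1, p - 1)\<close> each of the two operators is bounded by the Schur test,
uniformly after multiplication with \<open>Re \<mu>\<close>. For exponents in \<open>(p - 1, 2 p - 1)\<close> one factor \<open>x\<close> of the
weight is carried through \<open>backward_exp\<close>, and the error is absorbed by the dual Hardy inequality
(\<open>resolvent_bound\<close>, \<open>resolvent_estimate\<close>).

\<^item> The highest derivatives. If \<open>\<lambda> u - u'' = f\<close>, then \<open>v = x u'\<close> satisfies \<open>\<lambda> v - v'' = x f' + 2 f - 2 \<lambda> u\<close>.
By induction \<open>\<bar>\<lambda>\<bar> x\<^sup>i \<partial>\<^sup>i u\<close> is bounded, in the weight \<open>a\<close> of order zero, by the \<open>x\<^sup>i \<partial>\<^sup>i f\<close>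
(\<open>commutator_estimate\<close>). As multiplication by \<open>x\<^sup>k\<close> turns the weight \<open>a\<close> into \<open>G\<close>, the case \<open>i = k\<close> is
the bound for \<open>\<partial>\<^sup>k u\<close>; Hardy's inequality bounds the right-hand side by the norm of \<open>f\<close> in
\<open>W\<^sup>k\<^sup>,\<^sup>p\<close> (\<open>energy_Hardy\<close>).

\<^item> The function itself. In the weight \<open>G\<close> the one-weight bound applies as long as \<open>G < 2 p - 1\<close>. Beyond,
the pointwise bound for \<open>\<lambda> u\<close> contains a multiple of \<open>(Re \<mu>)\<^sup>2 exp (- Re \<mu> x / 2)\<close>, the multiple being the first
moment of the norm of \<open>f\<close>, and scaling shows that the norm of this function carries the factor \<open>\<bar>\<lambda>\<bar> powr (- (G - 2 p + 1) / (2 p))\<close>. This is where the growth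
function comes from (\<open>resolvent_bound_growth\<close>, \<open>undifferentiated_estimate\<close>).

\<^item> The remaining derivatives. Orders between \<open>0\<close> and \<open>k\<close> follow by interpolation, \<open>\<partial>\<^sup>2 u = \<lambda> u - f\<close> by
the equation, and \<open>\<partial> u\<close> by interpolation at the length \<open>1 / \<bar>\<mu>\<bar>\<close> (\<open>resolvent_chain_estimate\<close>).

\<^item> Uniqueness. The difference of two solutions is \<open>exp (\<mu> x) A + exp (- \<mu> x) B\<close>. The trace gives
\<open>B = - A\<close> and integrability at infinity \<open>A = 0\<close> (\<open>homogeneous_solution_zero\<close>). The induction above needs
this for \<open>x u'\<close>, whose trace is not known beforehand; it suffices that the difference is small at
some points arbitrarily close to \<open>0\<close>.

Weak derivatives enter only through the du Bois-Reymond lemma, proved here for Bochner integrals in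
possibly non-separable spaces: an element of the Sobolev space is represented by a chain of
functions each of which is a primitive of the next (\<open>sobolev_chain\<close>), and from then on the
differential equations are integral equations.\<close>

section \<open>Strong measurability and the Bochner integral\<close>

abbreviation enorm :: "'a::real_normed_vector \<Rightarrow> ennreal" where
  "enorm x \<equiv> ennreal (norm x)"
abbreviation norm_int :: "(real \<Rightarrow> 'a::real_normed_vector) \<Rightarrow> real \<Rightarrow> real \<Rightarrow> ennreal" where
  "norm_int f a b \<equiv> (\<integral>\<^sup>+x. enorm (f x) * indicator {a<..b} x \<partial>lborel)"
abbreviation exp_kernel :: "real \<Rightarrow> real \<Rightarrow> real \<Rightarrow> ennreal" where
  "exp_kernel c x y \<equiv> (if x < y then ennreal (c * exp (- (c * (y - x)))) else 0)"
abbreviation expc :: "complex \<Rightarrow> real \<Rightarrow> complex" where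
  "expc m x \<equiv> exp (m * complex_of_real x)"

abbreviation sbi :: "'s measure \<Rightarrow> ('s \<Rightarrow> 'a::banach) \<Rightarrow> bool" where
  "sbi \<equiv> Bochner_Integration.simple_bochner_integrable"
abbreviation sint :: "'s measure \<Rightarrow> ('s \<Rightarrow> 'a::banach) \<Rightarrow> 'a" where
  "sint \<equiv> Bochner_Integration.simple_bochner_integral"

lemma sbi_measurable:
  assumes "sbi M s" shows "(\<lambda>x. enorm (s x)) \<in> borel_measurable M"
proof -
  have "simple_function M s" using assms by (auto elim: Bochner_Integration.simple_bochner_integrable.cases)
  then have "simple_function M (\<lambda>x. enorm (s x))" by (rule simple_function_compose1)
  then show ?thesis by (rule borel_measurable_simple_function)
qed

text \<open>In general, the norm of a strongly measurable function is measurable only up to a null set. Additivity and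
dominated convergence are therefore always applied to a measurable representative of it.\<close>

lemma strongly_measurable_norm_rep:
  assumes "strongly_measurable M f"
  obtains r where "r \<in> borel_measurable M" "AE x in M. enorm (f x) = r x"
proof -
  obtain s where s: "\<And>i. sbi M (s i)" and lim: "AE x in M. (\<lambda>i::nat. s i x) \<longlonglongrightarrow> f x"
    using assms unfolding strongly_measurable_def by blast
  note [measurable] = sbi_measurable[OF s]
  let ?r = "\<lambda>x. liminf (\<lambda>i. enorm (s i x))"
  have "?r \<in> borel_measurable M" by measurable
  moreover have "AE x in M. enorm (f x) = ?r x"
    using lim
  proof eventually_elim
    case (elim x)
    then have "(\<lambda>i. enorm (s i x)) \<longlonglongrightarrow> enorm (f x)"
      by (intro tendsto_ennrealI tendsto_norm)
    then show ?case by (metis lim_imp_Liminf sequentially_bot)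
  qed
  ultimately show ?thesis using that by blast
qed

lemma strongly_measurable_nn_integral_add:
  assumes f: "strongly_measurable M f" and g: "strongly_measurable M g"
  shows "(\<integral>\<^sup>+x. enorm (f x) + enorm (g x) \<partial>M) =
    (\<integral>\<^sup>+x. enorm (f x) \<partial>M) + (\<integral>\<^sup>+x. enorm (g x) \<partial>M)"
proof -
  obtain r where r[measurable]: "r \<in> borel_measurable M" and fr: "AE x in M. enorm (f x) = r x"
    using strongly_measurable_norm_rep[OF f] by blast
  obtain q where q[measurable]: "q \<in> borel_measurable M" and gq: "AE x in M. enorm (g x) = q x"
    using strongly_measurable_norm_rep[OF g] by blast
  have "(\<integral>\<^sup>+x. enorm (f x) + enorm (g x) \<partial>M) = (\<integral>\<^sup>+x. r x + q x \<partial>M)"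
    by (rule nn_integral_cong_AE) (use fr gq in eventually_elim, simp)
  also have "\<dots> = (\<integral>\<^sup>+x. r x \<partial>M) + (\<integral>\<^sup>+x. q x \<partial>M)" by (rule nn_integral_add) auto
  also have "(\<integral>\<^sup>+x. r x \<partial>M) = (\<integral>\<^sup>+x. enorm (f x) \<partial>M)"
    by (rule nn_integral_cong_AE) (use fr in eventually_elim, simp)
  also have "(\<integral>\<^sup>+x. q x \<partial>M) = (\<integral>\<^sup>+x. enorm (g x) \<partial>M)"
    by (rule nn_integral_cong_AE) (use gq in eventually_elim, simp)
  finally show ?thesis .
qed

text \<open>Applied to approximating simple functions, \<open>b\<close> gives simple functions that converge by
continuity; \<open>b 0 0 = 0\<close> keeps their supports of finite measure.\<close>

lemma strongly_measurable_compose2: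
  assumes f: "strongly_measurable M f" and g: "strongly_measurable M g"
    and b: "continuous_on UNIV (\<lambda>z. b (fst z) (snd z))" and b0: "b 0 0 = 0"
  shows "strongly_measurable M (\<lambda>x. b (f x) (g x))"
proof -
  obtain s where s: "\<And>i. sbi M (s i)" and ls: "AE x in M. (\<lambda>i::nat. s i x) \<longlonglongrightarrow> f x"
    using f unfolding strongly_measurable_def by blast
  obtain t where t: "\<And>i. sbi M (t i)" and lt: "AE x in M. (\<lambda>i::nat. t i x) \<longlonglongrightarrow> g x"
    using g unfolding strongly_measurable_def by blast
  show ?thesis unfolding strongly_measurable_def
  proof (intro exI conjI allI)
    let ?p = "\<lambda>i x. b (s i x) (t i x)"
    show "sbi M (?p i)" for i
    proof (rule Bochner_Integration.simple_bochner_integrable.intros)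
      have S: "simple_function M (s i)" "simple_function M (t i)"
        using s t by (auto elim: Bochner_Integration.simple_bochner_integrable.cases)
      then show "simple_function M (?p i)" by (rule simple_function_compose2)
      have [measurable]: "s i \<in> measurable M (count_space UNIV)" "t i \<in> measurable M (count_space UNIV)"
        using S by (auto intro: measurable_simple_function)
      have fin: "emeasure M {y\<in>space M. s i y \<noteq> 0} \<noteq> \<infinity>" "emeasure M {y\<in>space M. t i y \<noteq> 0} \<noteq> \<infinity>"
        using s[of i] t[of i] by (auto elim!: Bochner_Integration.simple_bochner_integrable.cases)
      have "emeasure M {y\<in>space M. ?p i y \<noteq> 0} \<le>
          emeasure M ({y\<in>space M. s i y \<noteq> 0} \<union> {y\<in>space M. t i y \<noteq> 0})"
        by (intro emeasure_mono) (auto simp: b0)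
      also have "\<dots> \<le> emeasure M {y\<in>space M. s i y \<noteq> 0} + emeasure M {y\<in>space M. t i y \<noteq> 0}"
        by (intro emeasure_subadditive) auto
      finally show "emeasure M {y\<in>space M. ?p i y \<noteq> 0} \<noteq> \<infinity>" using fin by (auto simp: top_unique)
    qed
    show "AE x in M. (\<lambda>i. ?p i x) \<longlonglongrightarrow> b (f x) (g x)"
      using ls lt
    proof eventually_elim
      case (elim x)
      have "isCont (\<lambda>z. b (fst z) (snd z)) (f x, g x)"
        using b by (simp add: continuous_on_eq_continuous_at)
      from isCont_tendsto_compose[OF this tendsto_Pair[OF elim]] show ?case by simp
    qed
  qed
qed

lemma strongly_measurable_compose:
  assumes "strongly_measurable M f" "continuous_on UNIV T" "T 0 = 0"
  shows "strongly_measurable M (\<lambda>x. T (f x))"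
  by (rule strongly_measurable_compose2[where b="\<lambda>x y. T x", OF assms(1,1)])
     (use assms in \<open>auto intro!: continuous_on_compose2[OF assms(2)] continuous_intros\<close>)

lemma bounded_bilinear_scaleC: "bounded_bilinear (\<lambda>(a::complex) (x::'a::complex_banach). a *\<^sub>C x)"
proof
  fix a a' :: complex and b b' :: 'a and r :: real
  show "(a + a') *\<^sub>C b = a *\<^sub>C b + a' *\<^sub>C b" by (rule scaleC_add_left)
  show "a *\<^sub>C (b + b') = a *\<^sub>C b + a *\<^sub>C b'" by (rule scaleC_add_right)
  show "(r *\<^sub>R a) *\<^sub>C b = r *\<^sub>R a *\<^sub>C b"
    by (simp add: scaleR_conv_of_real scaleC_scaleC[symmetric] scaleC_of_real)
  show "a *\<^sub>C r *\<^sub>R b = r *\<^sub>R a *\<^sub>C b"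
    by (simp add: scaleC_of_real[symmetric] scaleC_scaleC mult.commute)
  show "\<exists>K. \<forall>(a::complex) b::'a. norm (a *\<^sub>C b) \<le> norm a * norm b * K"
    by (intro exI[of _ 1]) (simp add: norm_scaleC)
qed

interpretation scaleC: bounded_bilinear "\<lambda>(a::complex) (x::'a::complex_banach). a *\<^sub>C x"
  by (rule bounded_bilinear_scaleC)

lemma scaleC_simps [simp]:
  "(0::complex) *\<^sub>C (x::'a::complex_banach) = 0" "a *\<^sub>C (0::'a) = 0" "1 *\<^sub>C x = x"
  "(- a) *\<^sub>C x = - (a *\<^sub>C x)"  "a *\<^sub>C (- x) = - (a *\<^sub>C x)"
  using scaleC_of_real[of 1 x] by (auto simp: scaleC.zero_left scaleC.zero_right scaleC.minus_left scaleC.minus_right)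

lemma continuous_bilinear_uncurry:
  assumes "bounded_bilinear b" shows "continuous_on UNIV (\<lambda>z. b (fst z) (snd z))"
proof -
  interpret bounded_bilinear b by fact
  show ?thesis by (intro continuous_on continuous_intros)
qed

lemma
  assumes f: "strongly_measurable M f" and g: "strongly_measurable M g"
  shows strongly_measurable_add: "strongly_measurable M (\<lambda>x. f x + g x)"
    and strongly_measurable_diff: "strongly_measurable M (\<lambda>x. f x - g x)"
  by (rule strongly_measurable_compose2[OF f g]; auto intro!: continuous_intros)+

lemma strongly_measurable_bilinear:
  assumes "bounded_bilinear b" and f: "strongly_measurable M f" and g: "strongly_measurable M g"
  shows "strongly_measurable M (\<lambda>x. b (f x) (g x))"
  by (rule strongly_measurable_compose2[OF f g continuous_bilinear_uncurry[OF assms(1)]])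
     (rule bounded_bilinear.zero_left[OF assms(1)])

lemmas strongly_measurable_scaleR = strongly_measurable_bilinear[OF bounded_bilinear_scaleR]
lemmas strongly_measurable_scaleC = strongly_measurable_bilinear[OF bounded_bilinear_scaleC]

lemma strongly_measurable_linear:
  assumes "bounded_linear T" and f: "strongly_measurable M f"
  shows "strongly_measurable M (\<lambda>x. T (f x))"
  by (rule strongly_measurable_compose[OF f linear_continuous_on[OF assms(1)]])
     (rule linear_0[OF bounded_linear.linear[OF assms(1)]])

lemma strongly_measurable_cong_AE:
  assumes f: "strongly_measurable M f" and eq: "AE x in M. f x = g x"
  shows "strongly_measurable M g"
proof -
  obtain s where s: "\<And>i. sbi M (s i)" and ls: "AE x in M. (\<lambda>i::nat. s i x) \<longlonglongrightarrow> f x"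
    using f unfolding strongly_measurable_def by blast
  have "AE x in M. (\<lambda>i::nat. s i x) \<longlonglongrightarrow> g x" using ls eq by eventually_elim simp
  then show ?thesis using s unfolding strongly_measurable_def by blast
qed

lemma strongly_measurable_simple: "sbi M s \<Longrightarrow> strongly_measurable M s"
  unfolding strongly_measurable_def by (intro exI[of _ "\<lambda>_. s"]) auto

lemma sbi_nn_finite:
  assumes "sbi M s" shows "(\<integral>\<^sup>+x. enorm (s x) \<partial>M) < \<infinity>"
proof -
  have "sbi M (\<lambda>x. norm (s x))"
    by (rule simple_bochner_integrable_compose2[where p="\<lambda>x y. norm x", OF _ assms assms]) simp
  from simple_bochner_integral_eq_nn_integral[OF this] show ?thesis
    by (metis ennreal_less_top infinity_ennreal_def norm_ge_zero)
qed

lemma sint_norm_le: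
  assumes "sbi M s" shows "enorm (sint M s) \<le> (\<integral>\<^sup>+x. enorm (s x) \<partial>M)"
proof -
  have "sbi M (\<lambda>x. norm (s x))"
    by (rule simple_bochner_integrable_compose2[where p="\<lambda>x y. norm x", OF _ assms assms]) simp
  from simple_bochner_integral_eq_nn_integral[OF this] simple_bochner_integral_norm_bound[OF assms]
  show ?thesis by (metis ennreal_leI norm_ge_zero)
qed

lemma has_Bochner_integralE:
  assumes "has_Bochner_integral M f I"
  obtains s where "strongly_measurable M f" "\<And>i. sbi M (s i)"
    "(\<lambda>i::nat. \<integral>\<^sup>+x. enorm (f x - s i x) \<partial>M) \<longlonglongrightarrow> 0" "(\<lambda>i. sint M (s i)) \<longlonglongrightarrow> I"
  using assms unfolding has_Bochner_integral_def by blast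

lemma has_Bochner_integral_strongly_measurable:
  "has_Bochner_integral M f I \<Longrightarrow> strongly_measurable M f"
  unfolding has_Bochner_integral_def by blast

lemma has_Bochner_integral_norm_le:
  assumes "has_Bochner_integral M f I"
  shows "enorm I \<le> (\<integral>\<^sup>+x. enorm (f x) \<partial>M)"
proof -
  obtain s where f: "strongly_measurable M f" and s: "\<And>i. sbi M (s i)"
    and l: "(\<lambda>i::nat. \<integral>\<^sup>+x. enorm (f x - s i x) \<partial>M) \<longlonglongrightarrow> 0" and I: "(\<lambda>i. sint M (s i)) \<longlonglongrightarrow> I"
    using has_Bochner_integralE[OF assms] by blast
  have "enorm (sint M (s i)) \<le> (\<integral>\<^sup>+x. enorm (f x) \<partial>M) + (\<integral>\<^sup>+x. enorm (f x - s i x) \<partial>M)" for i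
  proof -
    have "enorm (sint M (s i)) \<le> (\<integral>\<^sup>+x. enorm (s i x) \<partial>M)" by (rule sint_norm_le[OF s])
    also have "\<dots> \<le> (\<integral>\<^sup>+x. enorm (f x) + enorm (f x - s i x) \<partial>M)"
      by (intro nn_integral_mono) (metis ennreal_leI ennreal_plus norm_ge_zero norm_minus_commute norm_triangle_sub)
    also have "\<dots> = (\<integral>\<^sup>+x. enorm (f x) \<partial>M) + (\<integral>\<^sup>+x. enorm (f x - s i x) \<partial>M)"
      by (intro strongly_measurable_nn_integral_add f strongly_measurable_diff strongly_measurable_simple s)
    finally show ?thesis .
  qed
  moreover have "(\<lambda>i. enorm (sint M (s i))) \<longlonglongrightarrow> enorm I"
    by (intro tendsto_ennrealI tendsto_norm I)
  moreover have "(\<lambda>i. (\<integral>\<^sup>+x. enorm (f x) \<partial>M) + (\<integral>\<^sup>+x. enorm (f x - s i x) \<partial>M)) \<longlonglongrightarrow>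
     (\<integral>\<^sup>+x. enorm (f x) \<partial>M) + 0"
    by (intro tendsto_add l) auto
  ultimately show ?thesis using LIMSEQ_le by (metis (no_types, lifting) add.right_neutral)
qed

lemma has_Bochner_integral_finite:
  assumes "has_Bochner_integral M f I"
  shows "(\<integral>\<^sup>+x. enorm (f x) \<partial>M) < \<infinity>"
proof -
  obtain s where f: "strongly_measurable M f" and s: "\<And>i. sbi M (s i)"
    and l: "(\<lambda>i::nat. \<integral>\<^sup>+x. enorm (f x - s i x) \<partial>M) \<longlonglongrightarrow> 0" and I: "(\<lambda>i. sint M (s i)) \<longlonglongrightarrow> I"
    using has_Bochner_integralE[OF assms] by blast
  have "eventually (\<lambda>i. (\<integral>\<^sup>+x. enorm (f x - s i x) \<partial>M) < 1) sequentially"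
    using l by (rule order_tendstoD) simp
  then obtain i where i: "(\<integral>\<^sup>+x. enorm (f x - s i x) \<partial>M) < 1"
    by (auto simp: eventually_sequentially)
  have "(\<integral>\<^sup>+x. enorm (f x) \<partial>M) \<le> (\<integral>\<^sup>+x. enorm (s i x) + enorm (f x - s i x) \<partial>M)"
    by (intro nn_integral_mono) (metis ennreal_leI ennreal_plus norm_ge_zero norm_triangle_sub)
  also have "\<dots> = (\<integral>\<^sup>+x. enorm (s i x) \<partial>M) + (\<integral>\<^sup>+x. enorm (f x - s i x) \<partial>M)"
    by (intro strongly_measurable_nn_integral_add f strongly_measurable_diff strongly_measurable_simple s)
  also have "\<dots> < \<infinity>" using i sbi_nn_finite[OF s[of i]] by (simp add: less_top order.strict_trans)
  finally show ?thesis .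
qed

lemma has_Bochner_integral_add:
  assumes "has_Bochner_integral M f I" "has_Bochner_integral M g J"
  shows "has_Bochner_integral M (\<lambda>x. f x + g x) (I + J)"
proof -
  obtain s where f: "strongly_measurable M f" and s: "\<And>i. sbi M (s i)"
    and l: "(\<lambda>i::nat. \<integral>\<^sup>+x. enorm (f x - s i x) \<partial>M) \<longlonglongrightarrow> 0" and I: "(\<lambda>i. sint M (s i)) \<longlonglongrightarrow> I"
    using has_Bochner_integralE[OF assms(1)] by blast
  obtain t where g: "strongly_measurable M g" and t: "\<And>i. sbi M (t i)"
    and lt: "(\<lambda>i::nat. \<integral>\<^sup>+x. enorm (g x - t i x) \<partial>M) \<longlonglongrightarrow> 0" and J: "(\<lambda>i. sint M (t i)) \<longlonglongrightarrow> J"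
    using has_Bochner_integralE[OF assms(2)] by blast
  have "(\<lambda>i::nat. \<integral>\<^sup>+x. enorm (f x + g x - (s i x + t i x)) \<partial>M) \<longlonglongrightarrow> 0"
  proof (rule tendsto_sandwich[OF _ _ tendsto_const])
    show "\<forall>\<^sub>F i in sequentially. (\<integral>\<^sup>+x. enorm (f x + g x - (s i x + t i x)) \<partial>M) \<le>
      (\<integral>\<^sup>+x. enorm (f x - s i x) \<partial>M) + (\<integral>\<^sup>+x. enorm (g x - t i x) \<partial>M)"
    proof (rule always_eventually, rule allI)
      fix i
      have "(\<integral>\<^sup>+x. enorm (f x + g x - (s i x + t i x)) \<partial>M) \<le>
        (\<integral>\<^sup>+x. enorm (f x - s i x) + enorm (g x - t i x) \<partial>M)"
        by (intro nn_integral_mono) (auto simp flip: ennreal_plus intro!: ennreal_leI norm_diff_triangle_ineq)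
      also have "\<dots> = (\<integral>\<^sup>+x. enorm (f x - s i x) \<partial>M) + (\<integral>\<^sup>+x. enorm (g x - t i x) \<partial>M)"
        by (intro strongly_measurable_nn_integral_add f g strongly_measurable_diff strongly_measurable_simple s t)
      finally show "(\<integral>\<^sup>+x. enorm (f x + g x - (s i x + t i x)) \<partial>M) \<le> \<dots>" .
    qed
    show "(\<lambda>i. (\<integral>\<^sup>+x. enorm (f x - s i x) \<partial>M) + (\<integral>\<^sup>+x. enorm (g x - t i x) \<partial>M)) \<longlonglongrightarrow> 0"
      using tendsto_add[OF l lt] by simp
  qed auto
  moreover have "sbi M (\<lambda>x. s i x + t i x)" for i
    by (rule simple_bochner_integrable_compose2[OF _ s t]) simp
  moreover have "(\<lambda>i. sint M (\<lambda>x. s i x + t i x)) \<longlonglongrightarrow> I + J"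
    by (simp add: simple_bochner_integral_add s t tendsto_add I J)
  ultimately show ?thesis unfolding has_Bochner_integral_def
    using strongly_measurable_add[OF f g] by (intro conjI exI[of _ "\<lambda>i x. s i x + t i x"]) auto
qed

lemma has_Bochner_integral_linear:
  assumes T: "bounded_linear T" and "has_Bochner_integral M f I"
  shows "has_Bochner_integral M (\<lambda>x. T (f x)) (T I)"
proof -
  interpret T: bounded_linear T by fact
  obtain K where K: "0 \<le> K" "\<And>x. norm (T x) \<le> norm x * K" using T.nonneg_bounded by blast
  obtain s where f: "strongly_measurable M f" and s: "\<And>i. sbi M (s i)"
    and l: "(\<lambda>i::nat. \<integral>\<^sup>+x. enorm (f x - s i x) \<partial>M) \<longlonglongrightarrow> 0" and I: "(\<lambda>i. sint M (s i)) \<longlonglongrightarrow> I"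
    using has_Bochner_integralE[OF assms(2)] by blast
  have "(\<lambda>i::nat. \<integral>\<^sup>+x. enorm (T (f x) - T (s i x)) \<partial>M) \<longlonglongrightarrow> 0"
  proof (rule tendsto_sandwich[OF _ _ tendsto_const])
    show "\<forall>\<^sub>F i in sequentially. (\<integral>\<^sup>+x. enorm (T (f x) - T (s i x)) \<partial>M) \<le>
      ennreal K * (\<integral>\<^sup>+x. enorm (f x - s i x) \<partial>M)"
    proof (rule always_eventually, rule allI)
      fix i
      obtain r where r[measurable]: "r \<in> borel_measurable M" and fr: "AE x in M. enorm (f x - s i x) = r x"
        using strongly_measurable_norm_rep[OF strongly_measurable_diff[OF f strongly_measurable_simple[OF s]]] by blast
      have "(\<integral>\<^sup>+x. enorm (T (f x) - T (s i x)) \<partial>M) \<le> (\<integral>\<^sup>+x. ennreal K * enorm (f x - s i x) \<partial>M)"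
        using K by (intro nn_integral_mono)
          (auto simp flip: ennreal_mult' T.diff intro!: ennreal_leI simp: mult.commute)
      also have "\<dots> = (\<integral>\<^sup>+x. ennreal K * r x \<partial>M)"
        by (rule nn_integral_cong_AE) (use fr in eventually_elim, simp)
      also have "\<dots> = ennreal K * (\<integral>\<^sup>+x. r x \<partial>M)" by (rule nn_integral_cmult) auto
      also have "(\<integral>\<^sup>+x. r x \<partial>M) = (\<integral>\<^sup>+x. enorm (f x - s i x) \<partial>M)"
        by (rule nn_integral_cong_AE) (use fr in eventually_elim, simp)
      finally show "(\<integral>\<^sup>+x. enorm (T (f x) - T (s i x)) \<partial>M) \<le>
        ennreal K * (\<integral>\<^sup>+x. enorm (f x - s i x) \<partial>M)" .
    qed
    show "(\<lambda>i. ennreal K * (\<integral>\<^sup>+x. enorm (f x - s i x) \<partial>M)) \<longlonglongrightarrow> 0"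
      using ennreal_tendsto_cmult[OF _ l, of "ennreal K"] by simp
  qed auto
  moreover have "sbi M (\<lambda>x. T (s i x))" for i
    by (rule simple_bochner_integrable_compose2[OF _ s s, where p="\<lambda>x y. T x"]) simp
  moreover have "(\<lambda>i. sint M (\<lambda>x. T (s i x))) \<longlonglongrightarrow> T I"
    by (simp add: simple_bochner_integral_linear[OF T.linear s] T.tendsto I)
  ultimately show ?thesis unfolding has_Bochner_integral_def
    using strongly_measurable_linear[OF T f] by (intro conjI exI[of _ "\<lambda>i x. T (s i x)"]) auto
qed

lemmas has_Bochner_integral_scaleR = has_Bochner_integral_linear[OF bounded_linear_scaleR_right]
lemmas has_Bochner_integral_scaleC = has_Bochner_integral_linear[OF scaleC.bounded_linear_right]
lemmas has_Bochner_integral_minus = has_Bochner_integral_linear[OF bounded_linear_minus[OF bounded_linear_ident]]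

lemma has_Bochner_integral_diff:
  assumes "has_Bochner_integral M f I" "has_Bochner_integral M g J"
  shows "has_Bochner_integral M (\<lambda>x. f x - g x) (I - J)"
  using has_Bochner_integral_add[OF assms(1) has_Bochner_integral_minus[OF assms(2)]] by simp

lemma has_Bochner_integral_cong_AE:
  assumes "has_Bochner_integral M f I" "AE x in M. f x = g x"
  shows "has_Bochner_integral M g I"
proof -
  have "(\<integral>\<^sup>+x. enorm (g x - s x) \<partial>M) = (\<integral>\<^sup>+x. enorm (f x - s x) \<partial>M)" for s
    by (rule nn_integral_cong_AE) (use assms(2) in eventually_elim, simp)
  then show ?thesis using assms(1) strongly_measurable_cong_AE[OF _ assms(2)]
    unfolding has_Bochner_integral_def by auto
qed

lemma has_Bochner_integral_unique:
  assumes "has_Bochner_integral M f I" "has_Bochner_integral M f J"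
  shows "I = J"
proof -
  have "enorm (I - J) \<le> 0"
    using has_Bochner_integral_norm_le[OF has_Bochner_integral_diff[OF assms]] by simp
  then show ?thesis by (simp add: ennreal_eq_0_iff)
qed

lemma has_Bochner_integral_zero [simp]: "has_Bochner_integral M (\<lambda>x. 0) 0"
proof -
  have "sbi M (\<lambda>x. 0::'b)" by (auto intro!: Bochner_Integration.simple_bochner_integrable.intros)
  moreover have "sint M (\<lambda>x. 0::'b) = 0" unfolding Bochner_Integration.simple_bochner_integral_def by (intro sum.neutral) auto
  ultimately show ?thesis unfolding has_Bochner_integral_def
    by (intro conjI strongly_measurable_simple exI[of _ "\<lambda>i x. 0"]) auto
qed

text \<open>The approximating simple functions \<open>s i\<close> need not be dominated. Cutting them to zero where their
norm exceeds twice that of \<open>f\<close> keeps them simple and pointwise convergent, and then \<open>3\<close> times the norm of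
\<open>f\<close> dominates the error. The integrals of the truncated functions form a Cauchy sequence.\<close>

lemma has_Bochner_integral_exists:
  fixes f :: "'s \<Rightarrow> 'a::banach"
  assumes f: "strongly_measurable M f" and fin: "(\<integral>\<^sup>+x. enorm (f x) \<partial>M) < \<infinity>"
  obtains I where "has_Bochner_integral M f I"
proof -
  obtain s where s: "\<And>i. sbi M (s i)" and lim: "AE x in M. (\<lambda>i::nat. s i x) \<longlonglongrightarrow> f x"
    using f unfolding strongly_measurable_def by blast
  obtain r where r[measurable]: "r \<in> borel_measurable M" and fr: "AE x in M. enorm (f x) = r x"
    using strongly_measurable_norm_rep[OF f] by blast
  note [measurable] = sbi_measurable[OF s]
  define t where "t i x = (if enorm (s i x) \<le> 2 * r x then s i x else 0)" for i x
  have t: "sbi M (t i)" for i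
  proof (rule Bochner_Integration.simple_bochner_integrable.intros)
    have si: "simple_function M (s i)" and fi: "emeasure M {y\<in>space M. s i y \<noteq> 0} \<noteq> \<infinity>"
      using s[of i] by (auto elim: Bochner_Integration.simple_bochner_integrable.cases)
    show "simple_function M (t i)" unfolding t_def
      by (intro simple_function_If si) auto
    have [measurable]: "s i \<in> measurable M (count_space UNIV)" using si by (rule measurable_simple_function)
    have "emeasure M {y\<in>space M. t i y \<noteq> 0} \<le> emeasure M {y\<in>space M. s i y \<noteq> 0}"
      by (intro emeasure_mono) (auto simp: t_def)
    then show "emeasure M {y\<in>space M. t i y \<noteq> 0} \<noteq> \<infinity>" using fi by (auto simp: top_unique)
  qed
  have ft: "strongly_measurable M (\<lambda>x. f x - t i x)" for i
    by (intro strongly_measurable_diff f strongly_measurable_simple t)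
  have "\<exists>q. q \<in> borel_measurable M \<and> (AE x in M. enorm (f x - t i x) = q x)" for i
    using strongly_measurable_norm_rep[OF ft] by blast
  then obtain q where q[measurable]: "\<And>i. q i \<in> borel_measurable M"
    and fq: "\<And>i. AE x in M. enorm (f x - t i x) = q i x" by metis
  have fq_all: "AE x in M. \<forall>i. enorm (f x - t i x) = q i x"
    using fq by (simp add: AE_all_countable)
  have r_fin: "(\<integral>\<^sup>+x. r x \<partial>M) < \<infinity>"
    using fin by (subst nn_integral_cong_AE[where v="\<lambda>x. enorm (f x)"]) (use fr in \<open>auto simp: eq_commute\<close>)
  have "(\<lambda>i. \<integral>\<^sup>+x. q i x \<partial>M) \<longlonglongrightarrow> (\<integral>\<^sup>+x. 0 \<partial>M)"
  proof (rule nn_integral_dominated_convergence)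
    show "(\<integral>\<^sup>+x. 3 * r x \<partial>M) < \<infinity>"
      using r_fin by (subst nn_integral_cmult) (auto simp: ennreal_mult_less_top)
    show "AE x in M. q i x \<le> 3 * r x" for i
      using fr fq[of i]
    proof eventually_elim
      case (elim x)
      have "enorm (t i x) \<le> 2 * r x" by (auto simp: t_def)
      moreover have "q i x \<le> r x + enorm (t i x)"
        unfolding elim[symmetric] by (simp flip: ennreal_plus add: norm_triangle_ineq4)
      ultimately have "q i x \<le> r x + 2 * r x" using add_left_mono order_trans by blast
      also have "\<dots> = 3 * r x" by (metis (no_types) mult_1 distrib_right numeral_One numeral_plus_numeral semiring_norm(3))
      finally show ?case .
    qed
    show "AE x in M. (\<lambda>i. q i x) \<longlonglongrightarrow> 0"
      using lim fr fq_all
    proof eventually_elim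
      case (elim x)
      have "(\<lambda>i. t i x) \<longlonglongrightarrow> f x"
      proof (cases "f x = 0")
        case True
        then have "r x = 0" using elim(2) by simp
        then have "t i x = 0" for i by (auto simp: t_def ennreal_eq_0_iff)
        then show ?thesis using True by simp
      next
        case False
        have "eventually (\<lambda>i. norm (s i x) < 2 * norm (f x)) sequentially"
          using tendsto_norm[OF elim(1)] by (rule order_tendstoD) (use False in auto)
        then have "eventually (\<lambda>i. s i x = t i x) sequentially"
        proof eventually_elim
          case (elim i)
          have "enorm (s i x) \<le> ennreal (2 * norm (f x))" using elim by (intro ennreal_leI) auto
          also have "\<dots> = 2 * r x" by (simp add: ennreal_mult \<open>enorm (f x) = r x\<close>)
          finally show ?case by (simp add: t_def)
        qed
        from tendsto_cong[OF this] elim(1) show ?thesis by simp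
      qed
      then have "(\<lambda>i. norm (f x - t i x)) \<longlonglongrightarrow> norm (f x - f x)" by (intro tendsto_intros)
      then have "(\<lambda>i. enorm (f x - t i x)) \<longlonglongrightarrow> ennreal 0" by (intro tendsto_ennrealI) simp
      then show ?case using elim(3) by simp
    qed
  qed auto
  then have t0: "(\<lambda>i. \<integral>\<^sup>+x. enorm (f x - t i x) \<partial>M) \<longlonglongrightarrow> 0"
    using nn_integral_cong_AE[OF fq] by simp
  have "Cauchy (\<lambda>i. sint M (t i))"
  proof (rule CauchyI')
    fix e :: real assume e: "0 < e"
    have "eventually (\<lambda>i. (\<integral>\<^sup>+x. enorm (f x - t i x) \<partial>M) < ennreal (e/2)) sequentially"
      using t0 by (rule order_tendstoD) (use e in auto)
    then obtain N where N: "\<And>i. i \<ge> N \<Longrightarrow> (\<integral>\<^sup>+x. enorm (f x - t i x) \<partial>M) < ennreal (e/2)"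
      by (auto simp: eventually_sequentially)
    have "norm (sint M (t m) - sint M (t n)) < e" if "m \<ge> N" "n > m" for m n
    proof -
      have d: "sbi M (\<lambda>x. t m x - t n x)" by (rule simple_bochner_integrable_compose2[OF _ t t]) simp
      have "enorm (sint M (t m) - sint M (t n)) \<le> (\<integral>\<^sup>+x. enorm (t m x - t n x) \<partial>M)"
        using sint_norm_le[OF d] by (simp add: simple_bochner_integral_diff t)
      also have "\<dots> \<le> (\<integral>\<^sup>+x. enorm (f x - t m x) + enorm (f x - t n x) \<partial>M)"
        by (intro nn_integral_mono)
           (metis ennreal_leI ennreal_plus norm_ge_zero norm_diff_triangle_le norm_minus_commute order_refl)
      also have "\<dots> = (\<integral>\<^sup>+x. enorm (f x - t m x) \<partial>M) + (\<integral>\<^sup>+x. enorm (f x - t n x) \<partial>M)"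
        by (intro strongly_measurable_nn_integral_add ft)
      also have "\<dots> < ennreal (e/2) + ennreal (e/2)"
        using N[of m] N[of n] that by (intro add_strict_mono) auto
      also have "\<dots> = ennreal e" using e by (simp flip: ennreal_plus)
      finally show ?thesis by (simp add: ennreal_less_iff)
    qed
    then show "\<exists>N. \<forall>m\<ge>N. \<forall>n>m. dist (sint M (t m)) (sint M (t n)) < e" unfolding dist_norm by blast
  qed
  then obtain I where "(\<lambda>i. sint M (t i)) \<longlonglongrightarrow> I" using Cauchy_convergent convergent_def by blast
  then have "has_Bochner_integral M f I" unfolding has_Bochner_integral_def using f t t0 by blast
  then show ?thesis by (rule that)
qed

section \<open>Powers on the extended half-line, Hoelder inequality and Schur test\<close>

text \<open>The power function on \<open>[0, \<infinity>]\<close> with \<open>epow \<top> p = \<top>\<close>, so that kernel estimates need no a priori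
finiteness.\<close>

definition epow :: "ennreal \<Rightarrow> real \<Rightarrow> ennreal" where
  "epow x p = (if x = \<top> then \<top> else ennreal (enn2real x powr p))"

lemma epow_ennreal [simp]: "0 \<le> r \<Longrightarrow> epow (ennreal r) p = ennreal (r powr p)"
  by (simp add: epow_def)

lemma epow_0 [simp]: "epow 0 p = 0"
  by (simp add: epow_def)

lemma epow_top [simp]: "epow \<top> p = \<top>"
  by (simp add: epow_def)

lemma epow_mono:
  assumes "0 \<le> p" "x \<le> y" shows "epow x p \<le> epow y p"
proof (cases "y = \<top>")
  case False
  then have "x \<noteq> \<top>" using assms(2) top_unique by auto
  then show ?thesis using assms False
    by (auto simp: epow_def top.not_eq_extremum intro!: ennreal_leI powr_mono2 enn2real_mono)
qed simp

lemma epow_mult: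
  assumes "0 < p" shows "epow (x * y) p = epow x p * epow y p"
proof (cases x; cases y)
  fix r s assume "x = ennreal r" "0 \<le> r" "y = ennreal s" "0 \<le> s"
  then show ?thesis by (simp add: ennreal_mult[symmetric] powr_mult)
next
  fix r assume "x = ennreal r" "0 \<le> r" "y = \<top>"
  then show ?thesis by (cases "r = 0") (auto simp: ennreal_mult_top)
next
  fix s assume "y = ennreal s" "0 \<le> s" "x = \<top>"
  then show ?thesis by (cases "s = 0") (auto simp: ennreal_top_mult)
qed simp

lemma epow_add:
  assumes "0 < p" shows "epow (x + y) p \<le> ennreal (2 powr p) * (epow x p + epow y p)"
proof -
  have "epow (x + y) p \<le> epow (ennreal 2 * max x y) p"
  proof (rule epow_mono)
    have "x + y \<le> max x y + max x y" by (intro add_mono) auto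
    then show "x + y \<le> ennreal 2 * max x y" by (simp add: mult_2)
  qed (use assms in simp)
  also have "\<dots> = ennreal (2 powr p) * epow (max x y) p" using assms epow_ennreal[of 2 p]
    by (simp only: epow_mult)
  also have "\<dots> \<le> ennreal (2 powr p) * (epow x p + epow y p)"
    by (intro mult_left_mono) (auto simp: max_def)
  finally show ?thesis .
qed

lemma measurable_epow [measurable]:
  assumes [measurable]: "f \<in> borel_measurable M" shows "(\<lambda>x. epow (f x) p) \<in> borel_measurable M"
  unfolding epow_def by measurable

text \<open>The tangent of \<open>t \<mapsto> t powr p\<close> at \<open>t = m\<close>: the inequality is sharp for \<open>g = m\<close>. Keeping the free parameter
\<open>m\<close> allows it to be optimised after integration.\<close>

lemma Young_tangent:
  fixes p g m :: real assumes "1 < p" "0 \<le> g" "0 < m"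
  shows "g \<le> (1/p) * m powr (1 - p) * g powr p + (1 - 1/p) * m"
proof (cases "g = 0")
  case False
  with assms have g: "0 < g" by simp
  have "(g powr p * m powr (1-p)) powr (1/p) * m powr (1 - 1/p) \<le> (1/p) * (g powr p * m powr (1-p)) + (1 - 1/p) * m"
    by (rule Youngs_inequality_0) (use assms g in \<open>auto simp: field_simps\<close>)
  moreover have "(g powr p * m powr (1-p)) powr (1/p) * m powr (1 - 1/p) = g"
  proof -
    have "(g powr p * m powr (1-p)) powr (1/p) = g * m powr ((1-p) * (1/p))"
      using assms g by (simp add: powr_mult powr_powr)
    moreover have "m powr ((1-p) * (1/p)) * m powr (1 - 1/p) = m powr 0"
      unfolding powr_add[symmetric] by (rule arg_cong[where f="\<lambda>t. m powr t"]) (use assms in \<open>simp add: field_simps\<close>)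
    ultimately show ?thesis using assms by (simp add: mult.assoc)
  qed
  ultimately show ?thesis by (simp add: mult.commute mult.left_commute)
qed (use assms in simp)

text \<open>Young's inequality at the point \<open>m * \<phi> y\<close>, integrated against \<open>k\<close>, bounds the integral by a sum of a
multiple of \<open>m powr (1 - p)\<close> and a multiple of \<open>m\<close>. The optimal \<open>m\<close> balances the two terms.\<close>

lemma weighted_Hoelder:
  fixes k g :: "'s \<Rightarrow> ennreal" and \<phi> :: "'s \<Rightarrow> real"
  assumes p: "1 < p" and [measurable]: "k \<in> borel_measurable M" "g \<in> borel_measurable M" "\<phi> \<in> borel_measurable M"
    and pos: "\<And>y. k y \<noteq> 0 \<Longrightarrow> 0 < \<phi> y" and A: "0 < A"
    and le: "(\<integral>\<^sup>+y. k y * ennreal (\<phi> y) \<partial>M) \<le> ennreal A"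
  shows "epow (\<integral>\<^sup>+y. k y * g y \<partial>M) p \<le>
    ennreal (A powr (p - 1)) * (\<integral>\<^sup>+y. k y * epow (g y) p * ennreal (\<phi> y powr (1 - p)) \<partial>M)"
proof -
  define I where "I = (\<integral>\<^sup>+y. k y * epow (g y) p * ennreal (\<phi> y powr (1 - p)) \<partial>M)"
  have step: "(\<integral>\<^sup>+y. k y * g y \<partial>M) \<le> ennreal ((1/p) * m powr (1-p)) * I + ennreal ((1 - 1/p) * m * A)" if m: "0 < m" for m
  proof -
    have "(\<integral>\<^sup>+y. k y * g y \<partial>M) \<le> (\<integral>\<^sup>+y. ennreal ((1/p) * m powr (1-p)) * (k y * epow (g y) p * ennreal (\<phi> y powr (1 - p)))
        + ennreal ((1 - 1/p) * m) * (k y * ennreal (\<phi> y)) \<partial>M)"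
    proof (rule nn_integral_mono)
      fix y
      show "k y * g y \<le> ennreal ((1/p) * m powr (1-p)) * (k y * epow (g y) p * ennreal (\<phi> y powr (1 - p)))
        + ennreal ((1 - 1/p) * m) * (k y * ennreal (\<phi> y))"
      proof (cases "k y = 0")
        case False
        then have ph: "0 < \<phi> y" by (rule pos)
        have "g y \<le> ennreal ((1/p) * m powr (1-p)) * (epow (g y) p * ennreal (\<phi> y powr (1 - p))) + ennreal ((1 - 1/p) * m) * ennreal (\<phi> y)"
        proof (cases "g y")
          case (real r)
          have "r \<le> (1/p) * (m * \<phi> y) powr (1 - p) * r powr p + (1 - 1/p) * (m * \<phi> y)"
            by (rule Young_tangent) (use p m ph real in auto)
          also have "\<dots> = ((1/p) * m powr (1-p)) * (r powr p * \<phi> y powr (1 - p)) + (1 - 1/p) * m * \<phi> y"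
            using m ph by (simp add: powr_mult)
          finally have "ennreal r \<le> ennreal (((1/p) * m powr (1-p)) * (r powr p * \<phi> y powr (1 - p)) + (1 - 1/p) * m * \<phi> y)"
            by (rule ennreal_leI)
          also have "\<dots> = ennreal ((1/p) * m powr (1-p)) * (epow (g y) p * ennreal (\<phi> y powr (1 - p))) + ennreal ((1 - 1/p) * m) * ennreal (\<phi> y)"
          proof -
            have "ennreal (((1/p) * m powr (1-p)) * (r powr p * \<phi> y powr (1 - p)) + (1 - 1/p) * m * \<phi> y)
              = ennreal (((1/p) * m powr (1-p)) * (r powr p * \<phi> y powr (1 - p))) + ennreal ((1 - 1/p) * m * \<phi> y)"
              using p m ph by (intro ennreal_plus) auto
            moreover have "ennreal ((1 - 1/p) * m * \<phi> y) = ennreal ((1 - 1/p) * m) * ennreal (\<phi> y)"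
              using p m ph by (intro ennreal_mult) auto
            moreover have "ennreal (((1/p) * m powr (1-p)) * (r powr p * \<phi> y powr (1 - p)))
              = ennreal ((1/p) * m powr (1-p)) * ennreal (r powr p * \<phi> y powr (1 - p))"
              using p by (intro ennreal_mult) auto
            moreover have "ennreal (r powr p * \<phi> y powr (1 - p)) = ennreal (r powr p) * ennreal (\<phi> y powr (1 - p))"
              by (intro ennreal_mult) auto
            ultimately show ?thesis using real by simp
          qed
          finally show ?thesis using real by simp
        next
          case top
          then show ?thesis using p m ph by (simp add: ennreal_top_mult ennreal_mult_top)
        qed
        from mult_left_mono[OF this, of "k y"] show ?thesis by (simp add: algebra_simps)
      qed simp
    qed
    also have "\<dots> = ennreal ((1/p) * m powr (1-p)) * I + ennreal ((1 - 1/p) * m) * (\<integral>\<^sup>+y. k y * ennreal (\<phi> y) \<partial>M)"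
      unfolding I_def by (subst nn_integral_add) (auto simp: nn_integral_cmult)
    also have "\<dots> \<le> ennreal ((1/p) * m powr (1-p)) * I + ennreal ((1 - 1/p) * m) * ennreal A"
      by (intro add_left_mono mult_left_mono le) simp
    also have "ennreal ((1 - 1/p) * m) * ennreal A = ennreal ((1 - 1/p) * m * A)"
      using p m A by (simp add: ennreal_mult'')
    finally show ?thesis .
  qed
  show ?thesis
  proof (cases "I")
    case top
    then show ?thesis unfolding I_def[symmetric] using A by (simp add: ennreal_mult_top)
  next
    case (real i)
    show ?thesis
    proof (cases "i = 0")
      case True
      \<comment> \<open>If the right-hand side vanishes, there is no optimal \<open>m\<close>; let it tend to
        \<open>0\<close> instead.\<close>
      have "(\<integral>\<^sup>+y. k y * g y \<partial>M) \<le> 0 + ennreal e" if "0 < e" for e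
      proof -
        have "0 < 1 - 1/p" using p by simp
        then have "(1 - 1/p) * (e / ((1 - 1/p) * A)) * A = e" "0 < e / ((1 - 1/p) * A)" using A that by auto
        then show ?thesis using step[of "e / ((1 - 1/p) * A)"] True real by simp
      qed
      then have "(\<integral>\<^sup>+y. k y * g y \<partial>M) \<le> 0" by (rule ennreal_le_epsilon)
      then show ?thesis by simp
    next
      case False
      with real have i: "0 < i" by simp
      \<comment> \<open>The two terms then have the ratio \<open>1 : (p - 1)\<close> and add up to \<open>m *
        A\<close>.\<close>
      define m where "m = (i / A) powr (1/p)"
      have m: "0 < m" using i A by (simp add: m_def)
      have mp: "m powr p = i / A" using i A p by (simp add: m_def powr_powr)
      have "(\<integral>\<^sup>+y. k y * g y \<partial>M) \<le> ennreal ((1/p) * m powr (1-p) * i + (1 - 1/p) * m * A)"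
      proof -
        have "ennreal ((1/p) * m powr (1-p) * i) = ennreal ((1/p) * m powr (1-p)) * I"
          using real p by (simp only: real, intro ennreal_mult) auto
        moreover have "ennreal ((1/p) * m powr (1-p) * i + (1 - 1/p) * m * A)
          = ennreal ((1/p) * m powr (1-p) * i) + ennreal ((1 - 1/p) * m * A)"
          using p m A real by (intro ennreal_plus) auto
        ultimately show ?thesis using step[OF m] by simp
      qed
      also have "(1/p) * m powr (1-p) * i + (1 - 1/p) * m * A = m * A"
      proof -
        have "m powr (1-p) * i = m * A" using mp m i A by (simp add: powr_diff field_simps)
        then show ?thesis using p by (simp add: field_simps)
      qed
      finally have "epow (\<integral>\<^sup>+y. k y * g y \<partial>M) p \<le> epow (ennreal (m * A)) p"
        using p by (intro epow_mono) auto
      also have "\<dots> = ennreal (A powr (p - 1) * i)"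
        using m A i by (simp add: powr_mult mp powr_diff)
      finally show ?thesis unfolding I_def[symmetric] using real A by (simp add: ennreal_mult'')
    qed
  qed
qed

text \<open>The \<open>p\<close>-th power of the norm in \<open>L\<^sup>p\<close> with weight \<open>x powr a\<close>; leaving out the root keeps all
estimates linear in this quantity.\<close>

definition wint :: "real \<Rightarrow> real \<Rightarrow> (real \<Rightarrow> ennreal) \<Rightarrow> ennreal" where
  "wint p a g = (\<integral>\<^sup>+x. epow (g x) p * ennreal (x powr a) * indicator {0<..} x \<partial>lborel)"

lemma wint_mono:
  assumes "0 \<le> p" "\<And>x. 0 < x \<Longrightarrow> f x \<le> g x" shows "wint p a f \<le> wint p a g"
  unfolding wint_def using assms
  by (intro nn_integral_mono) (auto simp: indicator_def intro!: mult_right_mono epow_mono)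

lemma wint_add:
  assumes [measurable]: "f \<in> borel_measurable borel" "g \<in> borel_measurable borel" and "0 < p"
  shows "wint p a (\<lambda>x. f x + g x) \<le> ennreal (2 powr p) * (wint p a f + wint p a g)"
proof -
  have "wint p a (\<lambda>x. f x + g x) \<le> (\<integral>\<^sup>+x. ennreal (2 powr p) * (epow (f x) p * ennreal (x powr a) * indicator {0<..} x
     + epow (g x) p * ennreal (x powr a) * indicator {0<..} x) \<partial>lborel)"
    unfolding wint_def
  proof (rule nn_integral_mono)
    fix x :: real
    show "epow (f x + g x) p * ennreal (x powr a) * indicator {0<..} x \<le> ennreal (2 powr p) * (epow (f x) p * ennreal (x powr a) * indicator {0<..} x
     + epow (g x) p * ennreal (x powr a) * indicator {0<..} x)"
      using mult_right_mono[OF epow_add[OF assms(3), of "f x" "g x"], of "ennreal (x powr a) * indicator {0<..} x"]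
      by (simp add: algebra_simps)
  qed
  also have "\<dots> = ennreal (2 powr p) * (wint p a f + wint p a g)"
    unfolding wint_def by (subst nn_integral_cmult, measurable, subst nn_integral_add) auto
  finally show ?thesis .
qed

lemma wint_cmult:
  assumes [measurable]: "f \<in> borel_measurable borel" and "0 < p"
  shows "wint p a (\<lambda>x. c * f x) = epow c p * wint p a f"
proof -
  have "wint p a (\<lambda>x. c * f x) = (\<integral>\<^sup>+x. epow c p * (epow (f x) p * ennreal (x powr a) * indicator {0<..} x) \<partial>lborel)"
    unfolding wint_def by (intro nn_integral_cong) (simp add: epow_mult[OF assms(2)] mult.assoc)
  then show ?thesis unfolding wint_def by (subst (asm) nn_integral_cmult) auto
qed

lemma wint_weight:
  assumes "0 < p" shows "wint p a (\<lambda>x. ennreal x * f x) = wint p (a + p) f"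
  unfolding wint_def
proof (rule nn_integral_cong)
  fix x :: real
  show "epow (ennreal x * f x) p * ennreal (x powr a) * indicator {0<..} x = epow (f x) p * ennreal (x powr (a + p)) * indicator {0<..} x"
    using assms by (cases "0 < x") (auto simp: epow_mult powr_add ennreal_mult'' mult_ac)
qed

definition kernel_op :: "(real \<Rightarrow> real \<Rightarrow> ennreal) \<Rightarrow> (real \<Rightarrow> ennreal) \<Rightarrow> real \<Rightarrow> ennreal" where
  "kernel_op k g x = (\<integral>\<^sup>+y. k x y * g y * indicator {0<..} y \<partial>lborel)"

lemma measurable_kernel_op [measurable]:
  assumes [measurable]: "(\<lambda>(x, y). k x y) \<in> borel_measurable (borel \<Otimes>\<^sub>M borel)" "g \<in> borel_measurable borel"
  shows "kernel_op k g \<in> borel_measurable borel"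
  unfolding kernel_op_def[abs_def] by measurable

text \<open>Hoelder's inequality with the auxiliary weight \<open>y powr (- s)\<close> in the inner integral, whose total mass
is bounded by \<open>row\<close>; after exchanging the integrals, \<open>col\<close> is exactly what remains.\<close>

lemma Schur_test:
  assumes p: "1 < p" and A: "0 < A" and B: "0 \<le> B"
    and [measurable]: "(\<lambda>(x, y). k x y) \<in> borel_measurable (borel \<Otimes>\<^sub>M borel)" "g \<in> borel_measurable borel"
    and row: "\<And>x. 0 < x \<Longrightarrow> (\<integral>\<^sup>+y. k x y * ennreal (y powr (- s)) * indicator {0<..} y \<partial>lborel) \<le> ennreal (A * x powr (- s))"
    and col: "\<And>y. 0 < y \<Longrightarrow> (\<integral>\<^sup>+x. k x y * ennreal (x powr (a - s * (p - 1))) * indicator {0<..} x \<partial>lborel)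
      \<le> ennreal (B * y powr (a - s * (p - 1)))"
  shows "wint p a (kernel_op k g) \<le> ennreal (A powr (p - 1) * B) * wint p a g"
proof -
  let ?i = "indicator {0<..} :: real \<Rightarrow> ennreal"
  let ?b = "a - s * (p - 1)"
  define G where "G y = epow (g y) p * ennreal (y powr (s * (p - 1)))" for y
  have [measurable]: "G \<in> borel_measurable borel" unfolding G_def[abs_def] by measurable
  have pw: "epow (kernel_op k g x) p * ennreal (x powr a) * ?i x \<le>
     ennreal (A powr (p-1)) * (\<integral>\<^sup>+y. k x y * ?i y * G y * (ennreal (x powr ?b) * ?i x) \<partial>lborel)" for x
  proof (cases "0 < x")
    case True
    have "epow (\<integral>\<^sup>+y. (k x y * ?i y) * g y \<partial>lborel) p \<le>
      ennreal ((A * x powr (- s)) powr (p - 1)) * (\<integral>\<^sup>+y. (k x y * ?i y) * epow (g y) p * ennreal ((if 0 < y then y powr (- s) else 1) powr (1 - p)) \<partial>lborel)"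
    proof (rule weighted_Hoelder[OF p])
      show "(\<integral>\<^sup>+y. (k x y * ?i y) * ennreal (if 0 < y then y powr - s else 1) \<partial>lborel) \<le> ennreal (A * x powr (- s))"
        using row[OF True] by (rule order_trans[rotated]) (auto intro!: nn_integral_mono simp: indicator_def)
    qed (use A True in \<open>auto simp: indicator_def\<close>)
    also have "(\<integral>\<^sup>+y. (k x y * ?i y) * epow (g y) p * ennreal ((if 0 < y then y powr (- s) else 1) powr (1 - p)) \<partial>lborel)
      = (\<integral>\<^sup>+y. k x y * ?i y * G y \<partial>lborel)"
      unfolding G_def by (intro nn_integral_cong) (auto simp: indicator_def powr_powr algebra_simps)
    finally have *: "epow (\<integral>\<^sup>+y. (k x y * ?i y) * g y \<partial>lborel) p \<le>
      ennreal ((A * x powr (- s)) powr (p - 1)) * (\<integral>\<^sup>+y. k x y * ?i y * G y \<partial>lborel)" .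
    have "epow (kernel_op k g x) p * ennreal (x powr a) \<le>
       ennreal ((A * x powr (- s)) powr (p - 1)) * (\<integral>\<^sup>+y. k x y * ?i y * G y \<partial>lborel) * ennreal (x powr a)"
      unfolding kernel_op_def using * by (intro mult_right_mono) (simp_all add: mult_ac)
    also have "\<dots> = ennreal ((A * x powr (- s)) powr (p - 1) * x powr a) * (\<integral>\<^sup>+y. k x y * ?i y * G y \<partial>lborel)"
      by (simp add: ennreal_mult'' mult_ac)
    also have "(A * x powr (- s)) powr (p - 1) * x powr a = A powr (p-1) * x powr ?b"
      using A True by (simp add: powr_mult powr_powr powr_add[symmetric])
    also have "ennreal (A powr (p-1) * x powr ?b) * (\<integral>\<^sup>+y. k x y * ?i y * G y \<partial>lborel)
      = ennreal (A powr (p-1)) * (\<integral>\<^sup>+y. k x y * ?i y * G y * ennreal (x powr ?b) \<partial>lborel)"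
      by (subst nn_integral_multc) (auto simp: ennreal_mult'' mult_ac)
    finally show ?thesis using True by simp
  qed simp
  have "wint p a (kernel_op k g) \<le> (\<integral>\<^sup>+x. ennreal (A powr (p-1)) * (\<integral>\<^sup>+y. k x y * ?i y * G y * (ennreal (x powr ?b) * ?i x) \<partial>lborel) \<partial>lborel)"
    unfolding wint_def by (intro nn_integral_mono pw)
  also have "\<dots> = ennreal (A powr (p-1)) * (\<integral>\<^sup>+x. (\<integral>\<^sup>+y. k x y * ?i y * G y * (ennreal (x powr ?b) * ?i x) \<partial>lborel) \<partial>lborel)"
    by (intro nn_integral_cmult) measurable
  also have "(\<integral>\<^sup>+x. (\<integral>\<^sup>+y. k x y * ?i y * G y * (ennreal (x powr ?b) * ?i x) \<partial>lborel) \<partial>lborel)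
     = (\<integral>\<^sup>+y. (\<integral>\<^sup>+x. k x y * ?i y * G y * (ennreal (x powr ?b) * ?i x) \<partial>lborel) \<partial>lborel)"
    by (rule lborel_pair.Fubini') measurable
  also have "\<dots> = (\<integral>\<^sup>+y. ?i y * G y * (\<integral>\<^sup>+x. k x y * ennreal (x powr ?b) * ?i x \<partial>lborel) \<partial>lborel)"
    by (intro nn_integral_cong, subst nn_integral_cmult[symmetric]) (auto intro!: nn_integral_cong simp: mult_ac)
  also have "\<dots> \<le> (\<integral>\<^sup>+y. ?i y * G y * ennreal (B * y powr ?b) \<partial>lborel)"
  proof (rule nn_integral_mono)
    fix y :: real
    show "?i y * G y * (\<integral>\<^sup>+x. k x y * ennreal (x powr ?b) * ?i x \<partial>lborel) \<le> ?i y * G y * ennreal (B * y powr ?b)"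
      using col[of y] by (cases "0 < y") (auto intro: mult_left_mono)
  qed
  also have "\<dots> = (\<integral>\<^sup>+y. ennreal B * (epow (g y) p * ennreal (y powr a) * ?i y) \<partial>lborel)"
  proof (rule nn_integral_cong)
    fix y :: real
    show "?i y * G y * ennreal (B * y powr ?b) = ennreal B * (epow (g y) p * ennreal (y powr a) * ?i y)"
    proof (cases "0 < y")
      case True
      have "y powr (s * (p - 1)) * (B * y powr ?b) = B * y powr a"
        using True by (simp add: powr_add[symmetric])
      then have "ennreal (y powr (s * (p - 1))) * ennreal (B * y powr ?b) = ennreal B * ennreal (y powr a)"
        using B by (simp flip: ennreal_mult'' ennreal_mult')
      then show ?thesis using True by (simp add: G_def) (simp add: mult_ac)
    qed simp
  qed
  also have "\<dots> = ennreal B * wint p a g" unfolding wint_def by (intro nn_integral_cmult) measurable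
  finally have "wint p a (kernel_op k g) \<le> ennreal (A powr (p - 1)) * (ennreal B * wint p a g)"
    by (simp add: mult_left_mono)
  then show ?thesis using A B by (simp add: ennreal_mult'' mult.assoc)
qed

section \<open>Exponential kernels on power-weighted spaces\<close>

lemma nn_integral_exp_forward:
  fixes c x :: real assumes c: "0 < c"
  shows "(\<integral>\<^sup>+y. ennreal (c * exp (- (c * (y - x)))) * indicator {x..} y \<partial>lborel) = 1"
proof -
  have "filterlim (\<lambda>y. c * (- x + y)) at_top at_top"
    by (intro filterlim_tendsto_pos_mult_at_top[OF tendsto_const c]
        filterlim_tendsto_add_at_top[OF tendsto_const] filterlim_ident)
  then have "filterlim (\<lambda>y. - (c * (y - x))) at_bot at_top" by (simp add: filterlim_uminus_at_bot)
  from filterlim_compose[OF exp_at_bot this] have "((\<lambda>y. - exp (- (c * (y - x)))) \<longlongrightarrow> - 0) at_top"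
    by (rule tendsto_minus)
  then have "(\<integral>\<^sup>+y. ennreal (c * exp (- (c * (y - x)))) * indicator {x..} y \<partial>lborel) = ennreal (0 - - exp (- (c * (x - x))))"
    by (intro nn_integral_FTC_atLeast) (use c in \<open>auto intro!: derivative_eq_intros\<close>)
  then show ?thesis by simp
qed

lemma nn_integral_exp_forward_le:
  fixes c x :: real assumes c: "0 < c"
  shows "(\<integral>\<^sup>+y. exp_kernel c x y \<partial>lborel) \<le> 1"
  unfolding nn_integral_exp_forward[OF c, of x, symmetric]
  by (intro nn_integral_mono) (auto simp: indicator_def)

lemma nn_integral_exp_backward_le:
  fixes c y :: real assumes c: "0 < c"
  shows "(\<integral>\<^sup>+x. exp_kernel c x y \<partial>lborel) \<le> 1"
proof -
  have "(\<integral>\<^sup>+x. exp_kernel c x y \<partial>lborel)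
    = ennreal \<bar>-1\<bar> * (\<integral>\<^sup>+x. (if 2 * y + -1 * x < y then ennreal (c * exp (- (c * (y - (2 * y + -1 * x))))) else 0) \<partial>lborel)"
    by (rule nn_integral_real_affine) auto
  also have "\<dots> = 1 * (\<integral>\<^sup>+x. (if y < x then ennreal (c * exp (- (c * (x - y)))) else 0) \<partial>lborel)"
    by (intro arg_cong2[where f="(*)"] nn_integral_cong) (auto simp: algebra_simps)
  finally show ?thesis using nn_integral_exp_forward_le[OF c, of y] by simp
qed

lemma nn_integral_powr_from_0:
  fixes b y :: real assumes "-1 < b" "0 < y"
  shows "(\<integral>\<^sup>+x. ennreal (x powr b) * indicator {0..y} x \<partial>lborel) = ennreal (y powr (b+1) / (b+1))"
  by (rule nn_integral_has_integral_lebesgue'[OF _ has_integral_powr_from_0]) (use assms in auto)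

lemma nn_integral_powr_to_infinity:
  fixes b x :: real assumes "b < -1" "0 < x"
  shows "(\<integral>\<^sup>+y. ennreal (y powr b) * indicator {x..} y \<partial>lborel) = ennreal (- (x powr (b+1)) / (b+1))"
  by (rule nn_integral_has_integral_lebesgue'[OF _ has_integral_powr_to_inf]) (use assms in auto)

lemma powr_comparable:
  fixes x y b :: real assumes "0 < y" "y / 2 \<le> x" "x \<le> 2 * y"
  shows "x powr b \<le> 2 powr \<bar>b\<bar> * y powr b"
proof (cases "0 \<le> b")
  case True
  have "x powr b \<le> (2 * y) powr b" using assms True by (intro powr_mono2) auto
  then show ?thesis using assms True by (simp add: powr_mult)
next
  case False
  have "x powr b \<le> (y / 2) powr b" using assms False by (intro powr_mono2') auto
  then show ?thesis using assms False by (simp add: powr_divide powr_minus field_simps)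
qed

lemma exp_neg_le_inverse: "0 < t \<Longrightarrow> exp (- t) \<le> 1 / (t::real)"
proof -
  assume t: "0 < t"
  then have "t \<le> exp t" using exp_ge_add_one_self[of t] by linarith
  then show ?thesis using t by (simp add: exp_minus field_simps)
qed

text \<open>Where \<open>y / 2 \<le> x\<close>, the power is comparable to \<open>y powr b\<close> and the kernel has total mass at most \<open>1\<close>.
Where \<open>x < y / 2\<close>, the kernel is at most \<open>2 / y\<close> because \<open>exp (- t) \<le> 1 / t\<close>. The bound is uniform in
the rate \<open>c\<close>, which is what makes the final estimate uniform in \<open>\<lambda>\<close>.\<close>

lemma exp_convolution_powr_le:
  fixes b c y :: real assumes b: "-1 < b" and c: "0 < c" and y: "0 < y"
  shows "(\<integral>\<^sup>+x. (if 0 < x \<and> x < y then ennreal (c * exp (- (c * (y - x))) * x powr b) else 0) \<partial>lborel)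
    \<le> ennreal ((2 powr \<bar>b\<bar> + 2 / (b+1)) * y powr b)"
proof -
  have "(\<integral>\<^sup>+x. (if 0 < x \<and> x < y then ennreal (c * exp (- (c * (y - x))) * x powr b) else 0) \<partial>lborel)
    \<le> (\<integral>\<^sup>+x. ennreal (2 powr \<bar>b\<bar> * y powr b) * exp_kernel c x y
        + ennreal (2 / y) * (ennreal (x powr b) * indicator {0..y} x) \<partial>lborel)"
  proof (rule nn_integral_mono)
    fix x :: real
    show "(if 0 < x \<and> x < y then ennreal (c * exp (- (c * (y - x))) * x powr b) else 0) \<le>
        ennreal (2 powr \<bar>b\<bar> * y powr b) * exp_kernel c x y
        + ennreal (2 / y) * (ennreal (x powr b) * indicator {0..y} x)"
    proof (cases "0 < x \<and> x < y")
      case True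
      have "c * exp (- (c * (y - x))) * x powr b \<le> 2 powr \<bar>b\<bar> * y powr b * (c * exp (- (c * (y - x)))) + 2 / y * x powr b"
      proof (cases "y / 2 \<le> x")
        case True
        have "c * exp (- (c * (y - x))) * x powr b \<le> c * exp (- (c * (y - x))) * (2 powr \<bar>b\<bar> * y powr b)"
          using c y True \<open>0 < x \<and> x < y\<close> by (intro mult_left_mono powr_comparable) auto
        then show ?thesis using y c by (simp add: mult_ac add_increasing2)
      next
        case False
        have "exp (- (c * (y - x))) \<le> exp (- (c * y / 2))" using False c by (simp add: field_simps)
        also have "\<dots> \<le> 1 / (c * y / 2)" using c y by (intro exp_neg_le_inverse) simp
        finally have "c * exp (- (c * (y - x))) \<le> 2 / y" using c y by (simp add: field_simps)
        then have "c * exp (- (c * (y - x))) * x powr b \<le> 2 / y * x powr b" by (intro mult_right_mono) auto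
        then show ?thesis using c by (simp add: add_increasing)
      qed
      then have "ennreal (c * exp (- (c * (y - x))) * x powr b) \<le> ennreal (2 powr \<bar>b\<bar> * y powr b * (c * exp (- (c * (y - x)))) + 2 / y * x powr b)"
        by (rule ennreal_leI)
      also have "\<dots> = ennreal (2 powr \<bar>b\<bar> * y powr b) * ennreal (c * exp (- (c * (y - x)))) + ennreal (2 / y) * ennreal (x powr b)"
      proof -
        have "ennreal (2 powr \<bar>b\<bar> * y powr b * (c * exp (- (c * (y - x))))) = ennreal (2 powr \<bar>b\<bar> * y powr b) * ennreal (c * exp (- (c * (y - x))))"
          using c by (intro ennreal_mult) auto
        moreover have "ennreal (2 / y * x powr b) = ennreal (2 / y) * ennreal (x powr b)"
          using y by (intro ennreal_mult) auto
        ultimately show ?thesis using c y by (subst ennreal_plus) auto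
      qed
      finally show ?thesis using True by simp
    qed auto
  qed
  also have "\<dots> = ennreal (2 powr \<bar>b\<bar> * y powr b) * (\<integral>\<^sup>+x. exp_kernel c x y \<partial>lborel)
      + ennreal (2 / y) * (\<integral>\<^sup>+x. ennreal (x powr b) * indicator {0..y} x \<partial>lborel)"
    by (subst nn_integral_add) (auto simp: nn_integral_cmult)
  also have "\<dots> \<le> ennreal (2 powr \<bar>b\<bar> * y powr b) * 1 + ennreal (2 / y) * ennreal (y powr (b+1) / (b+1))"
    unfolding nn_integral_powr_from_0[OF b y]
    by (intro add_mono mult_left_mono nn_integral_exp_backward_le c) auto
  also have "\<dots> = ennreal (2 powr \<bar>b\<bar> * y powr b + 2 / y * (y powr (b+1) / (b+1)))"
  proof -
    have "ennreal (2 / y * (y powr (b+1) / (b+1))) = ennreal (2 / y) * ennreal (y powr (b+1) / (b+1))"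
      using y b by (intro ennreal_mult) auto
    then show ?thesis using y b by (subst ennreal_plus) auto
  qed
  also have "2 powr \<bar>b\<bar> * y powr b + 2 / y * (y powr (b+1) / (b+1)) = (2 powr \<bar>b\<bar> + 2 / (b+1)) * y powr b"
    using y by (simp add: powr_add field_simps)
  finally show ?thesis .
qed

text \<open>The inverse of \<open>c - \<partial>\<close>, integrating from infinity, and the inverse of \<open>c + \<partial>\<close>, integrating from \<open>0\<close>;
\<open>backward_exp\<close> after \<open>forward_exp\<close> is the inverse of \<open>c\<^sup>2 - \<partial>\<^sup>2\<close> with Dirichlet condition.\<close>

definition forward_exp :: "real \<Rightarrow> (real \<Rightarrow> ennreal) \<Rightarrow> real \<Rightarrow> ennreal" where
  "forward_exp c g x = (\<integral>\<^sup>+y. (if x < y then ennreal (exp (- (c * (y - x)))) * g y else 0) \<partial>lborel)"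

definition backward_exp :: "real \<Rightarrow> (real \<Rightarrow> ennreal) \<Rightarrow> real \<Rightarrow> ennreal" where
  "backward_exp c g x = (\<integral>\<^sup>+y. (if 0 < y \<and> y \<le> x then ennreal (exp (- (c * (x - y)))) * g y else 0) \<partial>lborel)"

definition tail_int :: "(real \<Rightarrow> ennreal) \<Rightarrow> real \<Rightarrow> ennreal" where
  "tail_int g x = (\<integral>\<^sup>+y. (if x < y then g y else 0) \<partial>lborel)"

lemma measurable_exp_ops [measurable]:
  assumes [measurable]: "g \<in> borel_measurable borel"
  shows "forward_exp c g \<in> borel_measurable borel" "backward_exp c g \<in> borel_measurable borel"
    "tail_int g \<in> borel_measurable borel"
  unfolding forward_exp_def[abs_def] backward_exp_def[abs_def] tail_int_def[abs_def] by measurable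

text \<open>Schur test without auxiliary weight: rows have mass \<open>1\<close>, columns are \<open>exp_convolution_powr_le\<close>.\<close>

lemma forward_exp_bound:
  assumes p: "1 < p" and a: "-1 < a" and c: "0 < c" and [measurable]: "g \<in> borel_measurable borel"
  shows "wint p a (\<lambda>x. ennreal c * forward_exp c g x) \<le> ennreal (2 powr \<bar>a\<bar> + 2 / (a+1)) * wint p a g"
proof -
  define k where "k x y = exp_kernel c x y" for x y :: real
  have [measurable]: "(\<lambda>(x, y). k x y) \<in> borel_measurable (borel \<Otimes>\<^sub>M borel)" unfolding k_def by measurable
  have "wint p a (\<lambda>x. ennreal c * forward_exp c g x) \<le> wint p a (kernel_op k g)"
  proof (rule wint_mono)
    fix x :: real assume x: "0 < x"
    have "ennreal c * forward_exp c g x = (\<integral>\<^sup>+y. ennreal c * (if x < y then ennreal (exp (- (c * (y - x)))) * g y else 0) \<partial>lborel)"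
      unfolding forward_exp_def by (subst nn_integral_cmult) auto
    also have "\<dots> = kernel_op k g x"
      unfolding kernel_op_def k_def using x c
      by (intro nn_integral_cong) (auto simp: ennreal_mult mult_ac)
    finally show "ennreal c * forward_exp c g x \<le> kernel_op k g x" by simp
  qed (use p in simp)
  also have "\<dots> \<le> ennreal (1 powr (p - 1) * (2 powr \<bar>a\<bar> + 2 / (a+1))) * wint p a g"
  proof (rule Schur_test[OF p, where s=0])
    fix x :: real assume x: "0 < x"
    have "(\<integral>\<^sup>+y. k x y * ennreal (y powr - 0) * indicator {0<..} y \<partial>lborel) \<le> (\<integral>\<^sup>+y. exp_kernel c x y \<partial>lborel)"
      by (intro nn_integral_mono) (auto simp: k_def indicator_def)
    also have "\<dots> \<le> 1" by (rule nn_integral_exp_forward_le[OF c])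
    finally show "(\<integral>\<^sup>+y. k x y * ennreal (y powr - 0) * indicator {0<..} y \<partial>lborel) \<le> ennreal (1 * x powr - 0)"
      using x by simp
  next
    fix y :: real assume y: "0 < y"
    have "(\<integral>\<^sup>+x. k x y * ennreal (x powr (a - 0 * (p - 1))) * indicator {0<..} x \<partial>lborel) =
      (\<integral>\<^sup>+x. (if 0 < x \<and> x < y then ennreal (c * exp (- (c * (y - x))) * x powr a) else 0) \<partial>lborel)"
      using c by (intro nn_integral_cong) (auto simp: k_def indicator_def ennreal_mult)
    also have "\<dots> \<le> ennreal ((2 powr \<bar>a\<bar> + 2 / (a+1)) * y powr a)" by (rule exp_convolution_powr_le[OF a c y])
    finally show "(\<integral>\<^sup>+x. k x y * ennreal (x powr (a - 0 * (p - 1))) * indicator {0<..} x \<partial>lborel)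
      \<le> ennreal ((2 powr \<bar>a\<bar> + 2 / (a+1)) * y powr (a - 0 * (p - 1)))" by simp
  qed (use a in auto)
  finally show ?thesis by simp
qed

text \<open>Dual to \<open>forward_exp_bound\<close>: with \<open>s = a / (p - 1)\<close> the column condition becomes unweighted, and the
row condition is \<open>exp_convolution_powr_le\<close> for the exponent \<open>- s > -1\<close>.\<close>

lemma backward_exp_bound:
  assumes p: "1 < p" and a: "a < p - 1" and c: "0 < c" and [measurable]: "g \<in> borel_measurable borel"
  shows "wint p a (\<lambda>x. ennreal c * backward_exp c g x) \<le>
    ennreal ((2 powr \<bar>- (a / (p - 1))\<bar> + 2 / (- (a / (p - 1)) + 1)) powr (p - 1)) * wint p a g"
proof -
  define s where "s = a / (p - 1)"
  have s: "s < 1" "s * (p - 1) = a" using p a by (auto simp: s_def field_simps)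
  define k where "k x y = (if y \<le> x then ennreal (c * exp (- (c * (x - y)))) else 0)" for x y :: real
  have [measurable]: "(\<lambda>(x, y). k x y) \<in> borel_measurable (borel \<Otimes>\<^sub>M borel)" unfolding k_def by measurable
  have "wint p a (\<lambda>x. ennreal c * backward_exp c g x) \<le> wint p a (kernel_op k g)"
  proof (rule wint_mono)
    fix x :: real assume x: "0 < x"
    have "ennreal c * backward_exp c g x = (\<integral>\<^sup>+y. ennreal c * (if 0 < y \<and> y \<le> x then ennreal (exp (- (c * (x - y)))) * g y else 0) \<partial>lborel)"
      unfolding backward_exp_def by (subst nn_integral_cmult) auto
    also have "\<dots> = kernel_op k g x"
      unfolding kernel_op_def k_def using x c
      by (intro nn_integral_cong) (auto simp: ennreal_mult mult_ac indicator_def)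
    finally show "ennreal c * backward_exp c g x \<le> kernel_op k g x" by simp
  qed (use p in simp)
  also have "\<dots> \<le> ennreal ((2 powr \<bar>-s\<bar> + 2 / (-s+1)) powr (p - 1) * 1) * wint p a g"
  proof (rule Schur_test[OF p, where s=s])
    fix x :: real assume x: "0 < x"
    have "(\<integral>\<^sup>+y. k x y * ennreal (y powr - s) * indicator {0<..} y \<partial>lborel) =
      (\<integral>\<^sup>+y. (if 0 < y \<and> y < x then ennreal (c * exp (- (c * (x - y))) * y powr - s) else 0) \<partial>lborel)"
      using c by (intro nn_integral_cong_AE, use AE_lborel_singleton[of x] in eventually_elim) (auto simp: k_def indicator_def ennreal_mult)
    also have "\<dots> \<le> ennreal ((2 powr \<bar>-s\<bar> + 2 / (-s+1)) * x powr (-s))" by (rule exp_convolution_powr_le[OF _ c x]) (use s in simp)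
    finally show "(\<integral>\<^sup>+y. k x y * ennreal (y powr - s) * indicator {0<..} y \<partial>lborel)
      \<le> ennreal ((2 powr \<bar>-s\<bar> + 2 / (-s+1)) * x powr - s)" .
  next
    fix y :: real assume y: "0 < y"
    have "(\<integral>\<^sup>+x. k x y * ennreal (x powr (a - s * (p - 1))) * indicator {0<..} x \<partial>lborel) \<le>
      (\<integral>\<^sup>+x. ennreal (c * exp (- (c * (x - y)))) * indicator {y..} x \<partial>lborel)"
      using s by (intro nn_integral_mono) (auto simp: k_def indicator_def)
    also have "\<dots> = 1" by (rule nn_integral_exp_forward[OF c])
    finally show "(\<integral>\<^sup>+x. k x y * ennreal (x powr (a - s * (p - 1))) * indicator {0<..} x \<partial>lborel)
      \<le> ennreal (1 * y powr (a - s * (p - 1)))" using s y by simp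
  qed (use s in \<open>auto intro!: add_pos_nonneg\<close>)
  finally show ?thesis by (simp add: s_def)
qed

text \<open>The dual Hardy inequality: with \<open>y * g y\<close> as the function, the kernel is \<open>1 / y\<close> on \<open>x < y\<close>, which is
homogeneous of degree \<open>-1\<close>, so that the Schur test works with any small auxiliary power.\<close>

lemma tail_int_bound:
  assumes p: "1 < p" and a: "-1 < a"
  shows "\<exists>C>0. \<forall>g\<in>borel_measurable borel. wint p a (tail_int g) \<le> ennreal C * wint p (a + p) g"
proof -
  \<comment> \<open>Any \<open>s\<close> with \<open>0 < s * (p - 1) < a + 1\<close> would do.\<close>
  define s where "s = (a + 1) / (2 * (p - 1))"
  define b where "b = a - s * (p - 1)"
  have sp: "s * (p - 1) = (a + 1) / 2" using p by (simp add: s_def divide_simps)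
  have s: "0 < s" using p a by (simp add: s_def)
  have b: "-1 < b" unfolding b_def sp using a by (simp add: field_simps)
  define k where "k x y = (if x < y then ennreal (1 / y) else 0)" for x y :: real
  have [measurable]: "(\<lambda>(x, y). k x y) \<in> borel_measurable (borel \<Otimes>\<^sub>M borel)" unfolding k_def by measurable
  show ?thesis
  proof (intro exI[of _ "(1/s) powr (p - 1) * (1 / (b + 1))"] conjI ballI)
    fix g :: "real \<Rightarrow> ennreal" assume [measurable]: "g \<in> borel_measurable borel"
    have "wint p a (tail_int g) \<le> wint p a (kernel_op k (\<lambda>y. ennreal y * g y))"
    proof (rule wint_mono)
      fix x :: real assume x: "0 < x"
      have "tail_int g x = kernel_op k (\<lambda>y. ennreal y * g y) x"
        unfolding tail_int_def kernel_op_def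
      proof (rule nn_integral_cong)
        fix y :: real
        have "ennreal (1 / y) * ennreal y = 1" if "x < y"
          using x that by (simp flip: ennreal_mult)
        then show "(if x < y then g y else 0) = k x y * (ennreal y * g y) * indicator {0<..} y"
          using x by (auto simp: k_def mult.assoc[symmetric])
      qed
      then show "tail_int g x \<le> kernel_op k (\<lambda>y. ennreal y * g y) x" by simp
    qed (use p in simp)
    also have "\<dots> \<le> ennreal ((1/s) powr (p - 1) * (1 / (b + 1))) * wint p a (\<lambda>y. ennreal y * g y)"
    proof (rule Schur_test[OF p, where s=s])
      fix x :: real assume x: "0 < x"
      have "(\<integral>\<^sup>+y. k x y * ennreal (y powr - s) * indicator {0<..} y \<partial>lborel) \<le>
        (\<integral>\<^sup>+y. ennreal (y powr (-s-1)) * indicator {x..} y \<partial>lborel)"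
        using x by (intro nn_integral_mono) (auto simp: k_def indicator_def powr_diff simp flip: ennreal_mult)
      also have "\<dots> = ennreal (- (x powr (-s-1+1)) / (-s-1+1))"
        by (rule nn_integral_powr_to_infinity) (use s x in auto)
      finally show "(\<integral>\<^sup>+y. k x y * ennreal (y powr - s) * indicator {0<..} y \<partial>lborel) \<le> ennreal (1/s * x powr - s)" by simp
    next
      fix y :: real assume y: "0 < y"
      have "(\<integral>\<^sup>+x. k x y * ennreal (x powr b) * indicator {0<..} x \<partial>lborel) \<le>
        (\<integral>\<^sup>+x. ennreal (1 / y) * (ennreal (x powr b) * indicator {0..y} x) \<partial>lborel)"
        by (intro nn_integral_mono) (auto simp: k_def indicator_def)
      also have "\<dots> = ennreal (1/y) * ennreal (y powr (b+1) / (b+1))"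
        by (subst nn_integral_cmult) (auto simp: nn_integral_powr_from_0[OF b y])
      also have "\<dots> = ennreal (1 / (b+1) * y powr b)"
        using y b by (simp flip: ennreal_mult add: powr_add)
      finally show "(\<integral>\<^sup>+x. k x y * ennreal (x powr (a - s * (p - 1))) * indicator {0<..} x \<partial>lborel) \<le>
        ennreal (1 / (b+1) * y powr (a - s * (p - 1)))" by (simp add: b_def)
    qed (use s b in auto)
    also have "wint p a (\<lambda>y. ennreal y * g y) = wint p (a + p) g" using p by (intro wint_weight) simp
    finally show "wint p a (tail_int g) \<le> ennreal ((1/s) powr (p - 1) * (1 / (b + 1))) * wint p (a + p) g" .
  qed (use s b in auto)
qed

lemma mult_backward_exp:
  assumes "g \<in> borel_measurable borel"
  shows "backward_exp c (\<lambda>y. e * g y) x = e * backward_exp c g x"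
proof -
  note [measurable] = assms
  have "backward_exp c (\<lambda>y. e * g y) x = (\<integral>\<^sup>+y. e * (if 0 < y \<and> y \<le> x then ennreal (exp (- (c * (x - y)))) * g y else 0) \<partial>lborel)"
    unfolding backward_exp_def by (intro nn_integral_cong) (auto simp: mult_ac)
  then show ?thesis unfolding backward_exp_def by (subst (asm) nn_integral_cmult) auto
qed

lemma self_times_exp_neg_le: "u * exp (- u) \<le> exp (- (u / 2))" if "0 \<le> (u::real)"
proof -
  have "0 \<le> (u / 2 - 1)\<^sup>2" by simp
  then have "u \<le> 1 + u/2 + (u/2)\<^sup>2 / 2" by (simp add: power2_eq_square field_simps)
  also have "\<dots> \<le> exp (u / 2)" using that by (intro exp_lower_Taylor_quadratic) simp
  finally have "u * exp (- u) \<le> exp (u / 2) * exp (- u)" by (intro mult_right_mono) auto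
  also have "\<dots> = exp (- (u / 2))" by (simp add: exp_add[symmetric])
  finally show ?thesis .
qed

text \<open>Split \<open>x = (x - y) + y\<close> in front of the kernel. The factor \<open>x - y\<close> is absorbed by the kernel at the
price of half its rate, and \<open>y\<close> moves onto the function.\<close>

lemma weighted_backward_exp_le:
  assumes x: "0 < x" and c: "0 < c" and [measurable]: "h \<in> borel_measurable borel"
  shows "ennreal x * (ennreal (c\<^sup>2) * backward_exp c h x) \<le>
    2 * (ennreal (c / 2) * backward_exp (c / 2) h x) + ennreal c * (ennreal c * backward_exp c (\<lambda>y. ennreal y * h y) x)"
proof -
  let ?k = "\<lambda>c h y. if 0 < y \<and> y \<le> x then ennreal (exp (- (c * (x - y)))) * h y else 0"
  have pw: "x * (c\<^sup>2 * exp (- (c * (x - y)))) \<le> c * exp (- (c / 2 * (x - y))) + c\<^sup>2 * (exp (- (c * (x - y))) * y)" if "y \<le> x" for y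
  proof -
    have "(c * (x - y)) * exp (- (c * (x - y))) \<le> exp (- (c * (x - y) / 2))"
      using that c by (intro self_times_exp_neg_le) simp
    from mult_left_mono[OF this, of c] c show ?thesis by (simp add: power2_eq_square algebra_simps)
  qed
  have "ennreal x * (ennreal (c\<^sup>2) * backward_exp c h x) = (\<integral>\<^sup>+y. ennreal x * ennreal (c\<^sup>2) * ?k c h y \<partial>lborel)"
    unfolding backward_exp_def by (subst nn_integral_cmult) (auto simp: mult.assoc)
  also have "\<dots> \<le> (\<integral>\<^sup>+y. ennreal c * ?k (c/2) h y + ennreal (c\<^sup>2) * ?k c (\<lambda>y. ennreal y * h y) y \<partial>lborel)"
  proof (rule nn_integral_mono)
    fix y :: real
    show "ennreal x * ennreal (c\<^sup>2) * ?k c h y \<le> ennreal c * ?k (c/2) h y + ennreal (c\<^sup>2) * ?k c (\<lambda>y. ennreal y * h y) y"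
    proof (cases "0 < y \<and> y \<le> x")
      case True
      have "ennreal (x * (c\<^sup>2 * exp (- (c * (x - y))))) \<le> ennreal (c * exp (- (c / 2 * (x - y))) + c\<^sup>2 * (exp (- (c * (x - y))) * y))"
        by (intro ennreal_leI pw) (use True in simp)
      also have "\<dots> = ennreal c * ennreal (exp (- (c / 2 * (x - y)))) + ennreal (c\<^sup>2) * (ennreal (exp (- (c * (x - y)))) * ennreal y)"
        using c True by (simp add: ennreal_plus ennreal_mult)
      also have "ennreal (x * (c\<^sup>2 * exp (- (c * (x - y))))) = ennreal x * ennreal (c\<^sup>2) * ennreal (exp (- (c * (x - y))))"
        using c x by (simp add: ennreal_mult mult.assoc)
      finally have "ennreal x * ennreal (c\<^sup>2) * ennreal (exp (- (c * (x - y)))) \<le>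
        ennreal c * ennreal (exp (- (c / 2 * (x - y)))) + ennreal (c\<^sup>2) * (ennreal (exp (- (c * (x - y)))) * ennreal y)" .
      from mult_right_mono[OF this, of "h y"] True show ?thesis by (simp add: distrib_right mult.assoc)
    qed auto
  qed
  also have "\<dots> = ennreal c * backward_exp (c/2) h x + ennreal (c\<^sup>2) * backward_exp c (\<lambda>y. ennreal y * h y) x"
    unfolding backward_exp_def by (subst nn_integral_add) (auto simp: nn_integral_cmult)
  also have "ennreal c = 2 * ennreal (c / 2)" using c by (simp flip: ennreal_numeral ennreal_mult)
  finally have "ennreal x * (ennreal (c\<^sup>2) * backward_exp c h x) \<le>
    2 * ennreal (c / 2) * backward_exp (c/2) h x + ennreal (c\<^sup>2) * backward_exp c (\<lambda>y. ennreal y * h y) x" .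
  moreover have "ennreal (c\<^sup>2) = ennreal c * ennreal c" using c by (simp add: power2_eq_square ennreal_mult)
  ultimately show ?thesis by (simp add: mult.assoc)
qed

lemma forward_exp_le_tail_int: "0 < c \<Longrightarrow> forward_exp c g x \<le> tail_int g x"
  unfolding forward_exp_def tail_int_def
proof (intro nn_integral_mono)
  fix y :: real assume c: "0 < c"
  have "ennreal (exp (- (c * (y - x)))) * g y \<le> 1 * g y" if "x < y"
    using that c by (intro mult_right_mono) auto
  then show "(if x < y then ennreal (exp (- (c * (y - x)))) * g y else 0) \<le> (if x < y then g y else 0)" by auto
qed

text \<open>Below \<open>p - 1\<close> the two operators are bounded separately. Above, \<open>backward_exp\<close> alone is unbounded;
one factor \<open>x\<close> of the weight is moved through it, leaving the exponent \<open>b = a - p\<close> in \<open>(-1, p - 1)\<close>, where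
\<open>backward_exp\<close> is bounded. The first term of \<open>weighted_backward_exp_le\<close> has lost a power of \<open>x\<close>, which
\<open>tail_int_bound\<close> recovers. At \<open>a = p - 1\<close> both arguments break down.\<close>

lemma resolvent_bound:
  assumes p: "1 < p" and a: "-1 < a" "a < 2 * p - 1" "a \<noteq> p - 1"
  shows "\<exists>C>0. \<forall>c>0. \<forall>g\<in>borel_measurable borel.
    wint p a (\<lambda>x. ennreal (c\<^sup>2) * backward_exp c (forward_exp c g) x) \<le> ennreal C * wint p a g"
proof (cases "a < p - 1")
  case True
  define F where "F = 2 powr \<bar>a\<bar> + 2 / (a+1)"
  define S where "S = (2 powr \<bar>- (a / (p - 1))\<bar> + 2 / (- (a / (p - 1)) + 1)) powr (p - 1)"
  have F: "0 < F" unfolding F_def using a by (intro add_pos_pos) auto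
  have "0 < - (a / (p - 1)) + 1" using p True by (simp add: field_simps)
  then have S: "0 < S" unfolding S_def by (subst powr_gt_zero) (smt (verit) powr_gt_zero divide_pos_pos)
  show ?thesis
  proof (intro exI[of _ "S * F"] conjI allI ballI impI)
    fix c :: real and g :: "real \<Rightarrow> ennreal" assume c: "0 < c" and [measurable]: "g \<in> borel_measurable borel"
    have "wint p a (\<lambda>x. ennreal (c\<^sup>2) * backward_exp c (forward_exp c g) x) =
      wint p a (\<lambda>x. ennreal c * backward_exp c (\<lambda>y. ennreal c * forward_exp c g y) x)"
      using c by (simp add: mult_backward_exp power2_eq_square ennreal_mult mult.assoc)
    also have "\<dots> \<le> ennreal S * wint p a (\<lambda>y. ennreal c * forward_exp c g y)"
      unfolding S_def by (intro backward_exp_bound p True c) measurable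
    also have "\<dots> \<le> ennreal S * (ennreal F * wint p a g)"
      unfolding F_def by (intro mult_left_mono forward_exp_bound p a c) auto
    also have "\<dots> = ennreal (S * F) * wint p a g" using F S by (simp add: ennreal_mult mult.assoc)
    finally show "wint p a (\<lambda>x. ennreal (c\<^sup>2) * backward_exp c (forward_exp c g) x) \<le> ennreal (S * F) * wint p a g" .
  qed (use F S in simp)
next
  case False
  define b where "b = a - p"
  have b: "-1 < b" "b < p - 1" "b + p = a" using False a by (auto simp: b_def)
  define F where "F = 2 powr \<bar>a\<bar> + 2 / (a+1)"
  define S where "S = (2 powr \<bar>- (b / (p - 1))\<bar> + 2 / (- (b / (p - 1)) + 1)) powr (p - 1)"
  have F: "0 < F" unfolding F_def using a by (intro add_pos_pos) auto
  have "0 < - (b / (p - 1)) + 1" using p b by (simp add: field_simps)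
  then have S: "0 < S" unfolding S_def by (subst powr_gt_zero) (smt (verit) powr_gt_zero divide_pos_pos)
  obtain T where T: "0 < T" and tail: "\<And>g. g \<in> borel_measurable borel \<Longrightarrow> wint p b (tail_int g) \<le> ennreal T * wint p (b + p) g"
    using tail_int_bound[OF p b(1)] by blast
  let ?P = "2 powr p"
  show ?thesis
  proof (intro exI[of _ "?P * (?P * (S * T) + S * F)"] conjI allI ballI impI)
    fix c :: real and g :: "real \<Rightarrow> ennreal" assume c: "0 < c" and [measurable]: "g \<in> borel_measurable borel"
    let ?h = "forward_exp c g"
    have p0: "0 < p" using p by simp
    have e2: "epow 2 p = ennreal ?P" using epow_ennreal[of 2 p] by simp
    have *: "wint p b (\<lambda>x. 2 * (ennreal (c/2) * backward_exp (c/2) ?h x)) \<le> ennreal (?P * (S * T)) * wint p a g"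
    proof -
      have "wint p b (\<lambda>x. 2 * (ennreal (c/2) * backward_exp (c/2) ?h x)) = ennreal ?P * wint p b (\<lambda>x. ennreal (c/2) * backward_exp (c/2) ?h x)"
        using p0 by (subst wint_cmult) (auto simp: e2)
      also have "\<dots> \<le> ennreal ?P * (ennreal S * wint p b ?h)"
        unfolding S_def using c by (intro mult_left_mono backward_exp_bound p b) auto
      also have "\<dots> \<le> ennreal ?P * (ennreal S * (ennreal T * wint p (b + p) g))"
      proof (intro mult_left_mono)
        have "wint p b ?h \<le> wint p b (tail_int g)"
          using p0 c by (intro wint_mono forward_exp_le_tail_int) auto
        then show "wint p b ?h \<le> ennreal T * wint p (b + p) g" using tail[of g] by simp
      qed auto
      also have "\<dots> = ennreal (?P * (S * T)) * wint p a g" using S T b by (simp add: ennreal_mult mult.assoc)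
      finally show ?thesis .
    qed
    have **: "wint p b (\<lambda>x. ennreal c * (ennreal c * backward_exp c (\<lambda>y. ennreal y * ?h y) x)) \<le> ennreal (S * F) * wint p a g"
    proof -
      have "wint p b (\<lambda>x. ennreal c * (ennreal c * backward_exp c (\<lambda>y. ennreal y * ?h y) x)) =
        wint p b (\<lambda>x. ennreal c * backward_exp c (\<lambda>y. ennreal c * (ennreal y * ?h y)) x)"
        by (subst mult_backward_exp) auto
      also have "\<dots> \<le> ennreal S * wint p b (\<lambda>y. ennreal c * (ennreal y * ?h y))"
        unfolding S_def by (intro backward_exp_bound p b c) measurable
      also have "(\<lambda>y. ennreal c * (ennreal y * ?h y)) = (\<lambda>y. ennreal y * (ennreal c * ?h y))"
        by (auto simp: mult_ac)
      also have "wint p b \<dots> = wint p a (\<lambda>y. ennreal c * ?h y)" using p0 b by (simp add: wint_weight)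
      also have "ennreal S * \<dots> \<le> ennreal S * (ennreal F * wint p a g)"
        unfolding F_def by (intro mult_left_mono forward_exp_bound p a c) auto
      also have "\<dots> = ennreal (S * F) * wint p a g" using F S by (simp add: ennreal_mult mult.assoc)
      finally show ?thesis .
    qed
    have "wint p a (\<lambda>x. ennreal (c\<^sup>2) * backward_exp c ?h x) = wint p b (\<lambda>x. ennreal x * (ennreal (c\<^sup>2) * backward_exp c ?h x))"
      using p0 b by (simp add: wint_weight)
    also have "\<dots> \<le> wint p b (\<lambda>x. 2 * (ennreal (c / 2) * backward_exp (c / 2) ?h x) + ennreal c * (ennreal c * backward_exp c (\<lambda>y. ennreal y * ?h y) x))"
      using p0 c by (intro wint_mono weighted_backward_exp_le) auto
    also have "\<dots> \<le> ennreal ?P * (wint p b (\<lambda>x. 2 * (ennreal (c/2) * backward_exp (c/2) ?h x)) + wint p b (\<lambda>x. ennreal c * (ennreal c * backward_exp c (\<lambda>y. ennreal y * ?h y) x)))"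
      by (intro wint_add p0) measurable
    also have "\<dots> \<le> ennreal ?P * (ennreal (?P * (S * T)) * wint p a g + ennreal (S * F) * wint p a g)"
      by (intro mult_left_mono add_mono * **) auto
    also have "\<dots> = ennreal (?P * (?P * (S * T) + S * F)) * wint p a g"
      using F S T by (simp add: ennreal_mult ennreal_plus algebra_simps)
    finally show "wint p a (\<lambda>x. ennreal (c\<^sup>2) * backward_exp c ?h x) \<le> ennreal (?P * (?P * (S * T) + S * F)) * wint p a g" .
  qed (use F S T in \<open>auto intro!: mult_pos_pos add_pos_pos\<close>)
qed

definition first_moment :: "(real \<Rightarrow> ennreal) \<Rightarrow> ennreal" where
  "first_moment g = (\<integral>\<^sup>+z. (if 0 < z then ennreal z * g z else 0) \<partial>lborel)"

text \<open>Hoelder's inequality for the measure \<open>z dz\<close> on \<open>A\<close>, with an auxiliary power chosen so that the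
resulting weight is the given one.\<close>

lemma moment_Hoelder:
  assumes p: "1 < p" and g[measurable]: "g \<in> borel_measurable borel"
    and A[measurable]: "A \<in> sets borel" and pos: "A \<subseteq> {0<..}" and C: "0 < C"
    and le: "(\<integral>\<^sup>+z. ennreal (z powr (1 - s)) * indicator A z \<partial>lborel) \<le> ennreal C"
  shows "epow (\<integral>\<^sup>+z. ennreal z * indicator A z * g z \<partial>lborel) p \<le> ennreal (C powr (p - 1)) * wint p (1 + s * (p - 1)) g"
proof -
  let ?k = "\<lambda>z::real. ennreal z * indicator A z"
  have "epow (\<integral>\<^sup>+z. ?k z * g z \<partial>lborel) p \<le> ennreal (C powr (p - 1)) *
    (\<integral>\<^sup>+z. ?k z * epow (g z) p * ennreal ((z powr (- s)) powr (1 - p)) \<partial>lborel)"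
  proof (rule weighted_Hoelder[OF p])
    have "(\<integral>\<^sup>+z. ?k z * ennreal (z powr - s) \<partial>lborel) \<le> (\<integral>\<^sup>+z. ennreal (z powr (1 - s)) * indicator A z \<partial>lborel)"
      by (intro nn_integral_mono) (use pos in \<open>auto simp: indicator_def powr_diff powr_minus field_simps simp flip: ennreal_mult\<close>)
    also note le
    finally show "(\<integral>\<^sup>+z. ?k z * ennreal (z powr - s) \<partial>lborel) \<le> ennreal C" .
  qed (use C pos in \<open>auto simp: indicator_def split: if_splits\<close>)
  also have "(\<integral>\<^sup>+z. ?k z * epow (g z) p * ennreal ((z powr (- s)) powr (1 - p)) \<partial>lborel) \<le> wint p (1 + s * (p - 1)) g"
    unfolding wint_def
  proof (intro nn_integral_mono)
    fix z :: real
    have "z * (z powr - s) powr (1 - p) = z powr (1 + s * (p - 1))" if "0 < z"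
    proof -
      have "z * (z powr - s) powr (1 - p) = z powr 1 * z powr (s * (p - 1))"
        using that by (simp add: powr_powr algebra_simps)
      then show ?thesis by (simp only: powr_add)
    qed
    then have "0 < z \<Longrightarrow> ennreal z * ennreal ((z powr - s) powr (1 - p)) = ennreal (z powr (1 + s * (p - 1)))" by (simp flip: ennreal_mult)
    moreover have "?k z * epow (g z) p * ennreal ((z powr - s) powr (1 - p)) \<le>
      epow (g z) p * (ennreal z * ennreal ((z powr - s) powr (1 - p))) * indicator {0<..} z"
      using pos by (auto simp: indicator_def mult_ac)
    ultimately show "?k z * epow (g z) p * ennreal ((z powr - s) powr (1 - p)) \<le>
      epow (g z) p * ennreal (z powr (1 + s * (p - 1))) * indicator {0<..} z"
      by (cases "0 < z") auto
  qed
  finally show ?thesis by (simp add: mult_left_mono)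
qed

text \<open>By Hoelder's inequality the first moment is controlled near \<open>0\<close> by a weight below the critical
exponent \<open>2 * p - 1\<close> and near infinity by a weight above it.\<close>

lemma first_moment_bound:
  assumes p: "1 < p" and a: "a < 2 * p - 1" and b: "2 * p - 1 < b"
  shows "\<exists>C>0. \<forall>g\<in>borel_measurable borel. epow (first_moment g) p \<le> ennreal C * (wint p a g + wint p b g)"
proof -
  define s where "s = (a - 1) / (p - 1)"
  define t where "t = (b - 1) / (p - 1)"
  have s: "s < 2" "1 + s * (p - 1) = a" using p a by (auto simp: s_def field_simps)
  have t: "2 < t" "1 + t * (p - 1) = b" using p b by (auto simp: t_def field_simps)
  define A where "A = (1 / (2 - s)) powr (p - 1)"
  define B where "B = (1 / (t - 2)) powr (p - 1)"
  have A: "0 < A" "0 < B" using s t by (auto simp: A_def B_def)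
  show ?thesis
  proof (intro exI[of _ "2 powr p * (A + B)"] conjI ballI)
    fix g :: "real \<Rightarrow> ennreal" assume [measurable]: "g \<in> borel_measurable borel"
    let ?I = "\<lambda>A. \<integral>\<^sup>+z. ennreal z * indicator A z * g z \<partial>lborel"
    have "first_moment g = (\<integral>\<^sup>+z. ennreal z * indicator {0<..1} z * g z + ennreal z * indicator {1<..} z * g z \<partial>lborel)"
      unfolding first_moment_def by (intro nn_integral_cong) (auto simp: indicator_def)
    also have "\<dots> = ?I {0<..1} + ?I {1<..}" by (intro nn_integral_add) measurable
    finally have "epow (first_moment g) p \<le> ennreal (2 powr p) * (epow (?I {0<..1}) p + epow (?I {1<..}) p)"
      using epow_add p by simp
    also have "\<dots> \<le> ennreal (2 powr p) * (ennreal A * wint p a g + ennreal B * wint p b g)"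
    proof (intro mult_left_mono add_mono)
      have "(\<integral>\<^sup>+z. ennreal (z powr (1 - s)) * indicator {0<..1} z \<partial>lborel) \<le> (\<integral>\<^sup>+z. ennreal (z powr (1 - s)) * indicator {0..1} z \<partial>lborel)"
        by (intro nn_integral_mono) (auto simp: indicator_def)
      also have "\<dots> = ennreal (1 powr (1 - s + 1) / (1 - s + 1))"
        by (rule nn_integral_powr_from_0) (use s in auto)
      finally have "(\<integral>\<^sup>+z. ennreal (z powr (1 - s)) * indicator {0<..1} z \<partial>lborel) \<le> ennreal (1 / (2 - s))" by simp
      from moment_Hoelder[OF p _ _ _ _ this, of g] s show "epow (?I {0<..1}) p \<le> ennreal A * wint p a g"
        by (simp add: A_def subset_eq)
      have "(\<integral>\<^sup>+z. ennreal (z powr (1 - t)) * indicator {1<..} z \<partial>lborel) \<le> (\<integral>\<^sup>+z. ennreal (z powr (1 - t)) * indicator {1..} z \<partial>lborel)"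
        by (intro nn_integral_mono) (auto simp: indicator_def)
      also have "\<dots> = ennreal (- (1 powr (1 - t + 1)) / (1 - t + 1))"
        by (rule nn_integral_powr_to_infinity) (use t in auto)
      also have "- (1 powr (1 - t + 1)) / (1 - t + 1) = 1 / (t - 2)" using t by (simp add: divide_simps)
      finally have "(\<integral>\<^sup>+z. ennreal (z powr (1 - t)) * indicator {1<..} z \<partial>lborel) \<le> ennreal (1 / (t - 2))" .
      from moment_Hoelder[OF p _ _ _ _ this, of g] t show "epow (?I {1<..}) p \<le> ennreal B * wint p b g"
        by (simp add: B_def subset_eq)
    qed auto
    also have "\<dots> \<le> ennreal (2 powr p) * (ennreal (A + B) * wint p a g + ennreal (A + B) * wint p b g)"
      using A by (intro mult_left_mono add_mono mult_right_mono ennreal_leI) auto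
    also have "\<dots> = ennreal (2 powr p * (A + B)) * (wint p a g + wint p b g)"
      using A by (simp add: ennreal_mult algebra_simps)
    finally show "epow (first_moment g) p \<le> ennreal (2 powr p * (A + B)) * (wint p a g + wint p b g)" .
  qed (use A in auto)
qed

text \<open>Dropping the exponential and exchanging the integrals, each \<open>z\<close> is counted with the length \<open>z\<close> of
the interval \<open>{0<..<z}\<close>.\<close>

lemma integral_forward_exp_le_first_moment:
  assumes c: "0 < c" and [measurable]: "g \<in> borel_measurable borel"
  shows "(\<integral>\<^sup>+y. (if 0 < y then forward_exp c g y else 0) \<partial>lborel) \<le> first_moment g"
proof -
  have "(\<integral>\<^sup>+y. (if 0 < y then forward_exp c g y else 0) \<partial>lborel) \<le>
    (\<integral>\<^sup>+y. (\<integral>\<^sup>+z. (if 0 < y \<and> y < z then g z else 0) \<partial>lborel) \<partial>lborel)"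
  proof (rule nn_integral_mono)
    fix y :: real
    have "forward_exp c g y \<le> tail_int g y" by (rule forward_exp_le_tail_int[OF c])
    then show "(if 0 < y then forward_exp c g y else 0) \<le> (\<integral>\<^sup>+z. (if 0 < y \<and> y < z then g z else 0) \<partial>lborel)"
      by (auto simp: tail_int_def)
  qed
  also have "\<dots> = (\<integral>\<^sup>+z. (\<integral>\<^sup>+y. (if 0 < y \<and> y < z then g z else 0) \<partial>lborel) \<partial>lborel)"
    by (rule lborel_pair.Fubini') measurable
  also have "\<dots> \<le> first_moment g"
    unfolding first_moment_def
  proof (intro nn_integral_mono)
    fix z :: real
    have "(\<integral>\<^sup>+y. (if 0 < y \<and> y < z then g z else 0) \<partial>lborel) = (\<integral>\<^sup>+y. g z * indicator {0<..<z} y \<partial>lborel)"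
      by (intro nn_integral_cong) (auto simp: indicator_def)
    also have "\<dots> = (if 0 < z then ennreal z * g z else 0)"
      by (subst nn_integral_cmult_indicator) (auto simp: mult.commute)
    finally show "(\<integral>\<^sup>+y. (if 0 < y \<and> y < z then g z else 0) \<partial>lborel) \<le> (if 0 < z then ennreal z * g z else 0)" by simp
  qed
  finally show ?thesis .
qed

lemma nn_integral_exp_powr:
  fixes \<gamma> q :: real assumes \<gamma>: "-1 < \<gamma>" and q: "0 < q"
  shows "(\<integral>\<^sup>+x. ennreal (exp (- (q * x)) * x powr \<gamma>) * indicator {0<..} x \<partial>lborel) = ennreal (q powr (- \<gamma> - 1) * Gamma (\<gamma> + 1))"
proof -
  have "((\<lambda>t. t powr (\<gamma> + 1 - 1) / exp t) has_integral Gamma (\<gamma> + 1)) {0..}"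
    using \<gamma> by (intro Gamma_integral_real) simp
  then have "integral\<^sup>N lborel (\<lambda>x. ennreal (x powr (\<gamma> + 1 - 1) / exp x) * indicator {0..} x) = ennreal (Gamma (\<gamma> + 1))"
    by (intro nn_integral_has_integral_lebesgue') auto
  also have "integral\<^sup>N lborel (\<lambda>x. ennreal (x powr (\<gamma> + 1 - 1) / exp x) * indicator {0..} x) =
     (\<integral>\<^sup>+x. ennreal (exp (- x) * x powr \<gamma>) * indicator {0<..} x \<partial>lborel)"
    by (intro nn_integral_cong) (auto simp: indicator_def exp_minus field_simps)
  finally have G: "(\<integral>\<^sup>+x. ennreal (exp (- x) * x powr \<gamma>) * indicator {0<..} x \<partial>lborel) = ennreal (Gamma (\<gamma> + 1))" .
  have "(\<integral>\<^sup>+x. ennreal (exp (- (q * x)) * x powr \<gamma>) * indicator {0<..} x \<partial>lborel) =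
    ennreal \<bar>1/q\<bar> * (\<integral>\<^sup>+x. ennreal (exp (- (q * (0 + 1/q * x))) * (0 + 1/q * x) powr \<gamma>) * indicator {0<..} (0 + 1/q * x) \<partial>lborel)"
    using q by (intro nn_integral_real_affine) auto
  also have "(\<integral>\<^sup>+x. ennreal (exp (- (q * (0 + 1/q * x))) * (0 + 1/q * x) powr \<gamma>) * indicator {0<..} (0 + 1/q * x) \<partial>lborel)
    = (\<integral>\<^sup>+x. ennreal (q powr - \<gamma>) * (ennreal (exp (- x) * x powr \<gamma>) * indicator {0<..} x) \<partial>lborel)"
  proof (rule nn_integral_cong)
    fix x :: real
    show "ennreal (exp (- (q * (0 + 1/q * x))) * (0 + 1/q * x) powr \<gamma>) * indicator {0<..} (0 + 1/q * x)
      = ennreal (q powr - \<gamma>) * (ennreal (exp (- x) * x powr \<gamma>) * indicator {0<..} x)"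
      using q by (cases "0 < x") (auto simp: indicator_def powr_divide powr_minus field_simps simp flip: ennreal_mult)
  qed
  also have "\<dots> = ennreal (q powr - \<gamma>) * ennreal (Gamma (\<gamma> + 1))"
    by (subst nn_integral_cmult) (auto simp: G)
  also have "ennreal \<bar>1/q\<bar> * \<dots> = ennreal (q powr (- \<gamma> - 1) * Gamma (\<gamma> + 1))"
    using q \<gamma> by (simp add: powr_diff Gamma_real_nonneg flip: ennreal_mult)
  finally show ?thesis .
qed

text \<open>In \<open>backward_exp c h x\<close> with \<open>h = forward_exp c g\<close>, the part of the integral over \<open>x / 2 < y\<close> is bounded
uniformly, since \<open>x\<close> and \<open>y\<close> are comparable there. In the part over \<open>y \<le> x / 2\<close> the
kernel is at most \<open>exp (- c x / 2)\<close>, and the integral of \<open>h\<close> is at most the first moment of \<open>g\<close>. The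
power of \<open>c\<close> is the scaling of the weighted norm of \<open>c\<^sup>2 exp (- c x / 2)\<close>.\<close>

lemma resolvent_bound_growth:
  assumes p: "1 < p" and \<gamma>: "0 < \<gamma>"
  shows "\<exists>C>0. \<forall>c>0. \<forall>g\<in>borel_measurable borel.
    wint p \<gamma> (\<lambda>x. ennreal (c\<^sup>2) * backward_exp c (forward_exp c g) x) \<le>
      ennreal C * (wint p \<gamma> g + ennreal (c powr (2 * p - \<gamma> - 1)) * epow (first_moment g) p)"
proof -
  define F where "F = 2 powr \<bar>\<gamma>\<bar> + 2 / (\<gamma>+1)"
  have F: "0 < F" unfolding F_def using \<gamma> by (intro add_pos_pos) auto
  define K where "K = (p / 2) powr (- \<gamma> - 1) * Gamma (\<gamma> + 1)"
  have K: "0 < K" using p \<gamma> by (auto simp: K_def intro!: mult_pos_pos Gamma_real_pos)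
  \<comment> \<open>The part of the kernel close to the diagonal.\<close>
  define k where "k c x y = (if x / 2 < y \<and> y \<le> x then ennreal (c * exp (- (c * (x - y)))) else 0)" for c x y :: real
  have [measurable]: "(\<lambda>(x, y). k c x y) \<in> borel_measurable (borel \<Otimes>\<^sub>M borel)" for c unfolding k_def by measurable
  have p0: "0 < p" using p by simp
  have near: "wint p \<gamma> (kernel_op (k c) h) \<le> ennreal (2 powr \<gamma>) * wint p \<gamma> h"
    if c: "0 < c" and [measurable]: "h \<in> borel_measurable borel" for c h
  proof -
    have "wint p \<gamma> (kernel_op (k c) h) \<le> ennreal (1 powr (p - 1) * 2 powr \<gamma>) * wint p \<gamma> h"
    proof (rule Schur_test[OF p, where s=0])
      fix x :: real assume x: "0 < x"
      have "(\<integral>\<^sup>+y. k c x y * ennreal (y powr - 0) * indicator {0<..} y \<partial>lborel) \<le>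
        (\<integral>\<^sup>+y. (if y < x then ennreal (c * exp (- (c * (x - y)))) else 0) \<partial>lborel)"
        by (intro nn_integral_mono_AE, use AE_lborel_singleton[of x] in eventually_elim) (auto simp: k_def indicator_def)
      also have "\<dots> \<le> 1" by (rule nn_integral_exp_backward_le[OF c])
      finally show "(\<integral>\<^sup>+y. k c x y * ennreal (y powr - 0) * indicator {0<..} y \<partial>lborel) \<le> ennreal (1 * x powr - 0)"
        using x by simp
    next
      fix y :: real assume y: "0 < y"
      have "(\<integral>\<^sup>+x. k c x y * ennreal (x powr (\<gamma> - 0 * (p - 1))) * indicator {0<..} x \<partial>lborel) \<le>
        (\<integral>\<^sup>+x. ennreal (2 powr \<gamma> * y powr \<gamma>) * (ennreal (c * exp (- (c * (x - y)))) * indicator {y..} x) \<partial>lborel)"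
      proof (rule nn_integral_mono)
        fix x :: real
        have "x powr \<gamma> \<le> 2 powr \<gamma> * y powr \<gamma>" if "x / 2 < y" "y \<le> x"
          using powr_comparable[of y x \<gamma>] that y \<gamma> by simp
        then have "ennreal (x powr \<gamma>) * ennreal (c * exp (- (c * (x - y)))) \<le> ennreal (2 powr \<gamma> * y powr \<gamma>) * ennreal (c * exp (- (c * (x - y))))"
          if "x / 2 < y" "y \<le> x" using that by (intro mult_right_mono ennreal_leI) auto
        then show "k c x y * ennreal (x powr (\<gamma> - 0 * (p - 1))) * indicator {0<..} x \<le>
          ennreal (2 powr \<gamma> * y powr \<gamma>) * (ennreal (c * exp (- (c * (x - y)))) * indicator {y..} x)"
          by (auto simp: k_def indicator_def mult.commute)
      qed
      also have "\<dots> = ennreal (2 powr \<gamma> * y powr \<gamma>) * 1"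
        by (subst nn_integral_cmult) (auto simp: nn_integral_exp_forward[OF c])
      finally show "(\<integral>\<^sup>+x. k c x y * ennreal (x powr (\<gamma> - 0 * (p - 1))) * indicator {0<..} x \<partial>lborel)
        \<le> ennreal (2 powr \<gamma> * y powr (\<gamma> - 0 * (p - 1)))" by simp
    qed (use that in auto)
    then show ?thesis by simp
  qed
  show ?thesis
  proof (intro exI[of _ "2 powr p * (2 powr \<gamma> * F + K)"] conjI allI ballI impI)
    fix c :: real and g :: "real \<Rightarrow> ennreal" assume c: "0 < c" and [measurable]: "g \<in> borel_measurable borel"
    let ?h = "forward_exp c g"
    let ?J = "first_moment g"
    have pw: "ennreal (c\<^sup>2) * backward_exp c ?h x \<le> kernel_op (k c) (\<lambda>y. ennreal c * ?h y) x + ?J * ennreal (c\<^sup>2 * exp (- (c / 2 * x)))"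
      if x: "0 < x" for x
    proof -
      have "ennreal (c\<^sup>2) * backward_exp c ?h x = (\<integral>\<^sup>+y. ennreal (c\<^sup>2) * (if 0 < y \<and> y \<le> x then ennreal (exp (- (c * (x - y)))) * ?h y else 0) \<partial>lborel)"
        unfolding backward_exp_def by (subst nn_integral_cmult) auto
      also have "\<dots> \<le> (\<integral>\<^sup>+y. k c x y * (ennreal c * ?h y) * indicator {0<..} y + ennreal (c\<^sup>2 * exp (- (c / 2 * x))) * (if 0 < y then ?h y else 0) \<partial>lborel)"
      proof (rule nn_integral_mono)
        fix y :: real
        show "ennreal (c\<^sup>2) * (if 0 < y \<and> y \<le> x then ennreal (exp (- (c * (x - y)))) * ?h y else 0) \<le>
          k c x y * (ennreal c * ?h y) * indicator {0<..} y + ennreal (c\<^sup>2 * exp (- (c / 2 * x))) * (if 0 < y then ?h y else 0)"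
        proof (cases "0 < y \<and> y \<le> x")
          case True
          show ?thesis
          proof (cases "x / 2 < y")
            case True
            have "ennreal (c\<^sup>2) * (ennreal (exp (- (c * (x - y)))) * ?h y) = ennreal (c * exp (- (c * (x - y)))) * (ennreal c * ?h y)"
              using c by (simp add: power2_eq_square ennreal_mult mult_ac)
            then show ?thesis using True \<open>0 < y \<and> y \<le> x\<close> by (simp add: k_def)
          next
            case False
            have "c\<^sup>2 * exp (- (c * (x - y))) \<le> c\<^sup>2 * exp (- (c / 2 * x))"
              using False c by (intro mult_left_mono) (auto simp: field_simps)
            then have "ennreal (c\<^sup>2 * exp (- (c * (x - y)))) * ?h y \<le> ennreal (c\<^sup>2 * exp (- (c / 2 * x))) * ?h y"
              by (intro mult_right_mono ennreal_leI) auto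
            then show ?thesis using \<open>0 < y \<and> y \<le> x\<close> by (simp add: ennreal_mult mult.assoc add_increasing)
          qed
        qed auto
      qed
      also have "\<dots> = kernel_op (k c) (\<lambda>y. ennreal c * ?h y) x + ennreal (c\<^sup>2 * exp (- (c / 2 * x))) * (\<integral>\<^sup>+y. (if 0 < y then ?h y else 0) \<partial>lborel)"
        unfolding kernel_op_def by (subst nn_integral_add) (auto simp: nn_integral_cmult)
      also have "\<dots> \<le> kernel_op (k c) (\<lambda>y. ennreal c * ?h y) x + ennreal (c\<^sup>2 * exp (- (c / 2 * x))) * ?J"
        using c by (intro add_left_mono mult_left_mono integral_forward_exp_le_first_moment) auto
      finally show ?thesis by (simp add: mult.commute)
    qed
    have far: "wint p \<gamma> (\<lambda>x. ?J * ennreal (c\<^sup>2 * exp (- (c / 2 * x)))) = epow ?J p * ennreal (K * c powr (2 * p - \<gamma> - 1))"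
    proof -
      have "wint p \<gamma> (\<lambda>x. ?J * ennreal (c\<^sup>2 * exp (- (c / 2 * x)))) = epow ?J p * wint p \<gamma> (\<lambda>x. ennreal (c\<^sup>2 * exp (- (c / 2 * x))))"
        by (intro wint_cmult p0) measurable
      also have "wint p \<gamma> (\<lambda>x. ennreal (c\<^sup>2 * exp (- (c / 2 * x)))) =
        (\<integral>\<^sup>+x. ennreal (c powr (2 * p)) * (ennreal (exp (- (c * p / 2 * x)) * x powr \<gamma>) * indicator {0<..} x) \<partial>lborel)"
        unfolding wint_def
      proof (rule nn_integral_cong)
        fix x :: real
        have "(c\<^sup>2 * exp (- (c / 2 * x))) powr p = c powr (2 * p) * exp (- (c * p / 2 * x))"
          using c by (simp add: powr_mult powr_powr exp_powr_real mult_ac flip: powr_numeral)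
        then have "epow (ennreal (c\<^sup>2 * exp (- (c / 2 * x)))) p = ennreal (c powr (2 * p)) * ennreal (exp (- (c * p / 2 * x)))"
          by (subst epow_ennreal) (simp_all add: ennreal_mult)
        then show "epow (ennreal (c\<^sup>2 * exp (- (c / 2 * x)))) p * ennreal (x powr \<gamma>) * indicator {0<..} x =
           ennreal (c powr (2 * p)) * (ennreal (exp (- (c * p / 2 * x)) * x powr \<gamma>) * indicator {0<..} x)"
          by (simp only: ennreal_mult exp_ge_zero powr_ge_zero mult.assoc)
      qed
      also have "\<dots> = ennreal (c powr (2 * p)) * ennreal ((c * p / 2) powr (- \<gamma> - 1) * Gamma (\<gamma> + 1))"
        using nn_integral_exp_powr[of \<gamma> "c * p / 2"] c p \<gamma> by (subst nn_integral_cmult) auto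
      also have "\<dots> = ennreal (c powr (2 * p) * ((c * p / 2) powr (- \<gamma> - 1) * Gamma (\<gamma> + 1)))"
        using \<gamma> by (simp add: ennreal_mult Gamma_real_nonneg)
      also have "c powr (2 * p) * ((c * p / 2) powr (- \<gamma> - 1) * Gamma (\<gamma> + 1)) = K * c powr (2 * p - \<gamma> - 1)"
      proof -
        have "(c * p / 2) powr (- \<gamma> - 1) = c powr (- \<gamma> - 1) * (p / 2) powr (- \<gamma> - 1)"
          using powr_mult[of c "p / 2"] c p by simp
        moreover have "c powr (2 * p) * c powr (- \<gamma> - 1) = c powr (2 * p - \<gamma> - 1)"
          by (simp add: powr_add[symmetric] algebra_simps)
        moreover have "X * ((Y * Z) * G) = (Z * G) * (X * Y)" for X Y Z G :: real by (simp add: mult_ac)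
        ultimately show ?thesis unfolding K_def by simp
      qed
      finally show ?thesis .
    qed
    have "wint p \<gamma> (\<lambda>x. ennreal (c\<^sup>2) * backward_exp c ?h x) \<le>
      wint p \<gamma> (\<lambda>x. kernel_op (k c) (\<lambda>y. ennreal c * ?h y) x + ?J * ennreal (c\<^sup>2 * exp (- (c / 2 * x))))"
      using p0 by (intro wint_mono pw) auto
    also have "\<dots> \<le> ennreal (2 powr p) * (wint p \<gamma> (kernel_op (k c) (\<lambda>y. ennreal c * ?h y)) + wint p \<gamma> (\<lambda>x. ?J * ennreal (c\<^sup>2 * exp (- (c / 2 * x)))))"
      by (intro wint_add p0) measurable
    also have "\<dots> \<le> ennreal (2 powr p) * (ennreal (2 powr \<gamma>) * (ennreal F * wint p \<gamma> g) + epow ?J p * ennreal (K * c powr (2 * p - \<gamma> - 1)))"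
    proof (intro mult_left_mono add_mono)
      have "wint p \<gamma> (kernel_op (k c) (\<lambda>y. ennreal c * ?h y)) \<le> ennreal (2 powr \<gamma>) * wint p \<gamma> (\<lambda>y. ennreal c * ?h y)"
        by (intro near c) measurable
      also have "\<dots> \<le> ennreal (2 powr \<gamma>) * (ennreal F * wint p \<gamma> g)"
        unfolding F_def using \<gamma> by (intro mult_left_mono forward_exp_bound p c) auto
      finally show "wint p \<gamma> (kernel_op (k c) (\<lambda>y. ennreal c * ?h y)) \<le> ennreal (2 powr \<gamma>) * (ennreal F * wint p \<gamma> g)" .
      show "wint p \<gamma> (\<lambda>x. ?J * ennreal (c\<^sup>2 * exp (- (c / 2 * x)))) \<le> epow ?J p * ennreal (K * c powr (2 * p - \<gamma> - 1))"
        by (simp only: far order_refl)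
    qed auto
    also have "\<dots> = ennreal (2 powr p) * (ennreal (2 powr \<gamma> * F) * wint p \<gamma> g + ennreal K * (ennreal (c powr (2 * p - \<gamma> - 1)) * epow ?J p))"
      using F K by (simp add: ennreal_mult mult_ac)
    also have "\<dots> \<le> ennreal (2 powr p) * (ennreal (2 powr \<gamma> * F + K) * wint p \<gamma> g + ennreal (2 powr \<gamma> * F + K) * (ennreal (c powr (2 * p - \<gamma> - 1)) * epow ?J p))"
      using F K by (intro mult_left_mono add_mono mult_right_mono ennreal_leI) auto
    also have "\<dots> = ennreal (2 powr p * (2 powr \<gamma> * F + K)) * (wint p \<gamma> g + ennreal (c powr (2 * p - \<gamma> - 1)) * epow ?J p)"
    proof -
      have "ennreal (2 powr p * (2 powr \<gamma> * F + K)) = ennreal (2 powr p) * ennreal (2 powr \<gamma> * F + K)"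
        using F K by (intro ennreal_mult) auto
      then show ?thesis by (simp only: distrib_left mult.assoc)
    qed
    finally show "wint p \<gamma> (\<lambda>x. ennreal (c\<^sup>2) * backward_exp c (forward_exp c g) x) \<le>
      ennreal (2 powr p * (2 powr \<gamma> * F + K)) * (wint p \<gamma> g + ennreal (c powr (2 * p - \<gamma> - 1)) * epow ?J p)" .
  qed (use F K in \<open>auto intro!: mult_pos_pos add_pos_pos\<close>)
qed

section \<open>The half-line\<close>

lemma space_half_line [simp]: "space half_line = {0<..}"
  by (simp add: half_line_def)

lemma sets_half_line: "A \<in> sets half_line \<longleftrightarrow> A \<in> sets lebesgue \<and> A \<subseteq> {0<..}"
  unfolding half_line_def by (subst sets_restrict_space_iff) auto

lemma nn_integral_half_line: "nn_integral half_line h = (\<integral>\<^sup>+x. h x * indicator {0<..} x \<partial>lborel)"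
  unfolding half_line_def by (simp add: nn_integral_restrict_space nn_integral_completion)

lemma AE_half_line: "(AE x in half_line. P x) \<longleftrightarrow> (AE x in lborel. 0 < x \<longrightarrow> P x)"
  unfolding half_line_def by (simp add: AE_restrict_space_iff AE_completion_iff)

lemma measurable_half_line: "f \<in> borel_measurable borel \<Longrightarrow> f \<in> borel_measurable half_line"
  unfolding half_line_def by (intro measurable_restrict_space1 measurable_completion) simp

lemma emeasure_half_line:
  "A \<in> sets borel \<Longrightarrow> emeasure half_line (A \<inter> {0<..}) = emeasure lborel (A \<inter> {0<..})"
  unfolding half_line_def by (subst emeasure_restrict_space) auto

lemma emeasure_half_line_finite:
  assumes "A \<in> sets half_line" "A \<subseteq> {0..r}" shows "emeasure half_line A < \<infinity>"
proof -
  have "emeasure half_line A \<le> emeasure half_line ({0..r} \<inter> {0<..})"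
    using assms by (intro emeasure_mono) (auto simp: sets_half_line)
  also have "\<dots> = emeasure lborel ({0..r} \<inter> {0<..})" by (rule emeasure_half_line) auto
  also have "\<dots> \<le> emeasure lborel {0..r}" by (intro emeasure_mono) auto
  also have "\<dots> < \<infinity>" by (simp add: emeasure_lborel_Icc_eq)
  finally show ?thesis .
qed

lemma strongly_measurable_borel_rep:
  assumes "strongly_measurable half_line f"
  obtains g where "g \<in> borel_measurable borel" "AE x in half_line. enorm (f x) = g x"
proof -
  obtain r where r: "r \<in> borel_measurable half_line" and fr: "AE x in half_line. enorm (f x) = r x"
    using strongly_measurable_norm_rep[OF assms] by blast
  have "(\<lambda>x. r x * indicator {0<..} x) \<in> borel_measurable lebesgue"
    using r unfolding half_line_def by (subst (asm) borel_measurable_restrict_space_iff_ennreal) auto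
  then obtain g where g: "g \<in> borel_measurable lborel" "AE x in lborel. r x * indicator {0<..} x = g x"
    using completion_ex_borel_measurable by blast
  have "AE x in lborel. 0 < x \<longrightarrow> enorm (f x) = g x"
    using fr[unfolded AE_half_line] g(2) by eventually_elim auto
  then show ?thesis using that g(1) by (auto simp: AE_half_line)
qed

lemma eventually_le_real: "eventually (\<lambda>n. x \<le> real n) sequentially"
  by (rule eventually_sequentiallyI[of "nat \<lceil>x\<rceil>"]) linarith

text \<open>The simple functions sample \<open>F\<close> at the right end of grid intervals of length \<open>1 / (n + 1)\<close> up to \<open>n\<close>:
right ends, since they stay away from \<open>0\<close>, where \<open>F\<close> may blow up.\<close>

lemma strongly_measurable_continuous:
  fixes F :: "real \<Rightarrow> 'a::banach"
  assumes F: "continuous_on {0<..} F"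
  shows "strongly_measurable half_line F"
proof -
  define q :: "nat \<Rightarrow> real \<Rightarrow> real" where
    "q n x = (if x \<le> real n then real_of_int \<lceil>x * real (Suc n)\<rceil> / real (Suc n) else 0)" for n x
  define s where "s n x = (if q n x = 0 then 0 else F (q n x))" for n x
  have q: "simple_function half_line (q n)" for n
  proof (rule simple_function_borel_measurable)
    show "q n \<in> borel_measurable half_line"
      by (rule measurable_half_line) (unfold q_def[abs_def], measurable)
    have "q n ` space half_line \<subseteq> insert 0 ((\<lambda>k. real_of_int k / real (Suc n)) ` {0..\<lceil>real n * real (Suc n)\<rceil>})"
    proof clarify
      fix x assume x: "x \<in> space half_line" "q n x \<notin> (\<lambda>k. real_of_int k / real (Suc n)) ` {0..\<lceil>real n * real (Suc n)\<rceil>}"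
      show "q n x = 0"
      proof (rule ccontr)
        assume "q n x \<noteq> 0"
        then have le: "x \<le> real n" and q: "q n x = real_of_int \<lceil>x * real (Suc n)\<rceil> / real (Suc n)"
          by (auto simp: q_def split: if_splits)
        have "0 < x * real (Suc n)" using x(1) by simp
        then have "0 \<le> \<lceil>x * real (Suc n)\<rceil>" by linarith
        moreover have "\<lceil>x * real (Suc n)\<rceil> \<le> \<lceil>real n * real (Suc n)\<rceil>"
          using le by (intro ceiling_mono mult_right_mono) auto
        ultimately show False using x(2) q by (metis atLeastAtMost_iff imageI)
      qed
    qed
    then show "finite (q n ` space half_line)" by (rule finite_subset) auto
  qed
  have s: "sbi half_line (s n)" for n
  proof (rule Bochner_Integration.simple_bochner_integrable.intros)
    show sf: "simple_function half_line (s n)"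
      unfolding s_def by (rule simple_function_compose1[OF q])
    have "{y \<in> space half_line. s n y \<noteq> 0} \<in> sets half_line"
      using measurable_simple_function[OF sf] by measurable
    moreover have "{y \<in> space half_line. s n y \<noteq> 0} \<subseteq> {0..real n}" by (auto simp: s_def q_def split: if_splits)
    ultimately have "emeasure half_line {y \<in> space half_line. s n y \<noteq> 0} < \<infinity>"
      by (rule emeasure_half_line_finite)
    then show "emeasure half_line {y \<in> space half_line. s n y \<noteq> 0} \<noteq> \<infinity>" by simp
  qed
  have "(\<lambda>n. s n x) \<longlonglongrightarrow> F x" if x: "0 < x" for x
  proof -
    have ev: "eventually (\<lambda>n. x \<le> real n) sequentially"
      by (rule eventually_le_real)
    have bnd: "x \<le> real_of_int \<lceil>x * real (Suc n)\<rceil> / real (Suc n)"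
      "real_of_int \<lceil>x * real (Suc n)\<rceil> / real (Suc n) \<le> x + 1 / real (Suc n)" for n
    proof -
      have "x * real (Suc n) \<le> real_of_int \<lceil>x * real (Suc n)\<rceil>" "real_of_int \<lceil>x * real (Suc n)\<rceil> \<le> x * real (Suc n) + 1"
        by linarith+
      then show "x \<le> real_of_int \<lceil>x * real (Suc n)\<rceil> / real (Suc n)"
        "real_of_int \<lceil>x * real (Suc n)\<rceil> / real (Suc n) \<le> x + 1 / real (Suc n)"
        by (simp_all add: pos_le_divide_eq pos_divide_le_eq distrib_right del: of_nat_Suc)
    qed
    have "(\<lambda>n. 1 / real (Suc n)) \<longlonglongrightarrow> 0" using LIMSEQ_inverse_real_of_nat by (simp add: inverse_eq_divide)
    then have "(\<lambda>n. x + 1 / real (Suc n)) \<longlonglongrightarrow> x + 0" by (intro tendsto_add tendsto_const)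
    then have upper: "(\<lambda>n. x + 1 / real (Suc n)) \<longlonglongrightarrow> x" by (simp only: add_0_right)
    have lim: "(\<lambda>n. real_of_int \<lceil>x * real (Suc n)\<rceil> / real (Suc n)) \<longlonglongrightarrow> x"
    proof (rule tendsto_sandwich[OF _ _ tendsto_const upper])
      show "eventually (\<lambda>n. x \<le> real_of_int \<lceil>x * real (Suc n)\<rceil> / real (Suc n)) sequentially"
        by (intro always_eventually allI bnd)
      show "eventually (\<lambda>n. real_of_int \<lceil>x * real (Suc n)\<rceil> / real (Suc n) \<le> x + 1 / real (Suc n)) sequentially"
        by (intro always_eventually allI bnd)
    qed
    have "isCont F x" using F x by (simp add: continuous_on_eq_continuous_at)
    from isCont_tendsto_compose[OF this lim]
    have "(\<lambda>n. F (real_of_int \<lceil>x * real (Suc n)\<rceil> / real (Suc n))) \<longlonglongrightarrow> F x" .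
    moreover have "eventually (\<lambda>n. F (real_of_int \<lceil>x * real (Suc n)\<rceil> / real (Suc n)) = s n x) sequentially"
      using ev
    proof eventually_elim
      case (elim n)
      have "0 < q n x" using elim x bnd(1)[of n] by (simp add: q_def del: of_nat_Suc)
      then have "q n x \<noteq> 0" by simp
      then show ?case using elim by (simp add: s_def q_def)
    qed
    ultimately show ?thesis by (rule Lim_transform_eventually)
  qed
  then show ?thesis unfolding strongly_measurable_def using s
    by (intro exI[of _ s]) (auto simp: AE_half_line)
qed

lemma strongly_measurable_indicator:
  assumes A: "A \<in> sets half_line"
  shows "strongly_measurable half_line (indicator A :: real \<Rightarrow> real)"
  unfolding strongly_measurable_def
proof (intro exI conjI allI)
  let ?s = "\<lambda>n::nat. indicator (A \<inter> {0<..real n}) :: real \<Rightarrow> real"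
  fix n :: nat
  have m: "A \<inter> {0<..real n} \<in> sets half_line" using A by (auto simp: sets_half_line)
  show "sbi half_line (?s n)"
  proof (rule Bochner_Integration.simple_bochner_integrable.intros)
    show "simple_function half_line (?s n)" using m by (rule simple_function_indicator)
    have "{y \<in> space half_line. ?s n y \<noteq> 0} = A \<inter> {0<..real n}" by (auto simp: indicator_def)
    then show "emeasure half_line {y \<in> space half_line. ?s n y \<noteq> 0} \<noteq> \<infinity>"
      using emeasure_half_line_finite[OF m, of "real n"] by (simp add: less_top[symmetric] le_infI2 subset_eq)
  qed
next
  show "AE x in half_line. (\<lambda>n::nat. indicator (A \<inter> {0<..real n}) x) \<longlonglongrightarrow> (indicator A x :: real)"
    unfolding AE_half_line
  proof (intro AE_I2 impI)
    fix x :: real assume "0 < x"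
    have "eventually (\<lambda>n. x \<le> real n) sequentially"
      by (rule eventually_le_real)
    then have "eventually (\<lambda>n. indicator (A \<inter> {0<..real n}) x = (indicator A x :: real)) sequentially"
      by eventually_elim (use \<open>0 < x\<close> in \<open>auto simp: indicator_def\<close>)
    then show "(\<lambda>n::nat. indicator (A \<inter> {0<..real n}) x) \<longlonglongrightarrow> (indicator A x :: real)"
      by (rule tendsto_eventually)
  qed
qed

lemma strongly_measurable_indicator_borel:
  assumes A: "A \<in> sets borel"
  shows "strongly_measurable half_line (indicator A :: real \<Rightarrow> real)"
proof -
  have "A \<inter> {0<..} \<in> sets half_line" using A by (auto simp: sets_half_line)
  from strongly_measurable_cong_AE[OF strongly_measurable_indicator[OF this]]
  show ?thesis by (auto simp: AE_half_line indicator_def)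
qed

lemma strongly_measurable_restrict:
  "A \<in> sets borel \<Longrightarrow> strongly_measurable half_line f \<Longrightarrow> strongly_measurable half_line (\<lambda>x. indicator A x *\<^sub>R f x)"
  by (intro strongly_measurable_scaleR strongly_measurable_indicator_borel)

lemma has_Bochner_integral_of_has_bochner_integral:
  assumes "has_bochner_integral M f I" "strongly_measurable M f"
  shows "has_Bochner_integral M f I"
  using assms unfolding has_Bochner_integral_def by (auto elim!: has_bochner_integral.cases)

lemma has_Bochner_integral_FTC:
  fixes \<phi> :: "real \<Rightarrow> complex"
  assumes s: "0 < s" "s \<le> t" and d: "\<And>x. 0 < x \<Longrightarrow> (\<phi> has_vector_derivative \<phi>' x) (at x)" and c: "continuous_on {0<..} \<phi>'"
  shows "has_Bochner_integral half_line (\<lambda>x. indicator {s<..t} x *\<^sub>R \<phi>' x) (\<phi> t - \<phi> s)"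
proof -
  have sub: "{s..t} \<subseteq> {0<..}" using s by auto
  have "has_bochner_integral lborel (\<lambda>x. indicator {s..t} x *\<^sub>R \<phi>' x) (\<phi> t - \<phi> s)"
    using s sub by (intro has_bochner_integral_FTC_Icc has_vector_derivative_at_within[OF d] continuous_on_subset[OF c]) auto
  then have "has_bochner_integral lebesgue (\<lambda>x. indicator {s..t} x *\<^sub>R \<phi>' x) (\<phi> t - \<phi> s)"
    by (auto simp: has_bochner_integral_iff integrable_completion integral_completion)
  also have "(\<lambda>x. indicator {s..t} x *\<^sub>R \<phi>' x) = (\<lambda>x. indicator {0<..} x *\<^sub>R indicator {s..t} x *\<^sub>R \<phi>' x)"
    using s by (auto simp: indicator_def)
  finally have "has_bochner_integral half_line (\<lambda>x. indicator {s..t} x *\<^sub>R \<phi>' x) (\<phi> t - \<phi> s)"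
    unfolding half_line_def by (subst has_bochner_integral_restrict_space) auto
  then have "has_Bochner_integral half_line (\<lambda>x. indicator {s..t} x *\<^sub>R \<phi>' x) (\<phi> t - \<phi> s)"
    by (intro has_Bochner_integral_of_has_bochner_integral strongly_measurable_restrict strongly_measurable_continuous c) auto
  then show ?thesis
    by (rule has_Bochner_integral_cong_AE) (use AE_lborel_singleton[of s] in \<open>auto simp: AE_half_line indicator_def\<close>)
qed

section \<open>Primitives on the half-line\<close>

definition locally_integrable :: "(real \<Rightarrow> 'a::banach) \<Rightarrow> bool" where
  "locally_integrable f \<longleftrightarrow> strongly_measurable half_line f \<and>
     (\<forall>a b. 0 < a \<longrightarrow> norm_int f a b < \<infinity>)"

text \<open>Local absolute continuity in integrated form. Using the fundamental theorem as the definition avoids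
differentiating vector-valued functions almost everywhere.\<close>

definition primitive :: "(real \<Rightarrow> 'a::banach) \<Rightarrow> (real \<Rightarrow> 'a) \<Rightarrow> bool" where
  "primitive f F \<longleftrightarrow> strongly_measurable half_line f \<and>
     (\<forall>a b. 0 < a \<longrightarrow> a \<le> b \<longrightarrow> has_Bochner_integral half_line (\<lambda>x. indicator {a<..b} x *\<^sub>R f x) (F b - F a))"

lemma nn_integral_norm_restrict:
  assumes "0 \<le> a"
  shows "(\<integral>\<^sup>+x. enorm (indicator {a<..b} x *\<^sub>R f x) \<partial>half_line) = norm_int f a b"
  unfolding nn_integral_half_line using assms by (intro nn_integral_cong) (auto simp: indicator_def)

lemma primitive_locally_integrable:
  assumes "primitive f F" shows "locally_integrable f"
  unfolding locally_integrable_def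
proof (intro conjI allI impI)
  show "strongly_measurable half_line f" using assms by (simp add: primitive_def)
  fix a b :: real assume a: "0 < a"
  show "norm_int f a b < \<infinity>"
  proof (cases "a \<le> b")
    case True
    then have "has_Bochner_integral half_line (\<lambda>x. indicator {a<..b} x *\<^sub>R f x) (F b - F a)"
      using assms a by (simp add: primitive_def)
    from has_Bochner_integral_finite[OF this] show ?thesis using a by (subst (asm) nn_integral_norm_restrict) auto
  qed simp
qed

lemma primitive_norm_le:
  assumes "primitive f F" "0 < a" "a \<le> b"
  shows "enorm (F b - F a) \<le> norm_int f a b"
proof -
  have "has_Bochner_integral half_line (\<lambda>x. indicator {a<..b} x *\<^sub>R f x) (F b - F a)"
    using assms by (simp add: primitive_def)
  from has_Bochner_integral_norm_le[OF this] show ?thesis using assms by (subst (asm) nn_integral_norm_restrict) auto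
qed

text \<open>The witness is the primitive of a real-valued representative of the norm. It bounds increments of
vector-valued primitives by those of one continuous monotone real function.\<close>

lemma locally_integrable_modulus:
  fixes f :: "real \<Rightarrow> 'a::banach"
  assumes f: "locally_integrable f" and a: "0 < a" "a \<le> b"
  obtains V where "continuous_on {a..b} V" "\<And>s t. a \<le> s \<Longrightarrow> s \<le> t \<Longrightarrow> t \<le> b \<Longrightarrow> V s \<le> V t"
    "\<And>s t. a \<le> s \<Longrightarrow> s \<le> t \<Longrightarrow> t \<le> b \<Longrightarrow> norm_int f s t \<le> ennreal (V t - V s)"
proof -
  obtain r where r[measurable]: "r \<in> borel_measurable borel" and fr: "AE x in half_line. enorm (f x) = r x"
    using strongly_measurable_borel_rep f unfolding locally_integrable_def by blast
  define g where "g x = enn2real (r x) * indicator {a<..b} x" for x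
  have g0: "0 \<le> g x" for x by (simp add: g_def)
  have [measurable]: "g \<in> borel_measurable borel" unfolding g_def[abs_def] by measurable
  have gf: "AE x in lborel. ennreal (g x) = enorm (f x) * indicator {a<..b} x"
    using fr[unfolded AE_half_line]
  proof eventually_elim
    case (elim x)
    then show ?case using a by (cases "x \<in> {a<..b}") (auto simp: g_def enn2real_ennreal simp flip: elim)
  qed
  have "(\<integral>\<^sup>+x. ennreal (g x) \<partial>lborel) = norm_int f a b"
    by (rule nn_integral_cong_AE[OF gf])
  then have "(\<integral>\<^sup>+x. enorm (g x) \<partial>lborel) < \<infinity>" using f a g0 by (simp add: locally_integrable_def)
  then have "integrable lborel g" by (intro integrableI_bounded) auto
  then have gi: "g integrable_on UNIV" by (rule integrable_on_lborel)
  then have gi': "g integrable_on {s..t}" for s t by (rule integrable_on_subinterval) simp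
  define V where "V t = integral {a..t} g" for t
  have diff: "V t - V s = integral {s..t} g" if "a \<le> s" "s \<le> t" for s t
    unfolding V_def using Henstock_Kurzweil_Integration.integral_combine[OF that gi'] by simp
  show ?thesis
  proof (rule that)
    show "continuous_on {a..b} V" unfolding V_def by (rule indefinite_integral_continuous_1[OF gi'])
    fix s t assume st: "a \<le> s" "s \<le> t" "t \<le> b"
    have "0 \<le> V t - V s" unfolding diff[OF st(1,2)] using g0 by (intro integral_nonneg gi') auto
    then show "V s \<le> V t" by simp
    have "norm_int f s t \<le> (\<integral>\<^sup>+x. ennreal (g x) * indicator {s..t} x \<partial>lborel)"
      by (intro nn_integral_mono_AE, use gf in eventually_elim) (use st in \<open>auto simp: indicator_def split: if_splits\<close>)
    also have "\<dots> = ennreal (integral {s..t} g)"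
      using gi' g0 by (intro nn_integral_has_integral_lebesgue' integrable_integral) auto
    finally show "norm_int f s t \<le> ennreal (V t - V s)"
      using diff[OF st(1,2)] by simp
  qed
qed

lemma primitive_continuous:
  assumes F: "primitive f F" shows "continuous_on {0<..} F"
proof -
  have "isCont F x" if x: "0 < x" for x
  proof -
    obtain V where V: "continuous_on {x/2..x+1} V" and mono: "\<And>s t. x/2 \<le> s \<Longrightarrow> s \<le> t \<Longrightarrow> t \<le> x+1 \<Longrightarrow> V s \<le> V t"
      and le: "\<And>s t. x/2 \<le> s \<Longrightarrow> s \<le> t \<Longrightarrow> t \<le> x+1 \<Longrightarrow> norm_int f s t \<le> ennreal (V t - V s)"
      using locally_integrable_modulus[OF primitive_locally_integrable[OF F], of "x/2" "x+1"] x by auto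
    have *: "norm (F t - F s) \<le> V t - V s" if "x/2 \<le> s" "s \<le> t" "t \<le> x+1" for s t
    proof -
      have "enorm (F t - F s) \<le> ennreal (V t - V s)"
        using primitive_norm_le[OF F, of s t] le[OF that] x that by (auto intro: order_trans)
      then show ?thesis using mono[OF that] by (simp add: ennreal_le_iff)
    qed
    have "isCont V x"
      using V x by (intro continuous_on_interior[OF V]) auto
    then have "(\<lambda>y. \<bar>V y - V x\<bar>) \<midarrow>x\<rightarrow> 0"
      unfolding isCont_def by (metis LIM_zero tendsto_rabs_zero)
    moreover have "eventually (\<lambda>y. norm (F y - F x) \<le> \<bar>V y - V x\<bar>) (at x)"
    proof -
      have "eventually (\<lambda>y. y \<in> {x/2<..<x+1}) (at x)"
        using x by (intro eventually_at_in_open') auto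
      then show ?thesis
      proof eventually_elim
        case (elim y)
        then show ?case using *[of x y] *[of y x] x by (cases "x \<le> y") (auto simp: norm_minus_commute)
      qed
    qed
    ultimately have "(\<lambda>y. F y - F x) \<midarrow>x\<rightarrow> 0" by (rule Lim_null_comparison[rotated])
    then show ?thesis unfolding isCont_def by (rule LIM_zero_cancel)
  qed
  then show ?thesis by (auto intro: continuous_at_imp_continuous_on)
qed

lemma continuous_locally_integrable:
  fixes F :: "real \<Rightarrow> 'a::banach"
  assumes F: "continuous_on {0<..} F" shows "locally_integrable F"
  unfolding locally_integrable_def
proof (intro conjI allI impI strongly_measurable_continuous F)
  fix a b :: real assume a: "0 < a"
  have "compact (F ` {a..b})" using a by (intro compact_continuous_image continuous_on_subset[OF F]) auto
  then obtain K where K: "\<And>x. x \<in> {a..b} \<Longrightarrow> norm (F x) \<le> K"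
    using compact_imp_bounded bounded_iff by (metis imageI)
  have "norm_int F a b \<le> (\<integral>\<^sup>+x. ennreal K * indicator {a<..b} x \<partial>lborel)"
    using K by (intro nn_integral_mono) (auto simp: indicator_def intro!: ennreal_leI)
  also have "\<dots> < \<infinity>" by (cases "a \<le> b") (auto simp: nn_integral_cmult_indicator ennreal_mult_less_top)
  finally show "norm_int F a b < \<infinity>" .
qed

lemma locally_integrable_integral_exists:
  assumes "locally_integrable f" "0 < a"
  obtains I where "has_Bochner_integral half_line (\<lambda>x. indicator {a<..b} x *\<^sub>R f x) I"
proof -
  have "(\<integral>\<^sup>+x. enorm (indicator {a<..b} x *\<^sub>R f x) \<partial>half_line) < \<infinity>"
    using assms by (subst nn_integral_norm_restrict) (auto simp: locally_integrable_def)
  moreover have "strongly_measurable half_line (\<lambda>x. indicator {a<..b} x *\<^sub>R f x)"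
    using assms by (intro strongly_measurable_restrict) (auto simp: locally_integrable_def)
  ultimately show ?thesis using that has_Bochner_integral_exists by blast
qed

lemma locally_integrable_scaleC:
  assumes "continuous_on {0<..} \<phi>" "locally_integrable f"
  shows "locally_integrable (\<lambda>x. \<phi> x *\<^sub>C f x)"
  unfolding locally_integrable_def
proof (intro conjI allI impI)
  show "strongly_measurable half_line (\<lambda>x. \<phi> x *\<^sub>C f x)"
    using assms(2) by (intro strongly_measurable_scaleC[OF strongly_measurable_continuous[OF assms(1)]]) (auto simp: locally_integrable_def)
  obtain r where r[measurable]: "r \<in> borel_measurable borel" and fr: "AE x in half_line. enorm (f x) = r x"
    using strongly_measurable_borel_rep assms(2) unfolding locally_integrable_def by blast
  fix a b :: real assume a: "0 < a"
  have "compact (\<phi> ` {a..b})" using a by (intro compact_continuous_image continuous_on_subset[OF assms(1)]) auto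
  then obtain K where K: "\<And>x. x \<in> {a..b} \<Longrightarrow> norm (\<phi> x) \<le> K"
    using compact_imp_bounded bounded_iff by (metis imageI)
  have *: "AE x in lborel. enorm (f x) * indicator {a<..b} x = r x * indicator {a<..b} x"
    using fr[unfolded AE_half_line] by eventually_elim (use a in \<open>auto simp: indicator_def\<close>)
  have "(\<integral>\<^sup>+x. enorm (\<phi> x *\<^sub>C f x) * indicator {a<..b} x \<partial>lborel) \<le>
    (\<integral>\<^sup>+x. ennreal K * (r x * indicator {a<..b} x) \<partial>lborel)"
    using *
  proof (intro nn_integral_mono_AE, eventually_elim)
    case (elim x)
    show ?case
    proof (cases "x \<in> {a<..b}")
      case True
      have "norm (\<phi> x *\<^sub>C f x) \<le> K * norm (f x)"
        using K[of x] True by (auto simp: norm_scaleC intro!: mult_right_mono)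
      then have "enorm (\<phi> x *\<^sub>C f x) \<le> ennreal K * enorm (f x)"
        by (subst ennreal_mult''[symmetric]) (auto intro: ennreal_leI)
      then show ?thesis using elim True by simp
    qed simp
  qed
  also have "\<dots> = ennreal K * norm_int f a b"
    using nn_integral_cong_AE[OF *] by (subst nn_integral_cmult) auto
  also have "\<dots> < \<infinity>" using assms(2) a by (auto simp: locally_integrable_def ennreal_mult_less_top)
  finally show "(\<integral>\<^sup>+x. enorm (\<phi> x *\<^sub>C f x) * indicator {a<..b} x \<partial>lborel) < \<infinity>" .
qed

lemma locally_integrable_add:
  assumes f: "locally_integrable f" and g: "locally_integrable g"
  shows "locally_integrable (\<lambda>x. f x + g x)"
  unfolding locally_integrable_def
proof (intro conjI allI impI)
  show sm: "strongly_measurable half_line (\<lambda>x. f x + g x)"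
    using f g by (intro strongly_measurable_add) (auto simp: locally_integrable_def)
  fix a b :: real assume a: "0 < a"
  obtain I J where "has_Bochner_integral half_line (\<lambda>x. indicator {a<..b} x *\<^sub>R f x) I"
     "has_Bochner_integral half_line (\<lambda>x. indicator {a<..b} x *\<^sub>R g x) J"
    using locally_integrable_integral_exists f g a by metis
  from has_Bochner_integral_finite[OF has_Bochner_integral_add[OF this]]
  have "(\<integral>\<^sup>+x. enorm (indicator {a<..b} x *\<^sub>R (f x + g x)) \<partial>half_line) < \<infinity>"
    by (simp add: scaleR_add_right)
  then show "(\<integral>\<^sup>+x. enorm (f x + g x) * indicator {a<..b} x \<partial>lborel) < \<infinity>"
    using a by (subst (asm) nn_integral_norm_restrict) auto
qed

text \<open>Over \<open>n + 1\<close> equal pieces, the increments sum up to \<open>O(1 / n)\<close>, because those of \<open>V\<close> telescope.\<close>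

lemma additive_increment_bound_imp_const:
  fixes \<Phi> :: "real \<Rightarrow> 'a::real_normed_vector"
  assumes ab: "a \<le> b" and K: "0 \<le> K"
    and le: "\<And>s t. a \<le> s \<Longrightarrow> s \<le> t \<Longrightarrow> t \<le> b \<Longrightarrow> norm (\<Phi> t - \<Phi> s) \<le> K * (t - s) * (V t - V s)"
  shows "\<Phi> b = \<Phi> a"
proof -
  define x where "x n i = a + (b - a) * real i / real (Suc n)" for n i
  have bound: "norm (\<Phi> b - \<Phi> a) \<le> K * (b - a) * (V b - V a) * (1 / real (Suc n))" for n
  proof -
    have ends: "x n 0 = a" "x n (Suc n) = b" by (auto simp: x_def)
    have "\<Phi> b - \<Phi> a = (\<Sum>i<Suc n. \<Phi> (x n (Suc i)) - \<Phi> (x n i))"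
      by (subst sum_lessThan_telescope) (simp add: ends)
    then have "norm (\<Phi> b - \<Phi> a) \<le> (\<Sum>i<Suc n. norm (\<Phi> (x n (Suc i)) - \<Phi> (x n i)))"
      by (simp only: norm_sum)
    also have "\<dots> \<le> (\<Sum>i<Suc n. K * ((b - a) / real (Suc n)) * (V (x n (Suc i)) - V (x n i)))"
    proof (rule sum_mono)
      fix i assume i: "i \<in> {..<Suc n}"
      have 1: "a \<le> x n i" using ab by (simp add: x_def)
      have 2: "x n (Suc i) - x n i = (b - a) / real (Suc n)"
        by (simp add: x_def diff_divide_distrib[symmetric] algebra_simps del: of_nat_Suc) (simp add: algebra_simps)
      then have 3: "x n i \<le> x n (Suc i)" using ab by (smt (verit) divide_nonneg_nonneg of_nat_0_le_iff)
      have "(b - a) * real (Suc i) / real (Suc n) \<le> (b - a) * 1"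
        using i ab unfolding times_divide_eq_right[symmetric] by (intro mult_left_mono) auto
      then have 4: "x n (Suc i) \<le> b" by (simp add: x_def del: of_nat_Suc)
      show "norm (\<Phi> (x n (Suc i)) - \<Phi> (x n i)) \<le> K * ((b - a) / real (Suc n)) * (V (x n (Suc i)) - V (x n i))"
        using le[OF 1 3 4] by (simp only: 2)
    qed
    also have "\<dots> = K * ((b - a) / real (Suc n)) * (V b - V a)"
    proof -
      have "(\<Sum>i<Suc n. V (x n (Suc i)) - V (x n i)) = V b - V a"
        by (subst sum_lessThan_telescope) (simp add: ends)
      then show ?thesis by (simp only: sum_distrib_left[symmetric])
    qed
    finally show ?thesis by simp
  qed
  have "(\<lambda>n. K * (b - a) * (V b - V a) * (1 / real (Suc n))) \<longlonglongrightarrow> K * (b - a) * (V b - V a) * 0"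
    using LIMSEQ_inverse_real_of_nat by (intro tendsto_mult tendsto_const) (simp add: inverse_eq_divide)
  then have "norm (\<Phi> b - \<Phi> a) \<le> K * (b - a) * (V b - V a) * 0"
    by (rule LIMSEQ_le_const) (use bound in auto)
  then show ?thesis by simp
qed

lemma has_Bochner_integral_interval_diff:
  assumes "0 < a" "a \<le> s" "s \<le> t"
    and "has_Bochner_integral half_line (\<lambda>x. indicator {a<..t} x *\<^sub>R f x) J"
    and "has_Bochner_integral half_line (\<lambda>x. indicator {a<..s} x *\<^sub>R f x) I"
  shows "has_Bochner_integral half_line (\<lambda>x. indicator {s<..t} x *\<^sub>R f x) (J - I)"
proof -
  have "(\<lambda>x. indicator {a<..t} x *\<^sub>R f x - indicator {a<..s} x *\<^sub>R f x) = (\<lambda>x. indicator {s<..t} x *\<^sub>R f x)"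
    using assms(1-3) by (auto simp: indicator_def fun_eq_iff)
  with has_Bochner_integral_diff[OF assms(4,5)] show ?thesis by simp
qed

text \<open>The product rule for a primitive and a \<open>C\<^sup>1\<close> scalar. The function \<open>\<phi> F - \<integral> h\<close>, where \<open>h = \<phi> f + \<phi>' F\<close>, has
increments bounded by a constant times \<open>(t - s) (V t - V s)\<close>: compare \<open>h\<close> on \<open>{s<..t}\<close> with
\<open>\<phi> t f + \<phi>' F s\<close>, whose integral is known exactly. By \<open>additive_increment_bound_imp_const\<close> it is
constant.\<close>

lemma primitive_product:
  fixes f F :: "real \<Rightarrow> 'a::complex_banach" and \<phi> \<phi>' :: "real \<Rightarrow> complex"
  assumes F: "primitive f F" and d: "\<And>x. 0 < x \<Longrightarrow> (\<phi> has_vector_derivative \<phi>' x) (at x)"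
    and c: "continuous_on {0<..} \<phi>'"
  shows "primitive (\<lambda>x. \<phi> x *\<^sub>C f x + \<phi>' x *\<^sub>C F x) (\<lambda>x. \<phi> x *\<^sub>C F x)"
proof -
  have c\<phi>: "continuous_on {0<..} \<phi>"
    using d by (intro continuous_at_imp_continuous_on) (auto intro: has_vector_derivative_continuous)
  have cF: "continuous_on {0<..} F" by (rule primitive_continuous[OF F])
  have lf: "locally_integrable f" by (rule primitive_locally_integrable[OF F])
  define h where "h x = \<phi> x *\<^sub>C f x + \<phi>' x *\<^sub>C F x" for x
  have lh: "locally_integrable h" unfolding h_def
    by (intro locally_integrable_add locally_integrable_scaleC c\<phi> c lf continuous_locally_integrable cF)
  show ?thesis unfolding primitive_def h_def[symmetric]
  proof (intro conjI allI impI)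
    show "strongly_measurable half_line h" using lh by (simp add: locally_integrable_def)
    fix a b :: real assume a: "0 < a" "a \<le> b"
    have "\<exists>I. has_Bochner_integral half_line (\<lambda>x. indicator {a<..t} x *\<^sub>R h x) I" for t
      using locally_integrable_integral_exists[OF lh a(1)] by blast
    then obtain I where I: "\<And>t. has_Bochner_integral half_line (\<lambda>x. indicator {a<..t} x *\<^sub>R h x) (I t)" by metis
    have sub: "{a..b} \<subseteq> {0<..}" using a by auto
    have "compact (\<phi>' ` {a..b})" by (intro compact_continuous_image continuous_on_subset[OF c sub]) auto
    then obtain K0 where K0: "\<And>x. x \<in> {a..b} \<Longrightarrow> norm (\<phi>' x) \<le> K0"
      using compact_imp_bounded bounded_iff by (metis imageI)
    define K where "K = max K0 0"
    have K1: "norm (\<phi>' x) \<le> K" if "x \<in> {a..b}" for x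
      by (rule order_trans[OF K0[OF that]]) (simp add: K_def)
    have K2: "0 \<le> K" by (simp add: K_def)
    note K = K1 K2
    obtain V where "continuous_on {a..b} V" and mono: "\<And>s t. a \<le> s \<Longrightarrow> s \<le> t \<Longrightarrow> t \<le> b \<Longrightarrow> V s \<le> V t"
      and V: "\<And>s t. a \<le> s \<Longrightarrow> s \<le> t \<Longrightarrow> t \<le> b \<Longrightarrow> norm_int f s t \<le> ennreal (V t - V s)"
      by (rule locally_integrable_modulus[OF lf a]) (rule that)
    obtain r where r[measurable]: "r \<in> borel_measurable borel" and fr: "AE x in half_line. enorm (f x) = r x"
      using strongly_measurable_borel_rep lf unfolding locally_integrable_def by blast
    have lip: "norm (\<phi> t - \<phi> s) \<le> K * (t - s)" if st: "a \<le> s" "s \<le> t" "t \<le> b" for s t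
    proof -
      have "enorm (\<phi> t - \<phi> s) \<le> (\<integral>\<^sup>+x. enorm (indicator {s<..t} x *\<^sub>R \<phi>' x) \<partial>half_line)"
        using st a by (intro has_Bochner_integral_norm_le has_Bochner_integral_FTC d c) auto
      also have "\<dots> = norm_int \<phi>' s t"
        using st a by (intro nn_integral_norm_restrict) auto
      also have "\<dots> \<le> (\<integral>\<^sup>+x. ennreal K * indicator {s<..t} x \<partial>lborel)"
        using K st by (intro nn_integral_mono) (auto simp: indicator_def intro!: ennreal_leI)
      also have "\<dots> = ennreal (K * (t - s))"
        using K st by (subst nn_integral_cmult_indicator) (auto simp: ennreal_mult)
      finally show ?thesis using K st by (simp add: ennreal_le_iff)
    qed
    define \<Phi> where "\<Phi> t = \<phi> t *\<^sub>C F t - I t" for t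
    have "\<Phi> b = \<Phi> a"
    proof (rule additive_increment_bound_imp_const[OF a(2)])
      show "0 \<le> 2 * K" using K by simp
      fix s t assume st: "a \<le> s" "s \<le> t" "t \<le> b"
      have s0: "0 < s" using a st by simp
      have 1: "has_Bochner_integral half_line (\<lambda>x. \<phi> t *\<^sub>C (indicator {s<..t} x *\<^sub>R f x)) (\<phi> t *\<^sub>C (F t - F s))"
        using F s0 st by (intro has_Bochner_integral_scaleC) (auto simp: primitive_def)
      have 2: "has_Bochner_integral half_line (\<lambda>x. (indicator {s<..t} x *\<^sub>R \<phi>' x) *\<^sub>C F s) ((\<phi> t - \<phi> s) *\<^sub>C F s)"
        by (rule has_Bochner_integral_linear[OF scaleC.bounded_linear_left has_Bochner_integral_FTC[OF s0 st(2) d c]])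
      have 3: "has_Bochner_integral half_line (\<lambda>x. indicator {s<..t} x *\<^sub>R h x) (I t - I s)"
        by (rule has_Bochner_integral_interval_diff[OF a(1) st(1,2) I I])
      have "has_Bochner_integral half_line
          (\<lambda>x. \<phi> t *\<^sub>C (indicator {s<..t} x *\<^sub>R f x) + (indicator {s<..t} x *\<^sub>R \<phi>' x) *\<^sub>C F s - indicator {s<..t} x *\<^sub>R h x)
          (\<phi> t *\<^sub>C (F t - F s) + (\<phi> t - \<phi> s) *\<^sub>C F s - (I t - I s))"
        by (intro has_Bochner_integral_diff has_Bochner_integral_add 1 2 3)
      also have "\<phi> t *\<^sub>C (F t - F s) + (\<phi> t - \<phi> s) *\<^sub>C F s - (I t - I s) = \<Phi> t - \<Phi> s"
        by (simp add: \<Phi>_def scaleC.diff_left scaleC.diff_right)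
      also have "(\<lambda>x. \<phi> t *\<^sub>C (indicator {s<..t} x *\<^sub>R f x) + (indicator {s<..t} x *\<^sub>R \<phi>' x) *\<^sub>C F s - indicator {s<..t} x *\<^sub>R h x)
        = (\<lambda>x. indicator {s<..t} x *\<^sub>R ((\<phi> t - \<phi> x) *\<^sub>C f x + \<phi>' x *\<^sub>C (F s - F x)))"
        by (auto simp: indicator_def h_def scaleC.diff_left scaleC.diff_right)
      finally have "enorm (\<Phi> t - \<Phi> s) \<le>
        (\<integral>\<^sup>+x. enorm (indicator {s<..t} x *\<^sub>R ((\<phi> t - \<phi> x) *\<^sub>C f x + \<phi>' x *\<^sub>C (F s - F x))) \<partial>half_line)"
        by (rule has_Bochner_integral_norm_le)
      also have "\<dots> = (\<integral>\<^sup>+x. enorm ((\<phi> t - \<phi> x) *\<^sub>C f x + \<phi>' x *\<^sub>C (F s - F x)) * indicator {s<..t} x \<partial>lborel)"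
        using s0 by (intro nn_integral_norm_restrict) simp
      also have "\<dots> \<le> (\<integral>\<^sup>+x. ennreal (K * (t - s)) * (r x * indicator {s<..t} x) + ennreal (K * (V t - V s)) * indicator {s<..t} x \<partial>lborel)"
        using fr[unfolded AE_half_line]
      proof (intro nn_integral_mono_AE, eventually_elim)
        case (elim x)
        show ?case
        proof (cases "x \<in> {s<..t}")
          case True
          then have x: "s \<le> x" "x \<le> t" "0 < x" "a \<le> x" "x \<le> b" using s0 st by auto
          have "norm (F x - F s) \<le> V x - V s"
          proof -
            have "enorm (F x - F s) \<le> ennreal (V x - V s)"
              using primitive_norm_le[OF F s0 x(1)] V[OF st(1) x(1) x(5)] by (rule order_trans)
            then show ?thesis using mono[OF st(1) x(1) x(5)] by (simp add: ennreal_le_iff)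
          qed
          also have "\<dots> \<le> V t - V s" using mono[OF x(4) x(2) st(3)] by simp
          finally have Fx: "norm (F s - F x) \<le> V t - V s" by (simp add: norm_minus_commute)
          have "norm (\<phi> t - \<phi> x) \<le> K * (t - s)"
            using lip[OF x(4) x(2) st(3)] K(2) x by (smt (verit) mult_left_mono)
          then have "norm ((\<phi> t - \<phi> x) *\<^sub>C f x + \<phi>' x *\<^sub>C (F s - F x)) \<le> K * (t - s) * norm (f x) + K * (V t - V s)"
            using Fx K(1)[of x] K(2) x
            by (intro order_trans[OF norm_triangle_ineq] add_mono) (auto simp: norm_scaleC intro!: mult_mono)
          then have "enorm ((\<phi> t - \<phi> x) *\<^sub>C f x + \<phi>' x *\<^sub>C (F s - F x)) \<le> ennreal (K * (t - s) * norm (f x) + K * (V t - V s))"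
            by (rule ennreal_leI)
          also have "\<dots> = ennreal (K * (t - s)) * r x + ennreal (K * (V t - V s))"
            using K(2) st mono[OF st] elim x by (simp add: ennreal_plus ennreal_mult)
          finally show ?thesis using True by simp
        qed simp
      qed
      also have "\<dots> = ennreal (K * (t - s)) * (\<integral>\<^sup>+x. r x * indicator {s<..t} x \<partial>lborel) + ennreal (K * (V t - V s)) * ennreal (t - s)"
        using st by (subst nn_integral_add) (auto simp: nn_integral_cmult nn_integral_cmult_indicator)
      also have "(\<integral>\<^sup>+x. r x * indicator {s<..t} x \<partial>lborel) = norm_int f s t"
        by (rule nn_integral_cong_AE, use fr[unfolded AE_half_line] in eventually_elim) (use s0 in \<open>auto simp: indicator_def\<close>)
      also have "ennreal (K * (t - s)) * \<dots> + ennreal (K * (V t - V s)) * ennreal (t - s) \<le>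
        ennreal (K * (t - s)) * ennreal (V t - V s) + ennreal (K * (V t - V s)) * ennreal (t - s)"
        by (intro add_right_mono mult_left_mono V st) simp
      also have "\<dots> = ennreal (2 * K * (t - s) * (V t - V s))"
      proof -
        have "ennreal (K * (t - s)) * ennreal (V t - V s) = ennreal (K * (t - s) * (V t - V s))"
          "ennreal (K * (V t - V s)) * ennreal (t - s) = ennreal (K * (V t - V s) * (t - s))"
          using K(2) st mono[OF st] by (simp_all only: ennreal_mult'' mult_nonneg_nonneg diff_ge_0_iff_ge)
        moreover have "ennreal (K * (t - s) * (V t - V s)) + ennreal (K * (V t - V s) * (t - s)) =
          ennreal (K * (t - s) * (V t - V s) + K * (V t - V s) * (t - s))"
          using K(2) st mono[OF st] by (intro ennreal_plus[symmetric]) auto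
        ultimately show ?thesis by (simp add: algebra_simps)
      qed
      finally show "norm (\<Phi> t - \<Phi> s) \<le> 2 * K * (t - s) * (V t - V s)"
        using K(2) st mono[OF st] by (subst (asm) ennreal_le_iff) auto
    qed
    moreover have "I a = 0" using has_Bochner_integral_unique[OF I[of a], of 0] by simp
    ultimately have "I b = \<phi> b *\<^sub>C F b - \<phi> a *\<^sub>C F a" by (simp add: \<Phi>_def algebra_simps)
    then show "has_Bochner_integral half_line (\<lambda>x. indicator {a<..b} x *\<^sub>R h x) (\<phi> b *\<^sub>C F b - \<phi> a *\<^sub>C F a)"
      using I[of b] by simp
  qed
qed

lemma primitive_add:
  assumes "primitive f F" "primitive g G" shows "primitive (\<lambda>x. f x + g x) (\<lambda>x. F x + G x)"
  unfolding primitive_def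
proof (intro conjI allI impI)
  show "strongly_measurable half_line (\<lambda>x. f x + g x)"
    using assms by (intro strongly_measurable_add) (auto simp: primitive_def)
  fix a b :: real assume "0 < a" "a \<le> b"
  then have "has_Bochner_integral half_line (\<lambda>x. indicator {a<..b} x *\<^sub>R f x + indicator {a<..b} x *\<^sub>R g x) ((F b - F a) + (G b - G a))"
    using assms by (intro has_Bochner_integral_add) (auto simp: primitive_def)
  then show "has_Bochner_integral half_line (\<lambda>x. indicator {a<..b} x *\<^sub>R (f x + g x)) (F b + G b - (F a + G a))"
    by (simp add: scaleR_add_right algebra_simps)
qed

lemma primitive_linear:
  assumes T: "bounded_linear T" and "primitive f F" shows "primitive (\<lambda>x. T (f x)) (\<lambda>x. T (F x))"
  unfolding primitive_def
proof (intro conjI allI impI)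
  interpret T: bounded_linear T by fact
  show "strongly_measurable half_line (\<lambda>x. T (f x))"
    using assms by (intro strongly_measurable_linear[OF T]) (auto simp: primitive_def)
  fix a b :: real assume "0 < a" "a \<le> b"
  then have "has_Bochner_integral half_line (\<lambda>x. T (indicator {a<..b} x *\<^sub>R f x)) (T (F b - F a))"
    using assms by (intro has_Bochner_integral_linear[OF T]) (auto simp: primitive_def)
  then show "has_Bochner_integral half_line (\<lambda>x. indicator {a<..b} x *\<^sub>R T (f x)) (T (F b) - T (F a))"
    by (simp add: T.scaleR T.diff)
qed

lemmas primitive_scaleC = primitive_linear[OF scaleC.bounded_linear_right]
lemmas primitive_minus = primitive_linear[OF bounded_linear_minus[OF bounded_linear_ident]]

lemma primitive_diff:
  assumes "primitive f F" "primitive g G" shows "primitive (\<lambda>x. f x - g x) (\<lambda>x. F x - G x)"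
  using primitive_add[OF assms(1) primitive_minus[OF assms(2)]] by simp

lemma primitive_cong:
  assumes "primitive f F" "AE x in half_line. f x = g x" "\<And>x. 0 < x \<Longrightarrow> F x = G x"
  shows "primitive g G"
  unfolding primitive_def
proof (intro conjI allI impI)
  show "strongly_measurable half_line g"
    using assms by (auto simp: primitive_def intro: strongly_measurable_cong_AE)
  fix a b :: real assume ab: "0 < a" "a \<le> b"
  then have "has_Bochner_integral half_line (\<lambda>x. indicator {a<..b} x *\<^sub>R f x) (F b - F a)"
    using assms by (auto simp: primitive_def)
  then have "has_Bochner_integral half_line (\<lambda>x. indicator {a<..b} x *\<^sub>R g x) (F b - F a)"
    by (rule has_Bochner_integral_cong_AE) (use assms(2) in eventually_elim, simp)
  then show "has_Bochner_integral half_line (\<lambda>x. indicator {a<..b} x *\<^sub>R g x) (G b - G a)"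
    using assms(3) ab by simp
qed

lemma primitive_zero_const:
  assumes "primitive (\<lambda>x. 0) F" "0 < x" "0 < y" shows "F x = F y"
proof -
  have *: "F b - F a = 0" if "0 < a" "a \<le> b" for a b
  proof -
    have "has_Bochner_integral half_line (\<lambda>x. indicator {a<..b} x *\<^sub>R 0) (F b - F a)"
      using assms(1) that by (simp only: primitive_def)
    then have "has_Bochner_integral half_line (\<lambda>x. 0) (F b - F a)" by simp
    then show ?thesis using has_Bochner_integral_unique has_Bochner_integral_zero by blast
  qed
  show ?thesis using *[of x y] *[of y x] assms by (cases "x \<le> y") auto
qed

lemma primitive_exists:
  assumes f: "locally_integrable f"
  obtains F where "primitive f F"
proof -
  have "\<exists>I. has_Bochner_integral half_line (\<lambda>x. indicator {a<..b} x *\<^sub>R f x) I" if "0 < a" for a b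
    using locally_integrable_integral_exists[OF f that] by blast
  then obtain I where I: "\<And>a b. 0 < a \<Longrightarrow> has_Bochner_integral half_line (\<lambda>x. indicator {a<..b} x *\<^sub>R f x) (I a b)"
    by metis
  \<comment> \<open>At most one of the two integrals is over a nonempty interval.\<close>
  define F where "F x = I 1 x - I x 1" for x
  have "primitive f F" unfolding primitive_def
  proof (intro conjI allI impI)
    show "strongly_measurable half_line f" using f by (simp add: locally_integrable_def)
    fix a b :: real assume ab: "0 < a" "a \<le> b"
    have "has_Bochner_integral half_line (\<lambda>x. (indicator {1<..b} x *\<^sub>R f x - indicator {b<..1} x *\<^sub>R f x)
       - (indicator {1<..a} x *\<^sub>R f x - indicator {a<..1} x *\<^sub>R f x)) (F b - F a)"
      unfolding F_def using ab by (intro has_Bochner_integral_diff I) auto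
    also have "(\<lambda>x. (indicator {1<..b} x *\<^sub>R f x - indicator {b<..1} x *\<^sub>R f x)
       - (indicator {1<..a} x *\<^sub>R f x - indicator {a<..1} x *\<^sub>R f x)) = (\<lambda>x. indicator {a<..b} x *\<^sub>R f x)"
      using ab by (auto simp: indicator_def)
    finally show "has_Bochner_integral half_line (\<lambda>x. indicator {a<..b} x *\<^sub>R f x) (F b - F a)" .
  qed
  then show ?thesis by (rule that)
qed

section \<open>Test functions\<close>

definition smooth :: "(real \<Rightarrow> real) \<Rightarrow> bool" where
  "smooth \<phi> \<longleftrightarrow> (\<forall>n x. (deriv ^^ n) \<phi> field_differentiable at x)"

text \<open>Smoothness is the largest class of functions closed under taking derivatives, so it suffices to
exhibit one such class containing \<open>f\<close>.\<close>

lemma smooth_coinduct: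
  assumes "f \<in> S" and step: "\<And>f. f \<in> S \<Longrightarrow> \<exists>g\<in>S. \<forall>x. (f has_field_derivative g x) (at x)"
  shows "smooth f"
proof -
  have closed: "deriv f \<in> S \<and> (\<forall>x. f field_differentiable at x)" if f: "f \<in> S" for f
  proof -
    obtain g where g: "g \<in> S" "\<forall>x. (f has_field_derivative g x) (at x)" using step[OF f] by blast
    then have "deriv f = g" by (auto simp: DERIV_imp_deriv)
    then show ?thesis using g by (auto simp: field_differentiable_def)
  qed
  have "(deriv ^^ n) f \<in> S" for n
    by (induction n) (use assms(1) closed in auto)
  then show ?thesis using closed by (auto simp: smooth_def)
qed

lemma smooth_DERIV: "smooth f \<Longrightarrow> (f has_field_derivative deriv f x) (at x)"
  unfolding smooth_def by (metis DERIV_deriv_iff_field_differentiable funpow_0)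

lemma smooth_deriv: "smooth f \<Longrightarrow> smooth (deriv f)"
  unfolding smooth_def by (metis comp_apply funpow_Suc_right)

lemma smooth_antiderivative:
  assumes "smooth g" "\<And>x. (f has_field_derivative g x) (at x)" shows "smooth f"
  by (rule smooth_coinduct[of _ "insert f {h. smooth h}"]) (use assms smooth_DERIV smooth_deriv in blast)+

lemma smooth_const: "smooth (\<lambda>x. c)"
  by (rule smooth_coinduct[of _ "{\<lambda>x. c | c. True}"]) (auto intro!: derivative_eq_intros)

lemma smooth_diff:
  assumes "smooth f" "smooth g" shows "smooth (\<lambda>x. f x - g x)"
proof (rule smooth_coinduct)
  show "(\<lambda>x. f x - g x) \<in> {\<lambda>x. f x - g x | f g. smooth f \<and> smooth g}" using assms by blast
  fix h assume "h \<in> {\<lambda>x. f x - g x | f g. smooth f \<and> smooth g}"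
  then obtain f g where h: "h = (\<lambda>x. f x - g x)" "smooth f" "smooth g" by blast
  show "\<exists>g\<in>{\<lambda>x. f x - g x | f g. smooth f \<and> smooth g}. \<forall>x. (h has_field_derivative g x) (at x)"
    by (rule bexI[of _ "\<lambda>x. deriv f x - deriv g x"])
       (use h in \<open>auto intro!: DERIV_diff smooth_DERIV smooth_deriv\<close>)
qed

lemma smooth_affine:
  assumes "smooth f" shows "smooth (\<lambda>x. c * f (m * x + d))"
proof (rule smooth_coinduct)
  let ?S = "{\<lambda>x. c * f (m * x + d) | c f. smooth f}"
  show "(\<lambda>x. c * f (m * x + d)) \<in> ?S" using assms by blast
  fix h assume "h \<in> ?S"
  then obtain c f where h: "h = (\<lambda>x. c * f (m * x + d))" "smooth f" by blast
  have "((\<lambda>x. f (m * x + d)) has_field_derivative deriv f (m * x + d) * m) (at x)" for x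
    by (rule DERIV_chain'[where g=f, OF _ smooth_DERIV[OF h(2)]]) (auto intro!: derivative_eq_intros)
  then have "(h has_field_derivative (c * m) * deriv f (m * x + d)) (at x)" for x
    unfolding h(1) by (auto intro!: derivative_eq_intros)
  moreover have "(\<lambda>x. (c * m) * deriv f (m * x + d)) \<in> ?S" using smooth_deriv[OF h(2)] by blast
  ultimately show "\<exists>g\<in>?S. \<forall>x. (h has_field_derivative g x) (at x)"
    by (intro bexI[of _ "\<lambda>x. (c * m) * deriv f (m * x + d)"]) auto
qed

text \<open>Products themselves are not closed under differentiation; finite sums of products are.\<close>

lemma smooth_mult:
  assumes "smooth f" "smooth g" shows "smooth (\<lambda>x. f x * g x)"
proof (rule smooth_coinduct)
  let ?S = "{\<lambda>x. \<Sum>(f, g)\<leftarrow>l. f x * g x | l :: ((real \<Rightarrow> real) \<times> (real \<Rightarrow> real)) list. \<forall>(f, g)\<in>set l. smooth f \<and> smooth g}"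
  have "(\<lambda>x. f x * g x) = (\<lambda>x. \<Sum>(f, g)\<leftarrow>[(f, g)]. f x * g x)" by simp
  then show "(\<lambda>x. f x * g x) \<in> ?S" using assms by (intro CollectI exI[of _ "[(f, g)]"]) auto
  fix h assume "h \<in> ?S"
  then obtain l :: "((real \<Rightarrow> real) \<times> (real \<Rightarrow> real)) list" where h: "h = (\<lambda>x. \<Sum>(f, g)\<leftarrow>l. f x * g x)" and l: "\<forall>(f, g)\<in>set l. smooth f \<and> smooth g" by blast
  define l' where "l' = concat (map (\<lambda>(f, g). [(deriv f, g), (f, deriv g)]) l)"
  have "((\<lambda>x. \<Sum>(f, g)\<leftarrow>l. f x * g x) has_field_derivative (\<Sum>(f, g)\<leftarrow>concat (map (\<lambda>(f, g). [(deriv f, g), (f, deriv g)]) l). f x * g x)) (at x)" for x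
    using l by (induction l) (auto intro!: derivative_eq_intros smooth_DERIV)
  moreover have "\<forall>(f, g)\<in>set l'. smooth f \<and> smooth g" using l smooth_deriv by (fastforce simp: l'_def)
  ultimately show "\<exists>g\<in>?S. \<forall>x. (h has_field_derivative g x) (at x)"
    unfolding h l'_def[symmetric] by (intro bexI[of _ "\<lambda>x. \<Sum>(f, g)\<leftarrow>l'. f x * g x"]) auto
qed

lemma power_poly_div_exp: "((\<lambda>s::real. s ^ n * poly q s / exp s) \<longlongrightarrow> 0) at_top"
proof (induction q arbitrary: n)
  case (pCons a q)
  have "((\<lambda>s::real. a * (s ^ n / exp s) + s ^ Suc n * poly q s / exp s) \<longlongrightarrow> a * 0 + 0) at_top"
    by (intro tendsto_add tendsto_mult tendsto_const tendsto_power_div_exp_0 pCons.IH)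
  then show ?case by (simp add: algebra_simps add_divide_distrib)
qed simp

text \<open>The flat function \<open>exp (- 1 / t)\<close> with a polynomial in \<open>1 / t\<close> in front, a family that is closed under
differentiation.\<close>

definition flat :: "real poly \<Rightarrow> real \<Rightarrow> real" where
  "flat q t = (if 0 < t then poly q (1 / t) * exp (- (1 / t)) else 0)"

lemma DERIV_eventually_eq:
  assumes "(f has_field_derivative d) (at t)" "eventually (\<lambda>s. f s = g s) (nhds t)"
  shows "(g has_field_derivative d) (at (t::real))"
  using DERIV_cong_ev[OF refl assms(2) refl] assms(1) by simp

lemma flat_DERIV: "(flat q has_field_derivative flat ([:0, 0, 1:] * (q - pderiv q)) t) (at t)"
proof -
  consider "t < 0" | "t = 0" | "0 < t" by linarith
  then show ?thesis
  proof cases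
    case 1
    have "((\<lambda>t. 0) has_field_derivative 0) (at t)" by simp
    moreover have "eventually (\<lambda>s. 0 = flat q s) (nhds t)"
      by (rule eventually_mono[OF eventually_nhds_in_open[of "{..<0}"]]) (use 1 in \<open>auto simp: flat_def\<close>)
    ultimately have "(flat q has_field_derivative 0) (at t)"
      by (rule DERIV_eventually_eq)
    then show ?thesis using 1 by (simp add: flat_def)
  next
    case 2
    have lim: "((\<lambda>h. flat q h / h) \<longlongrightarrow> 0) (at_right 0)"
    proof -
      have "((\<lambda>h. (inverse h) ^ 1 * poly q (inverse h) / exp (inverse h)) \<longlongrightarrow> 0) (at_right 0)"
        by (rule filterlim_compose[OF power_poly_div_exp filterlim_inverse_at_top_right])
      moreover have "eventually (\<lambda>h. (inverse h) ^ 1 * poly q (inverse h) / exp (inverse h) = flat q h / h) (at_right 0)"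
        using eventually_at_right_less[of 0] by eventually_elim (auto simp: flat_def exp_minus field_simps)
      ultimately show ?thesis by (rule Lim_transform_eventually)
    qed
    have "((\<lambda>h. flat q h / h) \<longlongrightarrow> 0) (at_left 0)"
    proof (rule tendsto_eventually)
      show "eventually (\<lambda>h. flat q h / h = 0) (at_left 0)"
        by (rule eventually_mono[OF eventually_at_left_real[of "-1" 0]]) (auto simp: flat_def)
    qed
    with lim have "((\<lambda>h. flat q h / h) \<longlongrightarrow> 0) (at 0)" by (simp add: filterlim_split_at)
    then show ?thesis using 2 by (simp add: DERIV_def flat_def)
  next
    case 3
    have "((\<lambda>t. poly q (1 / t) * exp (- (1 / t))) has_field_derivative
       poly ([:0, 0, 1:] * (q - pderiv q)) (1 / t) * exp (- (1 / t))) (at t)"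
      using 3 by (auto intro!: derivative_eq_intros DERIV_chain'[where g="poly q"] poly_DERIV simp: field_simps power2_eq_square)
    moreover have "eventually (\<lambda>s. poly q (1 / s) * exp (- (1 / s)) = flat q s) (nhds t)"
      by (rule eventually_mono[OF eventually_nhds_in_open[of "{0<..}"]]) (use 3 in \<open>auto simp: flat_def\<close>)
    ultimately have "(flat q has_field_derivative poly ([:0, 0, 1:] * (q - pderiv q)) (1 / t) * exp (- (1 / t))) (at t)"
      by (rule DERIV_eventually_eq)
    then show ?thesis using 3 by (simp add: flat_def)
  qed
qed

lemma smooth_flat: "smooth (flat q)"
  by (rule smooth_coinduct[of _ "range flat"]) (use flat_DERIV in blast)+

lemma test_functions_iff:
  "\<phi> \<in> test_functions \<longleftrightarrow> smooth \<phi> \<and> (\<exists>a b. 0 < a \<and> a \<le> b \<and> (\<forall>x. x \<notin> {a..b} \<longrightarrow> \<phi> x = 0))"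
  by (simp add: test_functions_def smooth_def)

text \<open>A smooth function that is positive exactly on \<open>{a<..<b}\<close> and tends to its indicator function as
\<open>n\<close> grows.\<close>

definition bump :: "real \<Rightarrow> real \<Rightarrow> nat \<Rightarrow> real \<Rightarrow> real" where
  "bump a b n x = flat 1 (real (Suc n) * (x - a)) * flat 1 (real (Suc n) * (b - x))"

lemma bump_test: assumes "0 < a" "a \<le> b" shows "bump a b n \<in> test_functions"
proof -
  have "bump a b n = (\<lambda>x. (1 * flat 1 (real (Suc n) * x + (- real (Suc n) * a))) * (1 * flat 1 (- real (Suc n) * x + real (Suc n) * b)))"
    by (rule ext) (simp add: bump_def algebra_simps)
  then have "smooth (bump a b n)" by (simp only:) (intro smooth_mult smooth_affine smooth_flat)
  moreover have "bump a b n x = 0" if "x \<notin> {a..b}" for x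
    using that by (auto simp: bump_def flat_def zero_less_mult_iff)
  ultimately show ?thesis using assms by (auto simp: test_functions_iff)
qed

lemma bump_bounds: "0 \<le> bump a b n x" "bump a b n x \<le> 1"
proof -
  have f: "0 \<le> flat 1 t" "flat 1 t \<le> 1" for t by (auto simp: flat_def)
  show "0 \<le> bump a b n x" "bump a b n x \<le> 1" unfolding bump_def using f by (auto intro!: mult_le_one)
qed

lemma bump_pos: "a < x \<Longrightarrow> x < b \<Longrightarrow> 0 < bump a b n x"
  by (auto simp: bump_def flat_def zero_less_mult_iff)

lemma bump_outside: "x \<notin> {a<..<b} \<Longrightarrow> bump a b n x = 0"
  by (auto simp: bump_def flat_def zero_less_mult_iff)

lemma bump_tendsto: "(\<lambda>n. bump a b n x) \<longlonglongrightarrow> indicator {a<..<b} x"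
proof (cases "x \<in> {a<..<b}")
  case True
  have flat: "(\<lambda>n. flat 1 (real (Suc n) * d)) \<longlonglongrightarrow> 1" if d: "0 < d" for d
  proof -
    have "(\<lambda>n. exp (- (1 / d * (1 / real (Suc n))))) \<longlonglongrightarrow> exp (- (1 / d * 0))"
      using LIMSEQ_inverse_real_of_nat by (intro tendsto_intros) (simp add: inverse_eq_divide)
    then show ?thesis using d by (simp add: flat_def mult.commute)
  qed
  have "(\<lambda>n. bump a b n x) \<longlonglongrightarrow> 1 * 1" unfolding bump_def using True by (intro tendsto_mult flat) auto
  then show ?thesis using True by simp
qed (simp add: bump_outside)

lemma deriv_zero_outside:
  assumes "\<And>x. x \<notin> {a..b} \<Longrightarrow> \<phi> x = 0" "x \<notin> {a..b}" shows "deriv \<phi> x = (0::real)"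
proof -
  have "eventually (\<lambda>y. \<phi> y = 0) (nhds x)"
    by (rule eventually_mono[OF eventually_nhds_in_open[of "- {a..b}"]]) (use assms in auto)
  then have "deriv \<phi> x = deriv (\<lambda>y. 0) x" by (intro deriv_cong_ev refl)
  then show ?thesis by simp
qed

lemma test_deriv:
  assumes "\<phi> \<in> test_functions" shows "deriv \<phi> \<in> test_functions"
proof -
  obtain a b where ab: "0 < a" "a \<le> b" "\<And>x. x \<notin> {a..b} \<Longrightarrow> \<phi> x = 0" and s: "smooth \<phi>"
    using assms by (auto simp: test_functions_iff)
  have "deriv \<phi> x = 0" if "x \<notin> {a..b}" for x by (rule deriv_zero_outside[OF ab(3) that])
  then show ?thesis using ab smooth_deriv[OF s] unfolding test_functions_iff by blast
qed

lemma test_continuous: "\<phi> \<in> test_functions \<Longrightarrow> continuous_on UNIV \<phi>"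
  by (auto simp: test_functions_iff intro!: continuous_at_imp_continuous_on DERIV_isCont smooth_DERIV)

lemma test_antiderivative:
  assumes \<psi>: "smooth \<psi>" and ab: "\<And>x. x \<notin> {a..b} \<Longrightarrow> \<psi> x = 0"
  obtains \<Psi> where "\<And>x. (\<Psi> has_field_derivative \<psi> x) (at x)" "\<And>x. x \<le> a \<Longrightarrow> \<Psi> x = 0" "\<And>x. b \<le> x \<Longrightarrow> \<Psi> x = \<Psi> b"
proof -
  have "\<exists>F. \<forall>x::real. -\<infinity> < ereal x \<longrightarrow> ereal x < \<infinity> \<longrightarrow> (F has_vector_derivative \<psi> x) (at x)"
    by (rule einterval_antiderivative) (use smooth_DERIV[OF \<psi>] in \<open>auto intro: DERIV_isCont\<close>)
  then obtain F where F: "\<And>x. (F has_field_derivative \<psi> x) (at x)" by (auto simp: has_real_derivative_iff_has_vector_derivative)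
  have left: "F x = F a" if "x \<le> a" for x
  proof (cases "x = a")
    case False
    then have "x < a" using that by simp
    moreover have "continuous_on {x..a} F" using F by (intro continuous_at_imp_continuous_on) (auto intro: DERIV_isCont)
    moreover have "(F has_real_derivative 0) (at y)" if "x < y" "y < a" for y using F[of y] ab[of y] that by simp
    ultimately show ?thesis using DERIV_isconst_end by metis
  qed simp
  have right: "F x = F b" if "b \<le> x" for x
  proof (cases "x = b")
    case False
    then have "b < x" using that by simp
    moreover have "continuous_on {b..x} F" using F by (intro continuous_at_imp_continuous_on) (auto intro: DERIV_isCont)
    moreover have "(F has_real_derivative 0) (at y)" if "b < y" "y < x" for y using F[of y] ab[of y] that by simp
    ultimately show ?thesis using DERIV_isconst_end by metis
  qed simp
  show ?thesis
  proof (rule that[of "\<lambda>x. F x - F a"])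
    show "((\<lambda>x. F x - F a) has_field_derivative \<psi> x) (at x)" for x
      by (auto intro!: derivative_eq_intros F)
    show "F x - F a = 0" if "x \<le> a" for x using left[OF that] by simp
    show "F x - F a = F b - F a" if "b \<le> x" for x using right[OF that] by simp
  qed
qed

section \<open>Weak derivatives and chains of primitives\<close>

text \<open>The hypothesis passes from bump functions to indicators of intervals and, by a Dynkin argument,
of Borel sets, always by dominated convergence. Since \<open>h\<close> is the limit of simple functions, it
takes values, almost everywhere, in the closure of a countable set \<open>D\<close>. If \<open>h\<close> were close to some
\<open>y \<in> D\<close> with \<open>y \<noteq> 0\<close> on a set \<open>A\<close> of positive measure, then the integral over \<open>A\<close> would be close to
\<open>measure A\<close> times \<open>y\<close> and hence not zero.\<close>

lemma fundamental_lemma: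
  fixes h :: "real \<Rightarrow> 'a::banach"
  assumes h: "\<And>\<phi>. \<phi> \<in> test_functions \<Longrightarrow> has_Bochner_integral half_line (\<lambda>x. \<phi> x *\<^sub>R h x) 0"
  shows "AE x in half_line. h x = 0"
proof -
  have "AE x in half_line. x \<in> {a<..<b} \<longrightarrow> h x = 0" if ab: "0 < a" "a < b" for a b
  proof -
    define g where "g x = indicator {a<..<b} x *\<^sub>R h x" for x
    let ?\<psi> = "bump (a/2) (b+1) 0"
    have \<psi>: "?\<psi> \<in> test_functions" using ab by (intro bump_test) auto
    obtain d where d: "0 < d" "\<And>x. x \<in> {a..b} \<Longrightarrow> d \<le> ?\<psi> x"
    proof -
      obtain z where z: "z \<in> {a..b}" "\<And>x. x \<in> {a..b} \<Longrightarrow> ?\<psi> z \<le> ?\<psi> x"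
        using continuous_attains_inf[of "{a..b}" ?\<psi>] continuous_on_subset[OF test_continuous[OF \<psi>]] ab by auto
      then show ?thesis using that[of "?\<psi> z"] bump_pos[of "a/2" z "b+1"] ab by auto
    qed
    have gm: "strongly_measurable half_line g"
    proof -
      have "strongly_measurable half_line (\<lambda>x. inverse (max d (?\<psi> x)) *\<^sub>R (indicator {a<..<b} x *\<^sub>R (?\<psi> x *\<^sub>R h x)))"
        using d test_continuous[OF \<psi>]
        by (intro strongly_measurable_scaleR strongly_measurable_continuous strongly_measurable_indicator_borel
            has_Bochner_integral_strongly_measurable[OF h[OF \<psi>]] continuous_intros) (auto intro: continuous_on_subset)
      also have "(\<lambda>x. inverse (max d (?\<psi> x)) *\<^sub>R (indicator {a<..<b} x *\<^sub>R (?\<psi> x *\<^sub>R h x))) = g"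
      proof
        fix x show "inverse (max d (?\<psi> x)) *\<^sub>R (indicator {a<..<b} x *\<^sub>R (?\<psi> x *\<^sub>R h x)) = g x"
          using d(1) d(2)[of x] by (auto simp: g_def indicator_def max_def)
      qed
      finally show ?thesis .
    qed
    have g_fin: "(\<integral>\<^sup>+x. enorm (g x) \<partial>half_line) < \<infinity>"
    proof -
      have "(\<integral>\<^sup>+x. enorm (g x) \<partial>half_line) \<le> (\<integral>\<^sup>+x. enorm (inverse d *\<^sub>R (?\<psi> x *\<^sub>R h x)) \<partial>half_line)"
      proof (intro nn_integral_mono ennreal_leI)
        fix x
        show "norm (g x) \<le> norm (inverse d *\<^sub>R (?\<psi> x *\<^sub>R h x))"
        proof (cases "x \<in> {a<..<b}")
          case True
          have "norm (h x) = (inverse d * d) * norm (h x)" using d(1) by simp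
          also have "\<dots> \<le> (inverse d * \<bar>?\<psi> x\<bar>) * norm (h x)"
            using d(1) d(2)[of x] True by (intro mult_right_mono mult_left_mono) auto
          finally show ?thesis using True d(1) by (simp add: g_def abs_mult mult.assoc)
        qed (simp add: g_def)
      qed
      also have "\<dots> < \<infinity>" by (rule has_Bochner_integral_finite[OF has_Bochner_integral_scaleR[OF h[OF \<psi>]]])
      finally show ?thesis .
    qed
    obtain r where r[measurable]: "r \<in> borel_measurable half_line" and gr: "AE x in half_line. enorm (g x) = r x"
      using strongly_measurable_norm_rep[OF gm] by blast
    have r_fin: "(\<integral>\<^sup>+x. r x \<partial>half_line) < \<infinity>"
      using g_fin nn_integral_cong_AE[OF gr] by simp
    \<comment> \<open>Dominated convergence: vanishing of the integral is preserved under bounded pointwise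
      limits of the scalar factor.\<close>
    have vanish: "has_Bochner_integral half_line (\<lambda>x. \<xi> x *\<^sub>R g x) 0"
      if \<xi>: "strongly_measurable half_line \<xi>" "\<And>x. \<bar>\<xi> x\<bar> \<le> 1"
        and \<theta>: "\<And>n. has_Bochner_integral half_line (\<lambda>x. \<theta> n x *\<^sub>R g x) 0" "\<And>n x. \<bar>\<theta> n x\<bar> \<le> 1"
        "\<And>n. \<theta> n \<in> borel_measurable half_line" "\<xi> \<in> borel_measurable half_line" "\<And>x. 0 < x \<Longrightarrow> (\<lambda>n. \<theta> n x) \<longlonglongrightarrow> \<xi> x"
      for \<xi> :: "real \<Rightarrow> real" and \<theta> :: "nat \<Rightarrow> real \<Rightarrow> real"
    proof -
      note [measurable] = \<theta>(3,4)
      have sm: "strongly_measurable half_line (\<lambda>x. \<xi> x *\<^sub>R g x)" by (intro strongly_measurable_scaleR \<xi>(1) gm)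
      have "(\<integral>\<^sup>+x. enorm (\<xi> x *\<^sub>R g x) \<partial>half_line) \<le> (\<integral>\<^sup>+x. enorm (g x) \<partial>half_line)"
        using mult_right_mono[OF \<xi>(2) norm_ge_zero] by (intro nn_integral_mono ennreal_leI) simp
      then obtain I where I: "has_Bochner_integral half_line (\<lambda>x. \<xi> x *\<^sub>R g x) I"
        using has_Bochner_integral_exists[OF sm] g_fin by (metis order_le_less_trans)
      have "(\<lambda>n. \<integral>\<^sup>+x. ennreal \<bar>\<xi> x - \<theta> n x\<bar> * r x \<partial>half_line) \<longlonglongrightarrow> (\<integral>\<^sup>+x. 0 \<partial>half_line)"
      proof (rule nn_integral_dominated_convergence)
        show "(\<integral>\<^sup>+x. 2 * r x \<partial>half_line) < \<infinity>"
          using r_fin by (subst nn_integral_cmult) (auto simp: ennreal_mult_less_top)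
        show "AE x in half_line. ennreal \<bar>\<xi> x - \<theta> n x\<bar> * r x \<le> 2 * r x" for n
        proof (intro AE_I2 mult_right_mono)
          fix x have "\<bar>\<xi> x - \<theta> n x\<bar> \<le> 2" using \<xi>(2)[of x] \<theta>(2)[of n x] by linarith
          then have "ennreal \<bar>\<xi> x - \<theta> n x\<bar> \<le> ennreal 2" by (rule ennreal_leI)
          then show "ennreal \<bar>\<xi> x - \<theta> n x\<bar> \<le> 2" by simp
        qed simp
        have rf: "AE x in half_line. r x \<noteq> \<infinity>" using r_fin by (intro nn_integral_noteq_infinite) auto
        show "AE x in half_line. (\<lambda>n. ennreal \<bar>\<xi> x - \<theta> n x\<bar> * r x) \<longlonglongrightarrow> 0"
          using rf AE_space
        proof eventually_elim
          case (elim x)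
          have "(\<lambda>n. \<bar>\<xi> x - \<theta> n x\<bar>) \<longlonglongrightarrow> \<bar>\<xi> x - \<xi> x\<bar>" using elim(2) by (intro tendsto_intros \<theta>(5)) auto
          then have "(\<lambda>n. ennreal \<bar>\<xi> x - \<theta> n x\<bar>) \<longlonglongrightarrow> ennreal 0" by (intro tendsto_ennrealI) simp
          then have "(\<lambda>n. r x * ennreal \<bar>\<xi> x - \<theta> n x\<bar>) \<longlonglongrightarrow> r x * 0"
            using elim by (intro ennreal_tendsto_cmult) (auto simp: less_top)
          then show ?case by (simp add: mult.commute)
        qed
      qed measurable
      moreover have "enorm I \<le> (\<integral>\<^sup>+x. ennreal \<bar>\<xi> x - \<theta> n x\<bar> * r x \<partial>half_line)" for n
      proof -
        have "enorm (I - 0) \<le> (\<integral>\<^sup>+x. enorm (\<xi> x *\<^sub>R g x - \<theta> n x *\<^sub>R g x) \<partial>half_line)"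
          by (intro has_Bochner_integral_norm_le has_Bochner_integral_diff I \<theta>(1))
        also have "\<dots> = (\<integral>\<^sup>+x. ennreal \<bar>\<xi> x - \<theta> n x\<bar> * r x \<partial>half_line)"
          by (rule nn_integral_cong_AE, use gr in eventually_elim)
             (simp flip: scaleR_diff_left add: ennreal_mult)
        finally show ?thesis by simp
      qed
      ultimately have "enorm I \<le> 0" by (intro LIMSEQ_le_const) auto
      then have "I = 0" by (simp add: ennreal_eq_0_iff)
      then show ?thesis using I by simp
    qed
    have intervals: "has_Bochner_integral half_line (\<lambda>x. indicator {u<..<v} x *\<^sub>R g x) 0" for u v
    proof -
      define u' v' where "u' = max u a" "v' = min v b"
      show ?thesis
      proof (cases "u' < v'")
        case True
        have uv: "0 < u'" "u' \<le> v'" using ab True by (auto simp: u'_v'_def)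
        have "has_Bochner_integral half_line (\<lambda>x. indicator {u'<..<v'} x *\<^sub>R g x) 0"
        proof (rule vanish[where \<theta>="bump u' v'"])
          fix n
          have "(\<lambda>x. bump u' v' n x *\<^sub>R g x) = (\<lambda>x. bump u' v' n x *\<^sub>R h x)"
          proof
            fix x show "bump u' v' n x *\<^sub>R g x = bump u' v' n x *\<^sub>R h x"
              using bump_outside[of x u' v' n] by (cases "x \<in> {a<..<b}") (auto simp: g_def u'_v'_def)
          qed
          then show "has_Bochner_integral half_line (\<lambda>x. bump u' v' n x *\<^sub>R g x) 0"
            using h[OF bump_test[OF uv]] by simp
          show "bump u' v' n \<in> borel_measurable half_line"
            by (intro measurable_half_line borel_measurable_continuous_onI test_continuous bump_test uv)
          show "strongly_measurable half_line (indicator {u'<..<v'} :: real \<Rightarrow> real)"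
            by (rule strongly_measurable_indicator_borel) simp
          show "(indicator {u'<..<v'} :: real \<Rightarrow> real) \<in> borel_measurable half_line"
            by (intro measurable_half_line) measurable
          fix x
          show "\<bar>bump u' v' n x\<bar> \<le> 1" using bump_bounds[of u' v' n x] by simp
          show "\<bar>indicator {u'<..<v'} x :: real\<bar> \<le> 1" by (simp add: indicator_def)
          show "(\<lambda>n. bump u' v' n x) \<longlonglongrightarrow> indicator {u'<..<v'} x" by (rule bump_tendsto)
        qed
        also have "(\<lambda>x. indicator {u'<..<v'} x *\<^sub>R g x) = (\<lambda>x. indicator {u<..<v} x *\<^sub>R g x)"
          by (auto simp: g_def indicator_def u'_v'_def)
        finally show ?thesis .
      next
        case False
        have "(\<lambda>x. indicator {u<..<v} x *\<^sub>R g x) = (\<lambda>x. 0)"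
          using False by (auto simp: g_def indicator_def u'_v'_def)
        then show ?thesis by simp
      qed
    qed
    have sets_eq: "sets borel = sigma_sets UNIV (range (\<lambda>(u, v). {u<..<v::real}))"
    proof -
      have eqf: "(\<lambda>(a, b). box a b :: real set) = (\<lambda>(u, v). {u<..<v})"
        by (auto simp: box_real fun_eq_iff)
      have "sets borel = sigma_sets UNIV (range (\<lambda>(a, b). box a b :: real set))"
        unfolding borel_eq_box by (rule sets_measure_of) simp
      also have "\<dots> = sigma_sets UNIV (range (\<lambda>(u, v). {u<..<v::real}))"
        by (rule arg_cong[where f="\<lambda>h. sigma_sets UNIV (range h)", OF eqf])
      finally show ?thesis .
    qed
    have borel: "has_Bochner_integral half_line (\<lambda>x. indicator A x *\<^sub>R g x) 0" if "A \<in> sets borel" for A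
    proof -
      have "A \<in> sigma_sets UNIV (range (\<lambda>(u, v). {u<..<v::real}))"
        using that unfolding sets_eq .
      have stable: "Int_stable (range (\<lambda>(u, v). {u<..<v::real}))"
        by (auto simp: Int_stable_def Int_greaterThanLessThan)
      have sub: "range (\<lambda>(u, v). {u<..<v::real}) \<subseteq> Pow UNIV" by simp
      from stable sub \<open>A \<in> sigma_sets UNIV (range (\<lambda>(u, v). {u<..<v::real}))\<close> show ?thesis
      proof (induction rule: sigma_sets_induct_disjoint)
        case (basic A) then show ?case using intervals by auto
      next
        case empty then show ?case by simp
      next
        case (compl A)
        have "has_Bochner_integral half_line (\<lambda>x. indicator {a<..<b} x *\<^sub>R g x - indicator A x *\<^sub>R g x) (0 - 0)"
          by (intro has_Bochner_integral_diff intervals compl.IH)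
        also have "(\<lambda>x. indicator {a<..<b} x *\<^sub>R g x - indicator A x *\<^sub>R g x) = (\<lambda>x. indicator (UNIV - A) x *\<^sub>R g x)"
          by (auto simp: g_def indicator_def)
        finally show ?case by simp
      next
        case (union A)
        have Ab: "A i \<in> sets borel" for i
          using union.hyps(2) unfolding sets_eq by auto
        have fin: "has_Bochner_integral half_line (\<lambda>x. indicator (\<Union>i<n. A i) x *\<^sub>R g x) 0" for n
        proof (induction n)
          case (Suc n)
          have "has_Bochner_integral half_line (\<lambda>x. indicator (\<Union>i<n. A i) x *\<^sub>R g x + indicator (A n) x *\<^sub>R g x) (0 + 0)"
            by (intro has_Bochner_integral_add Suc union.IH)
          also have "(\<lambda>x. indicator (\<Union>i<n. A i) x *\<^sub>R g x + indicator (A n) x *\<^sub>R g x) = (\<lambda>x. indicator (\<Union>i<Suc n. A i) x *\<^sub>R g x)"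
          proof
            fix x
            have "\<not> (x \<in> A n \<and> x \<in> (\<Union>i<n. A i))"
            proof
              assume "x \<in> A n \<and> x \<in> (\<Union>i<n. A i)"
              then obtain i where "i < n" "x \<in> A i" "x \<in> A n" by blast
              then show False using disjoint_family_onD[OF union.hyps(1), of i n] by auto
            qed
            then show "indicator (\<Union>i<n. A i) x *\<^sub>R g x + indicator (A n) x *\<^sub>R g x = indicator (\<Union>i<Suc n. A i) x *\<^sub>R g x"
              by (auto simp: indicator_def lessThan_Suc)
          qed
          finally show ?case by simp
        qed simp
        show ?case
        proof (rule vanish[where \<theta>="\<lambda>n. indicator (\<Union>i<n. A i)"])
          fix x
          have "eventually (\<lambda>n. indicator (\<Union>i<n. A i) x = (indicator (\<Union>(range A)) x :: real)) sequentially"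
          proof (cases "x \<in> \<Union>(range A)")
            case True
            then obtain i where "x \<in> A i" by blast
            then have "n > i \<Longrightarrow> indicator (\<Union>i<n. A i) x = (indicator (\<Union>(range A)) x :: real)" for n
              by (auto simp: indicator_def)
            then show ?thesis by (rule eventually_mono[OF eventually_gt_at_top[of i]])
          qed (auto simp: indicator_def)
          then show "(\<lambda>n. indicator (\<Union>i<n. A i) x) \<longlonglongrightarrow> (indicator (\<Union>(range A)) x :: real)"
            by (rule tendsto_eventually)
        next
          fix n
          have Un: "(\<Union>i<n. A i) \<in> sets borel" and U: "\<Union>(range A) \<in> sets borel" using Ab by auto
          show "strongly_measurable half_line (indicator (\<Union>(range A)) :: real \<Rightarrow> real)"
            by (rule strongly_measurable_indicator_borel[OF U])
          show "(indicator (\<Union>(range A)) :: real \<Rightarrow> real) \<in> borel_measurable half_line"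
            by (intro measurable_half_line borel_measurable_indicator U)
          show "(indicator (\<Union>i<n. A i) :: real \<Rightarrow> real) \<in> borel_measurable half_line"
            by (intro measurable_half_line borel_measurable_indicator Un)
          fix x
          show "\<bar>indicator (\<Union>i<n. A i) x :: real\<bar> \<le> 1" "\<bar>indicator (\<Union>(range A)) x :: real\<bar> \<le> 1"
            by (simp_all add: indicator_def)
        qed (rule fin)
      qed
    qed
    obtain s where s: "\<And>i. sbi half_line (s i)" and lim: "AE x in half_line. (\<lambda>i::nat. s i x) \<longlonglongrightarrow> g x"
      using gm unfolding strongly_measurable_def by blast
    \<comment> \<open>The nonzero values of the approximating simple functions; their closure contains
      almost every nonzero value of \<open>g\<close>.\<close>
    define D where "D = (\<Union>i. s i ` space half_line) - {0}"
    have "finite (s i ` space half_line)" for i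
    proof -
      have "simple_function half_line (s i)"
        using s[of i] by (auto elim: Bochner_Integration.simple_bochner_integrable.cases)
      then show ?thesis by (rule simple_functionD)
    qed
    then have "countable (\<Union>i. s i ` space half_line)"
      by (intro countable_UN) (auto simp del: space_half_line intro: countable_finite)
    then have D: "countable D" unfolding D_def by (rule countable_Diff)
    have close: "AE x in half_line. x \<in> {a<..<b} \<longrightarrow> \<not> norm (y - g x) \<le> norm y / 2" if y: "y \<in> D" for y
    proof -
      have y0: "y \<noteq> 0" using y by (simp add: D_def)
      have smy: "strongly_measurable half_line (\<lambda>x. indicator {a<..<b} x *\<^sub>R y - g x)"
        by (intro strongly_measurable_diff gm strongly_measurable_linear[OF bounded_linear_scaleR_left] strongly_measurable_indicator_borel) auto
      obtain q where q[measurable]: "q \<in> borel_measurable borel" and yq: "AE x in half_line. enorm (indicator {a<..<b} x *\<^sub>R y - g x) = q x"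
        using strongly_measurable_borel_rep[OF smy] by blast
      define A where "A = {x \<in> {a<..<b}. q x \<le> ennreal (norm y / 2)}"
      have A[measurable]: "A \<in> sets borel" unfolding A_def by measurable
      have Apos: "A \<subseteq> {0<..}" using ab by (auto simp: A_def)
      have Ah: "A \<in> sets half_line" using A Apos by (auto simp: sets_half_line)
      have Af: "emeasure half_line A < \<infinity>" by (rule emeasure_half_line_finite[OF Ah, of b]) (use ab in \<open>auto simp: A_def\<close>)
      have em: "emeasure half_line A = ennreal (measure half_line A)"
        using Af by (intro emeasure_eq_ennreal_measure) simp
      have "has_Bochner_integral half_line (indicator A :: real \<Rightarrow> real) (measure half_line A)"
        by (intro has_Bochner_integral_of_has_bochner_integral has_bochner_integral_real_indicator Ah Af strongly_measurable_indicator)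
      from has_Bochner_integral_diff[OF has_Bochner_integral_linear[OF bounded_linear_scaleR_left this] borel[OF A]]
      have "enorm (measure half_line A *\<^sub>R y - 0) \<le> (\<integral>\<^sup>+x. enorm (indicator A x *\<^sub>R y - indicator A x *\<^sub>R g x) \<partial>half_line)"
        by (rule has_Bochner_integral_norm_le)
      also have "\<dots> \<le> (\<integral>\<^sup>+x. ennreal (norm y / 2) * indicator A x \<partial>half_line)"
        using yq
      proof (intro nn_integral_mono_AE, eventually_elim)
        case (elim x)
        show ?case
        proof (cases "x \<in> A")
          case True
          then have "x \<in> {a<..<b}" "q x \<le> ennreal (norm y / 2)" by (auto simp: A_def)
          then have "enorm (y - g x) \<le> ennreal (norm y / 2)" using elim by simp
          then show ?thesis using True by simp
        qed simp
      qed
      also have "\<dots> = ennreal (norm y / 2) * emeasure half_line A" by (intro nn_integral_cmult_indicator Ah)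
      also have "\<dots> = ennreal (norm y / 2 * measure half_line A)"
        unfolding em by (intro ennreal_mult[symmetric]) auto
      finally have le: "enorm (measure half_line A *\<^sub>R y - 0) \<le> ennreal (norm y / 2 * measure half_line A)" .
      have "norm (measure half_line A *\<^sub>R y - 0) \<le> norm y / 2 * measure half_line A"
        by (rule ennreal_le_iff[THEN iffD1, OF _ le]) simp
      then have "measure half_line A * norm y \<le> norm y / 2 * measure half_line A" by simp
      then have "norm y * measure half_line A \<le> 0" by (simp add: mult.commute)
      moreover have "0 \<le> measure half_line A" by simp
      ultimately have "measure half_line A = 0" using y0 by (metis antisym mult_le_0_iff not_le zero_less_norm_iff)
      then have "emeasure half_line A = 0" unfolding em by simp
      then have "AE x in half_line. x \<notin> A" using Ah by (intro AE_not_in) auto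
      then show ?thesis using yq
      proof eventually_elim
        case (elim x)
        show ?case
        proof (intro impI notI)
          assume x: "x \<in> {a<..<b}" "norm (y - g x) \<le> norm y / 2"
          have "q x \<le> ennreal (norm y / 2)" using x by (simp flip: elim(2) add: ennreal_leI)
          then show False using elim(1) x(1) by (simp add: A_def)
        qed
      qed
    qed
    have "AE x in half_line. \<forall>y\<in>D. x \<in> {a<..<b} \<longrightarrow> \<not> norm (y - g x) \<le> norm y / 2"
      by (subst AE_ball_countable[OF D]) (use close in blast)
    then show ?thesis using lim AE_space
    proof eventually_elim
      case (elim x)
      show ?case
      proof (rule impI, rule ccontr)
        assume x: "x \<in> {a<..<b}" "h x \<noteq> 0"
        then have g0: "g x \<noteq> 0" by (simp add: g_def)
        then obtain i where "dist (s i x) (g x) < norm (g x) / 3"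
          using metric_LIMSEQ_D[OF elim(2), of "norm (g x) / 3"] by auto
        then have i: "norm (s i x - g x) < norm (g x) / 3" by (simp add: dist_norm)
        moreover have "norm (g x) - norm (s i x - g x) \<le> norm (s i x)"
          using norm_triangle_ineq2[of "g x" "g x - s i x"] by (simp add: norm_minus_commute)
        ultimately have "norm (s i x - g x) \<le> norm (s i x) / 2" "s i x \<noteq> 0" using g0 by auto
        then show False using elim(1,3) x(1) by (auto simp: D_def)
      qed
    qed
  qed
  note local = this
  have "AE x in half_line. x \<in> {1 / real (Suc n)<..<real n + 2} \<longrightarrow> h x = 0" for n
  proof (rule local)
    have "1 / real (Suc n) \<le> 1" by simp
    then show "1 / real (Suc n) < real n + 2" by linarith
  qed simp
  then have "AE x in half_line. \<forall>n::nat. x \<in> {1 / real (Suc n)<..<real n + 2} \<longrightarrow> h x = 0"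
    by (subst AE_all_countable) blast
  then show ?thesis using AE_space
  proof eventually_elim
    case (elim x)
    obtain m where m: "1 / real (Suc m) < x" using elim(2) nat_approx_posE by auto
    obtain l where l: "x < real l" using reals_Archimedean2 by blast
    have "1 / real (Suc (max m l)) \<le> 1 / real (Suc m)" by (intro divide_left_mono) auto
    then show ?case using elim(1)[rule_format, of "max m l"] m l by auto
  qed
qed

text \<open>A bump function positive on \<open>{a..b}\<close> is bounded below there, so integrability of its product with \<open>h\<close>
gives integrability of \<open>h\<close> itself.\<close>

lemma test_locally_integrable:
  fixes h :: "real \<Rightarrow> 'a::banach"
  assumes h: "\<And>\<phi>. \<phi> \<in> test_functions \<Longrightarrow> \<exists>I. has_Bochner_integral half_line (\<lambda>x. \<phi> x *\<^sub>R h x) I"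
    and sm: "strongly_measurable half_line h"
  shows "locally_integrable h"
  unfolding locally_integrable_def
proof (intro conjI allI impI sm)
  fix a b :: real assume a: "0 < a"
  show "norm_int h a b < \<infinity>"
  proof (cases "a \<le> b")
    case True
    let ?\<psi> = "bump (a/2) (b+1) 0"
    have \<psi>: "?\<psi> \<in> test_functions" using a True by (intro bump_test) auto
    obtain I where I: "has_Bochner_integral half_line (\<lambda>x. ?\<psi> x *\<^sub>R h x) I" using h[OF \<psi>] by blast
    obtain z where z: "z \<in> {a..b}" "\<And>x. x \<in> {a..b} \<Longrightarrow> ?\<psi> z \<le> ?\<psi> x"
      using continuous_attains_inf[of "{a..b}" ?\<psi>] continuous_on_subset[OF test_continuous[OF \<psi>]] True by auto
    define d where "d = ?\<psi> z"
    have d: "0 < d" "\<And>x. x \<in> {a..b} \<Longrightarrow> d \<le> ?\<psi> x" using z bump_pos[of "a/2" z "b+1"] a by (auto simp: d_def)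
    have "norm_int h a b \<le>
      (\<integral>\<^sup>+x. enorm (inverse d *\<^sub>R (?\<psi> x *\<^sub>R h x)) * indicator {0<..} x \<partial>lborel)"
    proof (rule nn_integral_mono)
      fix x
      show "enorm (h x) * indicator {a<..b} x \<le> enorm (inverse d *\<^sub>R (?\<psi> x *\<^sub>R h x)) * indicator {0<..} x"
      proof (cases "x \<in> {a<..b}")
        case True
        have "norm (h x) = (inverse d * d) * norm (h x)" using d(1) by simp
        also have "\<dots> \<le> (inverse d * \<bar>?\<psi> x\<bar>) * norm (h x)"
          using d(1) d(2)[of x] True by (intro mult_right_mono mult_left_mono) auto
        finally have "norm (h x) \<le> norm (inverse d *\<^sub>R (?\<psi> x *\<^sub>R h x))" using d(1) by (simp add: abs_mult mult.assoc)
        then show ?thesis using True a by (auto intro: ennreal_leI)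
      qed simp
    qed
    also have "\<dots> < \<infinity>"
      using has_Bochner_integral_finite[OF has_Bochner_integral_scaleR[OF I]] unfolding nn_integral_half_line .
    finally show ?thesis .
  qed simp
qed

lemma test_integral_exists:
  fixes h :: "real \<Rightarrow> 'a::banach"
  assumes h: "locally_integrable h" and \<phi>: "\<phi> \<in> test_functions"
  obtains I where "has_Bochner_integral half_line (\<lambda>x. \<phi> x *\<^sub>R h x) I"
proof -
  obtain a b where ab: "0 < a" "a \<le> b" "\<And>x. x \<notin> {a..b} \<Longrightarrow> \<phi> x = 0"
    using \<phi> by (auto simp: test_functions_iff)
  have "compact (\<phi> ` {a..b})" by (intro compact_continuous_image continuous_on_subset[OF test_continuous[OF \<phi>]]) auto
  then obtain K where K: "\<And>x. x \<in> {a..b} \<Longrightarrow> norm (\<phi> x) \<le> K"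
    using compact_imp_bounded bounded_iff by (metis imageI)
  have sm: "strongly_measurable half_line (\<lambda>x. \<phi> x *\<^sub>R h x)"
    using h by (intro strongly_measurable_scaleR[OF strongly_measurable_continuous[OF continuous_on_subset[OF test_continuous[OF \<phi>]]]])
      (auto simp: locally_integrable_def)
  obtain J where J: "has_Bochner_integral half_line (\<lambda>x. indicator {a/2<..b} x *\<^sub>R h x) J"
    using locally_integrable_integral_exists[OF h, of "a/2" b] ab by auto
  have "(\<integral>\<^sup>+x. enorm (\<phi> x *\<^sub>R h x) \<partial>half_line) \<le> (\<integral>\<^sup>+x. enorm (K *\<^sub>R (indicator {a/2<..b} x *\<^sub>R h x)) \<partial>half_line)"
  proof (intro nn_integral_mono ennreal_leI)
    fix x show "norm (\<phi> x *\<^sub>R h x) \<le> norm (K *\<^sub>R (indicator {a/2<..b} x *\<^sub>R h x))"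
    proof (cases "x \<in> {a..b}")
      case True
      then show ?thesis using K[OF True] ab by (auto simp: indicator_def intro!: mult_right_mono)
    qed (simp add: ab)
  qed
  also have "\<dots> < \<infinity>" by (rule has_Bochner_integral_finite[OF has_Bochner_integral_scaleR[OF J]])
  finally show ?thesis using has_Bochner_integral_exists[OF sm] that by blast
qed

lemma scaleC_real: "complex_of_real r *\<^sub>C x = r *\<^sub>R x"
  by (rule scaleC_of_real)

text \<open>The product rule on an interval outside of which \<open>\<phi>\<close> vanishes; the boundary terms are zero.\<close>

lemma primitive_integration_by_parts:
  fixes f F :: "real \<Rightarrow> 'a::complex_banach"
  assumes F: "primitive f F" and \<phi>: "\<phi> \<in> test_functions"
    and I: "has_Bochner_integral half_line (\<lambda>x. deriv \<phi> x *\<^sub>R F x) I"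
  shows "has_Bochner_integral half_line (\<lambda>x. \<phi> x *\<^sub>R f x) (- I)"
proof -
  obtain a b where ab: "0 < a" "a \<le> b" "\<And>x. x \<notin> {a..b} \<Longrightarrow> \<phi> x = 0"
    using \<phi> by (auto simp: test_functions_iff)
  have \<phi>': "deriv \<phi> \<in> test_functions" by (rule test_deriv[OF \<phi>])
  have d: "(\<phi> has_field_derivative deriv \<phi> x) (at x)" for x
    using \<phi> by (auto simp: test_functions_iff intro: smooth_DERIV)
  have out: "x \<notin> {a..b} \<Longrightarrow> deriv \<phi> x = 0" for x by (rule deriv_zero_outside[OF ab(3)])
  have "primitive (\<lambda>x. complex_of_real (\<phi> x) *\<^sub>C f x + complex_of_real (deriv \<phi> x) *\<^sub>C F x) (\<lambda>x. complex_of_real (\<phi> x) *\<^sub>C F x)"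
  proof (rule primitive_product[OF F])
    show "((\<lambda>x. complex_of_real (\<phi> x)) has_vector_derivative complex_of_real (deriv \<phi> x)) (at x)" for x
      using d[of x] by (intro has_vector_derivative_of_real) (simp add: has_real_derivative_iff_has_vector_derivative)
    show "continuous_on {0<..} (\<lambda>x. complex_of_real (deriv \<phi> x))"
      by (intro continuous_intros continuous_on_subset[OF test_continuous[OF \<phi>']]) auto
  qed
  then have "has_Bochner_integral half_line (\<lambda>x. indicator {a/2<..b+1} x *\<^sub>R (\<phi> x *\<^sub>R f x + deriv \<phi> x *\<^sub>R F x))
      (\<phi> (b+1) *\<^sub>R F (b+1) - \<phi> (a/2) *\<^sub>R F (a/2))"
    using ab unfolding primitive_def scaleC_real by (elim conjE allE[of _ "a/2"] allE[of _ "b+1"]) auto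
  also have "(\<lambda>x. indicator {a/2<..b+1} x *\<^sub>R (\<phi> x *\<^sub>R f x + deriv \<phi> x *\<^sub>R F x)) = (\<lambda>x. \<phi> x *\<^sub>R f x + deriv \<phi> x *\<^sub>R F x)"
  proof
    fix x show "indicator {a/2<..b+1} x *\<^sub>R (\<phi> x *\<^sub>R f x + deriv \<phi> x *\<^sub>R F x) = \<phi> x *\<^sub>R f x + deriv \<phi> x *\<^sub>R F x"
      using ab out by (cases "x \<in> {a..b}") (auto simp: indicator_def)
  qed
  also have "\<phi> (b+1) *\<^sub>R F (b+1) - \<phi> (a/2) *\<^sub>R F (a/2) = 0" using ab by simp
  finally have "has_Bochner_integral half_line (\<lambda>x. (\<phi> x *\<^sub>R f x + deriv \<phi> x *\<^sub>R F x) - deriv \<phi> x *\<^sub>R F x) (0 - I)"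
    by (intro has_Bochner_integral_diff I)
  then show ?thesis by simp
qed

text \<open>Every test function \<open>\<psi>\<close> becomes the derivative of a test function after subtracting a multiple of a
fixed bump that makes its mean zero. Hence the integral of \<open>\<psi> h\<close> is that of \<open>\<psi>\<close> times the vector
\<open>c\<close>, which is the normalised integral of \<open>h\<close> against that bump.\<close>

lemma has_Bochner_integral_zero_mean:
  fixes h :: "real \<Rightarrow> 'a::complex_banach"
  assumes h: "locally_integrable h"
    and 0: "\<And>\<phi>. \<phi> \<in> test_functions \<Longrightarrow> has_Bochner_integral half_line (\<lambda>x. deriv \<phi> x *\<^sub>R h x) 0"
  obtains c where "AE x in half_line. h x = c"
proof -
  let ?\<eta> = "bump 1 2 0"
  have \<eta>: "?\<eta> \<in> test_functions" "smooth ?\<eta>" using bump_test[of 1 2 0] by (auto simp: test_functions_iff)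
  obtain E where E: "\<And>x. (E has_field_derivative ?\<eta> x) (at x)" "\<And>x. x \<le> 1 \<Longrightarrow> E x = 0" "\<And>x. 2 \<le> x \<Longrightarrow> E x = E 2"
    by (rule test_antiderivative[OF \<eta>(2), of 1 2]) (auto simp: bump_outside)
  have "E 1 < E 2"
  proof (rule DERIV_pos_imp_increasing_open[of 1 2 E])
    show "continuous_on {1..2} E" using E(1) by (intro continuous_at_imp_continuous_on) (auto intro: DERIV_isCont)
    show "\<exists>y. (E has_real_derivative y) (at x) \<and> 0 < y" if "1 < x" "x < 2" for x
      using E(1) bump_pos[OF that] by blast
  qed simp
  then have E2: "E 2 \<noteq> 0" using E(2)[of 1] by simp
  obtain c1 where c1: "has_Bochner_integral half_line (\<lambda>x. ?\<eta> x *\<^sub>R h x) c1" using test_integral_exists[OF h \<eta>(1)] by blast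
  define c where "c = inverse (E 2) *\<^sub>R c1"
  have "AE x in half_line. h x - c = 0"
  proof (rule fundamental_lemma)
    fix \<psi> assume \<psi>: "\<psi> \<in> test_functions"
    then obtain a b where ab: "0 < a" "a \<le> b" "\<And>x. x \<notin> {a..b} \<Longrightarrow> \<psi> x = 0" and s: "smooth \<psi>"
      by (auto simp: test_functions_iff)
    obtain P where P: "\<And>x. (P has_field_derivative \<psi> x) (at x)" "\<And>x. x \<le> a \<Longrightarrow> P x = 0" "\<And>x. b \<le> x \<Longrightarrow> P x = P b"
      by (rule test_antiderivative[OF s ab(3)]) (assumption, rule that)
    \<comment> \<open>With this factor the primitive of \<open>\<psi> - k * bump 1 2 0\<close> has compact
      support.\<close>
    define k where "k = P b / E 2"
    define \<phi> where "\<phi> x = P x - k * E x" for x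
    have d\<phi>: "(\<phi> has_field_derivative \<psi> x - k * ?\<eta> x) (at x)" for x
      unfolding \<phi>_def by (auto intro!: derivative_eq_intros P E)
    have sd: "smooth (\<lambda>x. \<psi> x - k * ?\<eta> x)" by (intro smooth_diff smooth_mult smooth_const s \<eta>)
    have out: "\<phi> x = 0" if x: "x \<notin> {min a 1..max b 2}" for x
    proof -
      consider "x \<le> a" "x \<le> 1" | "b \<le> x" "2 \<le> x" using x by (auto simp: not_le)
      then show "\<phi> x = 0"
      proof cases
        case 1 then show ?thesis by (simp add: \<phi>_def P(2) E(2))
      next
        case 2
        then have "P x = P b" "E x = E 2" using P(3) E(3) by blast+
        then show ?thesis using E2 by (simp add: \<phi>_def k_def)
      qed
    qed
    have "smooth \<phi>" by (rule smooth_antiderivative[OF sd d\<phi>])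
    moreover have "0 < min a 1" "min a 1 \<le> max b 2" using ab by auto
    ultimately have "\<phi> \<in> test_functions" unfolding test_functions_iff using out by blast
    from 0[OF this] have 1: "has_Bochner_integral half_line (\<lambda>x. (\<psi> x - k * ?\<eta> x) *\<^sub>R h x) 0"
      using DERIV_imp_deriv[OF d\<phi>] by simp
    have 2: "has_Bochner_integral half_line (\<lambda>x. (\<psi> x - k * ?\<eta> x) *\<^sub>R h x + k *\<^sub>R (?\<eta> x *\<^sub>R h x)) (0 + k *\<^sub>R c1)"
      by (intro has_Bochner_integral_add 1 has_Bochner_integral_scaleR c1)
    \<comment> \<open>The Bochner integral of \<open>\<psi>\<close> times a vector is \<open>P b\<close>
      times that vector.\<close>
    have "((\<lambda>x. complex_of_real (P x)) has_vector_derivative complex_of_real (\<psi> x)) (at x)" for x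
      using P(1)[of x] by (intro has_vector_derivative_of_real) (simp add: has_real_derivative_iff_has_vector_derivative)
    then have "has_Bochner_integral half_line (\<lambda>x. indicator {a/2<..b} x *\<^sub>R complex_of_real (\<psi> x)) (complex_of_real (P b) - complex_of_real (P (a/2)))"
      using ab by (intro has_Bochner_integral_FTC) (auto intro!: continuous_intros continuous_on_subset[OF test_continuous[OF \<psi>]])
    also have "(\<lambda>x. indicator {a/2<..b} x *\<^sub>R complex_of_real (\<psi> x)) = (\<lambda>x. complex_of_real (\<psi> x))"
    proof
      fix x show "indicator {a/2<..b} x *\<^sub>R complex_of_real (\<psi> x) = complex_of_real (\<psi> x)"
        using ab by (cases "x \<in> {a..b}") (auto simp: indicator_def)
    qed
    finally have "has_Bochner_integral half_line (\<lambda>x. complex_of_real (\<psi> x)) (complex_of_real (P b))"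
      using P(2)[of "a/2"] ab by simp
    from has_Bochner_integral_linear[OF scaleC.bounded_linear_left[of c] this]
    have 3: "has_Bochner_integral half_line (\<lambda>x. \<psi> x *\<^sub>R c) (P b *\<^sub>R c)" by (simp add: scaleC_real)
    have "has_Bochner_integral half_line (\<lambda>x. \<psi> x *\<^sub>R h x - \<psi> x *\<^sub>R c) (k *\<^sub>R c1 - P b *\<^sub>R c)"
      using has_Bochner_integral_diff[OF 2 3] by (simp add: scaleR_diff_left)
    then show "has_Bochner_integral half_line (\<lambda>x. \<psi> x *\<^sub>R (h x - c)) 0"
      by (simp add: scaleR_diff_right k_def c_def divide_inverse)
  qed
  then show ?thesis using that by simp
qed

text \<open>A primitive \<open>G\<close> of \<open>g\<close> has the weak derivative \<open>g\<close> as well, so \<open>u - G\<close> has weak derivative zero.\<close>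

lemma du_Bois_Reymond:
  fixes u g :: "real \<Rightarrow> 'a::complex_banach"
  assumes w: "has_weak_deriv 1 u g" and u: "locally_integrable u" and g: "locally_integrable g"
  obtains U where "primitive g U" "AE x in half_line. u x = U x"
proof -
  obtain G where G: "primitive g G" using primitive_exists[OF g] by blast
  have lG: "locally_integrable G" by (intro continuous_locally_integrable primitive_continuous[OF G])
  have l: "locally_integrable (\<lambda>x. u x - G x)"
    using locally_integrable_add[OF u locally_integrable_scaleC[OF continuous_on_const lG, of "-1"]] by simp
  obtain c where c: "AE x in half_line. u x - G x = c"
  proof (rule has_Bochner_integral_zero_mean[OF l])
    fix \<phi> assume \<phi>: "\<phi> \<in> test_functions"
    obtain I where I: "has_Bochner_integral half_line (\<lambda>x. deriv \<phi> x *\<^sub>R u x) I"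
      "has_Bochner_integral half_line (\<lambda>x. \<phi> x *\<^sub>R g x) (- I)"
      using w \<phi> unfolding has_weak_deriv_def by fastforce
    obtain J where J: "has_Bochner_integral half_line (\<lambda>x. deriv \<phi> x *\<^sub>R G x) J"
      using test_integral_exists[OF lG test_deriv[OF \<phi>]] by blast
    have "- I = - J"
      using has_Bochner_integral_unique[OF I(2) primitive_integration_by_parts[OF G \<phi> J]] .
    then have "I - J = 0" by simp
    then show "has_Bochner_integral half_line (\<lambda>x. deriv \<phi> x *\<^sub>R (u x - G x)) 0"
      using has_Bochner_integral_diff[OF I(1) J] by (simp add: scaleR_diff_right)
  qed (rule that)
  have "primitive (\<lambda>x. g x + 0) (\<lambda>x. G x + c)"
    by (rule primitive_add[OF G]) (auto simp: primitive_def intro: has_Bochner_integral_strongly_measurable[OF has_Bochner_integral_zero])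
  then have "primitive g (\<lambda>x. G x + c)" by simp
  moreover have "AE x in half_line. u x = G x + c" using c by eventually_elim (auto simp: algebra_simps)
  ultimately show ?thesis by (rule that)
qed

lemma has_weak_deriv_unique:
  fixes u g h :: "real \<Rightarrow> 'a::banach"
  assumes "has_weak_deriv j u g" "has_weak_deriv j u h"
  shows "AE x in half_line. g x = h x"
proof -
  have "AE x in half_line. g x - h x = 0"
  proof (rule fundamental_lemma)
    fix \<phi> assume \<phi>: "\<phi> \<in> test_functions"
    obtain I where I: "has_Bochner_integral half_line (\<lambda>x. (deriv ^^ j) \<phi> x *\<^sub>R u x) I"
      "has_Bochner_integral half_line (\<lambda>x. \<phi> x *\<^sub>R g x) ((-1) ^ j *\<^sub>R I)"
      using assms(1) \<phi> unfolding has_weak_deriv_def by blast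
    obtain J where J: "has_Bochner_integral half_line (\<lambda>x. (deriv ^^ j) \<phi> x *\<^sub>R u x) J"
      "has_Bochner_integral half_line (\<lambda>x. \<phi> x *\<^sub>R h x) ((-1) ^ j *\<^sub>R J)"
      using assms(2) \<phi> unfolding has_weak_deriv_def by blast
    have "I = J" by (rule has_Bochner_integral_unique[OF I(1) J(1)])
    then show "has_Bochner_integral half_line (\<lambda>x. \<phi> x *\<^sub>R (g x - h x)) 0"
      using has_Bochner_integral_diff[OF I(2) J(2)] by (simp add: scaleR_diff_right)
  qed
  then show ?thesis by simp
qed

lemma has_weak_deriv_cong:
  assumes "has_weak_deriv j u g" "AE x in half_line. u x = u' x" "AE x in half_line. g x = g' x"
  shows "has_weak_deriv j u' g'"
  unfolding has_weak_deriv_def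
proof
  fix \<phi> assume "\<phi> \<in> test_functions"
  then obtain I where I: "has_Bochner_integral half_line (\<lambda>x. (deriv ^^ j) \<phi> x *\<^sub>R u x) I"
      "has_Bochner_integral half_line (\<lambda>x. \<phi> x *\<^sub>R g x) ((-1) ^ j *\<^sub>R I)"
    using assms(1) unfolding has_weak_deriv_def by blast
  have "has_Bochner_integral half_line (\<lambda>x. (deriv ^^ j) \<phi> x *\<^sub>R u' x) I"
    by (rule has_Bochner_integral_cong_AE[OF I(1)]) (use assms(2) in eventually_elim, simp)
  moreover have "has_Bochner_integral half_line (\<lambda>x. \<phi> x *\<^sub>R g' x) ((-1) ^ j *\<^sub>R I)"
    by (rule has_Bochner_integral_cong_AE[OF I(2)]) (use assms(3) in eventually_elim, simp)
  ultimately show "\<exists>I. has_Bochner_integral half_line (\<lambda>x. (deriv ^^ j) \<phi> x *\<^sub>R u' x) I \<and>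
     has_Bochner_integral half_line (\<lambda>x. \<phi> x *\<^sub>R g' x) ((-1) ^ j *\<^sub>R I)" by blast
qed

lemma has_weak_deriv_0:
  assumes "locally_integrable u" shows "has_weak_deriv 0 u u"
  unfolding has_weak_deriv_def
proof
  fix \<phi> assume "\<phi> \<in> test_functions"
  then obtain I where "has_Bochner_integral half_line (\<lambda>x. \<phi> x *\<^sub>R u x) I"
    using test_integral_exists[OF assms] by blast
  then show "\<exists>I. has_Bochner_integral half_line (\<lambda>x. (deriv ^^ 0) \<phi> x *\<^sub>R u x) I \<and>
     has_Bochner_integral half_line (\<lambda>x. \<phi> x *\<^sub>R u x) ((-1) ^ 0 *\<^sub>R I)"
    by (intro exI[of _ I]) simp
qed

text \<open>Classical form of a function with \<open>m\<close> weak derivatives: \<open>U i\<close> is the representative of the \<open>i\<close>-th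
derivative.\<close>

definition primitive_chain :: "nat \<Rightarrow> (nat \<Rightarrow> real \<Rightarrow> 'a::banach) \<Rightarrow> bool" where
  "primitive_chain m U \<longleftrightarrow> locally_integrable (U m) \<and> (\<forall>i<m. primitive (U (Suc i)) (U i))"

lemma primitive_chain_locally_integrable:
  assumes "primitive_chain m U" "i \<le> m" shows "locally_integrable (U i)"
proof (cases "i = m")
  case False
  then have "primitive (U (Suc i)) (U i)" using assms by (simp add: primitive_chain_def)
  then show ?thesis by (intro continuous_locally_integrable primitive_continuous)
qed (use assms in \<open>simp add: primitive_chain_def\<close>)

lemma primitive_chain_weak_deriv:
  fixes U :: "nat \<Rightarrow> real \<Rightarrow> 'a::complex_banach"
  assumes U: "primitive_chain m U" and "i + j \<le> m"
  shows "has_weak_deriv i (U j) (U (i + j))"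
  using assms(2)
proof (induction i)
  case 0
  have "locally_integrable (U j)" using primitive_chain_locally_integrable[OF U] 0 by simp
  then show ?case by (simp add: has_weak_deriv_0)
next
  case (Suc i)
  have w: "has_weak_deriv i (U j) (U (i + j))" using Suc by simp
  have P: "primitive (U (Suc (i + j))) (U (i + j))" using U Suc.prems by (simp add: primitive_chain_def)
  show ?case unfolding has_weak_deriv_def
  proof
    fix \<phi> assume \<phi>: "\<phi> \<in> test_functions"
    obtain I where I: "has_Bochner_integral half_line (\<lambda>x. (deriv ^^ i) (deriv \<phi>) x *\<^sub>R U j x) I"
      "has_Bochner_integral half_line (\<lambda>x. deriv \<phi> x *\<^sub>R U (i + j) x) ((-1) ^ i *\<^sub>R I)"
      using w test_deriv[OF \<phi>] unfolding has_weak_deriv_def by blast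
    have "has_Bochner_integral half_line (\<lambda>x. \<phi> x *\<^sub>R U (Suc i + j) x) ((-1) ^ Suc i *\<^sub>R I)"
      using primitive_integration_by_parts[OF P \<phi> I(2)] by simp
    moreover have "(deriv ^^ Suc i) \<phi> = (deriv ^^ i) (deriv \<phi>)" by (simp add: funpow_swap1)
    ultimately show "\<exists>I. has_Bochner_integral half_line (\<lambda>x. (deriv ^^ Suc i) \<phi> x *\<^sub>R U j x) I \<and>
       has_Bochner_integral half_line (\<lambda>x. \<phi> x *\<^sub>R U (Suc i + j) x) ((-1) ^ Suc i *\<^sub>R I)"
      using I(1) by auto
  qed
qed

text \<open>The derivative of a test function is again a test function.\<close>

lemma weak_deriv_shift:
  assumes "has_weak_deriv j u g" "has_weak_deriv (Suc j) u h" shows "has_weak_deriv 1 g h"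
  unfolding has_weak_deriv_def
proof
  fix \<phi> assume \<phi>: "\<phi> \<in> test_functions"
  obtain I where I: "has_Bochner_integral half_line (\<lambda>x. (deriv ^^ j) (deriv \<phi>) x *\<^sub>R u x) I"
    "has_Bochner_integral half_line (\<lambda>x. deriv \<phi> x *\<^sub>R g x) ((-1) ^ j *\<^sub>R I)"
    using assms(1) test_deriv[OF \<phi>] unfolding has_weak_deriv_def by blast
  obtain J where J: "has_Bochner_integral half_line (\<lambda>x. (deriv ^^ Suc j) \<phi> x *\<^sub>R u x) J"
    "has_Bochner_integral half_line (\<lambda>x. \<phi> x *\<^sub>R h x) ((-1) ^ Suc j *\<^sub>R J)"
    using assms(2) \<phi> unfolding has_weak_deriv_def by blast
  have "(deriv ^^ Suc j) \<phi> = (deriv ^^ j) (deriv \<phi>)" by (simp add: funpow_swap1)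
  then have "I = J" using has_Bochner_integral_unique[OF I(1)] J(1) by simp
  then show "\<exists>I. has_Bochner_integral half_line (\<lambda>x. (deriv ^^ 1) \<phi> x *\<^sub>R g x) I \<and>
     has_Bochner_integral half_line (\<lambda>x. \<phi> x *\<^sub>R h x) ((-1) ^ 1 *\<^sub>R I)"
    using I(2) J(2) by (intro exI[of _ "(-1) ^ j *\<^sub>R I"]) auto
qed

section \<open>Power-weighted Lebesgue and Sobolev norms\<close>

lemma measurable_weight: "(\<lambda>x. ennreal (\<bar>x\<bar> powr a)) \<in> borel_measurable half_line"
  by (intro measurable_half_line) measurable

lemma AE_weighted: "(AE x in weighted a. P x) \<longleftrightarrow> (AE x in half_line. P x)"
  unfolding weighted_def AE_density[OF measurable_weight] AE_half_line
  by (intro arg_cong2[where f=eventually] refl) (auto intro!: ext)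

text \<open>The measures have the same null sets, but a simple function may be supported on a set that is
finite for one and infinite for the other. Cutting the \<open>i\<close>-th function to \<open>{1 / (i + 1)<..i}\<close>, where
every power weight is bounded, repairs this.\<close>

lemma strongly_measurable_weighted_transfer:
  assumes s: "strongly_measurable (weighted b) f" and ab: "a = 0 \<or> b = 0"
  shows "strongly_measurable (weighted a) f"
proof -
  obtain s where s: "\<And>i. sbi (weighted b) (s i)" and lim: "AE x in weighted b. (\<lambda>i::nat. s i x) \<longlonglongrightarrow> f x"
    using s unfolding strongly_measurable_def by blast
  have sp: "space (weighted c) = {0<..}" "sets (weighted c) = sets half_line" for c by (auto simp: weighted_def)
  define J where "J i = {1 / real (Suc i)<..real i}" for i :: nat
  define t where "t i x = (if x \<in> J i then s i x else 0)" for i x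
  have half: "{0<..} \<in> sets half_line" by (simp add: sets_half_line)
  have J: "J i \<in> sets half_line" for i
    by (auto simp: J_def sets_half_line intro: order.strict_trans[rotated])
  have "sbi (weighted a) (t i)" for i
  proof (rule Bochner_Integration.simple_bochner_integrable.intros)
    have "simple_function (weighted b) (s i)" using s[of i] by (auto elim: Bochner_Integration.simple_bochner_integrable.cases)
    then have "simple_function (weighted a) (s i)" by (simp add: simple_function_def sp)
    then show sf: "simple_function (weighted a) (t i)" unfolding t_def
      by (intro simple_function_If_set) (auto simp: sp intro: sets.Int[OF J] half)
    have Jf: "emeasure (weighted a) (J i) < \<infinity>"
    proof -
      have "emeasure (weighted a) (J i) = (\<integral>\<^sup>+x. ennreal (\<bar>x\<bar> powr a) * indicator (J i) x \<partial>half_line)"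
        unfolding weighted_def by (intro emeasure_density measurable_weight J)
      also have "\<dots> \<le> (\<integral>\<^sup>+x. ennreal (max (real i powr a) ((1 / real (Suc i)) powr a)) * indicator (J i) x \<partial>half_line)"
      proof (intro nn_integral_mono)
        fix x
        have "\<bar>x\<bar> powr a \<le> max (real i powr a) ((1 / real (Suc i)) powr a)" if "x \<in> J i"
        proof (cases "0 \<le> a")
          case True
          have "0 < x" using that by (auto simp: J_def intro: order.strict_trans[rotated])
          then have "\<bar>x\<bar> powr a \<le> real i powr a" using that True by (intro powr_mono2) (auto simp: J_def)
          then show ?thesis by simp
        next
          case False
          have "0 < x" using that by (auto simp: J_def intro: order.strict_trans[rotated])
          then have "\<bar>x\<bar> powr a \<le> (1 / real (Suc i)) powr a" using that False by (intro powr_mono2') (auto simp: J_def)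
          then show ?thesis by simp
        qed
        then show "ennreal (\<bar>x\<bar> powr a) * indicator (J i) x \<le> ennreal (max (real i powr a) ((1 / real (Suc i)) powr a)) * indicator (J i) x"
          by (auto simp: indicator_def intro: ennreal_leI)
      qed
      also have "\<dots> = ennreal (max (real i powr a) ((1 / real (Suc i)) powr a)) * emeasure half_line (J i)"
        by (intro nn_integral_cmult_indicator J)
      also have "\<dots> < \<infinity>"
      proof -
        have "J i \<subseteq> {0..real i}"
        proof
          fix x assume "x \<in> J i"
          then have "1 / real (Suc i) < x" "x \<le> real i" by (auto simp only: J_def greaterThanAtMost_iff)
          moreover have "0 \<le> 1 / real (Suc i)" by simp
          ultimately have "0 \<le> x" "x \<le> real i" by linarith+
          then show "x \<in> {0..real i}" by simp
        qed
        then show ?thesis using emeasure_half_line_finite[OF J, of i "real i"] by (simp add: ennreal_mult_less_top)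
      qed
      finally show ?thesis .
    qed
    have "emeasure (weighted a) {y \<in> space (weighted a). t i y \<noteq> 0} \<le> emeasure (weighted a) (J i)"
      by (intro emeasure_mono) (auto simp: t_def sp J)
    then show "emeasure (weighted a) {y \<in> space (weighted a). t i y \<noteq> 0} \<noteq> \<infinity>"
      using Jf by (auto simp: top_unique)
  qed
  moreover have "AE x in weighted a. (\<lambda>i. t i x) \<longlonglongrightarrow> f x"
    using lim unfolding AE_weighted using AE_space
  proof eventually_elim
    case (elim x)
    obtain m where m: "1 / real (Suc m) < x" using elim(2) nat_approx_posE by auto
    have "eventually (\<lambda>i. s i x = t i x) sequentially"
      using eventually_le_real[of x] eventually_ge_at_top[of m]
    proof eventually_elim
      case (elim i)
      have "1 / real (Suc i) \<le> 1 / real (Suc m)" using elim by (intro divide_left_mono) auto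
      then show ?case using m elim by (simp add: t_def J_def)
    qed
    with elim(1) show ?case by (rule Lim_transform_eventually)
  qed
  ultimately show ?thesis unfolding strongly_measurable_def by blast
qed

lemma strongly_measurable_weighted_0: "strongly_measurable (weighted 0) f = strongly_measurable half_line f"
proof -
  have "weighted 0 = density half_line (\<lambda>x. 1)"
    unfolding weighted_def
    by (rule density_cong) (auto simp: AE_half_line intro!: measurable_half_line)
  then show ?thesis by (simp add: density_1)
qed

lemma strongly_measurable_weighted: "strongly_measurable (weighted a) f \<longleftrightarrow> strongly_measurable half_line f"
  using strongly_measurable_weighted_transfer[of a f 0] strongly_measurable_weighted_transfer[of 0 f a]
  by (auto simp: strongly_measurable_weighted_0)

lemma wint_cong_AE: "AE x in half_line. f x = g x \<Longrightarrow> wint p a f = wint p a g"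
  unfolding wint_def AE_half_line
  by (rule nn_integral_cong_AE, erule eventually_mono) (auto simp: indicator_def)

definition lp_int :: "real \<Rightarrow> real \<Rightarrow> (real \<Rightarrow> 'a::banach) \<Rightarrow> ennreal" where
  "lp_int p a f = wint p a (\<lambda>x. enorm (f x))"

lemma lp_int_cong: "AE x in half_line. f x = g x \<Longrightarrow> lp_int p a f = lp_int p a g"
  unfolding lp_int_def by (rule wint_cong_AE) auto

lemma lp_int_borel_rep:
  assumes "strongly_measurable half_line f"
  obtains g where "g \<in> borel_measurable borel" "AE x in half_line. enorm (f x) = g x"
    "\<And>p a. lp_int p a f = wint p a g"
  using strongly_measurable_borel_rep[OF assms] wint_cong_AE unfolding lp_int_def by metis

lemma nn_integral_weighted:
  assumes "strongly_measurable half_line f"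
  shows "(\<integral>\<^sup>+x. ennreal (norm (f x) powr p) \<partial>weighted a) = lp_int p a f"
proof -
  obtain g where g[measurable]: "g \<in> borel_measurable borel" and fg: "AE x in half_line. enorm (f x) = g x"
    and eq: "\<And>p a. lp_int p a f = wint p a g" using lp_int_borel_rep[OF assms] by blast
  have "(\<integral>\<^sup>+x. ennreal (norm (f x) powr p) \<partial>weighted a) = (\<integral>\<^sup>+x. epow (g x) p \<partial>weighted a)"
    by (rule nn_integral_cong_AE) (use fg[folded AE_weighted[where a=a]] in eventually_elim, simp flip: epow_ennreal)
  also have "\<dots> = (\<integral>\<^sup>+x. ennreal (\<bar>x\<bar> powr a) * epow (g x) p \<partial>half_line)"
    unfolding weighted_def by (intro nn_integral_density measurable_weight measurable_half_line) measurable
  also have "\<dots> = wint p a g" unfolding wint_def nn_integral_half_line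
    by (intro nn_integral_cong) (auto simp: indicator_def mult_ac)
  finally show ?thesis by (simp add: eq)
qed

lemma Lp_iff: "f \<in> Lp (weighted a) p \<longleftrightarrow> strongly_measurable half_line f \<and> lp_int p a f < \<infinity>"
  using nn_integral_weighted[where f=f and p=p and a=a] by (auto simp: Lp_def strongly_measurable_weighted)

lemma Lp_norm_eq: "strongly_measurable half_line f \<Longrightarrow> Lp_norm (weighted a) p f = enn2real (lp_int p a f) powr (1 / p)"
  by (simp add: Lp_norm_def nn_integral_weighted)

text \<open>The du Bois-Reymond lemma applied to consecutive weak derivatives, each but the last
being replaced by its continuous representative.\<close>

lemma sobolev_chain:
  fixes f :: "real \<Rightarrow> 'a::complex_banach"
  assumes f: "f \<in> sobolev k p a"
  obtains F where "primitive_chain k F" "AE x in half_line. f x = F 0 x"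
    "\<And>i. i \<le> k \<Longrightarrow> F i \<in> Lp (weighted a) p" "\<And>i. i \<le> k \<Longrightarrow> has_weak_deriv i f (F i)"
proof -
  have "\<forall>j. \<exists>g. j \<le> k \<longrightarrow> g \<in> Lp (weighted a) p \<and> has_weak_deriv j f g"
    using f by (auto simp: sobolev_def)
  then obtain g where g: "\<And>j. j \<le> k \<Longrightarrow> g j \<in> Lp (weighted a) p" "\<And>j. j \<le> k \<Longrightarrow> has_weak_deriv j f (g j)"
    by metis
  have lg: "locally_integrable (g j)" if "j \<le> k" for j
    using g[OF that] by (intro test_locally_integrable) (auto simp: Lp_iff has_weak_deriv_def)
  have "\<exists>U. (AE x in half_line. g j x = U x) \<and> (j < k \<longrightarrow> primitive (g (Suc j)) U)" if "j \<le> k" for j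
  proof (cases "j < k")
    case True
    obtain U where "primitive (g (Suc j)) U" "AE x in half_line. g j x = U x"
      by (rule du_Bois_Reymond[OF weak_deriv_shift[OF g(2) g(2)] lg lg, of j]) (use True that in auto)
    then show ?thesis by blast
  qed auto
  then have "\<forall>j. \<exists>U. j \<le> k \<longrightarrow> (AE x in half_line. g j x = U x) \<and> (j < k \<longrightarrow> primitive (g (Suc j)) U)"
    by blast
  then obtain F where F: "\<And>j. j \<le> k \<Longrightarrow> AE x in half_line. g j x = F j x"
      "\<And>j. j < k \<Longrightarrow> primitive (g (Suc j)) (F j)" by (metis less_imp_le_nat)
  have wF: "has_weak_deriv i f (F i)" if "i \<le> k" for i
    by (rule has_weak_deriv_cong[OF g(2)[OF that] _ F(1)[OF that]]) simp
  have LF: "F i \<in> Lp (weighted a) p" if "i \<le> k" for i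
    using g(1)[OF that] lp_int_cong[OF F(1)[OF that]] strongly_measurable_cong_AE[OF _ F(1)[OF that]]
    by (auto simp: Lp_iff)
  have l: "locally_integrable (F k)"
    using LF[of k] wF[of k] by (intro test_locally_integrable) (auto simp: Lp_iff has_weak_deriv_def)
  have "primitive_chain k F" unfolding primitive_chain_def
    using l primitive_cong[OF F(2) F(1)] by auto
  moreover have "AE x in half_line. f x = F 0 x"
  proof -
    have f0: "f \<in> Lp (weighted a) p" using f by (simp add: sobolev_def)
    have "locally_integrable f"
      using f0 wF[of 0] by (intro test_locally_integrable) (auto simp: Lp_iff has_weak_deriv_def)
    then have "has_weak_deriv 0 f f" by (rule has_weak_deriv_0)
    then show ?thesis using has_weak_deriv_unique wF[of 0] by blast
  qed
  ultimately show ?thesis using that LF wF by blast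
qed

lemma weak_deriv_AE:
  assumes "has_weak_deriv j u g" shows "AE x in half_line. weak_deriv j u x = g x"
  unfolding weak_deriv_def by (rule has_weak_deriv_unique[OF someI[of "has_weak_deriv j u", OF assms] assms])

lemma chain_weak_deriv_AE:
  fixes U :: "nat \<Rightarrow> real \<Rightarrow> 'a::complex_banach"
  assumes U: "primitive_chain m U" and u: "AE x in half_line. u x = U 0 x" and ij: "i + j \<le> m"
  shows "AE x in half_line. weak_deriv i (weak_deriv j u) x = U (i + j) x"
    "has_weak_deriv j u (U j)"
proof -
  have sym: "AE x in half_line. U 0 x = u x" using u by (auto simp: eq_commute)
  have "has_weak_deriv j (U 0) (U j)" using primitive_chain_weak_deriv[OF U, of j 0] ij by simp
  then show 1: "has_weak_deriv j u (U j)" by (rule has_weak_deriv_cong[OF _ sym]) simp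
  have "AE x in half_line. U j x = weak_deriv j u x" using weak_deriv_AE[OF 1] by (auto simp: eq_commute)
  then have "has_weak_deriv i (weak_deriv j u) (U (i + j))"
    using has_weak_deriv_cong[OF primitive_chain_weak_deriv[OF U ij]] by auto
  then show "AE x in half_line. weak_deriv i (weak_deriv j u) x = U (i + j) x" by (rule weak_deriv_AE)
qed

lemma sobolev_norm_chain:
  fixes U :: "nat \<Rightarrow> real \<Rightarrow> 'a::complex_banach"
  assumes U: "primitive_chain m U" and u: "AE x in half_line. u x = U 0 x" and j: "k + j \<le> m"
  shows "sobolev_norm k p a (weak_deriv j u) = (\<Sum>i\<le>k. enn2real (lp_int p a (U (i + j))) powr (1 / p))"
  unfolding sobolev_norm_def
proof (rule sum.cong[OF refl])
  fix i assume "i \<in> {..k}"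
  then have ij: "i + j \<le> m" using j by simp
  note ae = chain_weak_deriv_AE(1)[OF U u ij]
  have sm: "strongly_measurable half_line (U (i + j))"
    using primitive_chain_locally_integrable[OF U ij] by (simp add: locally_integrable_def)
  have "strongly_measurable half_line (weak_deriv i (weak_deriv j u))"
    by (rule strongly_measurable_cong_AE[OF sm]) (use ae in \<open>auto simp: eq_commute\<close>)
  then show "Lp_norm (weighted a) p (weak_deriv i (weak_deriv j u)) = enn2real (lp_int p a (U (i + j))) powr (1 / p)"
    by (simp add: Lp_norm_eq lp_int_cong[OF ae])
qed

lemma sobolev_norm_chain_0:
  fixes U :: "nat \<Rightarrow> real \<Rightarrow> 'a::complex_banach"
  assumes U: "primitive_chain m U" and u: "AE x in half_line. u x = U 0 x" and j: "k \<le> m"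
  shows "sobolev_norm k p a u = (\<Sum>i\<le>k. enn2real (lp_int p a (U i)) powr (1 / p))"
  unfolding sobolev_norm_def
proof (rule sum.cong[OF refl])
  fix i assume "i \<in> {..k}"
  then have i: "i \<le> m" using j by simp
  have "has_weak_deriv i u (U i)" using chain_weak_deriv_AE(2)[OF U u, of 0 i] i by simp
  then have ae: "AE x in half_line. weak_deriv i u x = U i x" by (rule weak_deriv_AE)
  have sm: "strongly_measurable half_line (U i)"
    using primitive_chain_locally_integrable[OF U i] by (simp add: locally_integrable_def)
  have "strongly_measurable half_line (weak_deriv i u)"
    by (rule strongly_measurable_cong_AE[OF sm]) (use ae in \<open>auto simp: eq_commute\<close>)
  then show "Lp_norm (weighted a) p (weak_deriv i u) = enn2real (lp_int p a (U i)) powr (1 / p)"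
    by (simp add: Lp_norm_eq lp_int_cong[OF ae])
qed

section \<open>Construction of the resolvent by two first-order equations\<close>

lemma AE_half_line_interval_witness:
  assumes "AE x in half_line. Q x" "0 \<le> s" "s < t"
  obtains y where "s < y" "y < t" "Q y"
proof -
  have "\<exists>y. s < y \<and> y < t \<and> Q y"
  proof (rule ccontr)
    assume no: "\<not> ?thesis"
    have "AE x in lborel. x \<notin> {s<..<t}"
      using assms(1)[unfolded AE_half_line] by eventually_elim (use assms(2) no in auto)
    then have "emeasure lborel {s<..<t} = 0" by (subst (asm) AE_iff_measurable[of "{s<..<t}"]) auto
    then show False using assms(3) by simp
  qed
  then show ?thesis using that by blast
qed

lemma wint_finite_AE:
  assumes "wint p a g < \<infinity>" and [measurable]: "g \<in> borel_measurable borel"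
  shows "AE x in half_line. g x < \<infinity>"
proof -
  have "AE x in lborel. epow (g x) p * ennreal (x powr a) * indicator {0<..} x \<noteq> \<infinity>"
    using assms(1) unfolding wint_def by (intro nn_integral_noteq_infinite) auto
  then show ?thesis unfolding AE_half_line
  proof eventually_elim
    case (elim x)
    show ?case
    proof (intro impI, rule ccontr)
      assume x: "0 < x" "\<not> g x < \<infinity>"
      then have "g x = \<top>" by (simp add: not_less top_unique)
      then show False using elim x(1) by (simp add: ennreal_top_mult)
    qed
  qed
qed

text \<open>Finiteness at one point implies finiteness further to the right, because moving the point from \<open>y\<close> to
\<open>x > y\<close> changes the kernel by the factor \<open>exp (c (x - y))\<close> only; a finite norm gives finiteness almost
everywhere.\<close>

lemma forward_exp_finite:
  assumes fin: "wint p a (forward_exp c g) < \<infinity>" and c: "0 < c" and [measurable]: "g \<in> borel_measurable borel" and x: "0 < x"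
  shows "forward_exp c g x < \<infinity>"
proof -
  obtain y where y: "0 < y" "y < x" "forward_exp c g y < \<infinity>"
    using AE_half_line_interval_witness[OF wint_finite_AE[OF fin] _ x] by auto
  have "forward_exp c g x \<le> (\<integral>\<^sup>+z. ennreal (exp (c * (x - y))) * (if y < z then ennreal (exp (- (c * (z - y)))) * g z else 0) \<partial>lborel)"
    unfolding forward_exp_def
  proof (rule nn_integral_mono)
    fix z
    have "exp (- (c * (z - x))) = exp (c * (x - y)) * exp (- (c * (z - y)))"
      by (simp add: exp_add[symmetric] algebra_simps)
    then have "ennreal (exp (- (c * (z - x)))) = ennreal (exp (c * (x - y))) * ennreal (exp (- (c * (z - y))))"
      by (simp add: ennreal_mult)
    then show "(if x < z then ennreal (exp (- (c * (z - x)))) * g z else 0) \<le>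
      ennreal (exp (c * (x - y))) * (if y < z then ennreal (exp (- (c * (z - y)))) * g z else 0)"
      using y by (auto simp: mult.assoc)
  qed
  also have "\<dots> = ennreal (exp (c * (x - y))) * forward_exp c g y"
    unfolding forward_exp_def by (subst nn_integral_cmult) auto
  also have "\<dots> < \<infinity>" using y by (simp add: ennreal_mult_less_top)
  finally show ?thesis .
qed

text \<open>As for \<open>forward_exp_finite\<close>, with finiteness spreading to the left.\<close>

lemma backward_exp_finite:
  assumes fin: "wint p a (backward_exp c h) < \<infinity>" and c: "0 < c" and [measurable]: "h \<in> borel_measurable borel" and x: "0 < x"
  shows "backward_exp c h x < \<infinity>"
proof -
  obtain y where y: "x < y" "y < x + 1" "backward_exp c h y < \<infinity>"
    using AE_half_line_interval_witness[OF wint_finite_AE[OF fin], of x "x + 1"] x by auto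
  have "backward_exp c h x \<le> (\<integral>\<^sup>+z. ennreal (exp (c * (y - x))) * (if 0 < z \<and> z \<le> y then ennreal (exp (- (c * (y - z)))) * h z else 0) \<partial>lborel)"
    unfolding backward_exp_def
  proof (rule nn_integral_mono)
    fix z
    have "exp (- (c * (x - z))) = exp (c * (y - x)) * exp (- (c * (y - z)))"
      by (simp add: exp_add[symmetric] algebra_simps)
    then have "ennreal (exp (- (c * (x - z)))) = ennreal (exp (c * (y - x))) * ennreal (exp (- (c * (y - z))))"
      by (simp add: ennreal_mult)
    then show "(if 0 < z \<and> z \<le> x then ennreal (exp (- (c * (x - z)))) * h z else 0) \<le>
      ennreal (exp (c * (y - x))) * (if 0 < z \<and> z \<le> y then ennreal (exp (- (c * (y - z)))) * h z else 0)"
      using y by (auto simp: mult.assoc)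
  qed
  also have "\<dots> = ennreal (exp (c * (y - x))) * backward_exp c h y"
    unfolding backward_exp_def by (subst nn_integral_cmult) auto
  also have "\<dots> < \<infinity>" using y by (simp add: ennreal_mult_less_top)
  finally show ?thesis .
qed

lemma exp_has_vector_derivative: "((\<lambda>x. expc \<mu> x) has_vector_derivative \<mu> * expc \<mu> x) (at x)"
proof -
  have "((\<lambda>z. exp (\<mu> * z)) has_field_derivative expc \<mu> x * \<mu>) (at (complex_of_real x))"
    by (auto intro!: derivative_eq_intros)
  from has_vector_derivative_real_field[OF this] show ?thesis by (simp add: mult.commute)
qed

lemma continuous_on_exp_real: "continuous_on S (\<lambda>x. expc \<mu> x)"
  by (intro continuous_intros)

text \<open>The integrating factor for first-order equations.\<close>

lemma primitive_exp:
  assumes "primitive f F"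
  shows "primitive (\<lambda>x. expc \<mu> x *\<^sub>C (f x + \<mu> *\<^sub>C F x)) (\<lambda>x. expc \<mu> x *\<^sub>C F x)"
proof -
  have "primitive (\<lambda>x. expc \<mu> x *\<^sub>C f x + (\<mu> * expc \<mu> x) *\<^sub>C F x) (\<lambda>x. expc \<mu> x *\<^sub>C F x)"
    by (rule primitive_product[OF assms exp_has_vector_derivative]) (intro continuous_intros)
  then show ?thesis by (simp add: scaleC_add_right scaleC_scaleC mult.commute)
qed

lemma norm_exp_scaleC: "norm (expc \<mu> x *\<^sub>C v) = exp (Re \<mu> * x) * norm v"
  by (simp add: norm_scaleC)

lemma exp_scaleC_cancel: "expc \<mu> x *\<^sub>C expc (- \<mu>) x *\<^sub>C v = v"
  by (simp add: scaleC_scaleC exp_add[symmetric])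

text \<open>Each first-order equation is solved by integrating after multiplication with its integrating
factor; the pointwise bounds are the triangle inequality under the integral. The boundary value
of \<open>u\<close> is zero because the integral defining it runs over \<open>{0<..x}\<close>.\<close>

lemma resolvent_construction:
  fixes f :: "real \<Rightarrow> 'a::complex_banach"
  assumes \<mu>: "0 < Re \<mu>" and f: "strongly_measurable half_line f"
    and g[measurable]: "g \<in> borel_measurable borel" and fg: "AE x in half_line. enorm (f x) = g x"
    and fin1: "\<And>x. 0 < x \<Longrightarrow> forward_exp (Re \<mu>) g x < \<infinity>"
    and fin2: "\<And>x. 0 < x \<Longrightarrow> backward_exp (Re \<mu>) (forward_exp (Re \<mu>) g) x < \<infinity>"
  obtains w u where "primitive (\<lambda>x. \<mu> *\<^sub>C w x - f x) w" "primitive (\<lambda>x. w x - \<mu> *\<^sub>C u x) u"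
    "\<And>x. 0 < x \<Longrightarrow> enorm (w x) \<le> forward_exp (Re \<mu>) g x"
    "\<And>x. 0 < x \<Longrightarrow> enorm (u x) \<le> backward_exp (Re \<mu>) (forward_exp (Re \<mu>) g) x"
    "(u \<longlongrightarrow> 0) (at_right 0)"
proof -
  define c where "c = Re \<mu>"
  have c: "0 < c" using \<mu> by (simp add: c_def)
  \<comment> \<open>The substitution \<open>w = exp (\<mu> x) Q\<close> turns \<open>w' = \<mu> w -
    f\<close> into \<open>Q' = - q\<close>.\<close>
  define q where "q y = expc (- \<mu>) y *\<^sub>C f y" for y
  have norm_q: "norm (q y) = exp (- (c * y)) * norm (f y)" for y
    unfolding q_def norm_exp_scaleC by (simp add: c_def)
  have qm: "strongly_measurable half_line q" unfolding q_def
    by (intro strongly_measurable_scaleC strongly_measurable_continuous continuous_on_exp_real f)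
  have intq: "(\<integral>\<^sup>+y. enorm (indicator {x<..} y *\<^sub>R q y) \<partial>half_line) = ennreal (exp (- (c * x))) * forward_exp c g x"
    if "0 < x" for x
  proof -
    have "(\<integral>\<^sup>+y. enorm (indicator {x<..} y *\<^sub>R q y) \<partial>half_line) =
      (\<integral>\<^sup>+y. ennreal (exp (- (c * x))) * (if x < y then ennreal (exp (- (c * (y - x)))) * g y else 0) \<partial>lborel)"
      unfolding nn_integral_half_line
    proof (rule nn_integral_cong_AE, use fg[unfolded AE_half_line] in eventually_elim)
      case (elim y)
      have "exp (- (c * y)) = exp (- (c * x)) * exp (- (c * (y - x)))" by (simp add: exp_add[symmetric] algebra_simps)
      then have "ennreal (exp (- (c * y)) * norm (f y)) = ennreal (exp (- (c * x))) * (ennreal (exp (- (c * (y - x)))) * enorm (f y))"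
        by (simp add: ennreal_mult mult.assoc)
      then show ?case using elim that by (auto simp: norm_q indicator_def)
    qed
    then show ?thesis unfolding forward_exp_def by (subst (asm) nn_integral_cmult) auto
  qed
  have "\<exists>I. has_Bochner_integral half_line (\<lambda>y. indicator {x<..} y *\<^sub>R q y) I" if x: "0 < x" for x
  proof -
    have "(\<integral>\<^sup>+y. enorm (indicator {x<..} y *\<^sub>R q y) \<partial>half_line) < \<infinity>"
      unfolding intq[OF x] using fin1[OF x] by (simp add: c_def ennreal_mult_less_top)
    moreover have "strongly_measurable half_line (\<lambda>y. indicator {x<..} y *\<^sub>R q y)" by (intro strongly_measurable_restrict qm) simp
    ultimately show ?thesis using has_Bochner_integral_exists by metis
  qed
  then obtain Q where Q: "\<And>x. 0 < x \<Longrightarrow> has_Bochner_integral half_line (\<lambda>y. indicator {x<..} y *\<^sub>R q y) (Q x)" by metis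
  have "primitive (\<lambda>x. - q x) Q" unfolding primitive_def
  proof (intro conjI allI impI)
    show "strongly_measurable half_line (\<lambda>x. - q x)"
      by (rule strongly_measurable_linear[OF bounded_linear_minus[OF bounded_linear_ident] qm])
    fix a b :: real assume ab: "0 < a" "a \<le> b"
    have "has_Bochner_integral half_line (\<lambda>y. indicator {b<..} y *\<^sub>R q y - indicator {a<..} y *\<^sub>R q y) (Q b - Q a)"
      using ab by (intro has_Bochner_integral_diff Q) auto
    also have "(\<lambda>y. indicator {b<..} y *\<^sub>R q y - indicator {a<..} y *\<^sub>R q y) = (\<lambda>y. indicator {a<..b} y *\<^sub>R - q y)"
      using ab by (auto simp: indicator_def fun_eq_iff)
    finally show "has_Bochner_integral half_line (\<lambda>y. indicator {a<..b} y *\<^sub>R - q y) (Q b - Q a)" .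
  qed
  define w where "w x = expc \<mu> x *\<^sub>C Q x" for x
  have w: "primitive (\<lambda>x. \<mu> *\<^sub>C w x - f x) w"
  proof -
    have "primitive (\<lambda>x. expc \<mu> x *\<^sub>C (- q x + \<mu> *\<^sub>C Q x)) w"
      unfolding w_def by (rule primitive_exp[OF \<open>primitive (\<lambda>x. - q x) Q\<close>])
    moreover have "expc \<mu> x *\<^sub>C (- q x + \<mu> *\<^sub>C Q x) = \<mu> *\<^sub>C w x - f x" for x
      unfolding scaleC_add_right w_def q_def by (simp add: exp_scaleC_cancel) (simp add: scaleC_scaleC mult.commute scaleC.diff_right exp_add[symmetric])
    ultimately show ?thesis by simp
  qed
  have w_le: "enorm (w x) \<le> forward_exp c g x" if x: "0 < x" for x
  proof -
    have "enorm (w x) = ennreal (exp (c * x)) * enorm (Q x)"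
      unfolding w_def norm_exp_scaleC by (simp add: c_def ennreal_mult)
    also have "\<dots> \<le> ennreal (exp (c * x)) * (ennreal (exp (- (c * x))) * forward_exp c g x)"
      using has_Bochner_integral_norm_le[OF Q[OF x]] unfolding intq[OF x] by (intro mult_left_mono) simp_all
    also have "\<dots> = forward_exp c g x"
      by (simp add: mult.assoc[symmetric] exp_minus flip: ennreal_mult)
    finally show ?thesis .
  qed
  have cw: "continuous_on {0<..} w" by (rule primitive_continuous[OF w])
  \<comment> \<open>The substitution \<open>u = exp (- \<mu> x) R\<close> turns \<open>u' = w - \<mu>
    u\<close> into \<open>R' = r\<close>.\<close>
  define r where "r y = expc \<mu> y *\<^sub>C w y" for y
  have norm_r: "norm (r y) = exp (c * y) * norm (w y)" for y
    unfolding r_def norm_exp_scaleC by (simp add: c_def)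
  have rm: "strongly_measurable half_line r" unfolding r_def
    by (intro strongly_measurable_scaleC strongly_measurable_continuous continuous_on_exp_real cw)
  have intr: "(\<integral>\<^sup>+y. enorm (indicator {0<..x} y *\<^sub>R r y) \<partial>half_line) \<le> ennreal (exp (c * x)) * backward_exp c (forward_exp c g) x"
    for x
  proof -
    have "(\<integral>\<^sup>+y. enorm (indicator {0<..x} y *\<^sub>R r y) \<partial>half_line) \<le>
      (\<integral>\<^sup>+y. ennreal (exp (c * x)) * (if 0 < y \<and> y \<le> x then ennreal (exp (- (c * (x - y)))) * forward_exp c g y else 0) \<partial>lborel)"
      unfolding nn_integral_half_line
    proof (rule nn_integral_mono)
      fix y
      have "exp (c * y) = exp (c * x) * exp (- (c * (x - y)))" by (simp add: exp_add[symmetric] algebra_simps)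
      then have "ennreal (exp (c * y) * norm (w y)) = ennreal (exp (c * x)) * (ennreal (exp (- (c * (x - y)))) * enorm (w y))"
        by (simp add: ennreal_mult mult.assoc)
      then show "enorm (indicator {0<..x} y *\<^sub>R r y) * indicator {0<..} y \<le>
        ennreal (exp (c * x)) * (if 0 < y \<and> y \<le> x then ennreal (exp (- (c * (x - y)))) * forward_exp c g y else 0)"
        using w_le[of y] by (auto simp: norm_r indicator_def intro!: mult_left_mono)
    qed
    also have "\<dots> = ennreal (exp (c * x)) * backward_exp c (forward_exp c g) x"
      unfolding backward_exp_def by (subst nn_integral_cmult) auto
    finally show ?thesis .
  qed
  have "\<exists>I. has_Bochner_integral half_line (\<lambda>y. indicator {0<..x} y *\<^sub>R r y) I" if x: "0 < x" for x
  proof -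
    have "(\<integral>\<^sup>+y. enorm (indicator {0<..x} y *\<^sub>R r y) \<partial>half_line) < \<infinity>"
      by (rule le_less_trans[OF intr]) (use fin2[OF x] in \<open>simp add: c_def ennreal_mult_less_top\<close>)
    moreover have "strongly_measurable half_line (\<lambda>y. indicator {0<..x} y *\<^sub>R r y)" by (intro strongly_measurable_restrict rm) simp
    ultimately show ?thesis using has_Bochner_integral_exists by metis
  qed
  then obtain R where R: "\<And>x. 0 < x \<Longrightarrow> has_Bochner_integral half_line (\<lambda>y. indicator {0<..x} y *\<^sub>R r y) (R x)" by metis
  have "primitive r R" unfolding primitive_def
  proof (intro conjI allI impI rm)
    fix a b :: real assume ab: "0 < a" "a \<le> b"
    have "has_Bochner_integral half_line (\<lambda>y. indicator {0<..b} y *\<^sub>R r y - indicator {0<..a} y *\<^sub>R r y) (R b - R a)"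
      using ab by (intro has_Bochner_integral_diff R) auto
    also have "(\<lambda>y. indicator {0<..b} y *\<^sub>R r y - indicator {0<..a} y *\<^sub>R r y) = (\<lambda>y. indicator {a<..b} y *\<^sub>R r y)"
      using ab by (auto simp: indicator_def fun_eq_iff)
    finally show "has_Bochner_integral half_line (\<lambda>y. indicator {a<..b} y *\<^sub>R r y) (R b - R a)" .
  qed
  define u where "u x = expc (- \<mu>) x *\<^sub>C R x" for x
  have u: "primitive (\<lambda>x. w x - \<mu> *\<^sub>C u x) u"
  proof -
    have "primitive (\<lambda>x. expc (- \<mu>) x *\<^sub>C (r x + (- \<mu>) *\<^sub>C R x)) u"
      unfolding u_def by (rule primitive_exp[OF \<open>primitive r R\<close>])
    moreover have "expc (- \<mu>) x *\<^sub>C (r x + (- \<mu>) *\<^sub>C R x) = w x - \<mu> *\<^sub>C u x" for x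
    proof -
      have "expc (- \<mu>) x *\<^sub>C r x = w x"
        unfolding r_def using exp_scaleC_cancel[of "- \<mu>" x "w x"] by simp
      then show ?thesis unfolding scaleC_add_right u_def by (simp add: scaleC_scaleC mult.commute)
    qed
    ultimately show ?thesis by simp
  qed
  have norm_u: "enorm (u x) = ennreal (exp (- (c * x))) * enorm (R x)" for x
    unfolding u_def norm_exp_scaleC by (simp add: c_def ennreal_mult)
  have u_le: "enorm (u x) \<le> backward_exp c (forward_exp c g) x" if x: "0 < x" for x
  proof -
    have "enorm (u x) \<le> ennreal (exp (- (c * x))) * (ennreal (exp (c * x)) * backward_exp c (forward_exp c g) x)"
      unfolding norm_u using has_Bochner_integral_norm_le[OF R[OF x]] intr[of x] by (intro mult_left_mono) (auto intro: order_trans)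
    also have "\<dots> = backward_exp c (forward_exp c g) x"
      by (simp add: mult.assoc[symmetric] exp_minus flip: ennreal_mult)
    finally show ?thesis .
  qed
  have "(u \<longlongrightarrow> 0) (at_right 0)"
  proof (rule tendstoI)
    fix e :: real assume e: "0 < e"
    obtain k where k[measurable]: "k \<in> borel_measurable half_line" and rk: "AE x in half_line. enorm (r x) = k x"
      using strongly_measurable_norm_rep[OF rm] by blast
    define N where "N n = (\<integral>\<^sup>+y. enorm (indicator {0<..1 / real (Suc n)} y *\<^sub>R r y) \<partial>half_line)" for n
    have ind[measurable]: "(\<lambda>y. indicator {0<..t::real} y :: ennreal) \<in> borel_measurable half_line" for t
      by (intro measurable_half_line) measurable
    have Nk: "N n = (\<integral>\<^sup>+y. indicator {0<..1 / real (Suc n)} y * k y \<partial>half_line)" for n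
      unfolding N_def by (rule nn_integral_cong_AE, use rk in eventually_elim) (auto simp: indicator_def)
    have "(\<lambda>n. \<integral>\<^sup>+y. indicator {0<..1 / real (Suc n)} y * k y \<partial>half_line) \<longlonglongrightarrow> (\<integral>\<^sup>+y. 0 \<partial>half_line)"
    proof (rule nn_integral_dominated_convergence)
      have "(\<integral>\<^sup>+y. indicator {0<..1} y * k y \<partial>half_line) = N 0" unfolding Nk by simp
      also have "\<dots> < \<infinity>" unfolding N_def
        by (rule le_less_trans[OF intr]) (use fin2[of 1] in \<open>simp add: c_def ennreal_mult_less_top\<close>)
      finally show "(\<integral>\<^sup>+y. indicator {0<..1} y * k y \<partial>half_line) < \<infinity>" .
      have le1: "1 / real (Suc n) \<le> 1" for n by simp
      show "AE y in half_line. indicator {0<..1 / real (Suc n)} y * k y \<le> indicator {0<..1} y * k y" for n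
        by (intro AE_I2) (auto simp: indicator_def simp del: of_nat_Suc dest: order_trans[OF _ le1])
      show "AE y in half_line. (\<lambda>n. indicator {0<..1 / real (Suc n)} y * k y) \<longlonglongrightarrow> 0"
        using AE_space
      proof eventually_elim
        case (elim y)
        obtain m where m: "1 / real (Suc m) < y" using elim nat_approx_posE by auto
        have "eventually (\<lambda>n. indicator {0<..1 / real (Suc n)} y * k y = 0) sequentially"
          using eventually_ge_at_top[of m]
        proof eventually_elim
          case (elim n)
          have "1 / real (Suc n) \<le> 1 / real (Suc m)" using elim by (intro divide_left_mono) auto
          then show ?case using m by (simp add: indicator_def)
        qed
        then show ?case by (rule tendsto_eventually)
      qed
    qed measurable
    then have "N \<longlonglongrightarrow> 0" by (simp add: Nk[abs_def])
    then have "eventually (\<lambda>n. N n < ennreal e) sequentially" by (rule order_tendstoD) (use e in simp)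
    then obtain n where n: "N n < ennreal e" by (auto simp: eventually_sequentially)
    have "dist (u x) 0 < e" if x: "0 < x" "x < 1 / real (Suc n)" for x
    proof -
      have "enorm (u x) \<le> 1 * enorm (R x)"
        unfolding norm_u using c x by (intro mult_right_mono) auto
      also have "\<dots> \<le> (\<integral>\<^sup>+y. enorm (indicator {0<..x} y *\<^sub>R r y) \<partial>half_line)"
        using has_Bochner_integral_norm_le[OF R[OF x(1)]] by simp
      also have "\<dots> \<le> N n" unfolding N_def
        using x by (intro nn_integral_mono) (auto simp: indicator_def)
      also note n
      finally show ?thesis using e by (simp add: ennreal_less_iff)
    qed
    then show "eventually (\<lambda>x. dist (u x) 0 < e) (at_right 0)"
      unfolding eventually_at_right_field by (intro exI[of _ "1 / real (Suc n)"]) auto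
  qed
  then show ?thesis using that[OF w u] w_le u_le by (simp add: c_def)
qed

section \<open>Uniqueness and the estimate for one weight\<close>

text \<open>A weak form of vanishing at \<open>0\<close>, along some sequence only. It follows from mere integrability
conditions and still determines solutions.\<close>

definition small_near_0 :: "(real \<Rightarrow> 'a::real_normed_vector) \<Rightarrow> bool" where
  "small_near_0 U \<longleftrightarrow> (\<forall>e>0. \<exists>x. 0 < x \<and> x < e \<and> norm (U x) < e)"

text \<open>Some power weight makes the function \<open>p\<close>-integrable at infinity; this excludes exponential growth, for
solutions in any of the weighted spaces at once.\<close>

definition tail_int_finite :: "real \<Rightarrow> (real \<Rightarrow> 'a::real_normed_vector) \<Rightarrow> bool" where
  "tail_int_finite p U \<longleftrightarrow> (\<exists>b. (\<integral>\<^sup>+x. epow (enorm (U x)) p * ennreal (x powr b) * indicator {1..} x \<partial>lborel) < \<infinity>)"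

lemma lp_int_tail_int_finite:
  assumes "lp_int p a U < \<infinity>" shows "tail_int_finite p U"
proof -
  have "(\<integral>\<^sup>+x. epow (enorm (U x)) p * ennreal (x powr a) * indicator {1..} x \<partial>lborel) \<le> lp_int p a U"
    unfolding lp_int_def wint_def by (intro nn_integral_mono) (auto simp: indicator_def)
  then show ?thesis using assms unfolding tail_int_finite_def by (meson le_less_trans)
qed

lemma tail_int_finite_diff:
  fixes U V :: "real \<Rightarrow> 'a::banach"
  assumes U: "tail_int_finite p U" "strongly_measurable half_line U"
    and V: "tail_int_finite p V" "strongly_measurable half_line V" and p: "0 < p"
  shows "tail_int_finite p (\<lambda>x. U x - V x)"
proof -
  obtain b1 where b1: "(\<integral>\<^sup>+x. epow (enorm (U x)) p * ennreal (x powr b1) * indicator {1..} x \<partial>lborel) < \<infinity>"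
    using U by (auto simp: tail_int_finite_def)
  obtain b2 where b2: "(\<integral>\<^sup>+x. epow (enorm (V x)) p * ennreal (x powr b2) * indicator {1..} x \<partial>lborel) < \<infinity>"
    using V by (auto simp: tail_int_finite_def)
  obtain g where g[measurable]: "g \<in> borel_measurable borel" and Ug: "AE x in half_line. enorm (U x) = g x"
    using strongly_measurable_borel_rep[OF U(2)] by blast
  obtain h where h[measurable]: "h \<in> borel_measurable borel" and Vh: "AE x in half_line. enorm (V x) = h x"
    using strongly_measurable_borel_rep[OF V(2)] by blast
  define b where "b = min b1 b2"
  have Ug': "AE x in lborel. epow (enorm (U x)) p * ennreal (x powr b1) * indicator {1..} x = epow (g x) p * ennreal (x powr b1) * indicator {1..} x"
    using Ug[unfolded AE_half_line] by eventually_elim (auto simp: indicator_def simp del: epow_ennreal)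
  have Vh': "AE x in lborel. epow (enorm (V x)) p * ennreal (x powr b2) * indicator {1..} x = epow (h x) p * ennreal (x powr b2) * indicator {1..} x"
    using Vh[unfolded AE_half_line] by eventually_elim (auto simp: indicator_def simp del: epow_ennreal)
  have "(\<integral>\<^sup>+x. epow (enorm (U x - V x)) p * ennreal (x powr b) * indicator {1..} x \<partial>lborel) \<le>
    (\<integral>\<^sup>+x. ennreal (2 powr p) * (epow (g x) p * ennreal (x powr b1) * indicator {1..} x + epow (h x) p * ennreal (x powr b2) * indicator {1..} x) \<partial>lborel)"
  proof (rule nn_integral_mono_AE, use Ug[unfolded AE_half_line] Vh[unfolded AE_half_line] in eventually_elim)
    case (elim x)
    show ?case
    proof (cases "1 \<le> x")
      case True
      have "enorm (U x - V x) \<le> g x + h x"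
        using elim True by (simp flip: ennreal_plus) (metis ennreal_leI ennreal_plus norm_ge_zero norm_triangle_ineq4)
      then have "epow (enorm (U x - V x)) p \<le> ennreal (2 powr p) * (epow (g x) p + epow (h x) p)"
        using epow_mono[of p] epow_add[OF p] p by (meson less_imp_le order_trans)
      then have "epow (enorm (U x - V x)) p * ennreal (x powr b) \<le> ennreal (2 powr p) * (epow (g x) p + epow (h x) p) * ennreal (x powr b)"
        by (rule mult_right_mono) simp
      also have "\<dots> = ennreal (2 powr p) * (epow (g x) p * ennreal (x powr b) + epow (h x) p * ennreal (x powr b))"
        by (simp add: algebra_simps)
      also have "\<dots> \<le> ennreal (2 powr p) * (epow (g x) p * ennreal (x powr b1) + epow (h x) p * ennreal (x powr b2))"
        using True by (intro mult_left_mono add_mono ennreal_leI powr_mono) (auto simp: b_def)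
      finally show ?thesis using True by simp
    qed simp
  qed
  also have "\<dots> = ennreal (2 powr p) * ((\<integral>\<^sup>+x. epow (g x) p * ennreal (x powr b1) * indicator {1..} x \<partial>lborel) + (\<integral>\<^sup>+x. epow (h x) p * ennreal (x powr b2) * indicator {1..} x \<partial>lborel))"
    by (subst nn_integral_cmult, measurable, subst nn_integral_add) auto
  also have "\<dots> < \<infinity>"
    using b1 b2 unfolding nn_integral_cong_AE[OF Ug'] nn_integral_cong_AE[OF Vh'] by (simp add: ennreal_mult_less_top)
  finally show ?thesis unfolding tail_int_finite_def by blast
qed

lemma primitive_const: "primitive (\<lambda>x. 0) (\<lambda>x. a)"
  by (auto simp: primitive_def intro: has_Bochner_integral_strongly_measurable[OF has_Bochner_integral_zero])

text \<open>\<open>E + \<mu> D\<close> solves a first-order equation and is a multiple of \<open>exp (\<mu> x)\<close>; integrating once more,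
\<open>D x = exp (\<mu> x) a' + exp (- \<mu> x) b\<close>. Smallness near \<open>0\<close> gives \<open>b = - a'\<close>, and then \<open>D\<close> grows
exponentially unless \<open>a' = 0\<close>.\<close>

lemma homogeneous_solution_zero:
  fixes D E :: "real \<Rightarrow> 'a::complex_banach"
  assumes \<mu>: "0 < Re \<mu>" and p: "0 < p"
    and D: "primitive E D" and E: "primitive (\<lambda>x. \<mu>\<^sup>2 *\<^sub>C D x) E"
    and near: "small_near_0 D" and inf: "tail_int_finite p D" and x: "0 < x"
  shows "D x = 0"
proof -
  define c where "c = Re \<mu>"
  have c: "0 < c" and \<mu>0: "\<mu> \<noteq> 0" using \<mu> by (auto simp: c_def)
  define A where "A x = E x + \<mu> *\<^sub>C D x" for x
  have "primitive (\<lambda>x. \<mu>\<^sup>2 *\<^sub>C D x + \<mu> *\<^sub>C E x) A"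
    unfolding A_def by (intro primitive_add E primitive_scaleC D)
  moreover have "\<mu>\<^sup>2 *\<^sub>C D x + \<mu> *\<^sub>C E x = \<mu> *\<^sub>C A x" for x
    by (simp add: A_def scaleC_add_right scaleC_scaleC power2_eq_square)
  ultimately have "primitive (\<lambda>x. \<mu> *\<^sub>C A x) A" by simp
  from primitive_exp[OF this, of "- \<mu>"]
  have "primitive (\<lambda>x. 0) (\<lambda>x. expc (- \<mu>) x *\<^sub>C A x)" by simp
  note const = primitive_zero_const[OF this]
  define a where "a = expc (- \<mu>) 1 *\<^sub>C A 1"
  have Aa: "A x = expc \<mu> x *\<^sub>C a" if "0 < x" for x
  proof -
    have "expc (- \<mu>) x *\<^sub>C A x = a" unfolding a_def using const[OF that zero_less_one] .
    then have "expc \<mu> x *\<^sub>C (expc (- \<mu>) x *\<^sub>C A x) = expc \<mu> x *\<^sub>C a" by simp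
    then show ?thesis by (simp only: exp_scaleC_cancel)
  qed
  \<comment> \<open>The growing part of \<open>D\<close>: \<open>exp (\<mu> x) a'\<close> solves \<open>D'
    + \<mu> D = exp (\<mu> x) a\<close>.\<close>
  define a' where "a' = (1 / (2 * \<mu>)) *\<^sub>C a"
  have "primitive (\<lambda>x. expc \<mu> x *\<^sub>C (E x + \<mu> *\<^sub>C D x)) (\<lambda>x. expc \<mu> x *\<^sub>C D x)"
    by (rule primitive_exp[OF D])
  moreover have "primitive (\<lambda>x. expc (2 * \<mu>) x *\<^sub>C (0 + (2 * \<mu>) *\<^sub>C a')) (\<lambda>x. expc (2 * \<mu>) x *\<^sub>C a')"
    by (rule primitive_exp[OF primitive_const])
  ultimately have "primitive (\<lambda>x. expc \<mu> x *\<^sub>C (E x + \<mu> *\<^sub>C D x) - expc (2 * \<mu>) x *\<^sub>C (0 + (2 * \<mu>) *\<^sub>C a'))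
     (\<lambda>x. expc \<mu> x *\<^sub>C D x - expc (2 * \<mu>) x *\<^sub>C a')"
    by (rule primitive_diff)
  then have "primitive (\<lambda>x. 0) (\<lambda>x. expc \<mu> x *\<^sub>C D x - expc (2 * \<mu>) x *\<^sub>C a')"
  proof (rule primitive_cong)
    have "expc \<mu> x *\<^sub>C (E x + \<mu> *\<^sub>C D x) - expc (2 * \<mu>) x *\<^sub>C (0 + (2 * \<mu>) *\<^sub>C a') = 0" if "0 < x" for x
    proof -
      have "(2 * \<mu>) *\<^sub>C a' = a" using \<mu>0 by (simp add: a'_def scaleC_scaleC)
      moreover have "expc \<mu> x *\<^sub>C expc \<mu> x *\<^sub>C a = expc (2 * \<mu>) x *\<^sub>C a"
        by (simp add: scaleC_scaleC exp_add[symmetric] mult.assoc)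
      ultimately show ?thesis using Aa[OF that] by (simp add: A_def)
    qed
    then show "AE x in half_line. expc \<mu> x *\<^sub>C (E x + \<mu> *\<^sub>C D x) - expc (2 * \<mu>) x *\<^sub>C (0 + (2 * \<mu>) *\<^sub>C a') = 0"
      by (intro AE_I2) simp
  qed simp
  note const2 = primitive_zero_const[OF this]
  define b where "b = expc \<mu> 1 *\<^sub>C D 1 - expc (2 * \<mu>) 1 *\<^sub>C a'"
  have Dx: "D x = expc \<mu> x *\<^sub>C a' + expc (- \<mu>) x *\<^sub>C b" if "0 < x" for x
  proof -
    have "expc \<mu> x *\<^sub>C D x - expc (2 * \<mu>) x *\<^sub>C a' = b"
      unfolding b_def using const2[OF that zero_less_one] .
    then have "expc (- \<mu>) x *\<^sub>C b = expc (- \<mu>) x *\<^sub>C expc \<mu> x *\<^sub>C D x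
       - expc (- \<mu>) x *\<^sub>C expc (2 * \<mu>) x *\<^sub>C a'"
      by (simp add: scaleC.diff_right[symmetric])
    also have "expc (- \<mu>) x *\<^sub>C expc \<mu> x *\<^sub>C D x = D x"
      using exp_scaleC_cancel[of "- \<mu>" x "D x"] by simp
    also have "expc (- \<mu>) x *\<^sub>C expc (2 * \<mu>) x *\<^sub>C a' = expc \<mu> x *\<^sub>C a'"
      by (simp add: scaleC_scaleC exp_add[symmetric])
    finally show ?thesis by simp
  qed
  have "a' + b = 0"
  proof (rule ccontr)
    assume ne: "a' + b \<noteq> 0"
    have "((\<lambda>x. expc \<mu> x *\<^sub>C a' + expc (- \<mu>) x *\<^sub>C b) \<longlongrightarrow>
      expc \<mu> 0 *\<^sub>C a' + expc (- \<mu>) 0 *\<^sub>C b) (at_right 0)"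
      by (intro tendsto_intros scaleC.tendsto)
    then have "((\<lambda>x. norm (expc \<mu> x *\<^sub>C a' + expc (- \<mu>) x *\<^sub>C b)) \<longlongrightarrow> norm (a' + b)) (at_right 0)"
      by (intro tendsto_norm) simp
    then have "eventually (\<lambda>x. norm (a' + b) / 2 < norm (expc \<mu> x *\<^sub>C a' + expc (- \<mu>) x *\<^sub>C b)) (at_right 0)"
      by (rule order_tendstoD) (use ne in simp)
    then obtain d where d: "0 < d" "\<And>x. 0 < x \<Longrightarrow> x < d \<Longrightarrow> norm (a' + b) / 2 < norm (expc \<mu> x *\<^sub>C a' + expc (- \<mu>) x *\<^sub>C b)"
      unfolding eventually_at_right_field by auto
    obtain x where x: "0 < x" "x < min d (norm (a' + b) / 2)" "norm (D x) < min d (norm (a' + b) / 2)"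
      using near[unfolded small_near_0_def, rule_format, of "min d (norm (a' + b) / 2)"] d(1) ne by auto
    then show False using d(2)[of x] Dx[of x] by simp
  qed
  then have b: "b = - a'" by (simp add: add_eq_0_iff)
  have "a' = 0"
  proof (rule ccontr)
    assume a': "a' \<noteq> 0"
    obtain b0 where b0: "(\<integral>\<^sup>+x. epow (enorm (D x)) p * ennreal (x powr b0) * indicator {1..} x \<partial>lborel) < \<infinity>"
      using inf by (auto simp: tail_int_finite_def)
    \<comment> \<open>For \<open>x \<ge> 1\<close>, \<open>exp (c x) - exp (- c x)\<close> is at least
      \<open>(1 - exp (- 2 c)) exp (c x)\<close>.\<close>
    define K where "K = norm a' * (1 - exp (- (2 * c)))"
    have K: "0 < K" using a' c by (auto simp: K_def intro!: mult_pos_pos)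
    have lower: "K * exp (c * x) \<le> norm (D x)" if "1 \<le> x" for x
    proof -
      have "D x = (expc \<mu> x - expc (- \<mu>) x) *\<^sub>C a'"
        using Dx[of x] that by (simp add: b scaleC.diff_left)
      then have "norm (D x) = cmod (expc \<mu> x - expc (- \<mu>) x) * norm a'"
        by (simp add: norm_scaleC)
      moreover have "exp (c * x) - exp (- (c * x)) \<le> cmod (expc \<mu> x - expc (- \<mu>) x)"
        using norm_triangle_ineq2[of "expc \<mu> x" "expc (- \<mu>) x"] by (simp add: c_def)
      ultimately have 1: "(exp (c * x) - exp (- (c * x))) * norm a' \<le> norm (D x)" by (simp add: mult_right_mono)
      have "exp (- (c * x)) = exp (c * x) * exp (- (2 * c * x))" by (simp add: exp_add[symmetric])
      also have "\<dots> \<le> exp (c * x) * exp (- (2 * c))" using c that by (intro mult_left_mono) auto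
      finally have "exp (c * x) * (1 - exp (- (2 * c))) \<le> exp (c * x) - exp (- (c * x))" by (simp add: algebra_simps)
      from mult_right_mono[OF this, of "norm a'"] 1 show ?thesis by (simp add: K_def mult_ac)
    qed
    define n where "n = nat \<lceil>\<bar>b0\<bar>\<rceil>"
    have nb: "\<bar>b0\<bar> \<le> real n" unfolding n_def by linarith
    have "eventually (\<lambda>s::real. s ^ n / exp s < 1) at_top"
      using tendsto_power_div_exp_0[of n] by (rule order_tendstoD) simp
    then obtain S where "\<forall>s\<ge>S. s ^ n / exp s < (1::real)" unfolding eventually_at_top_linorder ..
    then have S: "\<And>s. s \<ge> S \<Longrightarrow> s ^ n / exp s < 1" by blast
    define X where "X = max 1 (S / (p * c))"
    define L where "L = K powr p * (p * c) ^ n"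
    have L: "0 < L" using K p c by (simp add: L_def)
    have big: "L \<le> norm (D x) powr p * x powr b0" if "X \<le> x" for x
    proof -
      have x1: "1 \<le> x" using that by (simp add: X_def)
      have "S / (p * c) \<le> x" using that by (simp add: X_def)
      then have "S \<le> p * c * x" using p c by (simp add: pos_divide_le_eq mult.commute)
      then have "(p * c * x) ^ n / exp (p * c * x) < 1" by (rule S)
      then have "(p * c * x) ^ n \<le> exp (p * c * x)" by simp
      then have 1: "(p * c) ^ n * x ^ n \<le> exp (p * c * x)" by (simp add: power_mult_distrib)
      have "x powr - real n \<le> x powr b0" using nb x1 by (intro powr_mono) auto
      then have 2: "1 / x ^ n \<le> x powr b0" using x1 by (simp add: powr_minus powr_realpow inverse_eq_divide)
      have "(p * c) ^ n = (p * c) ^ n * x ^ n * (1 / x ^ n)" using x1 by simp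
      also have "\<dots> \<le> exp (p * c * x) * x powr b0" using 1 2 x1 p c by (intro mult_mono) auto
      finally have "L \<le> K powr p * (exp (p * c * x) * x powr b0)" unfolding L_def by (intro mult_left_mono) auto
      also have "\<dots> = (K * exp (c * x)) powr p * x powr b0"
        using K by (simp add: powr_mult exp_powr_real mult_ac)
      also have "\<dots> \<le> norm (D x) powr p * x powr b0"
        using K lower[OF x1] p by (intro mult_right_mono powr_mono2) auto
      finally show ?thesis .
    qed
    have "(\<integral>\<^sup>+x. ennreal L * indicator {X..} x \<partial>lborel) \<le> (\<integral>\<^sup>+x. epow (enorm (D x)) p * ennreal (x powr b0) * indicator {1..} x \<partial>lborel)"
    proof (rule nn_integral_mono)
      fix x
      show "ennreal L * indicator {X..} x \<le> epow (enorm (D x)) p * ennreal (x powr b0) * indicator {1..} x"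
      proof (cases "X \<le> x")
        case True
        have "ennreal L \<le> ennreal (norm (D x) powr p) * ennreal (x powr b0)"
          by (subst ennreal_mult[symmetric]) (auto intro!: ennreal_leI big[OF True])
        then show ?thesis using True by (simp add: X_def)
      qed simp
    qed
    also note b0
    finally have "(\<integral>\<^sup>+x. ennreal L * indicator {X..} x \<partial>lborel) < \<infinity>" .
    moreover have "emeasure lborel {X..} = \<infinity>"
    proof (rule ccontr)
      assume fin: "emeasure lborel {X..} \<noteq> \<infinity>"
      obtain m where m: "emeasure lborel {X..} = ennreal m" "0 \<le> m" using fin by (cases "emeasure lborel {X..}") auto
      have "emeasure lborel {X..X + (m + 1)} \<le> emeasure lborel {X..}" by (intro emeasure_mono) auto
      then show False using m by (simp add: ennreal_le_iff)
    qed
    ultimately show False using L by (simp add: nn_integral_cmult_indicator ennreal_mult_top)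
  qed
  then show ?thesis using Dx[OF x] b by simp
qed

lemma wint_mono_AE:
  assumes "0 \<le> p" "AE x in half_line. f x \<le> g x" shows "wint p a f \<le> wint p a g"
  unfolding wint_def using assms(2)[unfolded AE_half_line]
  by (intro nn_integral_mono_AE, eventually_elim)
     (use assms(1) in \<open>auto simp: indicator_def intro!: mult_right_mono epow_mono\<close>)

text \<open>The constant is that of \<open>(s + t) powr p \<le> 2 powr p * (s powr p + t powr p)\<close>.\<close>

lemma lp_int_triangle:
  fixes f :: "real \<Rightarrow> 'a::banach" and g :: "real \<Rightarrow> 'b::banach" and h :: "real \<Rightarrow> 'c::banach"
  assumes p: "0 < p" and f: "strongly_measurable half_line f" and g: "strongly_measurable half_line g"
    and \<alpha>: "0 \<le> \<alpha>" "0 \<le> \<beta>" and le: "\<And>x. 0 < x \<Longrightarrow> norm (h x) \<le> \<alpha> * norm (f x) + \<beta> * norm (g x)"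
  shows "lp_int p a h \<le> ennreal (2 powr p) * (ennreal (\<alpha> powr p) * lp_int p a f + ennreal (\<beta> powr p) * lp_int p a g)"
proof -
  obtain f' where f'[measurable]: "f' \<in> borel_measurable borel" and ff: "AE x in half_line. enorm (f x) = f' x"
    and ef: "\<And>p a. lp_int p a f = wint p a f'" using lp_int_borel_rep[OF f] by blast
  obtain g' where g'[measurable]: "g' \<in> borel_measurable borel" and gg: "AE x in half_line. enorm (g x) = g' x"
    and eg: "\<And>p a. lp_int p a g = wint p a g'" using lp_int_borel_rep[OF g] by blast
  have "lp_int p a h \<le> wint p a (\<lambda>x. ennreal \<alpha> * f' x + ennreal \<beta> * g' x)"
    unfolding lp_int_def
  proof (rule wint_mono_AE)
    show "AE x in half_line. enorm (h x) \<le> ennreal \<alpha> * f' x + ennreal \<beta> * g' x"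
      using ff gg AE_space
    proof eventually_elim
      case (elim x)
      have "enorm (h x) \<le> ennreal (\<alpha> * norm (f x) + \<beta> * norm (g x))"
        using le[of x] elim by (intro ennreal_leI) auto
      also have "\<dots> = ennreal \<alpha> * f' x + ennreal \<beta> * g' x"
        using \<alpha> elim by (simp add: ennreal_plus ennreal_mult)
      finally show ?case .
    qed
  qed (use p in simp)
  also have "\<dots> \<le> ennreal (2 powr p) * (wint p a (\<lambda>x. ennreal \<alpha> * f' x) + wint p a (\<lambda>x. ennreal \<beta> * g' x))"
    by (intro wint_add p) measurable
  also have "\<dots> = ennreal (2 powr p) * (ennreal (\<alpha> powr p) * lp_int p a f + ennreal (\<beta> powr p) * lp_int p a g)"
    using \<alpha> p by (simp add: wint_cmult ef eg)
  finally show ?thesis .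
qed

lemma lp_int_times_x:
  fixes f :: "real \<Rightarrow> 'a::banach"
  assumes "0 < p" shows "lp_int p a (\<lambda>x. x *\<^sub>R f x) = lp_int p (a + p) f"
proof -
  have "lp_int p a (\<lambda>x. x *\<^sub>R f x) = wint p a (\<lambda>x. ennreal x * enorm (f x))"
    unfolding lp_int_def by (intro wint_cong_AE AE_I2) (simp add: ennreal_mult)
  then show ?thesis using assms by (simp add: wint_weight lp_int_def)
qed

lemma lp_int_times_power:
  fixes f :: "real \<Rightarrow> 'a::banach"
  assumes "0 < p" shows "lp_int p a (\<lambda>x. x ^ i *\<^sub>R f x) = lp_int p (a + real i * p) f"
proof (induction i arbitrary: a)
  case (Suc i)
  have "lp_int p a (\<lambda>x. x ^ Suc i *\<^sub>R f x) = lp_int p a (\<lambda>x. x *\<^sub>R (x ^ i *\<^sub>R f x))" by simp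
  also have "\<dots> = lp_int p (a + p + real i * p) f" unfolding lp_int_times_x[OF assms] Suc.IH ..
  also have "a + p + real i * p = a + real (Suc i) * p" by (simp add: algebra_simps)
  finally show ?case .
qed simp

lemma strongly_measurable_power_mult:
  "strongly_measurable half_line f \<Longrightarrow> strongly_measurable half_line (\<lambda>x. x ^ i *\<^sub>R f x)"
  by (intro strongly_measurable_scaleR[OF strongly_measurable_continuous]) (auto intro!: continuous_intros)

text \<open>Otherwise the norm of \<open>h\<close> is at least \<open>e / x\<close> near \<open>0\<close>, which is not integrable.\<close>

lemma small_near_0_of_integrable:
  fixes h :: "real \<Rightarrow> 'a::real_normed_vector"
  assumes fin: "norm_int h 0 1 < \<infinity>"
  shows "small_near_0 (\<lambda>x. x *\<^sub>R h x)"
proof (rule ccontr)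
  assume "\<not> ?thesis"
  then obtain e where e: "0 < e" and big: "\<And>x. 0 < x \<Longrightarrow> x < e \<Longrightarrow> e \<le> norm (x *\<^sub>R h x)"
    unfolding small_near_0_def by (force simp: not_less)
  obtain M where M: "norm_int h 0 1 = ennreal M" "0 \<le> M"
    using fin by (cases "\<integral>\<^sup>+x. enorm (h x) * indicator {0<..1} x \<partial>lborel") auto
  define d where "d = min e 1 / 2"
  \<comment> \<open>Chosen so that the integral of \<open>e / x\<close> over \<open>{t..d}\<close> is
    \<open>M + e\<close>, more than the assumed value \<open>M\<close>.\<close>
  define t where "t = d * exp (- (M / e + 1))"
  have d: "0 < d" "d < e" "d \<le> 1" using e by (auto simp: d_def)
  have "0 \<le> M / e" using e M by simp
  then have "exp (- (M / e + 1)) \<le> 1" unfolding exp_le_one_iff by linarith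
  then have td: "0 < t" "t \<le> d" using d by (simp_all add: t_def mult_left_le)
  have "(\<integral>\<^sup>+x. ennreal (e / x) * indicator {t..d} x \<partial>lborel) = ennreal (e * ln d - e * ln t)"
  proof (rule nn_integral_FTC_Icc)
    show "((\<lambda>x. e * ln x) has_real_derivative e / x) (at x)" if "x \<in> {t..d}" for x
    proof -
      have "((\<lambda>x. e * ln x) has_real_derivative e * (1 / x)) (at x)"
        using that td by (intro DERIV_cmult DERIV_ln_divide) auto
      then show ?thesis by simp
    qed
    show "(\<lambda>x. e / x) \<in> borel_measurable borel" by measurable
    show "0 \<le> e / x" if "x \<in> {t..d}" for x using that td e by simp
    show "t \<le> d" by (rule td)
  qed
  also have "e * ln d - e * ln t = M + e"
    using d e by (simp add: t_def ln_mult field_simps)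
  finally have "ennreal (M + e) = (\<integral>\<^sup>+x. ennreal (e / x) * indicator {t..d} x \<partial>lborel)" by simp
  also have "\<dots> \<le> norm_int h 0 1"
  proof (rule nn_integral_mono)
    fix x
    show "ennreal (e / x) * indicator {t..d} x \<le> enorm (h x) * indicator {0<..1} x"
    proof (cases "x \<in> {t..d}")
      case True
      then have x: "0 < x" "x < e" "x \<le> 1" using td d by auto
      have "e / x \<le> norm (h x)" using big[OF x(1,2)] x by (simp add: field_simps)
      then show ?thesis using x True by (auto intro: ennreal_leI)
    qed simp
  qed
  finally show False using M e by simp
qed

text \<open>The constructed solution with its bounds. The statement about \<open>x u'\<close>, where \<open>u' = w - \<mu> u\<close>, is what
starts the induction in \<open>commutator_estimate\<close>: it replaces the Dirichlet condition for \<open>x u'\<close>.\<close>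

lemma resolvent_estimate:
  assumes p: "1 < p" and a: "-1 < a" "a < 2 * p - 1" "a \<noteq> p - 1"
  shows "\<exists>C<\<top>. 1 \<le> C \<and> (\<forall>\<mu> (f :: real \<Rightarrow> 'a::complex_banach) g. 0 < Re \<mu> \<longrightarrow> strongly_measurable half_line f \<longrightarrow>
    g \<in> borel_measurable borel \<longrightarrow> (AE x in half_line. enorm (f x) = g x) \<longrightarrow> lp_int p a f < \<infinity> \<longrightarrow>
    (\<exists>w u. primitive (\<lambda>x. \<mu> *\<^sub>C w x - f x) w \<and> primitive (\<lambda>x. w x - \<mu> *\<^sub>C u x) u \<and> (u \<longlongrightarrow> 0) (at_right 0) \<and>
      (\<forall>x>0. enorm (u x) \<le> backward_exp (Re \<mu>) (forward_exp (Re \<mu>) g) x) \<and>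
      ennreal (Re \<mu> powr (2 * p)) * lp_int p a u \<le> C * lp_int p a f \<and> lp_int p a w < \<infinity> \<and>
      small_near_0 (\<lambda>x. x *\<^sub>R (w x - \<mu> *\<^sub>C u x))))"
proof -
  obtain C where C: "0 < C" and bound: "\<And>c g. 0 < c \<Longrightarrow> g \<in> borel_measurable borel \<Longrightarrow>
    wint p a (\<lambda>x. ennreal (c\<^sup>2) * backward_exp c (forward_exp c g) x) \<le> ennreal C * wint p a g"
    using resolvent_bound[OF p a] by blast
  have p0: "0 < p" using p by simp
  show ?thesis
  proof (intro exI[of _ "ennreal (max 1 C)"] conjI allI impI)
    show "1 \<le> ennreal (max 1 C)" using ennreal_leI[of 1 "max 1 C"] by simp
    fix \<mu> and f :: "real \<Rightarrow> 'a" and g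
    assume \<mu>: "0 < Re \<mu>" and f: "strongly_measurable half_line f" and g[measurable]: "g \<in> borel_measurable borel"
      and fg: "AE x in half_line. enorm (f x) = g x" and fin: "lp_int p a f < \<infinity>"
    define c where "c = Re \<mu>"
    have c: "0 < c" using \<mu> by (simp add: c_def)
    have fwg: "lp_int p a f = wint p a g" unfolding lp_int_def by (rule wint_cong_AE[OF fg])
    have fin_g: "wint p a g < \<infinity>" using fin fwg by simp
    have cancel: "X < \<infinity>" if "ennreal r * X < \<infinity>" "0 < r" for X r
      using that by (auto simp: ennreal_mult_less_top)
    have "wint p a (\<lambda>x. ennreal c * forward_exp c g x) < \<infinity>"
      by (rule le_less_trans[OF forward_exp_bound[OF p a(1) c g]]) (use fin_g in \<open>simp add: ennreal_mult_less_top\<close>)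
    then have "ennreal (c powr p) * wint p a (forward_exp c g) < \<infinity>"
      using c p0 by (simp add: wint_cmult)
    then have F: "wint p a (forward_exp c g) < \<infinity>" by (rule cancel) (use c in simp)
    have eq: "wint p a (\<lambda>x. ennreal (c\<^sup>2) * backward_exp c (forward_exp c g) x) =
      ennreal (c powr (2 * p)) * wint p a (backward_exp c (forward_exp c g))"
      using c p0 by (simp add: wint_cmult powr_powr flip: powr_numeral)
    have "ennreal (c powr (2 * p)) * wint p a (backward_exp c (forward_exp c g)) < \<infinity>"
      unfolding eq[symmetric] by (rule le_less_trans[OF bound[OF c g]]) (use fin_g in \<open>simp add: ennreal_mult_less_top\<close>)
    then have B: "wint p a (backward_exp c (forward_exp c g)) < \<infinity>" by (rule cancel) (use c in simp)
    have fF: "forward_exp c g x < \<infinity>" if "0 < x" for x by (rule forward_exp_finite[OF F c g that])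
    have fB: "backward_exp c (forward_exp c g) x < \<infinity>" if "0 < x" for x
      by (rule backward_exp_finite[OF B c _ that]) measurable
    obtain w u where w: "primitive (\<lambda>x. \<mu> *\<^sub>C w x - f x) w" and u: "primitive (\<lambda>x. w x - \<mu> *\<^sub>C u x) u"
      and wle: "\<And>x. 0 < x \<Longrightarrow> enorm (w x) \<le> forward_exp c g x"
      and ule: "\<And>x. 0 < x \<Longrightarrow> enorm (u x) \<le> backward_exp c (forward_exp c g) x"
      and u0: "(u \<longlongrightarrow> 0) (at_right 0)"
      using resolvent_construction[OF \<mu> f g fg] fF fB unfolding c_def by blast
    have "ennreal (c powr (2 * p)) * lp_int p a u \<le> ennreal (c powr (2 * p)) * wint p a (backward_exp c (forward_exp c g))"
      unfolding lp_int_def using p0 ule by (intro mult_left_mono wint_mono) auto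
    also have "\<dots> \<le> ennreal C * lp_int p a f" unfolding eq[symmetric] fwg by (rule bound[OF c g])
    also have "\<dots> \<le> ennreal (max 1 C) * lp_int p a f" by (intro mult_right_mono ennreal_leI) auto
    finally have 1: "ennreal (c powr (2 * p)) * lp_int p a u \<le> ennreal (max 1 C) * lp_int p a f" .
    have "lp_int p a w \<le> wint p a (forward_exp c g)"
      unfolding lp_int_def using p0 wle by (intro wint_mono) auto
    then have 2: "lp_int p a w < \<infinity>" using F by (rule le_less_trans)
    have "norm_int w 0 1 \<le>
      (\<integral>\<^sup>+y. ennreal (exp c) * (if 0 < y \<and> y \<le> 1 then ennreal (exp (- (c * (1 - y)))) * forward_exp c g y else 0) \<partial>lborel)"
    proof (rule nn_integral_mono)
      fix y
      show "enorm (w y) * indicator {0<..1} y \<le> ennreal (exp c) * (if 0 < y \<and> y \<le> 1 then ennreal (exp (- (c * (1 - y)))) * forward_exp c g y else 0)"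
      proof (cases "0 < y \<and> y \<le> 1")
        case True
        have "1 \<le> exp c * exp (- (c * (1 - y)))" using c True by (simp add: exp_add[symmetric] algebra_simps)
        then have "1 \<le> ennreal (exp c) * ennreal (exp (- (c * (1 - y))))"
          using ennreal_leI[of 1] by (simp flip: ennreal_mult)
        then have "1 * forward_exp c g y \<le> ennreal (exp c) * ennreal (exp (- (c * (1 - y)))) * forward_exp c g y"
          by (rule mult_right_mono) simp
        then have "enorm (w y) \<le> ennreal (exp c) * ennreal (exp (- (c * (1 - y)))) * forward_exp c g y"
          using wle[of y] True unfolding mult_1 by (meson order_trans)
        then show ?thesis using True by (simp add: mult.assoc)
      qed auto
    qed
    also have "\<dots> = ennreal (exp c) * backward_exp c (forward_exp c g) 1"
      unfolding backward_exp_def by (subst nn_integral_cmult) auto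
    also have "\<dots> < \<infinity>" using fB[of 1] by (simp add: ennreal_mult_less_top)
    finally have sw: "small_near_0 (\<lambda>x. x *\<^sub>R w x)" by (rule small_near_0_of_integrable)
    have 3: "small_near_0 (\<lambda>x. x *\<^sub>R (w x - \<mu> *\<^sub>C u x))"
      unfolding small_near_0_def
    proof (intro allI impI)
      fix e :: real assume e: "0 < e"
      have "eventually (\<lambda>x. dist (u x) 0 < 1) (at_right 0)" using u0 by (rule tendstoD) simp
      then obtain d where d: "0 < d" "\<And>x. 0 < x \<Longrightarrow> x < d \<Longrightarrow> norm (u x) < 1"
        by (auto simp: eventually_at_right_field)
      define e' where "e' = min (e / 2) (min d (e / (2 * (cmod \<mu> + 1))))"
      have "0 < cmod \<mu> + 1" by (simp add: add_nonneg_pos)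
      then have e': "0 < e'" using e d by (simp add: e'_def)
      then obtain x where x: "0 < x" "x < e'" "norm (x *\<^sub>R w x) < e'"
        using sw unfolding small_near_0_def by blast
      have "x * (cmod \<mu> + 1) \<le> e / 2"
        using x(2) \<open>0 < cmod \<mu> + 1\<close> by (simp add: e'_def field_simps)
      moreover have "norm (x *\<^sub>R (\<mu> *\<^sub>C u x)) \<le> x * cmod \<mu>"
        using d(2)[of x] x by (simp add: norm_scaleC e'_def mult_left_le)
      moreover have "x * cmod \<mu> \<le> x * (cmod \<mu> + 1)" using x by simp
      moreover have "norm (x *\<^sub>R (w x - \<mu> *\<^sub>C u x)) \<le> norm (x *\<^sub>R w x) + norm (x *\<^sub>R (\<mu> *\<^sub>C u x))"
        by (simp only: scaleR_diff_right norm_triangle_ineq4)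
      ultimately have "norm (x *\<^sub>R (w x - \<mu> *\<^sub>C u x)) < e" using x(3) by (simp add: e'_def)
      moreover have "x < e" using x(2) e by (simp add: e'_def)
      ultimately show "\<exists>x. 0 < x \<and> x < e \<and> norm (x *\<^sub>R (w x - \<mu> *\<^sub>C u x)) < e" using x(1) by blast
    qed
    show "\<exists>w u. primitive (\<lambda>x. \<mu> *\<^sub>C w x - f x) w \<and> primitive (\<lambda>x. w x - \<mu> *\<^sub>C u x) u \<and> (u \<longlongrightarrow> 0) (at_right 0) \<and>
      (\<forall>x>0. enorm (u x) \<le> backward_exp (Re \<mu>) (forward_exp (Re \<mu>) g) x) \<and>
      ennreal (Re \<mu> powr (2 * p)) * lp_int p a u \<le> ennreal (max 1 C) * lp_int p a f \<and> lp_int p a w < \<infinity> \<and>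
      small_near_0 (\<lambda>x. x *\<^sub>R (w x - \<mu> *\<^sub>C u x))"
      using w u u0 ule 1 2 3 unfolding c_def by blast
  qed simp
qed

lemma small_near_0_tendsto_diff:
  assumes U: "small_near_0 U" and u: "(u \<longlongrightarrow> 0) (at_right 0)"
  shows "small_near_0 (\<lambda>x. U x - u x)"
  unfolding small_near_0_def
proof (intro allI impI)
  fix e :: real assume e: "0 < e"
  have "eventually (\<lambda>x. dist (u x) 0 < e / 2) (at_right 0)" using u by (rule tendstoD) (use e in simp)
  then obtain d where d: "0 < d" "\<And>x. 0 < x \<Longrightarrow> x < d \<Longrightarrow> norm (u x) < e / 2"
    by (auto simp: eventually_at_right_field)
  obtain x where x: "0 < x" "x < min d (e / 2)" "norm (U x) < min d (e / 2)"
    using U[unfolded small_near_0_def, rule_format, of "min d (e / 2)"] d e by auto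
  then have "norm (U x - u x) < e" using d(2)[of x] norm_triangle_ineq4[of "U x" "u x"] by auto
  then show "\<exists>x. 0 < x \<and> x < e \<and> norm (U x - u x) < e" using x e by auto
qed

lemma primitive_times_x:
  fixes f F :: "real \<Rightarrow> 'a::complex_banach"
  assumes "primitive f F" shows "primitive (\<lambda>x. x *\<^sub>R f x + F x) (\<lambda>x. x *\<^sub>R F x)"
proof -
  have "primitive (\<lambda>x. complex_of_real x *\<^sub>C f x + 1 *\<^sub>C F x) (\<lambda>x. complex_of_real x *\<^sub>C F x)"
    by (rule primitive_product[OF assms]) (auto intro!: derivative_eq_intros)
  then show ?thesis by (simp add: scaleC_real)
qed

text \<open>The difference solves the homogeneous equation; that its derivative vanishes too is seen by comparing
the primitives \<open>0\<close> and \<open>x e\<close> of the constant \<open>e\<close>.\<close>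

lemma solution_unique:
  fixes f :: "real \<Rightarrow> 'a::complex_banach"
  assumes \<mu>: "0 < Re \<mu>" and p: "0 < p"
    and U0: "primitive U1 U0" and U1: "primitive (\<lambda>x. \<mu>\<^sup>2 *\<^sub>C U0 x - f x) U1"
    and V0: "primitive V1 V0" and V1: "primitive (\<lambda>x. \<mu>\<^sup>2 *\<^sub>C V0 x - f x) V1"
    and near: "small_near_0 (\<lambda>x. U0 x - V0 x)" and inf: "tail_int_finite p (\<lambda>x. U0 x - V0 x)" and x: "0 < x"
  shows "U0 x = V0 x" "U1 x = V1 x"
proof -
  have D: "primitive (\<lambda>x. U1 x - V1 x) (\<lambda>x. U0 x - V0 x)" by (rule primitive_diff[OF U0 V0])
  have "primitive (\<lambda>x. (\<mu>\<^sup>2 *\<^sub>C U0 x - f x) - (\<mu>\<^sup>2 *\<^sub>C V0 x - f x)) (\<lambda>x. U1 x - V1 x)"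
    by (rule primitive_diff[OF U1 V1])
  then have E: "primitive (\<lambda>x. \<mu>\<^sup>2 *\<^sub>C (U0 x - V0 x)) (\<lambda>x. U1 x - V1 x)"
    by (simp add: scaleC.diff_right)
  have zero: "U0 x - V0 x = 0" if "0 < x" for x
    by (rule homogeneous_solution_zero[OF \<mu> p D E near inf that])
  then show "U0 x = V0 x" using x by simp
  have "primitive (\<lambda>x. 0) (\<lambda>x. U1 x - V1 x)"
    by (rule primitive_cong[OF E]) (use zero in \<open>auto intro!: AE_I2\<close>)
  note const = primitive_zero_const[OF this]
  define e where "e = U1 1 - V1 1"
  have e: "U1 x - V1 x = e" if "0 < x" for x unfolding e_def using const[OF that zero_less_one] .
  have "primitive (\<lambda>x. e) (\<lambda>x. 0)"
    by (rule primitive_cong[OF D]) (use zero e in \<open>auto intro!: AE_I2\<close>)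
  moreover have "primitive (\<lambda>x. e) (\<lambda>x. x *\<^sub>R e)" using primitive_times_x[OF primitive_const[of e]] by simp
  ultimately have P: "primitive (\<lambda>x. e) (\<lambda>x. 0)" "primitive (\<lambda>x. e) (\<lambda>x. x *\<^sub>R e)" by blast+
  have "has_Bochner_integral half_line (\<lambda>x. indicator {1<..2} x *\<^sub>R e) (0 - 0)"
    "has_Bochner_integral half_line (\<lambda>x. indicator {1<..2} x *\<^sub>R e) (2 *\<^sub>R e - 1 *\<^sub>R e)"
    using P(1)[unfolded primitive_def, THEN conjunct2, rule_format, of 1 2]
      P(2)[unfolded primitive_def, THEN conjunct2, rule_format, of 1 2] by simp_all
  from has_Bochner_integral_unique[OF this] have "2 *\<^sub>R e - 1 *\<^sub>R e = 0" by simp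
  then have "e = 0" by (simp only: scaleR_diff_left[symmetric]) simp
  then show "U1 x = V1 x" using e[OF x] by simp
qed

section \<open>Commuting the equation with the Euler operator\<close>

text \<open>The sum of the norms of \<open>x\<^sup>i \<partial>\<^sup>i f\<close> for \<open>i \<le> m\<close> in one and the same weight, all of whose terms
scale alike under dilations; it is natural for the Euler operator \<open>x \<partial>\<close>.\<close>

definition energy :: "real \<Rightarrow> real \<Rightarrow> nat \<Rightarrow> (nat \<Rightarrow> real \<Rightarrow> 'a::banach) \<Rightarrow> ennreal" where
  "energy p a m F = (\<Sum>i\<le>m. lp_int p a (\<lambda>x. x ^ i *\<^sub>R F i x))"

lemma energy_ge: "i \<le> m \<Longrightarrow> lp_int p a (\<lambda>x. x ^ i *\<^sub>R F i x) \<le> energy p a m F"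
  unfolding energy_def by (rule member_le_sum) auto

lemma energy_le: "(\<And>i. i \<le> m \<Longrightarrow> lp_int p a (\<lambda>x. x ^ i *\<^sub>R F i x) \<le> B) \<Longrightarrow> energy p a m F \<le> of_nat (Suc m) * B"
  unfolding energy_def using sum_bounded_above[of "{..m}" "\<lambda>i. lp_int p a (\<lambda>x. x ^ i *\<^sub>R F i x)" B] by simp

lemma energy_mono: "m \<le> n \<Longrightarrow> energy p a m F \<le> energy p a n F"
  unfolding energy_def by (rule sum_mono2) auto

lemma primitive_continuous_sm: "primitive f F \<Longrightarrow> strongly_measurable half_line F"
  by (intro strongly_measurable_continuous primitive_continuous)

text \<open>For \<open>m = \<bar>\<mu>\<bar>\<close> and \<open>c = Re \<mu>\<close>, which are comparable in the sector.\<close>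

lemma ennreal_powr_transfer:
  assumes \<kappa>: "0 < \<kappa>" and le: "\<kappa> * m \<le> c" "0 < c" "0 \<le> m" and q: "0 \<le> q"
  shows "ennreal (m powr q) \<le> ennreal (\<kappa> powr (- q)) * ennreal (c powr q)"
proof -
  have "(\<kappa> * m) powr q \<le> c powr q" using le \<kappa> q by (intro powr_mono2) auto
  then have "\<kappa> powr (- q) * (\<kappa> powr q * m powr q) \<le> \<kappa> powr (- q) * c powr q"
    using \<kappa> le by (intro mult_left_mono) (auto simp: powr_mult)
  moreover have "\<kappa> powr (- q) * (\<kappa> powr q * m powr q) = m powr q" using \<kappa> by (simp add: powr_minus)
  ultimately have "m powr q \<le> \<kappa> powr (- q) * c powr q" by simp
  then show ?thesis by (subst ennreal_mult[symmetric]) (auto intro: ennreal_leI)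
qed

text \<open>Induction on \<open>m\<close>. For \<open>m = 0\<close> the given solution is the constructed one by uniqueness. For the step,
\<open>V = x U'\<close> solves \<open>\<mu>\<^sup>2 V - V'' = G\<close> with \<open>G = x F' + 2 F - 2 \<mu>\<^sup>2 U\<close>; the induction hypothesis for
\<open>(U, F)\<close> bounds the term with \<open>\<mu>\<^sup>2 U\<close>, the one for \<open>(V, G)\<close> bounds \<open>V\<close> up to order \<open>m\<close>, and
\<open>x\<^sup>i V\<^sup>(\<^sup>i\<^sup>) = x\<^sup>i\<^sup>+\<^sup>1 U\<^sup>(\<^sup>i\<^sup>+\<^sup>1\<^sup>) + i x\<^sup>i U\<^sup>(\<^sup>i\<^sup>)\<close> recovers \<open>U\<close> up to order \<open>m + 1\<close>. The hypotheses
\<open>small_near_0\<close> and \<open>tail_int_finite\<close> hold for \<open>V\<close> by \<open>resolvent_estimate\<close>.\<close>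

lemma commutator_estimate:
  fixes p a \<kappa> :: real
  assumes p: "1 < p" and a: "-1 < a" "a < 2 * p - 1" "a \<noteq> p - 1" and \<kappa>: "0 < \<kappa>"
  shows "\<exists>C<\<top>. 1 \<le> C \<and> (\<forall>\<mu> (F :: nat \<Rightarrow> real \<Rightarrow> 'a::complex_banach) U.
    0 < Re \<mu> \<longrightarrow> \<kappa> * cmod \<mu> \<le> Re \<mu> \<longrightarrow> primitive_chain m F \<longrightarrow> (\<forall>i<m+2. primitive (U (Suc i)) (U i)) \<longrightarrow>
    (\<forall>i\<le>m. \<forall>x>0. U (i + 2) x = \<mu>\<^sup>2 *\<^sub>C U i x - F i x) \<longrightarrow> small_near_0 (U 0) \<longrightarrow> tail_int_finite p (U 0) \<longrightarrow>
    ennreal (cmod \<mu> powr (2 * p)) * energy p a m U \<le> C * energy p a m F)"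
proof -
  have p0: "0 < p" using p by simp
  obtain C0 where C0: "C0 < \<top>" "1 \<le> C0" and est: "\<And>\<mu> (f :: real \<Rightarrow> 'a) g. 0 < Re \<mu> \<Longrightarrow> strongly_measurable half_line f \<Longrightarrow>
    g \<in> borel_measurable borel \<Longrightarrow> (AE x in half_line. enorm (f x) = g x) \<Longrightarrow> lp_int p a f < \<infinity> \<Longrightarrow>
    (\<exists>w u. primitive (\<lambda>x. \<mu> *\<^sub>C w x - f x) w \<and> primitive (\<lambda>x. w x - \<mu> *\<^sub>C u x) u \<and> (u \<longlongrightarrow> 0) (at_right 0) \<and>
      (\<forall>x>0. enorm (u x) \<le> backward_exp (Re \<mu>) (forward_exp (Re \<mu>) g) x) \<and>
      ennreal (Re \<mu> powr (2 * p)) * lp_int p a u \<le> C0 * lp_int p a f \<and> lp_int p a w < \<infinity> \<and>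
      small_near_0 (\<lambda>x. x *\<^sub>R (w x - \<mu> *\<^sub>C u x)))"
    using resolvent_estimate[OF p a] by blast
  define K where "K = ennreal (\<kappa> powr (- (2 * p)))"
  \<comment> \<open>The case of order zero, for any solution: it agrees with the constructed one.\<close>
  have order0: "ennreal (cmod \<mu> powr (2 * p)) * lp_int p a U0 \<le> K * C0 * lp_int p a f \<and> lp_int p a U1 < \<infinity> \<and> small_near_0 (\<lambda>x. x *\<^sub>R U1 x)"
    if \<mu>: "0 < Re \<mu>" "\<kappa> * cmod \<mu> \<le> Re \<mu>" and f: "strongly_measurable half_line f" "lp_int p a f < \<infinity>"
      and U0: "primitive U1 U0" and U1: "primitive (\<lambda>x. \<mu>\<^sup>2 *\<^sub>C U0 x - f x) U1"
      and near: "small_near_0 U0" and inf: "tail_int_finite p U0"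
    for \<mu> and f U0 U1 :: "real \<Rightarrow> 'a"
  proof -
    obtain g where g: "g \<in> borel_measurable borel" "AE x in half_line. enorm (f x) = g x"
      using strongly_measurable_borel_rep[OF f(1)] by blast
    obtain w u where w: "primitive (\<lambda>x. \<mu> *\<^sub>C w x - f x) w" and u: "primitive (\<lambda>x. w x - \<mu> *\<^sub>C u x) u"
      and u0: "(u \<longlongrightarrow> 0) (at_right 0)"
      and ub: "ennreal (Re \<mu> powr (2 * p)) * lp_int p a u \<le> C0 * lp_int p a f" and wb: "lp_int p a w < \<infinity>"
      and sw: "small_near_0 (\<lambda>x. x *\<^sub>R (w x - \<mu> *\<^sub>C u x))"
      using est[OF \<mu>(1) f(1) g f(2)] by blast
    have V1: "primitive (\<lambda>x. \<mu>\<^sup>2 *\<^sub>C u x - f x) (\<lambda>x. w x - \<mu> *\<^sub>C u x)"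
    proof -
      have "primitive (\<lambda>x. (\<mu> *\<^sub>C w x - f x) - \<mu> *\<^sub>C (w x - \<mu> *\<^sub>C u x)) (\<lambda>x. w x - \<mu> *\<^sub>C u x)"
        by (intro primitive_diff w primitive_scaleC u)
      then show ?thesis by (simp add: scaleC.diff_right scaleC_scaleC power2_eq_square)
    qed
    have uf: "lp_int p a u < \<infinity>"
    proof -
      have "ennreal (Re \<mu> powr (2 * p)) * lp_int p a u < \<infinity>"
        by (rule le_less_trans[OF ub]) (use C0 f in \<open>simp add: ennreal_mult_less_top\<close>)
      then show ?thesis using \<mu> by (auto simp: ennreal_mult_less_top)
    qed
    have us: "strongly_measurable half_line u" "strongly_measurable half_line w"
      using primitive_continuous_sm u w by blast+
    have tf: "tail_int_finite p (\<lambda>x. U0 x - u x)"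
      by (intro tail_int_finite_diff inf lp_int_tail_int_finite[OF uf] us primitive_continuous_sm[OF U0] p0)
    have eq0: "U0 x = u x" and eq1: "U1 x = w x - \<mu> *\<^sub>C u x" if "0 < x" for x
      using solution_unique[OF \<mu>(1) p0 U0 U1 u V1 small_near_0_tendsto_diff[OF near u0] tf that] by auto
    have l0: "lp_int p a U0 = lp_int p a u" by (rule lp_int_cong) (auto intro!: AE_I2 simp: eq0)
    have "ennreal (cmod \<mu> powr (2 * p)) \<le> K * ennreal (Re \<mu> powr (2 * p))"
      unfolding K_def using \<mu> \<kappa> p0 by (intro ennreal_powr_transfer) auto
    then have "ennreal (cmod \<mu> powr (2 * p)) * lp_int p a U0 \<le> K * ennreal (Re \<mu> powr (2 * p)) * lp_int p a u"
      unfolding l0 by (rule mult_right_mono) simp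
    also have "\<dots> \<le> K * (C0 * lp_int p a f)" unfolding mult.assoc by (intro mult_left_mono ub) simp
    finally have 1: "ennreal (cmod \<mu> powr (2 * p)) * lp_int p a U0 \<le> K * C0 * lp_int p a f" by (simp add: mult.assoc)
    have "lp_int p a U1 \<le> ennreal (2 powr p) * (ennreal (1 powr p) * lp_int p a w + ennreal (cmod \<mu> powr p) * lp_int p a u)"
    proof (rule lp_int_triangle[OF p0 us(2,1)])
      fix x :: real assume "0 < x"
      then show "norm (U1 x) \<le> 1 * norm (w x) + cmod \<mu> * norm (u x)"
        using norm_triangle_ineq4[of "w x" "\<mu> *\<^sub>C u x"] by (simp add: eq1 norm_scaleC)
    qed auto
    also have "\<dots> < \<infinity>" using wb uf by (simp add: ennreal_mult_less_top)
    finally have 2: "lp_int p a U1 < \<infinity>" .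
    have 3: "small_near_0 (\<lambda>x. x *\<^sub>R U1 x)" using sw eq1 unfolding small_near_0_def by metis
    show ?thesis using 1 2 3 by blast
  qed
  show ?thesis
  proof (induction m)
    case 0
    show ?case
    proof (intro exI[of _ "max 1 (K * C0)"] conjI allI impI)
      show "max 1 (K * C0) < \<top>" using C0 by (simp add: K_def ennreal_mult_less_top max_def)
      fix \<mu> and F U :: "nat \<Rightarrow> real \<Rightarrow> 'a"
      assume \<mu>: "0 < Re \<mu>" "\<kappa> * cmod \<mu> \<le> Re \<mu>" and F: "primitive_chain 0 F" and U: "\<forall>i<0+2. primitive (U (Suc i)) (U i)"
        and eq: "\<forall>i\<le>0. \<forall>x>0. U (i + 2) x = \<mu>\<^sup>2 *\<^sub>C U i x - F i x"
        and near: "small_near_0 (U 0)" and inf: "tail_int_finite p (U 0)"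
      have Fm: "strongly_measurable half_line (F 0)" using F by (simp add: primitive_chain_def locally_integrable_def)
      have U01: "primitive (U 1) (U 0)" "primitive (U 2) (U 1)" using U[rule_format, of 0] U[rule_format, of 1] by (simp_all add: numeral_2_eq_2)
      have U1: "primitive (\<lambda>x. \<mu>\<^sup>2 *\<^sub>C U 0 x - F 0 x) (U 1)"
      proof (rule primitive_cong[OF U01(2)])
        show "AE x in half_line. U 2 x = \<mu>\<^sup>2 *\<^sub>C U 0 x - F 0 x"
        proof (rule AE_I2)
          fix x assume "x \<in> space half_line"
          then have "U (0 + 2) x = \<mu>\<^sup>2 *\<^sub>C U 0 x - F 0 x" by (intro eq[rule_format]) auto
          then show "U 2 x = \<mu>\<^sup>2 *\<^sub>C U 0 x - F 0 x" unfolding add_0 .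
        qed
      qed simp
      show "ennreal (cmod \<mu> powr (2 * p)) * energy p a 0 U \<le> max 1 (K * C0) * energy p a 0 F"
      proof (cases "lp_int p a (F 0) < \<infinity>")
        case True
        have "ennreal (cmod \<mu> powr (2 * p)) * lp_int p a (U 0) \<le> K * C0 * lp_int p a (F 0)"
          using order0[OF \<mu> Fm True U01(1) U1 near inf] by blast
        also have "\<dots> \<le> max 1 (K * C0) * lp_int p a (F 0)" by (intro mult_right_mono) auto
        finally show ?thesis by (simp add: energy_def)
      next
        case False
        then have "energy p a 0 F = \<top>" by (simp add: energy_def not_less top_unique)
        moreover have "max 1 (K * C0) \<noteq> 0" using max.cobounded1[of 1 "K * C0"] by (metis le_zero_eq zero_neq_one)
        ultimately show ?thesis by (simp add: ennreal_mult_top)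
      qed
    qed simp
  next
    case (Suc m)
    then obtain C where C: "C < \<top>" "1 \<le> C" and IH: "\<And>\<mu> (F :: nat \<Rightarrow> real \<Rightarrow> 'a) U.
        0 < Re \<mu> \<Longrightarrow> \<kappa> * cmod \<mu> \<le> Re \<mu> \<Longrightarrow> primitive_chain m F \<Longrightarrow> (\<forall>i<m+2. primitive (U (Suc i)) (U i)) \<Longrightarrow>
        (\<forall>i\<le>m. \<forall>x>0. U (i + 2) x = \<mu>\<^sup>2 *\<^sub>C U i x - F i x) \<Longrightarrow> small_near_0 (U 0) \<Longrightarrow> tail_int_finite p (U 0) \<Longrightarrow>
        ennreal (cmod \<mu> powr (2 * p)) * energy p a m U \<le> C * energy p a m F"
      by blast
    define P where "P = ennreal (2 powr p)"
    define N where "N = ennreal (real (m + 2) powr p)"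
    define A where "A = of_nat (Suc m) * (P * (1 + P * (N + P)))"
    define B where "B = of_nat (Suc m) * (P * (1 + N))"
    define C' where "C' = C + B * (C * (A * (1 + C)) + C)"
    have PN: "P < \<top>" "N < \<top>" by (auto simp: P_def N_def)
    then have AB: "A < \<top>" "B < \<top>" by (auto simp: A_def B_def ennreal_mult_less_top of_nat_less_top)
    show ?case
    proof (intro exI[of _ C'] conjI allI impI)
      show "C' < \<top>" unfolding C'_def using AB C by (simp add: ennreal_mult_less_top)
      show "1 \<le> C'" unfolding C'_def using C(2) by (rule add_increasing2[rotated]) simp
      fix \<mu> and F U :: "nat \<Rightarrow> real \<Rightarrow> 'a"
      assume \<mu>: "0 < Re \<mu>" "\<kappa> * cmod \<mu> \<le> Re \<mu>" and F: "primitive_chain (Suc m) F" and U: "\<forall>i<Suc m+2. primitive (U (Suc i)) (U i)"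
        and eq: "\<forall>i\<le>Suc m. \<forall>x>0. U (i + 2) x = \<mu>\<^sup>2 *\<^sub>C U i x - F i x"
        and near: "small_near_0 (U 0)" and inf: "tail_int_finite p (U 0)"
      define L where "L = ennreal (cmod \<mu> powr (2 * p))"
      define EF where "EF = energy p a (Suc m) F"
      have Fl: "locally_integrable (F i)" if "i \<le> Suc m" for i by (rule primitive_chain_locally_integrable[OF F that])
      have Fp: "primitive (F (Suc i)) (F i)" if "i < Suc m" for i using F that by (simp add: primitive_chain_def)
      have Fm: "strongly_measurable half_line (F i)" if "i \<le> Suc m" for i using Fl[OF that] by (simp add: locally_integrable_def)
      have Up: "primitive (U (Suc i)) (U i)" if "i < Suc m + 2" for i using U that by blast
      have Um: "strongly_measurable half_line (U i)" if "i < Suc m + 2" for i by (rule primitive_continuous_sm[OF Up[OF that]])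
      have Ul: "locally_integrable (U i)" if "i < Suc m + 2" for i by (intro continuous_locally_integrable primitive_continuous[OF Up[OF that]])
      show "ennreal (cmod \<mu> powr (2 * p)) * energy p a (Suc m) U \<le> C' * energy p a (Suc m) F"
      proof (cases "EF < \<infinity>")
        case False
        then have "EF = \<top>" by (simp add: not_less top_unique)
        moreover have "C' \<noteq> 0" using \<open>1 \<le> C'\<close> by auto
        ultimately show ?thesis by (simp add: EF_def ennreal_mult_top)
      next
        case True
        have "lp_int p a (\<lambda>x. x ^ 0 *\<^sub>R F 0 x) \<le> EF" unfolding EF_def by (rule energy_ge) simp
        then have F0: "lp_int p a (F 0) < \<infinity>" using True by simp
        have U1: "primitive (\<lambda>x. \<mu>\<^sup>2 *\<^sub>C U 0 x - F 0 x) (U 1)"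
        proof (rule primitive_cong)
          show "primitive (U 2) (U 1)" using Up[of 1] by (simp add: numeral_2_eq_2)
          show "AE x in half_line. U 2 x = \<mu>\<^sup>2 *\<^sub>C U 0 x - F 0 x"
          proof (rule AE_I2)
            fix x assume "x \<in> space half_line"
            then have "U (0 + 2) x = \<mu>\<^sup>2 *\<^sub>C U 0 x - F 0 x" by (intro eq[rule_format]) auto
            then show "U 2 x = \<mu>\<^sup>2 *\<^sub>C U 0 x - F 0 x" unfolding add_0 .
          qed
        qed simp
        have U1b: "lp_int p a (U 1) < \<infinity>" and sU1: "small_near_0 (\<lambda>x. x *\<^sub>R U 1 x)"
          using order0[OF \<mu> Fm F0 _ U1 near inf] Up[of 0] by auto
        \<comment> \<open>\<open>V i\<close> is the \<open>i\<close>-th derivative of \<open>x U'\<close>, and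
          \<open>G i\<close> that of \<open>x F' + 2 F - 2 \<mu>\<^sup>2 U\<close>, by the Leibniz rule.\<close>
        define V where "V i x = x *\<^sub>R U (Suc i) x + real i *\<^sub>R U i x" for i x
        define G where "G i x = x *\<^sub>R F (Suc i) x + (real i + 2) *\<^sub>R F i x - (2 * \<mu>\<^sup>2) *\<^sub>C U i x" for i x
        have VP: "primitive (V (Suc i)) (V i)" if "i < m + 2" for i
        proof -
          have "primitive (\<lambda>x. (x *\<^sub>R U (Suc (Suc i)) x + U (Suc i) x) + real i *\<^sub>R U (Suc i) x) (V i)"
            unfolding V_def using that by (intro primitive_add primitive_times_x primitive_linear[OF bounded_linear_scaleR_right] Up) auto
          then show ?thesis
            by (rule primitive_cong) (auto intro!: AE_I2 simp: V_def scaleR_add_left)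
        qed
        have GP: "primitive (G (Suc i)) (G i)" if "i < m" for i
        proof -
          have "primitive (\<lambda>x. (x *\<^sub>R F (Suc (Suc i)) x + F (Suc i) x) + (real i + 2) *\<^sub>R F (Suc i) x - (2 * \<mu>\<^sup>2) *\<^sub>C U (Suc i) x) (G i)"
            unfolding G_def using that
            by (intro primitive_diff primitive_add primitive_times_x primitive_scaleC primitive_linear[OF bounded_linear_scaleR_right] Up Fp) auto
          then show ?thesis
          proof (rule primitive_cong)
            have three: "v + 2 *\<^sub>R v = 3 *\<^sub>R v" for v :: 'a using scaleR_add_left[of 1 2 v] by simp
            show "AE x in half_line. (x *\<^sub>R F (Suc (Suc i)) x + F (Suc i) x) + (real i + 2) *\<^sub>R F (Suc i) x - (2 * \<mu>\<^sup>2) *\<^sub>C U (Suc i) x = G (Suc i) x"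
              by (rule AE_I2) (simp add: G_def scaleR_add_left three)
          qed simp
        qed
        have Gl: "locally_integrable (G m)"
        proof -
          have "locally_integrable (\<lambda>x. complex_of_real x *\<^sub>C F (Suc m) x + (complex_of_real (real m + 2) *\<^sub>C F m x + (- (2 * \<mu>\<^sup>2)) *\<^sub>C U m x))"
            by (intro locally_integrable_add locally_integrable_scaleC continuous_intros Fl Ul) auto
          then show ?thesis unfolding G_def scaleC_real by (simp add: algebra_simps)
        qed
        have GC: "primitive_chain m G" unfolding primitive_chain_def using Gl GP by blast
        have VG: "\<forall>i\<le>m. \<forall>x>0. V (i + 2) x = \<mu>\<^sup>2 *\<^sub>C V i x - G i x"
        proof (intro allI impI)
          fix i x assume i: "i \<le> m" and x: "(0::real) < x"
          have e1: "U (Suc (i + 2)) x = \<mu>\<^sup>2 *\<^sub>C U (Suc i) x - F (Suc i) x" using eq[rule_format, of "Suc i" x] i x by simp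
          have e2: "U (i + 2) x = \<mu>\<^sup>2 *\<^sub>C U i x - F i x" using eq[rule_format, of i x] i x by simp
          have "(2 * \<mu>\<^sup>2) *\<^sub>C U i x = 2 *\<^sub>R (\<mu>\<^sup>2 *\<^sub>C U i x)"
          proof -
            have "2 *\<^sub>C v = 2 *\<^sub>R v" for v :: 'a using scaleC_of_real[of 2 v] by simp
            then show ?thesis by (simp only: scaleC_scaleC[symmetric])
          qed
          then show "V (i + 2) x = \<mu>\<^sup>2 *\<^sub>C V i x - G i x"
            unfolding V_def G_def e1 e2
            by (simp add: scaleC_add_right scaleC.scaleR_right scaleR_diff_right scaleR_add_left algebra_simps)
        qed
        have Vnear: "small_near_0 (V 0)" using sU1 by (simp add: V_def[abs_def])
        \<comment> \<open>\<open>x U'\<close> is \<open>p\<close>-integrable in the weight \<open>a - p\<close>,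
          because \<open>U'\<close> is in the weight \<open>a\<close>.\<close>
        have Vinf: "tail_int_finite p (V 0)"
          using U1b lp_int_times_x[OF p0, of "a - p" "U 1"] by (intro lp_int_tail_int_finite[of p "a - p"]) (simp add: V_def[abs_def])
        have "L * energy p a m V \<le> C * energy p a m G"
          unfolding L_def using VP VG by (intro IH[of \<mu> G V, OF \<mu> GC _ _ Vnear Vinf]) auto
        moreover have LU: "L * energy p a m U \<le> C * EF"
        proof -
          have "L * energy p a m U \<le> C * energy p a m F" unfolding L_def
          proof (rule IH[of \<mu> F U, OF \<mu> _ _ _ near inf])
            show "primitive_chain m F" unfolding primitive_chain_def using Fl Fp by simp
          qed (use Up eq in auto)
          also have "\<dots> \<le> C * EF" unfolding EF_def by (intro mult_left_mono energy_mono) auto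
          finally show ?thesis .
        qed
        moreover have EG: "energy p a m G \<le> A * (EF + L * energy p a m U)"
        proof -
          have "lp_int p a (\<lambda>x. x ^ i *\<^sub>R G i x) \<le> P * (1 + P * (N + P)) * (EF + L * energy p a m U)" if i: "i \<le> m" for i
          proof -
            let ?k = "\<lambda>x. x ^ i *\<^sub>R ((real i + 2) *\<^sub>R F i x - (2 * \<mu>\<^sup>2) *\<^sub>C U i x)"
            have sF: "strongly_measurable half_line (\<lambda>x. x ^ i *\<^sub>R F i x)" using i by (intro strongly_measurable_power_mult Fm) auto
            have sU: "strongly_measurable half_line (\<lambda>x. x ^ i *\<^sub>R U i x)" using i by (intro strongly_measurable_power_mult Um) auto
            have sF': "strongly_measurable half_line (\<lambda>x. x ^ Suc i *\<^sub>R F (Suc i) x)" using i by (intro strongly_measurable_power_mult Fm) auto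
            have sk: "strongly_measurable half_line ?k"
              using i by (intro strongly_measurable_power_mult strongly_measurable_diff
                  strongly_measurable_linear[OF bounded_linear_scaleR_right] strongly_measurable_linear[OF scaleC.bounded_linear_right] Fm Um) auto
            have "lp_int p a ?k \<le> P * (ennreal ((real i + 2) powr p) * lp_int p a (\<lambda>x. x ^ i *\<^sub>R F i x)
               + ennreal ((2 * cmod \<mu> ^ 2) powr p) * lp_int p a (\<lambda>x. x ^ i *\<^sub>R U i x))"
              unfolding P_def
            proof (rule lp_int_triangle[OF p0 sF sU])
              fix x :: real assume x: "0 < x"
              have "norm (?k x) = norm ((real i + 2) *\<^sub>R (x ^ i *\<^sub>R F i x) - (2 * \<mu>\<^sup>2) *\<^sub>C (x ^ i *\<^sub>R U i x))"
                by (simp add: scaleR_diff_right scaleC.scaleR_right mult.commute)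
              also have "\<dots> \<le> norm ((real i + 2) *\<^sub>R (x ^ i *\<^sub>R F i x)) + norm ((2 * \<mu>\<^sup>2) *\<^sub>C (x ^ i *\<^sub>R U i x))"
                by (rule norm_triangle_ineq4)
              also have "\<dots> = (real i + 2) * norm (x ^ i *\<^sub>R F i x) + 2 * cmod \<mu> ^ 2 * norm (x ^ i *\<^sub>R U i x)"
              proof -
                have "norm ((real i + 2) *\<^sub>R v) = (real i + 2) * norm v" for v :: 'a by simp
                moreover have "norm ((2 * \<mu>\<^sup>2) *\<^sub>C v) = 2 * cmod \<mu> ^ 2 * norm v" for v :: 'a
                  by (simp add: norm_scaleC norm_mult norm_power)
                ultimately show ?thesis by (simp only:)
              qed
              finally show "norm (?k x) \<le> (real i + 2) * norm (x ^ i *\<^sub>R F i x) + 2 * cmod \<mu> ^ 2 * norm (x ^ i *\<^sub>R U i x)" .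
            qed auto
            also have "\<dots> \<le> P * (N * EF + (P * L) * energy p a m U)"
            proof (intro mult_left_mono add_mono mult_mono)
              show "ennreal ((real i + 2) powr p) \<le> N" unfolding N_def using i p0 by (intro ennreal_leI powr_mono2) auto
              show "lp_int p a (\<lambda>x. x ^ i *\<^sub>R F i x) \<le> EF" unfolding EF_def using i by (intro energy_ge) simp
              have "(2 * (cmod \<mu>)\<^sup>2) powr p = 2 powr p * cmod \<mu> powr (2 * p)"
                using \<mu> by (simp add: powr_mult powr_powr flip: powr_numeral)
              then show "ennreal ((2 * (cmod \<mu>)\<^sup>2) powr p) \<le> P * L" by (simp add: P_def L_def ennreal_mult)
              show "lp_int p a (\<lambda>x. x ^ i *\<^sub>R U i x) \<le> energy p a m U" by (rule energy_ge[OF i])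
            qed auto
            also have "\<dots> \<le> P * ((N + P) * (EF + L * energy p a m U))"
              by (intro mult_left_mono) (auto simp: algebra_simps add_increasing2)
            finally have k: "lp_int p a ?k \<le> P * ((N + P) * (EF + L * energy p a m U))" .
            have "lp_int p a (\<lambda>x. x ^ i *\<^sub>R G i x) \<le> P * (ennreal (1 powr p) * lp_int p a (\<lambda>x. x ^ Suc i *\<^sub>R F (Suc i) x) + ennreal (1 powr p) * lp_int p a ?k)"
              unfolding P_def
            proof (rule lp_int_triangle[OF p0 sF' sk])
              fix x :: real assume x: "0 < x"
              have "x ^ i *\<^sub>R G i x = x ^ Suc i *\<^sub>R F (Suc i) x + ?k x"
                by (simp add: G_def scaleR_diff_right scaleR_add_right mult.commute add_diff_eq)
              then show "norm (x ^ i *\<^sub>R G i x) \<le> 1 * norm (x ^ Suc i *\<^sub>R F (Suc i) x) + 1 * norm (?k x)"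
                by (simp only: mult_1 norm_triangle_ineq)
            qed auto
            also have "\<dots> \<le> P * (1 * EF + 1 * (P * ((N + P) * (EF + L * energy p a m U))))"
            proof (intro mult_left_mono add_mono mult_mono k)
              show "lp_int p a (\<lambda>x. x ^ Suc i *\<^sub>R F (Suc i) x) \<le> EF" unfolding EF_def using i by (intro energy_ge) simp
            qed auto
            also have "\<dots> \<le> P * (1 * (EF + L * energy p a m U) + 1 * (P * ((N + P) * (EF + L * energy p a m U))))"
              by (intro mult_left_mono add_mono) auto
            finally show ?thesis by (simp only: mult_1 distrib_right mult.assoc distrib_left add_ac)
          qed
          from energy_le[of m, OF this] show ?thesis by (simp add: A_def mult.assoc)
        qed
        moreover have EU: "energy p a (Suc m) U \<le> energy p a m U + B * (energy p a m V + energy p a m U)"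
        proof -
          have "lp_int p a (\<lambda>x. x ^ Suc i *\<^sub>R U (Suc i) x) \<le> P * (1 + N) * (energy p a m V + energy p a m U)" if i: "i \<le> m" for i
          proof -
            have sU: "strongly_measurable half_line (\<lambda>x. x ^ i *\<^sub>R U i x)" using i by (intro strongly_measurable_power_mult Um) auto
            have sV: "strongly_measurable half_line (\<lambda>x. x ^ i *\<^sub>R V i x)" using i by (intro strongly_measurable_power_mult primitive_continuous_sm[OF VP]) auto
            have "lp_int p a (\<lambda>x. x ^ Suc i *\<^sub>R U (Suc i) x) \<le>
              P * (ennreal (1 powr p) * lp_int p a (\<lambda>x. x ^ i *\<^sub>R V i x) + ennreal (real i powr p) * lp_int p a (\<lambda>x. x ^ i *\<^sub>R U i x))"
              unfolding P_def
            proof (rule lp_int_triangle[OF p0 sV sU])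
              fix x :: real assume x: "0 < x"
              have "x ^ Suc i *\<^sub>R U (Suc i) x = x ^ i *\<^sub>R V i x - real i *\<^sub>R (x ^ i *\<^sub>R U i x)"
                by (simp add: V_def scaleR_add_right mult.commute)
              then show "norm (x ^ Suc i *\<^sub>R U (Suc i) x) \<le> 1 * norm (x ^ i *\<^sub>R V i x) + real i * norm (x ^ i *\<^sub>R U i x)"
              proof -
                have "norm (real i *\<^sub>R v) = real i * norm v" for v :: 'a by simp
                then show ?thesis
                  using norm_triangle_ineq4[of "x ^ i *\<^sub>R V i x" "real i *\<^sub>R (x ^ i *\<^sub>R U i x)"]
                  unfolding \<open>x ^ Suc i *\<^sub>R U (Suc i) x = x ^ i *\<^sub>R V i x - real i *\<^sub>R (x ^ i *\<^sub>R U i x)\<close> mult_1 by (simp only:)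
              qed
            qed auto
            also have "\<dots> \<le> P * ((1 + N) * energy p a m V + (1 + N) * energy p a m U)"
            proof (intro mult_left_mono add_mono mult_mono)
              have "ennreal (real i powr p) \<le> N" unfolding N_def using i p0 by (intro ennreal_leI powr_mono2) auto
              then show "ennreal (real i powr p) \<le> 1 + N" by (rule add_increasing[rotated]) simp
            qed (use i in \<open>auto intro: energy_ge\<close>)
            finally show ?thesis by (simp only: distrib_left distrib_right mult.assoc mult_1 mult_1_right add_ac)
          qed
          then have "(\<Sum>i\<le>m. lp_int p a (\<lambda>x. x ^ Suc i *\<^sub>R U (Suc i) x)) \<le> of_nat (Suc m) * (P * (1 + N) * (energy p a m V + energy p a m U))"
            using sum_bounded_above[of "{..m}" "\<lambda>i. lp_int p a (\<lambda>x. x ^ Suc i *\<^sub>R U (Suc i) x)"] by simp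
          moreover have "energy p a (Suc m) U = lp_int p a (\<lambda>x. x ^ 0 *\<^sub>R U 0 x) + (\<Sum>i\<le>m. lp_int p a (\<lambda>x. x ^ Suc i *\<^sub>R U (Suc i) x))"
            unfolding energy_def by (rule sum.atMost_Suc_shift)
          moreover have "lp_int p a (\<lambda>x. x ^ 0 *\<^sub>R U 0 x) \<le> energy p a m U" by (rule energy_ge) simp
          ultimately show ?thesis by (simp only: B_def mult.assoc add_mono)
        qed
        ultimately have LV: "L * energy p a m V \<le> C * (A * (EF + C * EF))"
          by (meson add_left_mono mult_left_mono order_trans zero_le)
        have "L * energy p a (Suc m) U \<le> L * (energy p a m U + B * (energy p a m V + energy p a m U))"
          by (rule mult_left_mono[OF EU]) simp
        also have "\<dots> = L * energy p a m U + B * (L * energy p a m V + L * energy p a m U)" by (simp add: algebra_simps)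
        also have "\<dots> \<le> C * EF + B * (C * (A * (EF + C * EF)) + C * EF)"
          by (intro add_mono mult_left_mono LU LV) simp
        also have "\<dots> = C' * EF" by (simp add: C'_def algebra_simps)
        finally show ?thesis by (simp add: L_def EF_def)
      qed
    qed
  qed
qed

section \<open>Interpolation between derivatives and Hardy inequality\<close>

lemma deriv_funpow_zero_outside:
  assumes "\<And>x. x \<notin> {a..b} \<Longrightarrow> \<phi> x = 0" "x \<notin> {a..b}" shows "(deriv ^^ n) \<phi> x = (0::real)"
  using assms(2)
proof (induction n arbitrary: x)
  case (Suc n)
  then show ?case using deriv_zero_outside[of a b "(deriv ^^ n) \<phi>" x] by simp
qed (use assms in simp)

lemma smooth_funpow: "smooth f \<Longrightarrow> smooth ((deriv ^^ n) f)"
  by (induction n) (auto intro: smooth_deriv)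

lemma deriv_funpow_affine:
  assumes f: "smooth f"
  shows "(deriv ^^ n) (\<lambda>x. c * f (m * x + d)) = (\<lambda>x. c * m ^ n * (deriv ^^ n) f (m * x + d))"
proof (induction n)
  case (Suc n)
  let ?g = "(deriv ^^ n) f"
  have "((\<lambda>x. ?g (m * x + d)) has_field_derivative deriv ?g (m * x + d) * m) (at x)" for x
    by (rule DERIV_chain'[where g="?g", OF _ smooth_DERIV[OF smooth_funpow[OF f]]]) (auto intro!: derivative_eq_intros)
  then have "((\<lambda>x. c * m ^ n * ?g (m * x + d)) has_field_derivative c * m ^ n * (deriv ?g (m * x + d) * m)) (at x)" for x
    by (rule DERIV_cmult)
  then have "deriv (\<lambda>x. c * m ^ n * ?g (m * x + d)) = (\<lambda>x. c * m ^ n * (deriv ?g (m * x + d) * m))"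
    by (auto intro: DERIV_imp_deriv)
  then have "(deriv ^^ Suc n) (\<lambda>x. c * f (m * x + d)) = (\<lambda>x. c * m ^ n * (deriv ?g (m * x + d) * m))"
    by (simp only: funpow.simps comp_apply Suc.IH)
  then show ?case by (simp add: mult_ac)
qed simp

lemma smooth_compact_support_bounded:
  assumes f: "smooth f" and z: "\<And>x. x \<notin> {a..b} \<Longrightarrow> f x = 0"
  obtains B where "0 \<le> B" "\<And>x. \<bar>f x\<bar> \<le> B"
proof -
  have "continuous_on {a..b} f" using smooth_DERIV[OF f] by (intro continuous_at_imp_continuous_on) (auto intro: DERIV_isCont)
  then have "compact (f ` {a..b})" by (rule compact_continuous_image) simp
  then obtain B where B: "\<And>x. x \<in> {a..b} \<Longrightarrow> norm (f x) \<le> B" using compact_imp_bounded bounded_iff by (metis imageI)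
  have "\<bar>f x\<bar> \<le> max 0 B" for x using B[of x] z[of x] by (cases "x \<in> {a..b}") auto
  then show ?thesis using that[of "max 0 B"] by simp
qed

text \<open>Let \<open>\<phi>\<close> be a smooth cutoff with \<open>\<phi> x = 1\<close> and \<open>\<phi> (x + h) = 0\<close>, and \<open>\<psi> = - \<phi>'\<close>. Integrating the derivative of
\<open>\<phi> U\<^sup>(\<^sup>n\<^sup>)\<close> over the window expresses \<open>U\<^sup>(\<^sup>n\<^sup>) x\<close> by \<open>\<phi> U\<^sup>(\<^sup>n\<^sup>+\<^sup>1\<^sup>)\<close> and \<open>\<psi> U\<^sup>(\<^sup>n\<^sup>)\<close>; in the latter, all \<open>n\<close> derivatives
move onto \<open>\<psi>\<close>, which costs \<open>h powr (- n - 1)\<close>. The window lies to the right of \<open>x\<close>, away from the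
boundary.\<close>

lemma interpolation_pointwise:
  "\<exists>M\<ge>0. \<forall>h>0. \<forall>U :: nat \<Rightarrow> real \<Rightarrow> 'a::complex_banach. primitive_chain (Suc n) U \<longrightarrow> (\<forall>x>0.
    enorm (U n x) \<le> norm_int (U (Suc n)) x (x+h)
      + (\<integral>\<^sup>+y. ennreal (M / h ^ Suc n) * (enorm (U 0 y) * indicator {x<..x+h} y) \<partial>lborel))"
proof -
  let ?\<eta> = "bump 1 2 0"
  have \<eta>: "smooth ?\<eta>" using bump_test[of 1 2 0] by (auto simp: test_functions_iff)
  obtain E where E: "\<And>x. (E has_field_derivative ?\<eta> x) (at x)" "\<And>x. x \<le> 1 \<Longrightarrow> E x = 0" "\<And>x. 2 \<le> x \<Longrightarrow> E x = E 2"
    by (rule test_antiderivative[OF \<eta>, of 1 2]) (auto simp: bump_outside)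
  have mono: "E s \<le> E t" if "s \<le> t" for s t
    by (rule DERIV_nonneg_imp_nondecreasing[OF that]) (use E(1) bump_bounds in blast)
  have "E 1 < E 2"
  proof (rule DERIV_pos_imp_increasing_open[of 1 2 E])
    show "continuous_on {1..2} E" using E(1) by (intro continuous_at_imp_continuous_on) (auto intro: DERIV_isCont)
    show "\<exists>y. (E has_real_derivative y) (at x) \<and> 0 < y" if "1 < x" "x < 2" for x
      using E(1) bump_pos[OF that] by blast
  qed simp
  then have e: "0 < E 2" using E(2)[of 1] by simp
  have E01: "0 \<le> E t" "E t \<le> E 2" for t
    using mono[of "min t 1" t] mono[of t "max t 2"] E(2)[of "min t 1"] E(3)[of "max t 2"] by auto
  have zero: "(deriv ^^ n) ?\<eta> x = 0" if "x \<notin> {1..2}" for x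
    by (rule deriv_funpow_zero_outside[OF _ that]) (auto simp: bump_outside)
  obtain B where B: "0 \<le> B" "\<And>x. \<bar>(deriv ^^ n) ?\<eta> x\<bar> \<le> B"
    by (rule smooth_compact_support_bounded[OF smooth_funpow[OF \<eta>] zero]) (assumption, rule that)
  define M where "M = B / E 2"
  show ?thesis
  proof (intro exI[of _ M] conjI allI impI)
    show "0 \<le> M" using B e by (simp add: M_def)
    fix h x :: real and U :: "nat \<Rightarrow> real \<Rightarrow> 'a"
    assume h: "0 < h" and U: "primitive_chain (Suc n) U" and x: "0 < x"
    \<comment> \<open>A normalised bump transported from \<open>{1..2}\<close> to \<open>{x..x + h}\<close>;
      \<open>E\<close> is its antiderivative.\<close>
    define \<psi> where "\<psi> y = (1 / (h * E 2)) * ?\<eta> ((1 / h) * y + (1 - x / h))" for y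
    define \<phi> where "\<phi> y = 1 - (1 / E 2) * E ((1 / h) * y + (1 - x / h))" for y
    have arg: "(1 / h) * y + (1 - x / h) = (y - x) / h + 1" for y by (simp add: diff_divide_distrib)
    have \<psi>_smooth: "smooth \<psi>" unfolding \<psi>_def by (rule smooth_affine[OF \<eta>])
    have \<psi>_out: "\<psi> y = 0" if "y \<notin> {x<..<x+h}" for y
    proof -
      have "(1 / h) * y + (1 - x / h) \<notin> {1<..<2}" using that h unfolding arg by (auto simp: field_simps)
      from bump_outside[OF this] show ?thesis by (simp only: \<psi>_def mult_zero_right)
    qed
    have \<psi>: "\<psi> \<in> test_functions"
    proof -
      have "0 < x \<and> x \<le> x + h \<and> (\<forall>y. y \<notin> {x..x+h} \<longrightarrow> \<psi> y = 0)" using \<psi>_out x h by auto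
      then show ?thesis unfolding test_functions_iff using \<psi>_smooth by blast
    qed
    have d\<psi>: "(deriv ^^ n) \<psi> y = (1 / (h * E 2)) * (1 / h) ^ n * (deriv ^^ n) ?\<eta> ((1 / h) * y + (1 - x / h))" for y
      unfolding \<psi>_def by (simp only: deriv_funpow_affine[OF \<eta>])
    have d\<psi>_bound: "\<bar>(deriv ^^ n) \<psi> y\<bar> \<le> M / h ^ Suc n" for y
    proof -
      have "\<bar>(deriv ^^ n) \<psi> y\<bar> = (1 / (h * E 2)) * (1 / h) ^ n * \<bar>(deriv ^^ n) ?\<eta> ((1 / h) * y + (1 - x / h))\<bar>"
        unfolding d\<psi> using h e by (simp add: abs_mult)
      also have "\<dots> \<le> (1 / (h * E 2)) * (1 / h) ^ n * B" using h e by (intro mult_left_mono B) auto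
      also have "\<dots> = M / h ^ Suc n" using h by (simp add: M_def power_divide)
      finally show ?thesis .
    qed
    have d\<psi>_out: "(deriv ^^ n) \<psi> y = 0" if "y \<notin> {x..x+h}" for y
      by (rule deriv_funpow_zero_outside[OF _ that]) (use \<psi>_out in auto)
    have \<phi>_deriv: "(\<phi> has_field_derivative - \<psi> y) (at y)" for y
    proof -
      have "((\<lambda>y. E ((1 / h) * y + (1 - x / h))) has_field_derivative ?\<eta> ((1 / h) * y + (1 - x / h)) * (1 / h)) (at y)"
        by (rule DERIV_chain'[where g=E, OF _ E(1)]) (use h in \<open>auto intro!: derivative_eq_intros\<close>)
      then show ?thesis unfolding \<phi>_def \<psi>_def using e by (auto intro!: derivative_eq_intros)
    qed
    have \<phi>_le: "\<bar>\<phi> y\<bar> \<le> 1" for y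
    proof -
      have "0 \<le> (1 / E 2) * E ((1 / h) * y + (1 - x / h))" "(1 / E 2) * E ((1 / h) * y + (1 - x / h)) \<le> 1"
        using E01[of "(1 / h) * y + (1 - x / h)"] e by auto
      then show ?thesis unfolding \<phi>_def by linarith
    qed
    have \<phi>x: "\<phi> x = 1" "\<phi> (x + h) = 0" using e h E(2)[of 1] unfolding \<phi>_def arg by simp_all
    have P: "primitive (U (Suc n)) (U n)" using U by (simp add: primitive_chain_def)
    have "primitive (\<lambda>y. complex_of_real (\<phi> y) *\<^sub>C U (Suc n) y + complex_of_real (- \<psi> y) *\<^sub>C U n y) (\<lambda>y. complex_of_real (\<phi> y) *\<^sub>C U n y)"
    proof (rule primitive_product[OF P])
      show "((\<lambda>y. complex_of_real (\<phi> y)) has_vector_derivative complex_of_real (- \<psi> y)) (at y)" for y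
        using \<phi>_deriv[of y] by (intro has_vector_derivative_of_real has_real_derivative_iff_has_vector_derivative[THEN iffD1])
      show "continuous_on {0<..} (\<lambda>y. complex_of_real (- \<psi> y))"
        by (intro continuous_intros continuous_on_subset[OF test_continuous[OF \<psi>]]) auto
    qed
    then have "has_Bochner_integral half_line (\<lambda>y. indicator {x<..x+h} y *\<^sub>R (\<phi> y *\<^sub>R U (Suc n) y + (- \<psi> y) *\<^sub>R U n y))
      (\<phi> (x + h) *\<^sub>R U n (x + h) - \<phi> x *\<^sub>R U n x)"
      using x h unfolding primitive_def scaleC_real by auto
    then have 1: "has_Bochner_integral half_line (\<lambda>y. indicator {x<..x+h} y *\<^sub>R (\<phi> y *\<^sub>R U (Suc n) y + (- \<psi> y) *\<^sub>R U n y)) (- U n x)"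
      by (simp add: \<phi>x)
    have "has_weak_deriv n (U 0) (U n)" using primitive_chain_weak_deriv[OF U, of n 0] by simp
    then obtain I where I: "has_Bochner_integral half_line (\<lambda>y. (deriv ^^ n) \<psi> y *\<^sub>R U 0 y) I"
      "has_Bochner_integral half_line (\<lambda>y. \<psi> y *\<^sub>R U n y) ((-1) ^ n *\<^sub>R I)"
      using \<psi> unfolding has_weak_deriv_def by blast
    have "has_Bochner_integral half_line (\<lambda>y. indicator {x<..x+h} y *\<^sub>R (\<phi> y *\<^sub>R U (Suc n) y + (- \<psi> y) *\<^sub>R U n y) + \<psi> y *\<^sub>R U n y) (- U n x + (-1) ^ n *\<^sub>R I)"
      by (rule has_Bochner_integral_add[OF 1 I(2)])
    also have "(\<lambda>y. indicator {x<..x+h} y *\<^sub>R (\<phi> y *\<^sub>R U (Suc n) y + (- \<psi> y) *\<^sub>R U n y) + \<psi> y *\<^sub>R U n y) =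
      (\<lambda>y. indicator {x<..x+h} y *\<^sub>R (\<phi> y *\<^sub>R U (Suc n) y))"
    proof
      fix y show "indicator {x<..x+h} y *\<^sub>R (\<phi> y *\<^sub>R U (Suc n) y + (- \<psi> y) *\<^sub>R U n y) + \<psi> y *\<^sub>R U n y =
        indicator {x<..x+h} y *\<^sub>R (\<phi> y *\<^sub>R U (Suc n) y)"
        using \<psi>_out[of y] by (cases "y \<in> {x<..x+h}") auto
    qed
    finally have J: "has_Bochner_integral half_line (\<lambda>y. indicator {x<..x+h} y *\<^sub>R (\<phi> y *\<^sub>R U (Suc n) y)) (- U n x + (-1) ^ n *\<^sub>R I)" .
    have "norm (U n x) = norm ((-1) ^ n *\<^sub>R I - (- U n x + (-1) ^ n *\<^sub>R I))" by simp
    also have "\<dots> \<le> norm ((-1) ^ n *\<^sub>R I) + norm (- U n x + (-1) ^ n *\<^sub>R I)" by (rule norm_triangle_ineq4)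
    finally have "norm (U n x) \<le> norm (- U n x + (-1) ^ n *\<^sub>R I) + norm I" by (simp add: norm_power)
    then have "enorm (U n x) \<le> enorm (- U n x + (-1) ^ n *\<^sub>R I) + enorm I"
      by (simp flip: ennreal_plus add: ennreal_leI)
    also have "\<dots> \<le> norm_int (U (Suc n)) x (x+h)
      + (\<integral>\<^sup>+y. ennreal (M / h ^ Suc n) * (enorm (U 0 y) * indicator {x<..x+h} y) \<partial>lborel)"
    proof (rule add_mono)
      have "enorm (- U n x + (-1) ^ n *\<^sub>R I) \<le> (\<integral>\<^sup>+y. enorm (\<phi> y *\<^sub>R U (Suc n) y) * indicator {x<..x+h} y \<partial>lborel)"
        using has_Bochner_integral_norm_le[OF J] x by (subst (asm) nn_integral_norm_restrict) auto
      also have "\<dots> \<le> norm_int (U (Suc n)) x (x+h)"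
        using \<phi>_le by (intro nn_integral_mono mult_right_mono ennreal_leI) (auto simp: mult_left_le_one_le)
      finally show "enorm (- U n x + (-1) ^ n *\<^sub>R I) \<le> norm_int (U (Suc n)) x (x+h)" .
      have "enorm I \<le> (\<integral>\<^sup>+y. enorm ((deriv ^^ n) \<psi> y *\<^sub>R U 0 y) \<partial>half_line)"
        by (rule has_Bochner_integral_norm_le[OF I(1)])
      also have "\<dots> \<le> (\<integral>\<^sup>+y. ennreal (M / h ^ Suc n) * (enorm (U 0 y) * indicator {x<..x+h} y) \<partial>lborel)"
        unfolding nn_integral_half_line
      proof (rule nn_integral_mono_AE, use AE_lborel_singleton[of x] in eventually_elim)
        case (elim y)
        show ?case
        proof (cases "y \<in> {x..x+h}")
          case True
          have "enorm ((deriv ^^ n) \<psi> y *\<^sub>R U 0 y) \<le> ennreal (M / h ^ Suc n * norm (U 0 y))"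
            using mult_right_mono[OF d\<psi>_bound[of y] norm_ge_zero[of "U 0 y"]] by (intro ennreal_leI) (simp only: norm_scaleR)
          also have "\<dots> = ennreal (M / h ^ Suc n) * enorm (U 0 y)" by (rule ennreal_mult'') simp
          finally show ?thesis using True elim x by auto
        qed (simp add: d\<psi>_out)
      qed
      finally show "enorm I \<le> (\<integral>\<^sup>+y. ennreal (M / h ^ Suc n) * (enorm (U 0 y) * indicator {x<..x+h} y) \<partial>lborel)" .
    qed
    finally show "enorm (U n x) \<le> norm_int (U (Suc n)) x (x+h)
      + (\<integral>\<^sup>+y. ennreal (M / h ^ Suc n) * (enorm (U 0 y) * indicator {x<..x+h} y) \<partial>lborel)" .
  qed
qed

text \<open>The indicator of the window \<open>{x<..x + h}\<close> is at most \<open>e\<close> times the exponential kernel of rate \<open>1 / h\<close>,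
so that \<open>forward_exp_bound\<close> applies.\<close>

lemma interpolation:
  assumes p: "1 < p" and \<gamma>: "-1 < \<gamma>"
  shows "\<exists>C<\<top>. \<forall>h>0. \<forall>U :: nat \<Rightarrow> real \<Rightarrow> 'a::complex_banach. primitive_chain (Suc n) U \<longrightarrow>
    lp_int p \<gamma> (U n) \<le> C * (ennreal (h powr p) * lp_int p \<gamma> (U (Suc n)) + ennreal (h powr (- (real n * p))) * lp_int p \<gamma> (U 0))"
proof -
  have p0: "0 < p" using p by simp
  obtain M where M: "0 \<le> M" and pw: "\<And>h x U. 0 < h \<Longrightarrow> primitive_chain (Suc n) U \<Longrightarrow> 0 < x \<Longrightarrow>
    enorm (U n x :: 'a) \<le> norm_int (U (Suc n)) x (x+h)
      + (\<integral>\<^sup>+y. ennreal (M / h ^ Suc n) * (enorm (U 0 y) * indicator {x<..x+h} y) \<partial>lborel)"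
    using interpolation_pointwise[where n=n and 'a='a] by blast
  define A where "A = ennreal (2 powr \<bar>\<gamma>\<bar> + 2 / (\<gamma>+1))"
  define C where "C = ennreal (exp 1 powr p) * (A * (ennreal (2 powr p) * (1 + ennreal (M powr p))))"
  show ?thesis
  proof (intro exI[of _ C] conjI allI impI)
    show "C < \<top>" by (simp add: C_def A_def ennreal_mult_less_top)
    fix h :: real and U :: "nat \<Rightarrow> real \<Rightarrow> 'a"
    assume h: "0 < h" and U: "primitive_chain (Suc n) U"
    have sm: "strongly_measurable half_line (U i)" if "i \<le> Suc n" for i
      using primitive_chain_locally_integrable[OF U that] by (simp add: locally_integrable_def)
    obtain g1 where g1[measurable]: "g1 \<in> borel_measurable borel" and e1: "AE x in half_line. enorm (U (Suc n) x) = g1 x"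
      and l1: "\<And>p a. lp_int p a (U (Suc n)) = wint p a g1" using lp_int_borel_rep[OF sm] by blast
    obtain g0 where g0[measurable]: "g0 \<in> borel_measurable borel" and e0: "AE x in half_line. enorm (U 0 x) = g0 x"
      and l0: "\<And>p a. lp_int p a (U 0) = wint p a g0" using lp_int_borel_rep[OF sm[of 0]] by blast
    define k where "k y = g1 y + ennreal (M / h ^ Suc n) * g0 y" for y
    have [measurable]: "k \<in> borel_measurable borel" unfolding k_def[abs_def] by measurable
    have pointwise: "enorm (U n x) \<le> ennreal (exp 1) * forward_exp (1 / h) k x" if x: "0 < x" for x
    proof -
      have "norm_int (U (Suc n)) x (x+h) = (\<integral>\<^sup>+y. g1 y * indicator {x<..x+h} y \<partial>lborel)"
        by (rule nn_integral_cong_AE, use e1[unfolded AE_half_line] in eventually_elim) (use x in \<open>auto simp: indicator_def\<close>)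
      moreover have "(\<integral>\<^sup>+y. ennreal (M / h ^ Suc n) * (enorm (U 0 y) * indicator {x<..x+h} y) \<partial>lborel) =
         (\<integral>\<^sup>+y. ennreal (M / h ^ Suc n) * (g0 y * indicator {x<..x+h} y) \<partial>lborel)"
        by (rule nn_integral_cong_AE, use e0[unfolded AE_half_line] in eventually_elim) (use x in \<open>auto simp: indicator_def\<close>)
      ultimately have "enorm (U n x) \<le> (\<integral>\<^sup>+y. g1 y * indicator {x<..x+h} y \<partial>lborel) +
         (\<integral>\<^sup>+y. ennreal (M / h ^ Suc n) * (g0 y * indicator {x<..x+h} y) \<partial>lborel)"
        using pw[OF h U x] by simp
      also have "\<dots> = (\<integral>\<^sup>+y. k y * indicator {x<..x+h} y \<partial>lborel)"
        by (subst nn_integral_add[symmetric]) (auto simp: k_def algebra_simps)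
      also have "\<dots> \<le> (\<integral>\<^sup>+y. ennreal (exp 1) * (if x < y then ennreal (exp (- (1 / h * (y - x)))) * k y else 0) \<partial>lborel)"
      proof (rule nn_integral_mono)
        fix y
        show "k y * indicator {x<..x+h} y \<le> ennreal (exp 1) * (if x < y then ennreal (exp (- (1 / h * (y - x)))) * k y else 0)"
        proof (cases "y \<in> {x<..x+h}")
          case True
          have "(y - x) / h \<le> 1" using True h by simp
          then have "1 \<le> exp 1 * exp (- (1 / h * (y - x)))" by (simp add: exp_add[symmetric])
          then have "1 \<le> ennreal (exp 1) * ennreal (exp (- (1 / h * (y - x))))"
            using ennreal_leI[of 1] by (simp flip: ennreal_mult)
          then have "1 * k y \<le> ennreal (exp 1) * ennreal (exp (- (1 / h * (y - x)))) * k y"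
            by (rule mult_right_mono) simp
          then show ?thesis using True by (simp add: mult.assoc)
        qed simp
      qed
      also have "\<dots> = ennreal (exp 1) * forward_exp (1 / h) k x"
        unfolding forward_exp_def by (subst nn_integral_cmult) auto
      finally show ?thesis .
    qed
    have fwd: "wint p \<gamma> (forward_exp (1 / h) k) \<le> ennreal (h powr p) * (A * wint p \<gamma> k)"
    proof -
      have "ennreal ((1 / h) powr p) * wint p \<gamma> (forward_exp (1 / h) k) \<le> A * wint p \<gamma> k"
        using forward_exp_bound[OF p \<gamma>, of "1 / h" k] h p0 by (simp add: wint_cmult A_def)
      then have "ennreal (h powr p) * (ennreal ((1 / h) powr p) * wint p \<gamma> (forward_exp (1 / h) k)) \<le> ennreal (h powr p) * (A * wint p \<gamma> k)"
        by (rule mult_left_mono) simp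
      moreover have "ennreal (h powr p) * ennreal ((1 / h) powr p) = 1"
        using h by (simp add: powr_divide flip: ennreal_mult)
      ultimately show ?thesis by (simp add: mult.assoc[symmetric])
    qed
    have k: "wint p \<gamma> k \<le> ennreal (2 powr p) * (wint p \<gamma> g1 + ennreal ((M / h ^ Suc n) powr p) * wint p \<gamma> g0)"
    proof -
      have "wint p \<gamma> k \<le> ennreal (2 powr p) * (wint p \<gamma> g1 + wint p \<gamma> (\<lambda>y. ennreal (M / h ^ Suc n) * g0 y))"
        unfolding k_def by (intro wint_add p0) measurable
      then show ?thesis using M h p0 by (simp add: wint_cmult)
    qed
    have hp: "h powr p * (M / h ^ Suc n) powr p = M powr p * h powr (- (real n * p))"
    proof -
      have X: "(M / h ^ Suc n) powr p = M powr p / h powr (real (Suc n) * p)"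
        using M h by (simp add: powr_divide powr_powr powr_realpow[symmetric] del: power_Suc of_nat_Suc)
      have Z: "h powr p / h powr (real (Suc n) * p) = h powr (- (real n * p))"
        by (simp add: powr_diff[symmetric] algebra_simps)
      show ?thesis unfolding X Z[symmetric] by simp
    qed
    have "lp_int p \<gamma> (U n) \<le> wint p \<gamma> (\<lambda>x. ennreal (exp 1) * forward_exp (1 / h) k x)"
      unfolding lp_int_def using p0 pointwise by (intro wint_mono) auto
    also have "\<dots> = ennreal (exp 1 powr p) * wint p \<gamma> (forward_exp (1 / h) k)"
      using p0 by (simp add: wint_cmult)
    also have "\<dots> \<le> ennreal (exp 1 powr p) * (ennreal (h powr p) * (A * (ennreal (2 powr p) * (wint p \<gamma> g1 + ennreal ((M / h ^ Suc n) powr p) * wint p \<gamma> g0))))"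
      by (intro mult_left_mono order_trans[OF fwd] k) auto
    also have "\<dots> = ennreal (exp 1 powr p) * (A * (ennreal (2 powr p) * (ennreal (h powr p) * wint p \<gamma> g1 + (ennreal (h powr p) * ennreal ((M / h ^ Suc n) powr p)) * wint p \<gamma> g0)))"
      by (simp only: distrib_left mult_ac)
    also have "ennreal (h powr p) * ennreal ((M / h ^ Suc n) powr p) = ennreal (M powr p) * ennreal (h powr (- (real n * p)))"
      using hp by (simp flip: ennreal_mult)
    also have "ennreal (exp 1 powr p) * (A * (ennreal (2 powr p) * (ennreal (h powr p) * wint p \<gamma> g1 + (ennreal (M powr p) * ennreal (h powr (- (real n * p)))) * wint p \<gamma> g0)))
      \<le> ennreal (exp 1 powr p) * (A * (ennreal (2 powr p) * ((1 + ennreal (M powr p)) * (ennreal (h powr p) * wint p \<gamma> g1 + ennreal (h powr (- (real n * p))) * wint p \<gamma> g0))))"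
    proof (intro mult_left_mono)
      show "ennreal (h powr p) * wint p \<gamma> g1 + (ennreal (M powr p) * ennreal (h powr (- (real n * p)))) * wint p \<gamma> g0 \<le>
        (1 + ennreal (M powr p)) * (ennreal (h powr p) * wint p \<gamma> g1 + ennreal (h powr (- (real n * p))) * wint p \<gamma> g0)"
        unfolding distrib_left distrib_right mult_1 mult.assoc by (intro add_mono add_increasing2[OF _ order_refl] add_increasing[OF _ order_refl]) auto
    qed auto
    also have "\<dots> = C * (ennreal (h powr p) * lp_int p \<gamma> (U (Suc n)) + ennreal (h powr (- (real n * p))) * lp_int p \<gamma> (U 0))"
      by (simp only: C_def l1 l0 mult.assoc)
    finally show "lp_int p \<gamma> (U n) \<le> C * (ennreal (h powr p) * lp_int p \<gamma> (U (Suc n)) + ennreal (h powr (- (real n * p))) * lp_int p \<gamma> (U 0))" .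
  qed
qed

text \<open>In the resolvent estimate both terms on the right carry the same power of \<open>\<lambda>\<close>, so that the fixed
length \<open>h = 1\<close> suffices here.\<close>

lemma interpolation_intermediate:
  assumes p: "1 < p" and \<gamma>: "-1 < \<gamma>"
  shows "\<exists>C<\<top>. \<forall>U :: nat \<Rightarrow> real \<Rightarrow> 'a::complex_banach. primitive_chain k U \<longrightarrow>
    (\<forall>i\<le>k. lp_int p \<gamma> (U i) \<le> C * (lp_int p \<gamma> (U k) + lp_int p \<gamma> (U 0)))"
proof (induction k)
  case 0
  show ?case by (intro exI[of _ 1]) auto
next
  case (Suc k)
  then obtain C where C: "C < \<top>" and IH: "\<And>U i. primitive_chain k U \<Longrightarrow> i \<le> k \<Longrightarrow> lp_int p \<gamma> (U i :: real \<Rightarrow> 'a) \<le> C * (lp_int p \<gamma> (U k) + lp_int p \<gamma> (U 0))"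
    by blast
  obtain D where D: "D < \<top>" and step: "\<And>U h. 0 < h \<Longrightarrow> primitive_chain (Suc k) U \<Longrightarrow>
    lp_int p \<gamma> (U k :: real \<Rightarrow> 'a) \<le> D * (ennreal (h powr p) * lp_int p \<gamma> (U (Suc k)) + ennreal (h powr (- (real k * p))) * lp_int p \<gamma> (U 0))"
    using interpolation[OF p \<gamma>] by blast
  show ?case
  proof (intro exI[of _ "1 + C * (D + 1)"] conjI allI impI)
    show "1 + C * (D + 1) < \<top>" using C D by (simp add: ennreal_mult_less_top)
    fix U :: "nat \<Rightarrow> real \<Rightarrow> 'a" and i assume U: "primitive_chain (Suc k) U" and i: "i \<le> Suc k"
    let ?S = "lp_int p \<gamma> (U (Suc k)) + lp_int p \<gamma> (U 0)"
    show "lp_int p \<gamma> (U i) \<le> (1 + C * (D + 1)) * ?S"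
    proof (cases "i = Suc k")
      case True
      have "lp_int p \<gamma> (U i) \<le> 1 * ?S" using True by simp
      also have "\<dots> \<le> (1 + C * (D + 1)) * ?S" by (intro mult_right_mono) auto
      finally show ?thesis .
    next
      case False
      have Uk: "primitive_chain k U" using U primitive_chain_locally_integrable[OF U, of k] by (simp add: primitive_chain_def)
      have "lp_int p \<gamma> (U i) \<le> C * (lp_int p \<gamma> (U k) + lp_int p \<gamma> (U 0))" using False i by (intro IH Uk) simp
      also have "\<dots> \<le> C * (D * ?S + 1 * ?S)"
        using step[OF zero_less_one U] by (intro mult_left_mono add_mono) auto
      also have "\<dots> = C * (D + 1) * ?S" by (simp only: distrib_right mult.assoc)
      also have "\<dots> \<le> (1 + C * (D + 1)) * ?S" by (intro mult_right_mono) auto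
      finally show ?thesis .
    qed
  qed
qed

text \<open>For \<open>x < 1\<close> compare \<open>F0 x\<close> with its values on \<open>{1<..2}\<close>: the difference is at most the integral of the
derivative over \<open>{x<..}\<close>, to which the dual Hardy inequality applies. For \<open>x \<ge> 1\<close> the weight only
increases.\<close>

lemma local_Hardy:
  assumes p: "1 < p" and b: "-1 < b" "b + p \<le> \<gamma>"
  shows "\<exists>C<\<top>. \<forall>F0 F1 :: real \<Rightarrow> 'a::complex_banach. primitive F1 F0 \<longrightarrow>
    lp_int p b F0 \<le> C * (lp_int p \<gamma> F0 + lp_int p (b + p) F1)"
proof -
  have p0: "0 < p" and \<gamma>: "0 \<le> \<gamma>" "b \<le> \<gamma>" using p b by auto
  obtain T where T: "0 < T" and tail: "\<And>g. g \<in> borel_measurable borel \<Longrightarrow> wint p b (tail_int g) \<le> ennreal T * wint p (b + p) g"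
    using tail_int_bound[OF p b(1)] by blast
  let ?P = "ennreal (2 powr p)"
  define R where "R = ennreal (1 / (b + 1))"
  define C where "C = ?P * (1 + ?P * (R + ennreal T))"
  show ?thesis
  proof (intro exI[of _ C] conjI allI impI)
    show "C < \<top>" by (simp add: C_def R_def ennreal_mult_less_top)
    fix F0 F1 :: "real \<Rightarrow> 'a" assume F: "primitive F1 F0"
    have sm1: "strongly_measurable half_line F1" using F by (simp add: primitive_def)
    have sm0: "strongly_measurable half_line F0" by (rule primitive_continuous_sm[OF F])
    obtain g1 where g1[measurable]: "g1 \<in> borel_measurable borel" and e1: "AE x in half_line. enorm (F1 x) = g1 x"
      and l1: "\<And>p a. lp_int p a F1 = wint p a g1" using lp_int_borel_rep[OF sm1] by blast
    obtain g0 where g0[measurable]: "g0 \<in> borel_measurable borel" and e0: "AE x in half_line. enorm (F0 x) = g0 x"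
      and l0: "\<And>p a. lp_int p a F0 = wint p a g0" using lp_int_borel_rep[OF sm0] by blast
    define J where "J = (\<integral>\<^sup>+y. indicator {1<..2} y * g0 y \<partial>lborel)"
    \<comment> \<open>Averaging over \<open>{1<..2}\<close>, an interval of length one.\<close>
    have small: "enorm (F0 x) \<le> J + tail_int g1 x" if x: "0 < x" "x < 1" for x
    proof -
      have "enorm (F0 x) = (\<integral>\<^sup>+y. enorm (F0 x) * indicator {1<..2::real} y \<partial>lborel)"
        by (simp add: nn_integral_cmult_indicator)
      also have "\<dots> \<le> (\<integral>\<^sup>+y. indicator {1<..2} y * g0 y + tail_int g1 x * indicator {1<..2} y \<partial>lborel)"
      proof (rule nn_integral_mono_AE, use e0[unfolded AE_half_line] in eventually_elim)
        case (elim y)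
        show ?case
        proof (cases "y \<in> {1<..2}")
          case True
          then have y: "x \<le> y" "0 < y" using x by auto
          have "enorm (F0 y - F0 x) \<le> norm_int F1 x y"
            by (rule primitive_norm_le[OF F x(1) y(1)])
          also have "\<dots> \<le> tail_int g1 x" unfolding tail_int_def
            by (rule nn_integral_mono_AE, use e1[unfolded AE_half_line] in eventually_elim) (use x in \<open>auto simp: indicator_def\<close>)
          finally have 1: "enorm (F0 y - F0 x) \<le> tail_int g1 x" .
          have "enorm (F0 x) \<le> enorm (F0 y) + enorm (F0 y - F0 x)"
          proof -
            have "norm (F0 x) \<le> norm (F0 y) + norm (F0 y - F0 x)" using norm_triangle_ineq4[of "F0 y" "F0 y - F0 x"] by simp
            from ennreal_leI[OF this] show ?thesis by simp
          qed
          also have "\<dots> \<le> g0 y + tail_int g1 x" using 1 elim y by (intro add_mono) auto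
          finally show ?thesis using True by simp
        qed simp
      qed
      also have "\<dots> = J + tail_int g1 x" unfolding J_def
        by (subst nn_integral_add) (auto simp: nn_integral_cmult_indicator)
      finally show ?thesis .
    qed
    have J: "epow J p \<le> wint p \<gamma> g0"
    proof -
      have "epow J p \<le> ennreal (1 powr (p - 1)) * (\<integral>\<^sup>+y. indicator {1<..2} y * epow (g0 y) p * ennreal (1 powr (1 - p)) \<partial>lborel)"
        unfolding J_def by (rule weighted_Hoelder[OF p]) auto
      also have "\<dots> = (\<integral>\<^sup>+y. indicator {1<..2} y * epow (g0 y) p \<partial>lborel)" by simp
      also have "\<dots> \<le> wint p \<gamma> g0" unfolding wint_def
      proof (rule nn_integral_mono)
        fix y :: real
        have "1 \<le> y powr \<gamma>" if "1 < y" using that \<gamma> by (simp add: ge_one_powr_ge_zero)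
        then have "epow (g0 y) p * 1 \<le> epow (g0 y) p * ennreal (y powr \<gamma>)" if "1 < y"
          using that by (intro mult_left_mono) (auto simp: ennreal_leI[of 1, simplified])
        then show "indicator {1<..2} y * epow (g0 y) p \<le> epow (g0 y) p * ennreal (y powr \<gamma>) * indicator {0<..} y"
          by (auto simp: indicator_def)
      qed
      finally show ?thesis .
    qed
    have "lp_int p b F0 \<le> wint p b (\<lambda>x. indicator {1..} x * g0 x + (J * indicator {..1} x + tail_int g1 x))"
      unfolding lp_int_def
    proof (rule wint_mono_AE)
      show "AE x in half_line. enorm (F0 x) \<le> indicator {1..} x * g0 x + (J * indicator {..1} x + tail_int g1 x)"
        using e0 AE_space
      proof eventually_elim
        case (elim x)
        show ?case
        proof (cases "1 \<le> x")
          case True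
          then show ?thesis using elim by (simp add: add_increasing2)
        next
          case False
          then show ?thesis using small[of x] elim by simp
        qed
      qed
    qed (use p0 in simp)
    also have "\<dots> \<le> ?P * (wint p b (\<lambda>x. indicator {1..} x * g0 x) + wint p b (\<lambda>x. J * indicator {..1} x + tail_int g1 x))"
      by (intro wint_add p0) measurable
    also have "\<dots> \<le> ?P * (wint p b (\<lambda>x. indicator {1..} x * g0 x) + ?P * (wint p b (\<lambda>x. J * indicator {..1} x) + wint p b (tail_int g1)))"
      by (intro mult_left_mono add_left_mono wint_add p0) measurable
    also have "\<dots> \<le> ?P * (wint p \<gamma> g0 + ?P * (R * wint p \<gamma> g0 + ennreal T * wint p (b + p) g1))"
    proof (intro mult_left_mono add_mono tail)
      show "wint p b (\<lambda>x. indicator {1..} x * g0 x) \<le> wint p \<gamma> g0"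
        unfolding wint_def
      proof (rule nn_integral_mono)
        fix x :: real
        show "epow (indicator {1..} x * g0 x) p * ennreal (x powr b) * indicator {0<..} x \<le> epow (g0 x) p * ennreal (x powr \<gamma>) * indicator {0<..} x"
        proof (cases "1 \<le> x")
          case True
          then show ?thesis using \<gamma> by (auto intro!: mult_left_mono ennreal_leI powr_mono)
        qed simp
      qed
      have "wint p b (\<lambda>x. J * indicator {..1} x) = epow J p * wint p b (indicator {..1})"
        by (intro wint_cmult p0) measurable
      also have "wint p b (indicator {..1}) \<le> (\<integral>\<^sup>+x. ennreal (x powr b) * indicator {0..1} x \<partial>lborel)"
        unfolding wint_def by (intro nn_integral_mono) (use epow_ennreal[of 1 p] in \<open>auto simp: indicator_def\<close>)
      also have "\<dots> = R" using nn_integral_powr_from_0[of b 1] b by (simp add: R_def)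
      finally have "wint p b (\<lambda>x. J * indicator {..1} x) \<le> epow J p * R" by (simp add: mult_left_mono)
      also have "\<dots> \<le> wint p \<gamma> g0 * R" by (intro mult_right_mono J) simp
      finally show "wint p b (\<lambda>x. J * indicator {..1} x) \<le> R * wint p \<gamma> g0" by (simp add: mult.commute)
    qed auto
    also have "\<dots> \<le> C * (wint p \<gamma> g0 + wint p (b + p) g1)"
    proof -
      have "wint p \<gamma> g0 + ?P * (R * wint p \<gamma> g0 + ennreal T * wint p (b + p) g1) \<le>
        1 * (wint p \<gamma> g0 + wint p (b + p) g1) + ?P * (R * (wint p \<gamma> g0 + wint p (b + p) g1) + ennreal T * (wint p \<gamma> g0 + wint p (b + p) g1))"
        by (intro add_mono mult_left_mono) auto
      also have "\<dots> = (1 + ?P * (R + ennreal T)) * (wint p \<gamma> g0 + wint p (b + p) g1)"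
        by (simp only: distrib_right mult.assoc distrib_left add_ac)
      finally show ?thesis unfolding C_def mult.assoc by (rule mult_left_mono) simp
    qed
    finally show "lp_int p b F0 \<le> C * (lp_int p \<gamma> F0 + lp_int p (b + p) F1)" by (simp add: l0 l1)
  qed
qed

text \<open>Descending induction on the order. The highest order has the weight \<open>a + k p\<close> already, and each step
down uses \<open>local_Hardy\<close> with the bound for the next derivative.\<close>

lemma energy_Hardy:
  assumes p: "1 < p" and a: "-1 < a"
  shows "\<exists>C<\<top>. \<forall>F :: nat \<Rightarrow> real \<Rightarrow> 'a::complex_banach. primitive_chain k F \<longrightarrow>
    energy p a k F \<le> C * (\<Sum>i\<le>k. lp_int p (a + real k * p) (F i))"
proof -
  have p0: "0 < p" using p by simp
  let ?S = "\<lambda>F :: nat \<Rightarrow> real \<Rightarrow> 'a. \<Sum>i\<le>k. lp_int p (a + real k * p) (F i)"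
  have S: "lp_int p (a + real k * p) (F i) \<le> ?S F" if "i \<le> k" for F :: "nat \<Rightarrow> real \<Rightarrow> 'a" and i
    by (rule member_le_sum) (use that in auto)
  have "\<exists>C<\<top>. \<forall>F :: nat \<Rightarrow> real \<Rightarrow> 'a. primitive_chain k F \<longrightarrow> (\<forall>i. k - d \<le> i \<longrightarrow> i \<le> k \<longrightarrow> lp_int p (a + real i * p) (F i) \<le> C * ?S F)" for d
  proof (induction d)
    case 0
    show ?case by (intro exI[of _ 1]) (auto intro: S)
  next
    case (Suc d)
    then obtain C where C: "C < \<top>" and IH: "\<And>F i. primitive_chain k F \<Longrightarrow> k - d \<le> i \<Longrightarrow> i \<le> k \<Longrightarrow> lp_int p (a + real i * p) (F i :: real \<Rightarrow> 'a) \<le> C * ?S F"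
      by blast
    show ?case
    proof (cases "d < k")
      case False
      then have "k - Suc d = k - d" by simp
      then show ?thesis using Suc by simp
    next
      case True
      define j where "j = k - Suc d"
      have j: "j < k" "Suc j = k - d" using True by (auto simp: j_def)
      have "0 \<le> real j * p" using p0 by simp
      then have b: "-1 < a + real j * p" using a by linarith
      have "real (Suc j) \<le> real k" using j by (intro of_nat_mono) simp
      then have "real (Suc j) * p \<le> real k * p" using p0 by (intro mult_right_mono) auto
      then have le: "a + real j * p + p \<le> a + real k * p" by (simp add: algebra_simps)
      obtain D where D: "D < \<top>" and H: "\<And>F0 F1 :: real \<Rightarrow> 'a. primitive F1 F0 \<Longrightarrow>
          lp_int p (a + real j * p) F0 \<le> D * (lp_int p (a + real k * p) F0 + lp_int p (a + real j * p + p) F1)"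
        using local_Hardy[OF p b le] by blast
      show ?thesis
      proof (intro exI[of _ "C + D * (1 + C)"] conjI allI impI)
        show "C + D * (1 + C) < \<top>" using C D by (simp add: ennreal_mult_less_top)
        fix F :: "nat \<Rightarrow> real \<Rightarrow> 'a" and i assume F: "primitive_chain k F" and i: "k - Suc d \<le> i" "i \<le> k"
        show "lp_int p (a + real i * p) (F i) \<le> (C + D * (1 + C)) * ?S F"
        proof (cases "i = j")
          case False
          then have "lp_int p (a + real i * p) (F i) \<le> C * ?S F" using i j by (intro IH F) (auto simp: j_def)
          also have "\<dots> \<le> (C + D * (1 + C)) * ?S F" by (intro mult_right_mono) auto
          finally show ?thesis .
        next
          case True
          have "primitive (F (Suc j)) (F j)" using F j(1) by (simp add: primitive_chain_def)
          from H[OF this] have "lp_int p (a + real j * p) (F j) \<le> D * (lp_int p (a + real k * p) (F j) + lp_int p (a + real (Suc j) * p) (F (Suc j)))"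
            by (simp add: algebra_simps)
          also have "\<dots> \<le> D * (1 * ?S F + C * ?S F)"
            using S[of j F] IH[OF F, of "Suc j"] j by (intro mult_left_mono add_mono) auto
          also have "\<dots> = D * (1 + C) * ?S F" by (simp only: distrib_right mult.assoc)
          also have "\<dots> \<le> (C + D * (1 + C)) * ?S F" by (intro mult_right_mono) auto
          finally show ?thesis using True by simp
        qed
      qed
    qed
  qed
  from this[of k] obtain C where C: "C < \<top>" and bd: "\<And>F i. primitive_chain k F \<Longrightarrow> i \<le> k \<Longrightarrow> lp_int p (a + real i * p) (F i :: real \<Rightarrow> 'a) \<le> C * ?S F"
    by auto
  show ?thesis
  proof (intro exI[of _ "of_nat (Suc k) * C"] conjI allI impI)
    show "of_nat (Suc k) * C < \<top>" using C by (simp add: ennreal_mult_less_top of_nat_less_top)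
    fix F :: "nat \<Rightarrow> real \<Rightarrow> 'a" assume F: "primitive_chain k F"
    have "energy p a k F \<le> of_nat (Suc k) * (C * ?S F)"
      by (rule energy_le) (use bd[OF F] in \<open>simp add: lp_int_times_power[OF p0]\<close>)
    then show "energy p a k F \<le> of_nat (Suc k) * C * ?S F" by (simp only: mult.assoc)
  qed
qed

section \<open>The resolvent estimate\<close>

text \<open>The square root of \<open>\<lambda>\<close> has argument less than \<open>(\<pi> - \<omega>) / 2\<close> in modulus, whose cosine is \<open>sin (\<omega> / 2)\<close>.\<close>

lemma csqrt_sector:
  assumes \<omega>: "\<omega> \<in> {0<..<pi}" and lam: "lam \<in> sector (pi - \<omega>)"
  shows "sin (\<omega> / 2) * cmod (csqrt lam) \<le> Re (csqrt lam)" "0 < Re (csqrt lam)" "(csqrt lam)\<^sup>2 = lam"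
    "cmod (csqrt lam) powr 2 = cmod lam"
proof -
  have l0: "lam \<noteq> 0" and arg: "\<bar>Arg lam\<bar> < pi - \<omega>" using lam by (auto simp: sector_def)
  have sin_pos: "0 < sin (\<omega> / 2)" using \<omega> by (intro sin_gt_zero) auto
  have sq: "csqrt lam = exp (Ln lam / 2)" using l0 by (rule csqrt_exp_Ln)
  have im: "Im (Ln lam) = Arg lam" using l0 by (simp add: Arg_eq_Im_Ln)
  have "Re (csqrt lam) = cmod (csqrt lam) * cos (Arg lam / 2)"
    unfolding sq norm_exp_eq_Re Re_exp by (simp add: im)
  also have "cos (Arg lam / 2) = cos (\<bar>Arg lam\<bar> / 2)" by (cases "0 \<le> Arg lam") auto
  finally have re: "Re (csqrt lam) = cmod (csqrt lam) * cos (\<bar>Arg lam\<bar> / 2)" .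
  have "sin (\<omega> / 2) = cos ((pi - \<omega>) / 2)" by (simp add: sin_cos_eq diff_divide_distrib)
  also have "\<dots> \<le> cos (\<bar>Arg lam\<bar> / 2)" using arg \<omega> by (intro cos_monotone_0_pi_le) auto
  finally have le: "sin (\<omega> / 2) \<le> cos (\<bar>Arg lam\<bar> / 2)" .
  show 1: "sin (\<omega> / 2) * cmod (csqrt lam) \<le> Re (csqrt lam)"
    unfolding re using mult_right_mono[OF le norm_ge_zero[of "csqrt lam"]] by (simp add: mult.commute)
  have "0 < cmod (csqrt lam)" using l0 by simp
  then show "0 < Re (csqrt lam)" using 1 sin_pos by (smt (verit) mult_pos_pos)
  show "(csqrt lam)\<^sup>2 = lam" by simp
  have "cmod (csqrt lam) powr 2 = cmod (csqrt lam) ^ 2" using \<open>0 < cmod (csqrt lam)\<close> by (simp add: powr_numeral)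
  also have "\<dots> = cmod lam" by (simp flip: norm_power)
  finally show "cmod (csqrt lam) powr 2 = cmod lam" .
qed

text \<open>The equation \<open>U'' = \<lambda> U - F\<close>, differentiated \<open>i\<close> times, read as a recursion for the derivatives.\<close>

fun solution_chain :: "complex \<Rightarrow> (real \<Rightarrow> 'a) \<Rightarrow> (real \<Rightarrow> 'a) \<Rightarrow> (nat \<Rightarrow> real \<Rightarrow> 'a) \<Rightarrow> nat \<Rightarrow> real \<Rightarrow> 'a::complex_banach" where
  "solution_chain lam u0 u1 F 0 = u0"
| "solution_chain lam u0 u1 F (Suc 0) = u1"
| "solution_chain lam u0 u1 F (Suc (Suc i)) = (\<lambda>x. lam *\<^sub>C solution_chain lam u0 u1 F i x - F i x)"

lemma primitive_solution_chain:
  assumes F: "primitive_chain k F" and u0: "primitive u1 u0" and u1: "primitive (\<lambda>x. lam *\<^sub>C u0 x - F 0 x) u1"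
  shows "i < k + 2 \<Longrightarrow> primitive (solution_chain lam u0 u1 F (Suc i)) (solution_chain lam u0 u1 F i)"
proof (induction i rule: less_induct)
  case (less i)
  show ?case
  proof (cases i)
    case 0 then show ?thesis using u0 by simp
  next
    case (Suc j)
    show ?thesis
    proof (cases j)
      case 0 then show ?thesis using u1 Suc by simp
    next
      case (Suc l)
      have i: "i = Suc (Suc l)" using \<open>i = Suc j\<close> Suc by simp
      have "primitive (solution_chain lam u0 u1 F (Suc l)) (solution_chain lam u0 u1 F l)"
        using less.IH[of l] less.prems i by simp
      moreover have "primitive (F (Suc l)) (F l)" using F less.prems i by (simp add: primitive_chain_def)
      ultimately show ?thesis unfolding i by (simp add: primitive_diff primitive_scaleC)
    qed
  qed
qed

lemma primitive_chain_solution_chain: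
  assumes F: "primitive_chain k F" and u0: "primitive u1 u0" and u1: "primitive (\<lambda>x. lam *\<^sub>C u0 x - F 0 x) u1"
  shows "primitive_chain (k + 2) (solution_chain lam u0 u1 F)"
proof -
  note P = primitive_solution_chain[OF F u0 u1]
  have "locally_integrable (\<lambda>x. lam *\<^sub>C solution_chain lam u0 u1 F k x + (-1) *\<^sub>C F k x)"
    by (intro locally_integrable_add locally_integrable_scaleC continuous_on_const
        continuous_locally_integrable[OF primitive_continuous[OF P]] primitive_chain_locally_integrable[OF F]) auto
  then have "locally_integrable (solution_chain lam u0 u1 F (k + 2))" by simp
  then show ?thesis unfolding primitive_chain_def using P by blast
qed

lemma primitive_chain_shift: "primitive_chain m U \<Longrightarrow> i + n \<le> m \<Longrightarrow> primitive_chain n (\<lambda>j. U (i + j))"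
  using primitive_chain_locally_integrable[of m U "i + n"] by (auto simp: primitive_chain_def)

text \<open>The exponent \<open>a + k p\<close> equals neither \<open>p - 1\<close> nor \<open>2 p - 1\<close>: for \<open>k = 0\<close> by hypothesis, and for larger \<open>k\<close>
because \<open>a > -1\<close> puts it beyond \<open>k p - 1\<close>, while \<open>a \<noteq> p - 1\<close> keeps it off \<open>2 p - 1\<close> if \<open>k = 1\<close>. So one of
\<open>resolvent_bound\<close> and \<open>resolvent_bound_growth\<close> applies.\<close>

lemma undifferentiated_estimate:
  fixes p a \<kappa> :: real and k :: nat
  assumes p: "1 < p" and a: "-1 < a" "a < 2 * p - 1" "a \<noteq> p - 1" and \<kappa>: "0 < \<kappa>"
  shows "\<exists>C<\<top>. \<forall>\<mu> (g :: real \<Rightarrow> ennreal). 0 < Re \<mu> \<longrightarrow> \<kappa> * cmod \<mu> \<le> Re \<mu> \<longrightarrow> g \<in> borel_measurable borel \<longrightarrow>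
    ennreal (cmod \<mu> powr (2 * p)) * wint p (a + real k * p) (backward_exp (Re \<mu>) (forward_exp (Re \<mu>) g)) \<le>
      C * (1 + ennreal (cmod \<mu> powr (- max (a + real k * p - 2 * p + 1) 0))) * (wint p (a + real k * p) g + wint p a g)"
proof -
  have p0: "0 < p" using p by simp
  define G where "G = a + real k * p"
  have kp: "k = 0 \<or> real k * p \<ge> p" using p0 by (cases k) auto
  have kp2: "k = 0 \<or> k = 1 \<or> real k * p \<ge> 2 * p" using p0 by (cases "k = 0 \<or> k = 1") (auto intro!: mult_right_mono)
  have G1: "-1 < G" using a p0 unfolding G_def by (smt (verit) mult_nonneg_nonneg of_nat_0_le_iff)
  have Gp: "G \<noteq> p - 1" using kp a unfolding G_def by (cases "k = 0") (simp, linarith)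
  have G2: "G \<noteq> 2 * p - 1"
  proof -
    consider "k = 0" | "k = 1" | "2 * p \<le> real k * p" using kp2 by blast
    then show ?thesis using a unfolding G_def by cases (simp, simp, linarith)
  qed
  define K where "K = ennreal (\<kappa> powr (- (2 * p)))"
  have eq: "wint p G (\<lambda>x. ennreal (c\<^sup>2) * R x) = ennreal (c powr (2 * p)) * wint p G R"
    if "0 < c" "R \<in> borel_measurable borel" for c R
    using that p0 by (simp add: wint_cmult powr_powr flip: powr_numeral)
  show ?thesis unfolding G_def[symmetric]
  proof (cases "G < 2 * p - 1")
    case True
    obtain C where C: "0 < C" and bound: "\<And>c g. 0 < c \<Longrightarrow> g \<in> borel_measurable borel \<Longrightarrow>
      wint p G (\<lambda>x. ennreal (c\<^sup>2) * backward_exp c (forward_exp c g) x) \<le> ennreal C * wint p G g"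
      using resolvent_bound[OF p G1 True Gp] by blast
    show "\<exists>C<\<top>. \<forall>\<mu> (g :: real \<Rightarrow> ennreal). 0 < Re \<mu> \<longrightarrow> \<kappa> * cmod \<mu> \<le> Re \<mu> \<longrightarrow> g \<in> borel_measurable borel \<longrightarrow>
      ennreal (cmod \<mu> powr (2 * p)) * wint p G (backward_exp (Re \<mu>) (forward_exp (Re \<mu>) g)) \<le>
      C * (1 + ennreal (cmod \<mu> powr (- max (G - 2 * p + 1) 0))) * (wint p G g + wint p a g)"
    proof (intro exI[of _ "K * ennreal C"] conjI allI impI)
      show "K * ennreal C < \<top>" by (simp add: K_def ennreal_mult_less_top)
      fix \<mu> and g :: "real \<Rightarrow> ennreal" assume \<mu>: "0 < Re \<mu>" "\<kappa> * cmod \<mu> \<le> Re \<mu>" and g[measurable]: "g \<in> borel_measurable borel"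
      let ?R = "backward_exp (Re \<mu>) (forward_exp (Re \<mu>) g)"
      have "ennreal (cmod \<mu> powr (2 * p)) * wint p G ?R \<le> (K * ennreal (Re \<mu> powr (2 * p))) * wint p G ?R"
        unfolding K_def using \<mu> \<kappa> p0 by (intro mult_right_mono ennreal_powr_transfer) auto
      also have "\<dots> = K * wint p G (\<lambda>x. ennreal ((Re \<mu>)\<^sup>2) * ?R x)" using eq[OF \<mu>(1), of ?R] by (simp add: mult.assoc)
      also have "\<dots> \<le> K * (ennreal C * wint p G g)" by (intro mult_left_mono bound \<mu> g) simp
      also have "\<dots> = K * ennreal C * 1 * wint p G g" by (simp add: mult.assoc)
      also have "\<dots> \<le> K * ennreal C * (1 + ennreal (cmod \<mu> powr (- max (G - 2 * p + 1) 0))) * (wint p G g + wint p a g)"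
        by (intro mult_mono) auto
      finally show "ennreal (cmod \<mu> powr (2 * p)) * wint p G ?R \<le>
        K * ennreal C * (1 + ennreal (cmod \<mu> powr (- max (G - 2 * p + 1) 0))) * (wint p G g + wint p a g)" .
    qed
  next
    case False
    then have G: "2 * p - 1 < G" using G2 by simp
    then have G0: "0 < G" using p by simp
    obtain C where C: "0 < C" and bound: "\<And>c g. 0 < c \<Longrightarrow> g \<in> borel_measurable borel \<Longrightarrow>
      wint p G (\<lambda>x. ennreal (c\<^sup>2) * backward_exp c (forward_exp c g) x) \<le>
        ennreal C * (wint p G g + ennreal (c powr (2 * p - G - 1)) * epow (first_moment g) p)"
      using resolvent_bound_growth[OF p G0] by blast
    obtain D where D: "0 < D" and moment: "\<And>g. g \<in> borel_measurable borel \<Longrightarrow> epow (first_moment g) p \<le> ennreal D * (wint p a g + wint p G g)"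
      using first_moment_bound[OF p a(2) G] by blast
    define Q where "Q = ennreal (\<kappa> powr (2 * p - G - 1))"
    define C' where "C' = K * (ennreal C * (1 + Q * ennreal D))"
    show "\<exists>C<\<top>. \<forall>\<mu> (g :: real \<Rightarrow> ennreal). 0 < Re \<mu> \<longrightarrow> \<kappa> * cmod \<mu> \<le> Re \<mu> \<longrightarrow> g \<in> borel_measurable borel \<longrightarrow>
      ennreal (cmod \<mu> powr (2 * p)) * wint p G (backward_exp (Re \<mu>) (forward_exp (Re \<mu>) g)) \<le>
      C * (1 + ennreal (cmod \<mu> powr (- max (G - 2 * p + 1) 0))) * (wint p G g + wint p a g)"
    proof (intro exI[of _ C'] conjI allI impI)
      show "C' < \<top>" by (simp add: C'_def K_def Q_def ennreal_mult_less_top)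
      fix \<mu> and g :: "real \<Rightarrow> ennreal" assume \<mu>: "0 < Re \<mu>" "\<kappa> * cmod \<mu> \<le> Re \<mu>" and g[measurable]: "g \<in> borel_measurable borel"
      let ?R = "backward_exp (Re \<mu>) (forward_exp (Re \<mu>) g)"
      define T where "T = wint p G g + wint p a g"
      define m where "m = ennreal (cmod \<mu> powr (2 * p - G - 1))"
      have \<mu>0: "0 < cmod \<mu>" using \<mu> by auto
      have "Re \<mu> powr (2 * p - G - 1) \<le> (\<kappa> * cmod \<mu>) powr (2 * p - G - 1)"
        using \<mu> \<mu>0 \<kappa> G by (intro powr_mono2') auto
      also have "\<dots> = \<kappa> powr (2 * p - G - 1) * cmod \<mu> powr (2 * p - G - 1)"
        using \<kappa> by (simp add: powr_mult)
      finally have c_le: "ennreal (Re \<mu> powr (2 * p - G - 1)) \<le> Q * m"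
        unfolding Q_def m_def by (subst ennreal_mult[symmetric]) (auto intro: ennreal_leI)
      have "ennreal (cmod \<mu> powr (2 * p)) * wint p G ?R \<le> (K * ennreal (Re \<mu> powr (2 * p))) * wint p G ?R"
        unfolding K_def using \<mu> \<kappa> p0 by (intro mult_right_mono ennreal_powr_transfer) auto
      also have "\<dots> = K * wint p G (\<lambda>x. ennreal ((Re \<mu>)\<^sup>2) * ?R x)" using eq[OF \<mu>(1), of ?R] by (simp add: mult.assoc)
      also have "\<dots> \<le> K * (ennreal C * (wint p G g + ennreal (Re \<mu> powr (2 * p - G - 1)) * epow (first_moment g) p))"
        by (intro mult_left_mono bound \<mu> g) simp
      also have "\<dots> \<le> K * (ennreal C * (T + (Q * m) * (ennreal D * T)))"
      proof (intro mult_left_mono add_mono mult_mono c_le)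
        show "epow (first_moment g) p \<le> ennreal D * T" using moment[OF g] by (simp add: T_def add.commute)
      qed (auto simp: T_def)
      also have "\<dots> = K * (ennreal C * (1 * 1 + (Q * ennreal D) * m)) * T"
        by (simp only: distrib_left distrib_right mult_ac mult_1 mult_1_right)
      also have "\<dots> \<le> K * (ennreal C * ((1 + Q * ennreal D) * (1 + m))) * T"
      proof (intro mult_right_mono mult_left_mono)
        have "1 * 1 + (Q * ennreal D) * m \<le> (1 + m) + (Q * ennreal D) * (1 + m)" by (intro add_mono mult_left_mono) auto
        then show "1 * 1 + (Q * ennreal D) * m \<le> (1 + Q * ennreal D) * (1 + m)" by (simp only: distrib_right mult_1)
      qed auto
      also have "\<dots> = C' * (1 + m) * T" by (simp only: C'_def mult.assoc)
      also have "m = ennreal (cmod \<mu> powr (- max (G - 2 * p + 1) 0))"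
      proof -
        have "2 * p - G - 1 = - max (G - 2 * p + 1) 0" using G by (simp add: max_def)
        then show ?thesis unfolding m_def by (simp only:)
      qed
      finally show "ennreal (cmod \<mu> powr (2 * p)) * wint p G ?R \<le>
        C' * (1 + ennreal (cmod \<mu> powr (- max (G - 2 * p + 1) 0))) * (wint p G g + wint p a g)" unfolding T_def .
    qed
  qed
qed

text \<open>The estimate for all derivatives, in \<open>p\<close>-th powers, where \<open>\<mu>\<close> is the square root of \<open>\<lambda>\<close>. The bounds for
orders \<open>k\<close> and \<open>0\<close> come from \<open>commutator_estimate\<close> and \<open>undifferentiated_estimate\<close>. Those in between
follow by interpolation, and the two additional derivatives from the equation and from
interpolation at the length \<open>1 / \<bar>\<mu>\<bar>\<close>.\<close>

lemma resolvent_chain_estimate: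
  fixes p a \<kappa> :: real and k :: nat
  assumes p: "1 < p" and a: "-1 < a" "a < 2 * p - 1" "a \<noteq> p - 1" and \<kappa>: "0 < \<kappa>"
  defines "G \<equiv> a + real k * p"
  shows "\<exists>C<\<top>. \<forall>\<mu> (F :: nat \<Rightarrow> real \<Rightarrow> 'a::complex_banach). 0 < Re \<mu> \<longrightarrow> \<kappa> * cmod \<mu> \<le> Re \<mu> \<longrightarrow> primitive_chain k F \<longrightarrow>
    (\<forall>i\<le>k. lp_int p G (F i) < \<infinity>) \<longrightarrow>
    (\<exists>U. primitive_chain (k + 2) U \<and> (U 0 \<longlongrightarrow> 0) (at_right 0) \<and> (\<forall>i x. U (Suc (Suc i)) x = \<mu>\<^sup>2 *\<^sub>C U i x - F i x) \<and>
      (\<forall>i\<le>k. \<forall>j\<le>2. ennreal (cmod \<mu> powr (p * (2 - real j))) * lp_int p G (U (i + j)) \<le>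
        C * (1 + ennreal (cmod \<mu> powr (- max (G - 2 * p + 1) 0))) * (\<Sum>i\<le>k. lp_int p G (F i))))"
proof -
  have p0: "0 < p" using p by simp
  have G1: "-1 < G" using a p0 unfolding G_def by (smt (verit) mult_nonneg_nonneg of_nat_0_le_iff)
  obtain C0 where C0: "C0 < \<top>" and est: "\<And>\<mu> (f :: real \<Rightarrow> 'a) g. 0 < Re \<mu> \<Longrightarrow> strongly_measurable half_line f \<Longrightarrow>
    g \<in> borel_measurable borel \<Longrightarrow> (AE x in half_line. enorm (f x) = g x) \<Longrightarrow> lp_int p a f < \<infinity> \<Longrightarrow>
    (\<exists>w u. primitive (\<lambda>x. \<mu> *\<^sub>C w x - f x) w \<and> primitive (\<lambda>x. w x - \<mu> *\<^sub>C u x) u \<and> (u \<longlongrightarrow> 0) (at_right 0) \<and>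
      (\<forall>x>0. enorm (u x) \<le> backward_exp (Re \<mu>) (forward_exp (Re \<mu>) g) x) \<and>
      ennreal (Re \<mu> powr (2 * p)) * lp_int p a u \<le> C0 * lp_int p a f \<and> lp_int p a w < \<infinity> \<and>
      small_near_0 (\<lambda>x. x *\<^sub>R (w x - \<mu> *\<^sub>C u x)))"
    using resolvent_estimate[OF p a, where 'a='a] by blast
  obtain CB where CB: "CB < \<top>" and comm: "\<And>\<mu> (F :: nat \<Rightarrow> real \<Rightarrow> 'a) U.
    0 < Re \<mu> \<Longrightarrow> \<kappa> * cmod \<mu> \<le> Re \<mu> \<Longrightarrow> primitive_chain k F \<Longrightarrow> (\<forall>i<k+2. primitive (U (Suc i)) (U i)) \<Longrightarrow>
    (\<forall>i\<le>k. \<forall>x>0. U (i + 2) x = \<mu>\<^sup>2 *\<^sub>C U i x - F i x) \<Longrightarrow> small_near_0 (U 0) \<Longrightarrow> tail_int_finite p (U 0) \<Longrightarrow>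
    ennreal (cmod \<mu> powr (2 * p)) * energy p a k U \<le> CB * energy p a k F"
    using commutator_estimate[OF p a \<kappa>, where 'a='a and m=k] by blast
  obtain CA where CA: "CA < \<top>" and undiff: "\<And>\<mu> (g :: real \<Rightarrow> ennreal). 0 < Re \<mu> \<Longrightarrow> \<kappa> * cmod \<mu> \<le> Re \<mu> \<Longrightarrow> g \<in> borel_measurable borel \<Longrightarrow>
    ennreal (cmod \<mu> powr (2 * p)) * wint p G (backward_exp (Re \<mu>) (forward_exp (Re \<mu>) g)) \<le>
      CA * (1 + ennreal (cmod \<mu> powr (- max (G - 2 * p + 1) 0))) * (wint p G g + wint p a g)"
    using undifferentiated_estimate[OF p a \<kappa>, where k=k] unfolding G_def by blast
  obtain CH where CH: "CH < \<top>" and hardy: "\<And>F :: nat \<Rightarrow> real \<Rightarrow> 'a. primitive_chain k F \<Longrightarrow> energy p a k F \<le> CH * (\<Sum>i\<le>k. lp_int p G (F i))"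
    using energy_Hardy[OF p a(1), where 'a='a and k=k] unfolding G_def by blast
  obtain CI where CI: "CI < \<top>" and inter: "\<And>(U :: nat \<Rightarrow> real \<Rightarrow> 'a) i. primitive_chain k U \<Longrightarrow> i \<le> k \<Longrightarrow>
    lp_int p G (U i) \<le> CI * (lp_int p G (U k) + lp_int p G (U 0))"
    using interpolation_intermediate[OF p G1, where 'a='a and k=k] by blast
  obtain CL where CL: "CL < \<top>" and landau: "\<And>h (U :: nat \<Rightarrow> real \<Rightarrow> 'a). 0 < h \<Longrightarrow> primitive_chain (Suc 1) U \<Longrightarrow>
    lp_int p G (U 1) \<le> CL * (ennreal (h powr p) * lp_int p G (U (Suc 1)) + ennreal (h powr (- (real 1 * p))) * lp_int p G (U 0))"
    using interpolation[OF p G1, where 'a='a and n=1] by blast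
  define P where "P = ennreal (2 powr p)"
  \<comment> \<open>Constants for the derivatives of order \<open>i\<close>, \<open>i + 1\<close> and
    \<open>i + 2\<close>.\<close>
  define D0 where "D0 = CI * (CB * CH + CA * (1 + CH))"
  define D2 where "D2 = P * (D0 + 1)"
  define D1 where "D1 = CL * (D2 + D0)"
  have D: "D0 < \<top>" "D1 < \<top>" "D2 < \<top>"
    using CB CH CA CI CL by (auto simp: D0_def D1_def D2_def P_def ennreal_mult_less_top)
  show ?thesis
  proof (intro exI[of _ "D0 + D1 + D2"] conjI allI impI)
    show "D0 + D1 + D2 < \<top>" using D by simp
    fix \<mu> and F :: "nat \<Rightarrow> real \<Rightarrow> 'a"
    assume \<mu>: "0 < Re \<mu>" "\<kappa> * cmod \<mu> \<le> Re \<mu>" and F: "primitive_chain k F" and fin: "\<forall>i\<le>k. lp_int p G (F i) < \<infinity>"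
    have \<mu>0: "0 < cmod \<mu>" using \<mu> by auto
    define S where "S = (\<Sum>i\<le>k. lp_int p G (F i))"
    define L where "L = ennreal (cmod \<mu> powr (2 * p))"
    define H where "H = 1 + ennreal (cmod \<mu> powr (- max (G - 2 * p + 1) 0))"
    have S: "S < \<top>" unfolding S_def using fin by simp
    have FS: "lp_int p G (F i) \<le> S" if "i \<le> k" for i unfolding S_def by (rule member_le_sum) (use that in auto)
    have EF: "energy p a k F \<le> CH * S" unfolding S_def by (rule hardy[OF F])
    have "lp_int p a (\<lambda>x. x ^ 0 *\<^sub>R F 0 x) \<le> energy p a k F" by (rule energy_ge) simp
    then have F0: "lp_int p a (F 0) \<le> CH * S" using EF by simp
    have F0fin: "lp_int p a (F 0) < \<infinity>"
      by (rule le_less_trans[OF F0]) (use CH S in \<open>simp add: ennreal_mult_less_top\<close>)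
    have Fm: "strongly_measurable half_line (F i)" if "i \<le> k" for i
      using primitive_chain_locally_integrable[OF F that] by (simp add: locally_integrable_def)
    obtain g where g[measurable]: "g \<in> borel_measurable borel" and fg: "AE x in half_line. enorm (F 0 x) = g x"
      and lg: "\<And>p a. lp_int p a (F 0) = wint p a g" using lp_int_borel_rep[OF Fm[of 0]] by blast
    obtain w u where w: "primitive (\<lambda>x. \<mu> *\<^sub>C w x - F 0 x) w" and u: "primitive (\<lambda>x. w x - \<mu> *\<^sub>C u x) u"
      and u0: "(u \<longlongrightarrow> 0) (at_right 0)"
      and ule: "\<And>x. 0 < x \<Longrightarrow> enorm (u x) \<le> backward_exp (Re \<mu>) (forward_exp (Re \<mu>) g) x"
      and ub: "ennreal (Re \<mu> powr (2 * p)) * lp_int p a u \<le> C0 * lp_int p a (F 0)"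
      using est[OF \<mu>(1) Fm[of 0] g fg F0fin] by blast
    have u1: "primitive (\<lambda>x. \<mu>\<^sup>2 *\<^sub>C u x - F 0 x) (\<lambda>x. w x - \<mu> *\<^sub>C u x)"
    proof -
      have "primitive (\<lambda>x. (\<mu> *\<^sub>C w x - F 0 x) - \<mu> *\<^sub>C (w x - \<mu> *\<^sub>C u x)) (\<lambda>x. w x - \<mu> *\<^sub>C u x)"
        by (intro primitive_diff w primitive_scaleC u)
      then show ?thesis by (simp add: scaleC.diff_right scaleC_scaleC power2_eq_square)
    qed
    define U where "U = solution_chain (\<mu>\<^sup>2) u (\<lambda>x. w x - \<mu> *\<^sub>C u x) F"
    have UC: "primitive_chain (k + 2) U" unfolding U_def by (rule primitive_chain_solution_chain[OF F u u1])
    have Urec: "U (Suc (Suc i)) x = \<mu>\<^sup>2 *\<^sub>C U i x - F i x" for i x by (simp add: U_def)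
    have U0: "U 0 = u" by (simp add: U_def)
    have Um: "strongly_measurable half_line (U i)" if "i \<le> k + 2" for i
      using primitive_chain_locally_integrable[OF UC that] by (simp add: locally_integrable_def)
    have Uk: "primitive_chain k U" using primitive_chain_shift[OF UC, of 0 k] by simp
    have near: "small_near_0 (U 0)"
    proof -
      have "eventually (\<lambda>x. 0 < x \<and> x < e \<and> norm (u x) < e) (at_right 0)" if e: "0 < e" for e
        using tendstoD[OF u0 e] eventually_at_right_less[of 0] eventually_at_right_real[OF e]
        by eventually_elim auto
      then show ?thesis unfolding small_near_0_def U0
        by (metis (no_types, lifting) eventually_happens trivial_limit_at_right_real)
    qed
    have "lp_int p a u < \<infinity>"
    proof -
      have "ennreal (Re \<mu> powr (2 * p)) * lp_int p a u < \<infinity>"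
        by (rule le_less_trans[OF ub]) (use C0 F0fin in \<open>simp add: ennreal_mult_less_top\<close>)
      then show ?thesis using \<mu> by (auto simp: ennreal_mult_less_top)
    qed
    then have inf: "tail_int_finite p (U 0)" unfolding U0 by (rule lp_int_tail_int_finite)
    \<comment> \<open>The weight \<open>G\<close> is the weight \<open>a\<close> after multiplication with
      \<open>x ^ k\<close>.\<close>
    have top_order: "L * lp_int p G (U k) \<le> CB * CH * S"
    proof -
      have "lp_int p a (\<lambda>x. x ^ k *\<^sub>R U k x) \<le> energy p a k U" by (rule energy_ge) simp
      then have "L * lp_int p G (U k) \<le> L * energy p a k U"
        unfolding lp_int_times_power[OF p0] G_def by (rule mult_left_mono) simp
      also have "\<dots> \<le> CB * energy p a k F" unfolding L_def
        using UC Urec by (intro comm \<mu> F near inf) (auto simp: primitive_chain_def)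
      also have "\<dots> \<le> CB * (CH * S)" by (intro mult_left_mono EF) simp
      finally show ?thesis by (simp add: mult.assoc)
    qed
    have low_order: "L * lp_int p G (U 0) \<le> CA * H * ((1 + CH) * S)"
    proof -
      have "L * lp_int p G (U 0) \<le> L * wint p G (backward_exp (Re \<mu>) (forward_exp (Re \<mu>) g))"
        unfolding U0 lp_int_def using p0 ule by (intro mult_left_mono wint_mono) auto
      also have "\<dots> \<le> CA * H * (wint p G g + wint p a g)" unfolding L_def H_def by (rule undiff[OF \<mu> g])
      also have "\<dots> \<le> CA * H * (1 * S + CH * S)"
        using FS[of 0] F0 by (intro mult_left_mono add_mono) (auto simp: lg)
      finally show ?thesis by (simp only: distrib_right)
    qed
    have H1: "1 \<le> H" unfolding H_def by simp
    have ord0: "L * lp_int p G (U i) \<le> D0 * (H * S)" if "i \<le> k" for i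
    proof -
      have "L * lp_int p G (U i) \<le> L * (CI * (lp_int p G (U k) + lp_int p G (U 0)))"
        by (intro mult_left_mono inter[OF Uk that]) simp
      also have "\<dots> = CI * (L * lp_int p G (U k) + L * lp_int p G (U 0))" by (simp only: distrib_left mult_ac)
      also have "\<dots> \<le> CI * (CB * CH * (1 * S) + CA * H * ((1 + CH) * S))"
        using top_order low_order by (intro mult_left_mono add_mono) auto
      also have "\<dots> \<le> CI * (CB * CH * (H * S) + CA * H * ((1 + CH) * S))"
        using H1 by (intro mult_left_mono add_mono mult_right_mono) auto
      also have "\<dots> = D0 * (H * S)" unfolding D0_def by (simp only: distrib_left distrib_right mult_ac mult_1 mult_1_right)
      finally show ?thesis .
    qed
    have ord2: "lp_int p G (U (i + 2)) \<le> D2 * (H * S)" if i: "i \<le> k" for i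
    proof -
      have "lp_int p G (U (i + 2)) \<le> P * (ennreal ((cmod \<mu> ^ 2) powr p) * lp_int p G (U i) + ennreal (1 powr p) * lp_int p G (F i))"
        unfolding P_def
      proof (rule lp_int_triangle[OF p0 Um Fm[OF i]])
        fix x :: real
        have "norm (U (i + 2) x) \<le> norm (\<mu>\<^sup>2 *\<^sub>C U i x) + norm (F i x)" using norm_triangle_ineq4[of "\<mu>\<^sup>2 *\<^sub>C U i x" "F i x"] by (simp add: Urec)
        then show "norm (U (i + 2) x) \<le> cmod \<mu> ^ 2 * norm (U i x) + 1 * norm (F i x)" by (simp add: norm_scaleC norm_power)
      qed (use i in auto)
      also have "ennreal ((cmod \<mu> ^ 2) powr p) = L" unfolding L_def using \<mu>0 by (simp add: powr_powr flip: powr_numeral)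
      also have "P * (L * lp_int p G (U i) + ennreal (1 powr p) * lp_int p G (F i)) \<le> P * (D0 * (H * S) + 1 * (H * S))"
      proof (intro mult_left_mono add_mono ord0 i)
        have "lp_int p G (F i) \<le> 1 * S" using FS[OF i] by simp
        also have "\<dots> \<le> H * S" by (intro mult_right_mono H1) simp
        finally show "ennreal (1 powr p) * lp_int p G (F i) \<le> 1 * (H * S)" by simp
      qed auto
      also have "\<dots> = D2 * (H * S)" unfolding D2_def by (simp only: distrib_right mult.assoc)
      finally show ?thesis .
    qed
    have ord1: "ennreal (cmod \<mu> powr p) * lp_int p G (U (i + 1)) \<le> D1 * (H * S)" if i: "i \<le> k" for i
    proof -
      define h where "h = 1 / cmod \<mu>"
      have h: "0 < h" using \<mu>0 by (simp add: h_def)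
      define q where "q = ennreal (cmod \<mu> powr p)"
      have hp: "ennreal (h powr (- (real 1 * p))) = q" "q * ennreal (h powr p) = 1"
      proof -
        have "h powr (- p) = cmod \<mu> powr p" unfolding h_def using \<mu>0 by (simp add: powr_divide powr_minus)
        then show "ennreal (h powr (- (real 1 * p))) = q" by (simp add: q_def)
        have "cmod \<mu> powr p * h powr p = 1" unfolding h_def using \<mu>0 by (simp add: powr_divide)
        then show "q * ennreal (h powr p) = 1" unfolding q_def by (subst ennreal_mult[symmetric]) auto
      qed
      have qq: "q * q = L" unfolding q_def L_def by (subst ennreal_mult[symmetric]) (auto simp: powr_add[symmetric])
      have "primitive_chain (Suc 1) (\<lambda>j. U (i + j))" using i by (intro primitive_chain_shift[OF UC]) simp
      from landau[OF h this]
      have "q * lp_int p G (U (i + 1)) \<le> q * (CL * (ennreal (h powr p) * lp_int p G (U (i + 2)) + q * lp_int p G (U i)))"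
        unfolding hp(1) by (intro mult_left_mono) (simp_all add: numeral_2_eq_2)
      also have "\<dots> = CL * ((q * ennreal (h powr p)) * lp_int p G (U (i + 2)) + (q * q) * lp_int p G (U i))"
        by (simp only: distrib_left mult_ac)
      also have "\<dots> \<le> CL * (D2 * (H * S) + D0 * (H * S))"
        unfolding hp(2) qq mult_1 by (intro mult_left_mono add_mono ord2 ord0 i) simp
      also have "\<dots> = D1 * (H * S)" unfolding D1_def by (simp only: distrib_right mult.assoc)
      finally show ?thesis by (simp only: q_def)
    qed
    show "\<exists>U. primitive_chain (k + 2) U \<and> (U 0 \<longlongrightarrow> 0) (at_right 0) \<and> (\<forall>i x. U (Suc (Suc i)) x = \<mu>\<^sup>2 *\<^sub>C U i x - F i x) \<and>
      (\<forall>i\<le>k. \<forall>j\<le>2. ennreal (cmod \<mu> powr (p * (2 - real j))) * lp_int p G (U (i + j)) \<le>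
        (D0 + D1 + D2) * (1 + ennreal (cmod \<mu> powr (- max (G - 2 * p + 1) 0))) * (\<Sum>i\<le>k. lp_int p G (F i)))"
    proof (intro exI[of _ U] conjI allI impI UC Urec)
      show "(U 0 \<longlongrightarrow> 0) (at_right 0)" unfolding U0 by (rule u0)
      fix i j :: nat assume i: "i \<le> k" and "j \<le> 2"
      then consider "j = 0" | "j = 1" | "j = 2" by linarith
      then have "ennreal (cmod \<mu> powr (p * (2 - real j))) * lp_int p G (U (i + j)) \<le> (D0 + D1 + D2) * (H * S)"
      proof cases
        case 1
        have "D0 * (H * S) \<le> (D0 + D1 + D2) * (H * S)" by (intro mult_right_mono) (auto simp: add.assoc)
        then show ?thesis using ord0[OF i] 1 by (simp add: L_def mult.commute)
      next
        case 2
        have "D1 * (H * S) \<le> (D0 + D1 + D2) * (H * S)" by (intro mult_right_mono) (auto simp: add_increasing add_increasing2)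
        then show ?thesis using ord1[OF i] 2 by simp
      next
        case 3
        have "D2 * (H * S) \<le> (D0 + D1 + D2) * (H * S)" by (intro mult_right_mono) (auto simp: add_increasing)
        then show ?thesis using ord2[OF i] 3 \<mu>0 by simp
      qed
      then show "ennreal (cmod \<mu> powr (p * (2 - real j))) * lp_int p G (U (i + j)) \<le>
        (D0 + D1 + D2) * (1 + ennreal (cmod \<mu> powr (- max (G - 2 * p + 1) 0))) * (\<Sum>i\<le>k. lp_int p G (F i))"
        by (simp only: H_def S_def mult.assoc)
    qed
  qed
qed

lemma trace_small_near_0:
  assumes "has_trace v 0" "AE x in half_line. v x = V x" shows "small_near_0 V"
  unfolding small_near_0_def
proof (intro allI impI)
  fix e :: real assume e: "0 < e"
  obtain z where z: "continuous_on {0..} z" "AE x in half_line. z x = v x" "z 0 = 0"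
    using assms(1) by (auto simp: has_trace_def)
  obtain d where d: "0 < d" "\<And>x. 0 \<le> x \<Longrightarrow> dist x 0 < d \<Longrightarrow> dist (z x) (z 0) < e"
    using z(1)[unfolded continuous_on_iff, rule_format, of 0 e] e by auto
  have "AE x in half_line. z x = V x" using z(2) assms(2) by eventually_elim simp
  then obtain y where y: "0 < y" "y < min d e" "z y = V y"
    using AE_half_line_interval_witness[of "\<lambda>x. z x = V x" 0 "min d e"] d e by auto
  then have "norm (V y) < e" using d(2)[of y] z(3) by simp
  then show "\<exists>x. 0 < x \<and> x < e \<and> norm (V x) < e" using y by auto
qed

text \<open>Extended by \<open>0\<close>, the function is continuous up to the boundary.\<close>

lemma tendsto_has_trace:
  assumes c: "continuous_on {0<..} u" and l: "(u \<longlongrightarrow> 0) (at_right 0)"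
  shows "has_trace u 0"
proof -
  define v where "v x = (if 0 < x then u x else 0)" for x
  have "continuous (at x within {0..}) v" if "0 \<le> x" for x
  proof (cases "x = 0")
    case True
    have "(v \<longlongrightarrow> 0) (at_right 0)"
      by (rule Lim_transform_eventually[OF l]) (use eventually_at_right_less[of 0] in \<open>eventually_elim, simp add: v_def\<close>)
    then show ?thesis using True by (simp add: continuous_within v_def at_within_Ici_at_right)
  next
    case False
    then have "isCont u x" using c that by (simp add: continuous_on_eq_continuous_at)
    moreover have "eventually (\<lambda>y. v y = u y) (nhds x)"
      by (rule eventually_mono[OF eventually_nhds_in_open[of "{0<..}"]]) (use False that in \<open>auto simp: v_def\<close>)
    ultimately have "isCont v x" using isCont_cong by metis
    then show ?thesis by (rule continuous_at_imp_continuous_at_within)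
  qed
  then have "continuous_on {0..} v" by (simp add: continuous_on_eq_continuous_within)
  moreover have "AE x in half_line. v x = u x" by (intro AE_I2) (simp add: v_def)
  ultimately show ?thesis unfolding has_trace_def by (intro exI[of _ v]) (simp add: v_def)
qed

text \<open>The passage from \<open>p\<close>-th powers to norms: if \<open>h\<close> denotes the growth function and \<open>e = max (G - 2 p + 1) 0\<close>, then
\<open>1 + \<bar>\<lambda>\<bar> powr (- e / 2) \<le> 2 * h powr p\<close>, and the \<open>p\<close>-th root of the estimate for \<open>\<partial>\<^sup>i\<^sup>+\<^sup>j u\<close> is one of the
\<open>3 (k + 1)\<close> summands of the left-hand side.\<close>

theorem theorem3p1:
  fixes p \<gamma> \<omega> :: real and k :: nat
  assumes "1 < p"
    and "\<gamma> \<in> {-1<..<2 * p - 1} - {p - 1}"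
    and "\<omega> \<in> {0<..<pi}"
    and "UMD TYPE('a::complex_banach)"
  shows "\<exists>C>0. \<forall>f \<in> (sobolev k p (\<gamma> + real k * p) :: (real \<Rightarrow> 'a) set).
           \<forall>lam \<in> sector (pi - \<omega>).
             \<exists>u. resolvent_solution k p (\<gamma> + real k * p) lam f u \<and>
                 (\<forall>v. resolvent_solution k p (\<gamma> + real k * p) lam f v \<longrightarrow>
                      (AE x in half_line. v x = u x)) \<and>
                 (\<Sum>j\<le>2. cmod lam powr (1 - real j / 2) *
                    sobolev_norm k p (\<gamma> + real k * p) (weak_deriv j u))
                 \<le> C * growth p k \<gamma> lam * sobolev_norm k p (\<gamma> + real k * p) f"
proof -
  note p = assms(1) and \<omega> = assms(3)
  have p0: "0 < p" using p by simp
  define \<kappa> where "\<kappa> = sin (\<omega> / 2)"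
  have \<kappa>: "0 < \<kappa>" unfolding \<kappa>_def using \<omega> by (intro sin_gt_zero) auto
  define G where "G = \<gamma> + real k * p"
  have \<gamma>: "-1 < \<gamma>" "\<gamma> < 2 * p - 1" "\<gamma> \<noteq> p - 1" using assms(2) by auto
  define e where "e = max (G - 2 * p + 1) 0"
  obtain C where C: "C < \<top>" and main: "\<And>\<mu> (F :: nat \<Rightarrow> real \<Rightarrow> 'a). 0 < Re \<mu> \<Longrightarrow> \<kappa> * cmod \<mu> \<le> Re \<mu> \<Longrightarrow> primitive_chain k F \<Longrightarrow>
    (\<forall>i\<le>k. lp_int p G (F i) < \<infinity>) \<Longrightarrow>
    (\<exists>U. primitive_chain (k + 2) U \<and> (U 0 \<longlongrightarrow> 0) (at_right 0) \<and> (\<forall>i x. U (Suc (Suc i)) x = \<mu>\<^sup>2 *\<^sub>C U i x - F i x) \<and>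
      (\<forall>i\<le>k. \<forall>j\<le>2. ennreal (cmod \<mu> powr (p * (2 - real j))) * lp_int p G (U (i + j)) \<le>
        C * (1 + ennreal (cmod \<mu> powr (- e))) * (\<Sum>i\<le>k. lp_int p G (F i))))"
    using resolvent_chain_estimate[OF p \<gamma> \<kappa>, where 'a='a and k=k] unfolding G_def e_def by blast
  define c where "c = enn2real C"
  have c: "0 \<le> c" "C = ennreal c" using C by (auto simp: c_def ennreal_enn2real_if)
  \<comment> \<open>The factor \<open>2\<close> is from \<open>1 + \<bar>\<lambda>\<bar> powr (- e / 2)
    \<le> 2 * h powr p\<close>, and \<open>k + 1\<close> from summing over the derivatives of
    \<open>f\<close>.\<close>
  define K where "K = (c * 2 * real (Suc k)) powr (1 / p)"
  have K: "0 \<le> K" by (simp add: K_def)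
  show ?thesis unfolding G_def[symmetric]
  proof (intro exI[of _ "3 * real (Suc k) * K + 1"] conjI ballI)
    show "0 < 3 * real (Suc k) * K + 1" using K by (intro add_nonneg_pos mult_nonneg_nonneg) auto
    fix f :: "real \<Rightarrow> 'a" and lam assume f: "f \<in> sobolev k p G" and lam: "lam \<in> sector (pi - \<omega>)"
    define \<mu> where "\<mu> = csqrt lam"
    note cs = csqrt_sector[OF \<omega> lam, folded \<mu>_def \<kappa>_def]
    have l0: "0 < cmod lam" using lam by (simp add: sector_def)
    have mod_pow: "cmod \<mu> powr q = cmod lam powr (q / 2)" for q
      using cs(4) by (metis powr_powr mult.commute nonzero_eq_divide_eq zero_neq_numeral)
    obtain F where F: "primitive_chain k F" and fF: "AE x in half_line. f x = F 0 x"
      and FL: "\<And>i. i \<le> k \<Longrightarrow> F i \<in> Lp (weighted G) p" by (rule sobolev_chain[OF f]) (rule that)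
    have Ffin: "\<forall>i\<le>k. lp_int p G (F i) < \<infinity>" using FL by (auto simp: Lp_iff)
    obtain U where U: "primitive_chain (k + 2) U" and U0: "(U 0 \<longlongrightarrow> 0) (at_right 0)"
      and Urec: "\<And>i x. U (Suc (Suc i)) x = \<mu>\<^sup>2 *\<^sub>C U i x - F i x"
      and Uest: "\<And>i j. i \<le> k \<Longrightarrow> j \<le> 2 \<Longrightarrow> ennreal (cmod \<mu> powr (p * (2 - real j))) * lp_int p G (U (i + j)) \<le>
        C * (1 + ennreal (cmod \<mu> powr (- e))) * (\<Sum>i\<le>k. lp_int p G (F i))"
      using main[OF cs(2,1) F Ffin] by blast
    define S where "S = (\<Sum>i\<le>k. enn2real (lp_int p G (F i)))"
    have S: "0 \<le> S" "(\<Sum>i\<le>k. lp_int p G (F i)) = ennreal S"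
    proof -
      show "0 \<le> S" unfolding S_def by (intro sum_nonneg) auto
      have "(\<Sum>i\<le>k. lp_int p G (F i)) = (\<Sum>i\<le>k. ennreal (enn2real (lp_int p G (F i))))"
        using Ffin by (intro sum.cong refl) (auto simp: ennreal_enn2real_if)
      then show "(\<Sum>i\<le>k. lp_int p G (F i)) = ennreal S" unfolding S_def by simp
    qed
    have est: "lp_int p G (U (i + j)) < \<infinity>"
      "cmod lam powr (p * (1 - real j / 2)) * enn2real (lp_int p G (U (i + j))) \<le> c * (1 + cmod lam powr (- (e / 2))) * S"
      if ij: "i \<le> k" "j \<le> 2" for i j
    proof -
      have ex: "cmod \<mu> powr (p * (2 - real j)) = cmod lam powr (p * (1 - real j / 2))" "cmod \<mu> powr (- e) = cmod lam powr (- (e / 2))"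
        unfolding mod_pow by (simp_all add: algebra_simps diff_divide_distrib)
      have "ennreal (cmod lam powr (p * (1 - real j / 2))) * lp_int p G (U (i + j)) \<le> ennreal c * (1 + ennreal (cmod lam powr (- (e / 2)))) * ennreal S"
        using Uest[OF ij] unfolding ex S(2) c(2) .
      also have "\<dots> = ennreal (c * (1 + cmod lam powr (- (e / 2))) * S)"
        using c S by (simp add: ennreal_mult)
      finally have *: "ennreal (cmod lam powr (p * (1 - real j / 2))) * lp_int p G (U (i + j)) \<le> ennreal (c * (1 + cmod lam powr (- (e / 2))) * S)" .
      have "ennreal (cmod lam powr (p * (1 - real j / 2))) * lp_int p G (U (i + j)) < \<infinity>"
        by (rule le_less_trans[OF *]) simp
      then show fin: "lp_int p G (U (i + j)) < \<infinity>" using l0 by (auto simp: ennreal_mult_less_top)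
      then obtain r where r: "lp_int p G (U (i + j)) = ennreal r" "0 \<le> r" by (cases "lp_int p G (U (i + j))") auto
      have "ennreal (cmod lam powr (p * (1 - real j / 2)) * r) \<le> ennreal (c * (1 + cmod lam powr (- (e / 2))) * S)"
        using * unfolding r(1) by (subst ennreal_mult) (auto simp: r)
      then have "cmod lam powr (p * (1 - real j / 2)) * r \<le> c * (1 + cmod lam powr (- (e / 2))) * S"
        using c S by (subst (asm) ennreal_le_iff) auto
      then show "cmod lam powr (p * (1 - real j / 2)) * enn2real (lp_int p G (U (i + j))) \<le> c * (1 + cmod lam powr (- (e / 2))) * S"
        using r by simp
    qed
    have Ufin: "lp_int p G (U n) < \<infinity>" if n: "n \<le> k + 2" for n
    proof -
      have "n = min n k + (n - min n k)" "n - min n k \<le> 2" using n by auto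
      then show ?thesis using est(1)[of "min n k" "n - min n k"] by simp
    qed
    have Um: "strongly_measurable half_line (U i)" if "i \<le> k + 2" for i
      using primitive_chain_locally_integrable[OF U that] by (simp add: locally_integrable_def)
    have U01: "primitive (U 1) (U 0)" and U12: "primitive (U 2) (U 1)"
      using U by (auto simp: primitive_chain_def numeral_2_eq_2)
    have U12': "primitive (\<lambda>x. \<mu>\<^sup>2 *\<^sub>C U 0 x - F 0 x) (U 1)"
      by (rule primitive_cong[OF U12]) (auto simp: numeral_2_eq_2 Urec)
    have refl0: "AE x in half_line. U 0 x = U 0 x" by simp
    have Uw: "has_weak_deriv j (U 0) (U j)" if "j \<le> k + 2" for j
      using primitive_chain_weak_deriv[OF U, of j 0] that by simp
    have sol: "resolvent_solution k p G lam f (U 0)"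
      unfolding resolvent_solution_def sobolev_Dir_def Laplacian_Dir_def
    proof (intro conjI CollectI)
      have ULp: "U j \<in> Lp (weighted G) p" if "j \<le> k + 2" for j using Um[OF that] Ufin[OF that] by (simp add: Lp_iff)
      show "U 0 \<in> sobolev (k + 2) p G" unfolding sobolev_def using ULp Uw by blast
      show "has_trace (U 0) 0" by (rule tendsto_has_trace[OF primitive_continuous[OF U01] U0])
      have "AE x in half_line. weak_deriv 2 (U 0) x = U 2 x" by (rule weak_deriv_AE[OF Uw]) simp
      then show "AE x in half_line. lam *\<^sub>C U 0 x - weak_deriv 2 (U 0) x = f x"
        using fF
      proof eventually_elim
        case (elim x)
        have "U 2 x = lam *\<^sub>C U 0 x - F 0 x" using Urec[of 0 x] unfolding cs(3) by (simp only: numeral_2_eq_2)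
        then show ?case using elim by simp
      qed
    qed
    have unique: "AE x in half_line. v x = U 0 x" if v: "resolvent_solution k p G lam f v" for v
    proof -
      have vs: "v \<in> sobolev (k + 2) p G" and vt: "has_trace v 0"
        and veq: "AE x in half_line. lam *\<^sub>C v x - weak_deriv 2 v x = f x"
        using v by (auto simp: resolvent_solution_def sobolev_Dir_def Laplacian_Dir_def)
      obtain V where V: "primitive_chain (k + 2) V" and vV: "AE x in half_line. v x = V 0 x"
        and VL: "\<And>i. i \<le> k + 2 \<Longrightarrow> V i \<in> Lp (weighted G) p" and Vw: "\<And>i. i \<le> k + 2 \<Longrightarrow> has_weak_deriv i v (V i)"
        by (rule sobolev_chain[OF vs]) (rule that)
      have V01: "primitive (V 1) (V 0)" and V12: "primitive (V 2) (V 1)"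
        using V by (auto simp: primitive_chain_def numeral_2_eq_2)
      have "AE x in half_line. weak_deriv 2 v x = V 2 x" by (rule weak_deriv_AE[OF Vw]) simp
      then have "AE x in half_line. V 2 x = \<mu>\<^sup>2 *\<^sub>C V 0 x - F 0 x"
        using veq vV fF by eventually_elim (auto simp: cs(3) algebra_simps)
      then have V12': "primitive (\<lambda>x. \<mu>\<^sup>2 *\<^sub>C V 0 x - F 0 x) (V 1)" by (rule primitive_cong[OF V12]) simp
      have near: "small_near_0 (\<lambda>x. V 0 x - U 0 x)"
        by (rule small_near_0_tendsto_diff[OF trace_small_near_0[OF vt vV] U0])
      have inf: "tail_int_finite p (\<lambda>x. V 0 x - U 0 x)"
        using VL[of 0] Ufin[of 0] Um[of 0] p0 by (intro tail_int_finite_diff) (auto simp: Lp_iff intro: lp_int_tail_int_finite)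
      have VU: "V 0 x = U 0 x" if "0 < x" for x
        by (rule solution_unique(1)[OF cs(2) p0 V01 V12' U01 U12' near inf that])
      show ?thesis using vV AE_space[of half_line] by eventually_elim (simp add: VU)
    qed
    have norm: "(\<Sum>j\<le>2. cmod lam powr (1 - real j / 2) * sobolev_norm k p G (weak_deriv j (U 0)))
      \<le> (3 * real (Suc k) * K + 1) * growth p k \<gamma> lam * sobolev_norm k p G f"
    proof -
      define W where "W = sobolev_norm k p G f"
      define h where "h = growth p k \<gamma> lam"
      have h_eq: "h = 1 + cmod lam powr (- (e / (2 * p)))" by (simp add: h_def growth_def e_def G_def)
      have h1: "1 \<le> h" by (simp add: h_eq)
      have W_eq: "W = (\<Sum>i\<le>k. enn2real (lp_int p G (F i)) powr (1 / p))"
        unfolding W_def by (rule sobolev_norm_chain_0[OF F fF order_refl])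
      have W0: "0 \<le> W" unfolding W_eq by (intro sum_nonneg) simp
      have "enn2real (lp_int p G (F i)) \<le> W powr p" if "i \<le> k" for i
      proof -
        have "enn2real (lp_int p G (F i)) powr (1 / p) \<le> W" unfolding W_eq
          by (rule member_le_sum) (use that in auto)
        then have "(enn2real (lp_int p G (F i)) powr (1 / p)) powr p \<le> W powr p" using p0 by (intro powr_mono2) auto
        then show ?thesis using p0 by (simp add: powr_powr)
      qed
      then have SW: "S \<le> real (Suc k) * W powr p"
        unfolding S_def using sum_bounded_above[of "{..k}" "\<lambda>i. enn2real (lp_int p G (F i))" "W powr p"] by simp
      have Hh: "1 + cmod lam powr (- (e / 2)) \<le> 2 * h powr p"
      proof -
        have "(cmod lam powr (- (e / (2 * p)))) powr p \<le> h powr p" using p0 by (intro powr_mono2) (auto simp: h_eq)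
        moreover have "(cmod lam powr (- (e / (2 * p)))) powr p = cmod lam powr (- (e / 2))" using p0 by (simp add: powr_powr)
        moreover have "1 \<le> h powr p" using h1 p0 by (simp add: ge_one_powr_ge_zero)
        ultimately show ?thesis by simp
      qed
      have each: "cmod lam powr (1 - real j / 2) * enn2real (lp_int p G (U (i + j))) powr (1 / p) \<le> K * (h * W)" if ij: "i \<le> k" "j \<le> 2" for i j
      proof -
        have "cmod lam powr (1 - real j / 2) * enn2real (lp_int p G (U (i + j))) powr (1 / p)
          = (cmod lam powr (p * (1 - real j / 2)) * enn2real (lp_int p G (U (i + j)))) powr (1 / p)"
          using p0 by (simp add: powr_mult powr_powr)
        also have "\<dots> \<le> (c * (1 + cmod lam powr (- (e / 2))) * S) powr (1 / p)"
          using est(2)[OF ij] p0 by (intro powr_mono2) auto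
        also have "\<dots> \<le> (c * (2 * h powr p) * (real (Suc k) * W powr p)) powr (1 / p)"
          using p0 c S SW Hh by (intro powr_mono2 mult_mono mult_nonneg_nonneg) auto
        also have "c * (2 * h powr p) * (real (Suc k) * W powr p) = (c * 2 * real (Suc k)) * (h * W) powr p"
          using h1 W0 by (simp add: powr_mult)
        also have "\<dots> powr (1 / p) = K * ((h * W) powr p) powr (1 / p)"
          unfolding K_def by (rule powr_mult)
        also have "((h * W) powr p) powr (1 / p) = h * W" using p0 h1 W0 by (simp add: powr_powr)
        finally show ?thesis .
      qed
      have "(\<Sum>j\<le>2. cmod lam powr (1 - real j / 2) * sobolev_norm k p G (weak_deriv j (U 0)))
        = (\<Sum>j\<le>2. \<Sum>i\<le>k. cmod lam powr (1 - real j / 2) * enn2real (lp_int p G (U (i + j))) powr (1 / p))"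
        using sobolev_norm_chain[OF U refl0] by (intro sum.cong refl) (simp add: sum_distrib_left)
      also have "\<dots> \<le> (\<Sum>j\<le>(2::nat). real (Suc k) * (K * (h * W)))"
      proof (rule sum_mono)
        fix j :: nat assume j: "j \<in> {..2}"
        show "(\<Sum>i\<le>k. cmod lam powr (1 - real j / 2) * enn2real (lp_int p G (U (i + j))) powr (1 / p)) \<le> real (Suc k) * (K * (h * W))"
          using sum_bounded_above[of "{..k}" "\<lambda>i. cmod lam powr (1 - real j / 2) * enn2real (lp_int p G (U (i + j))) powr (1 / p)" "K * (h * W)"] each j
          by simp
      qed
      also have "\<dots> = 3 * real (Suc k) * K * (h * W)" by simp
      also have "\<dots> \<le> (3 * real (Suc k) * K + 1) * (h * W)" using h1 W0 by (intro mult_right_mono) auto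
      finally show ?thesis unfolding W_def h_def by (simp only: mult.assoc)
    qed
    show "\<exists>u. resolvent_solution k p G lam f u \<and> (\<forall>v. resolvent_solution k p G lam f v \<longrightarrow> (AE x in half_line. v x = u x)) \<and>
      (\<Sum>j\<le>2. cmod lam powr (1 - real j / 2) * sobolev_norm k p G (weak_deriv j u)) \<le> (3 * real (Suc k) * K + 1) * growth p k \<gamma> lam * sobolev_norm k p G f"
      using sol unique norm by blast
  qed
qed

end
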